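(* For any $\epsilon \in (0, 0.5]$, there is a (randomized) algorithm in the Massively Parallel Computation (MPC) model that, given a string $S \in \Sigma^n$ over an integer alphabet $\Sigma=[0,\sigma)$, computes all maximal palindromes in $S$ in $\mathcal{O}(1)$ rounds, with $\mathcal{O}(n)$ total time and $\mathcal{O}(n)$ total memory, and $\mathcal{O}(n^{1-\epsilon})$ memory per machine; the algorithm succeeds with high probability.
   Context: A string is a palindrome if it equals its reverse. For a fragment $S[a\mathinner{.\,.} b]$ (the occurrence of $S[a]\dots S[b]$ at position $a$) that is a palindrome, its center is $\frac{a+b}{2}$; it is a maximal palindrome if no longer palindromic fragment of $S$ has the same center. Computing all maximal palindromes means outputting, for every center, the longest palindromic fragment with that center. In the MPC model, the input of size $\mathcal{O}(n)$ is distributed over machines, each with strongly sublinear local memory (here $\mathcal{O}(n^{1-\epsilon})$ words); computation proceeds in synchronous rounds, in each of which every machine performs local computation on its data and then machines exchange messages, with the total size of messages sent and received by each machine in a round bounded by its local memory. Total memory is the sum of memory over all machines; total time is the sum of local computation time over all machines. "With high probability" means with probability at least $1-n^{-c}$ for an arbitrary constant $c>0$. *)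

theory Defs
  imports "HOL-Probability.Probability"
begin

section \<open>Maximal palindromes\<close>

text \<open>
  Positions are numbered from 0, so a string of length \<open>n\<close> has the positions \<open>0, \<dots>, n - 1\<close>.
  The fragment from \<open>a\<close> to \<open>b\<close> includes both end positions and is nonempty.
\<close>

definition fragment :: "'a list \<Rightarrow> nat \<Rightarrow> nat \<Rightarrow> 'a list" where
  "fragment S a b = take (Suc b - a) (drop a S)"

definition palindrome :: "'a list \<Rightarrow> bool" where
  "palindrome xs \<longleftrightarrow> rev xs = xs"

definition palindromic_fragment :: "'a list \<Rightarrow> nat \<Rightarrow> nat \<Rightarrow> bool" where
  "palindromic_fragment S a b \<longleftrightarrow> a \<le> b \<and> b < length S \<and> palindrome (fragment S a b)"

definition center :: "nat \<Rightarrow> nat \<Rightarrow> real" where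
  "center a b = (real a + real b) / 2"

definition maximal_palindromes :: "'a list \<Rightarrow> (nat \<times> nat) set" where
  "maximal_palindromes S =
     {(a, b). palindromic_fragment S a b \<and>
        \<not> (\<exists>a' b'. palindromic_fragment S a' b' \<and> center a' b' = center a b \<and>
                    length (fragment S a' b') > length (fragment S a b))}"


section \<open>Local computation: a randomized word RAM\<close>

text \<open>
  An algorithm is one program text, the same for all machines and all input lengths. A machine has
  the registers that occur in the program (a constant number), an addressable memory, and an inbox
  that can be read by index. All values are words, that is, numbers below \<open>2 ^ w\<close>, where \<open>w\<close> is
  the word length; words have \<open>\<Omega>(log (n + \<sigma>))\<close> bits, where the constant factor
  depends on the algorithm only. Every executed instruction, including every evaluation of a guard, takes
  one unit of time; as the expressions of a fixed program have constant size, this agrees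
  with unit cost per arithmetic operation up to a constant factor.
\<close>

datatype binop = Add | Sub | Mult | Div | Mod | And | Or | Xor | Shl | Shr | Less | Equal

datatype expr =
    Const nat
  | Reg nat
  | Inbox_Length
  | Inbox_Tag expr
  | Inbox_Word expr
  | Binop binop expr expr

datatype program =
    Skip
  | Assign nat expr
  | Load nat expr
  | Store expr expr
  | Rand nat
  | Send expr expr
  | Output expr expr
  | Finish
  | Seq program program
  | If expr program program
  | While expr program

text \<open>
  The inbox contains tagged words. Before the first round these are letters tagged with their
  positions in the input string; later on, received words tagged with the number of the sender. The
  outbox contains words tagged with the number of the receiver. The field \<open>extent\<close> is one more than
  the largest memory address that has been accessed, and \<open>peak\<close> is the largest space usage in
  any round so far; it does not count the constantly many registers.
\<close>

record machine =
  regs :: "nat \<Rightarrow> nat"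
  memory :: "nat \<Rightarrow> nat"
  extent :: nat
  inbox :: "(nat \<times> nat) list"
  outbox :: "(nat \<times> nat) list"
  outputs :: "(nat \<times> nat) list"
  finished :: bool
  steps :: nat
  peak :: nat

context
  includes bit_operations_syntax
begin

primrec eval_binop :: "nat \<Rightarrow> binop \<Rightarrow> nat \<Rightarrow> nat \<Rightarrow> nat" where
  "eval_binop w Add a b = (a + b) mod 2 ^ w"
| "eval_binop w Sub a b = (a + (2 ^ w - b)) mod 2 ^ w"
| "eval_binop w Mult a b = (a * b) mod 2 ^ w"
| "eval_binop w Div a b = a div b"
| "eval_binop w Mod a b = a mod b"
| "eval_binop w And a b = a AND b"
| "eval_binop w Or a b = a OR b"
| "eval_binop w Xor a b = a XOR b"
| "eval_binop w Shl a b = push_bit b a mod 2 ^ w"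
| "eval_binop w Shr a b = drop_bit b a"
| "eval_binop w Less a b = (if a < b then 1 else 0)"
| "eval_binop w Equal a b = (if a = b then 1 else 0)"

end

primrec eval :: "nat \<Rightarrow> expr \<Rightarrow> machine \<Rightarrow> nat" where
  "eval w (Const k) M = k mod 2 ^ w"
| "eval w (Reg x) M = regs M x"
| "eval w Inbox_Length M = length (inbox M) mod 2 ^ w"
| "eval w (Inbox_Tag e) M =
     (let i = eval w e M in if i < length (inbox M) then fst (inbox M ! i) else 0)"
| "eval w (Inbox_Word e) M =
     (let i = eval w e M in if i < length (inbox M) then snd (inbox M ! i) else 0)"
| "eval w (Binop f e1 e2) M = eval_binop w f (eval w e1 M) (eval w e2 M)"

definition tick :: "machine \<Rightarrow> machine" where
  "tick M = M\<lparr>steps := steps M + 1\<rparr>"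

definition set_reg :: "nat \<Rightarrow> nat \<Rightarrow> machine \<Rightarrow> machine" where
  "set_reg x v M = M\<lparr>regs := (regs M)(x := v)\<rparr>"

definition touch :: "nat \<Rightarrow> machine \<Rightarrow> machine" where
  "touch a M = M\<lparr>extent := max (extent M) (Suc a)\<rparr>"

text \<open>Runs that do not terminate contribute to the missing mass of the subprobability.\<close>

partial_function (spmf) while_spmf :: "('s \<Rightarrow> bool) \<Rightarrow> ('s \<Rightarrow> 's spmf) \<Rightarrow> 's \<Rightarrow> 's spmf" where
  "while_spmf guard body s =
     (if guard s then bind_spmf (body s) (while_spmf guard body) else return_spmf s)"

primrec exec :: "nat \<Rightarrow> program \<Rightarrow> machine \<Rightarrow> machine spmf" where
  "exec w Skip M = return_spmf (tick M)"
| "exec w (Assign x e) M = return_spmf (tick (set_reg x (eval w e M) M))"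
| "exec w (Load x e) M =
     (let a = eval w e M in return_spmf (tick (touch a (set_reg x (memory M a) M))))"
| "exec w (Store e1 e2) M =
     (let a = eval w e1 M
      in return_spmf (tick (touch a (M\<lparr>memory := (memory M)(a := eval w e2 M)\<rparr>))))"
| "exec w (Rand x) M =
     map_spmf (\<lambda>v. tick (set_reg x v M)) (spmf_of_set {..<2 ^ w})"
| "exec w (Send e1 e2) M =
     return_spmf (tick (M\<lparr>outbox := outbox M @ [(eval w e1 M, eval w e2 M)]\<rparr>))"
| "exec w (Output e1 e2) M =
     return_spmf (tick (M\<lparr>outputs := outputs M @ [(eval w e1 M, eval w e2 M)]\<rparr>))"
| "exec w Finish M = return_spmf (tick (M\<lparr>finished := True\<rparr>))"
| "exec w (Seq p q) M = bind_spmf (exec w p M) (exec w q)"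
| "exec w (If e p q) M = (if eval w e M \<noteq> 0 then exec w p (tick M) else exec w q (tick M))"
| "exec w (While e p) M =
     map_spmf tick (while_spmf (\<lambda>M. eval w e M \<noteq> 0) (\<lambda>M. exec w p (tick M)) M)"


section \<open>Massively parallel computation\<close>

text \<open>The machines use independent random words.\<close>

primrec map_list_spmf :: "('a \<Rightarrow> 'b spmf) \<Rightarrow> 'a list \<Rightarrow> 'b list spmf" where
  "map_list_spmf f [] = return_spmf []"
| "map_list_spmf f (x # xs) =
     bind_spmf (f x) (\<lambda>y. bind_spmf (map_list_spmf f xs) (\<lambda>ys. return_spmf (y # ys)))"

definition incoming :: "machine list \<Rightarrow> nat \<Rightarrow> (nat \<times> nat) list" where
  "incoming Ms j =
     concat (map (\<lambda>i. map (\<lambda>(d, v). (i, v)) (filter (\<lambda>(d, v). d = j) (outbox (Ms ! i))))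
                 [0..<length Ms])"

text \<open>
  The space a machine uses in a round covers its memory, what it received before the round,
  everything it sends and receives in the round, and its part of the output. Every tagged word and
  every pair of output words counts as two words. In particular, a bound on the space of
  a machine also bounds the total size of the messages it sends and of those it receives in a round.
\<close>

definition round_space :: "machine list \<Rightarrow> nat \<Rightarrow> nat" where
  "round_space Ms j =
     (let M = Ms ! j
      in extent M + 2 * length (inbox M) + 2 * length (outbox M)
         + 2 * length (incoming Ms j) + 2 * length (outputs M))"

definition exchange :: "machine list \<Rightarrow> machine list" where
  "exchange Ms =
     map (\<lambda>j. let M = Ms ! j
              in M\<lparr>inbox := incoming Ms j, outbox := [],
                   peak := max (peak M) (round_space Ms j)\<rparr>)
         [0..<length Ms]"

text \<open>A configuration consists of the number of completed rounds and the states of all machines.\<close>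

type_synonym config = "nat \<times> machine list"

definition mpc_round :: "nat \<Rightarrow> program \<Rightarrow> config \<Rightarrow> config spmf" where
  "mpc_round w P = (\<lambda>(r, Ms). map_spmf (\<lambda>Ms'. (Suc r, exchange Ms')) (map_list_spmf (exec w P) Ms))"

text \<open>
  Initially the registers 0, 1, 2, 3 of a machine contain the length of the string, the size of the
  alphabet, the number of machines, and the number of this machine; \<open>I ! j\<close> is the part of the
  input stored in machine \<open>j\<close>.
\<close>

definition initial_machine :: "nat \<Rightarrow> nat \<Rightarrow> nat \<Rightarrow> nat \<Rightarrow> (nat \<times> nat) list \<Rightarrow> machine" where
  "initial_machine n \<sigma> m j xs =
     \<lparr>regs = (\<lambda>_. 0)(0 := n, 1 := \<sigma>, 2 := m, 3 := j), memory = (\<lambda>_. 0), extent = 0,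
      inbox = xs, outbox = [], outputs = [], finished = False, steps = 0, peak = 0\<rparr>"

definition initial_config :: "nat \<Rightarrow> nat \<Rightarrow> (nat \<times> nat) list list \<Rightarrow> config" where
  "initial_config n \<sigma> I =
     (0, map (\<lambda>j. initial_machine n \<sigma> (length I) j (I ! j)) [0..<length I])"

text \<open>The computation stops after the first round at the end of which all machines have finished.\<close>

definition mpc_run :: "nat \<Rightarrow> program \<Rightarrow> nat \<Rightarrow> nat \<Rightarrow> (nat \<times> nat) list list \<Rightarrow> config spmf" where
  "mpc_run w P n \<sigma> I =
     while_spmf (\<lambda>(r, Ms). \<exists>M\<in>set Ms. \<not> finished M) (mpc_round w P) (initial_config n \<sigma> I)"

definition rounds :: "config \<Rightarrow> nat" where
  "rounds cfg = fst cfg"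

definition total_time :: "config \<Rightarrow> nat" where
  "total_time cfg = (\<Sum>M\<leftarrow>snd cfg. steps M)"

definition total_memory :: "config \<Rightarrow> nat" where
  "total_memory cfg = (\<Sum>M\<leftarrow>snd cfg. peak M)"

definition all_outputs :: "config \<Rightarrow> (nat \<times> nat) list" where
  "all_outputs cfg = concat (map outputs (snd cfg))"

text \<open>
  The letters are distributed arbitrarily over \<open>\<lceil>n powr \<epsilon>\<rceil>\<close> machines, with at most
  \<open>\<lceil>n powr (1 - \<epsilon>)\<rceil>\<close> letters in each machine.
\<close>

definition input_distribution :: "real \<Rightarrow> nat list \<Rightarrow> (nat \<times> nat) list list \<Rightarrow> bool" where
  "input_distribution \<epsilon> S I \<longleftrightarrow>
     length I = nat \<lceil>real (length S) powr \<epsilon>\<rceil> \<and>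
     mset (concat I) = mset (zip [0..<length S] S) \<and>
     (\<forall>xs\<in>set I. length xs \<le> nat \<lceil>real (length S) powr (1 - \<epsilon>)\<rceil>)"

definition outputs_maximal_palindromes :: "nat list \<Rightarrow> config \<Rightarrow> bool" where
  "outputs_maximal_palindromes S cfg \<longleftrightarrow>
     distinct (all_outputs cfg) \<and> set (all_outputs cfg) = maximal_palindromes S"

end

theory Submission
  imports Defs "HOL-Number_Theory.Cong"
begin

text \<open>
  With \<open>m\<close> machines, machine \<open>j\<close> is responsible for the centers in block \<open>j\<close> of length \<open>B\<close>, and it
  obtains a window that extends four blocks to both sides. Manacher's algorithm computes the maximal
  palindromes of the window; they are maximal in \<open>S\<close> unless they touch an end of the window. The
  palindromes that do touch it are long compared to the distance of their centers, so the string is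
  periodic around the block. Therefore they are all determined by three of them: those around
  the first and the last such center, and the one around the center of the periodic run. So every
  machine has only three queries to ask.

  A query compares pieces of \<open>m\<close> letters to the right of the center with mirrored pieces to the
  left, by hash values. All machines store the hash values of the right pieces, of which there are
  about \<open>n / m\<close>, and machine \<open>r\<close> stores those of the left pieces that start at the positions congruent
  to \<open>r\<close> modulo \<open>m\<close>. All left pieces of one query start in the same residue class, so a single machine
  finds the first mismatching piece. Afterwards every machine contributes one letter of this piece and one of its mirror image.

  Letters are hashed by multiplication with a random word and division, and pieces by a polynomial
  at a random point. The modulus is a product of \<open>k\<close> primes of size at least about \<open>n powr (7 / 12)\<close>
  and at most about \<open>n powr (2 / 3)\<close>, so that trial division finds them in linear time. A nonzero
  coefficient is divisible by fewer than \<open>J\<close> of them; for each of the other primes, which are large compared to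
  the degree \<open>m \<le> 2 * n powr (1 / 2)\<close>, few residues are roots. Hence a constant \<open>k\<close> yields any
  polynomially small error probability.
\<close>


section \<open>Weakest preconditions\<close>

text \<open>The obstacle is the modulus. Its primes must exceed the degree, of order n powr (1 / 2),
  by a power of n, while trial division (candidates times divisors) is linear only up to n powr (2 /
  3). The exponent 7 / 12 is the midpoint: each prime gains a factor n powr (1 / 12), whence the
  integer twelfth root \<open>v\<close> in which all sizes are expressed. The range from
  \<open>v ^ 7\<close> to \<open>v ^ 8\<close> is wide enough for a weak Chebyshev bound. Letters
  are hashed first because \<sigma> need not be polynomial in n, so differences of letters could
  have more than constantly many prime divisors. Only machine 0 draws random words, and only two, so
  the rest of a run is deterministic. Resource bounds hold for every draw, states are specified even
  for bad hash values, and failures are counted among pairs of words. Four blocks on both sides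
  suffice because palindromes that leave the window share a core of seven blocks, whereas two
  centers in one block yield a period below two blocks.\<close>

definition word_bound :: "nat \<Rightarrow> nat" where
  "word_bound w = 2 ^ w"

lemma word_bound_pos [simp]: "0 < word_bound w"
  by (simp add: word_bound_def)

abbreviation plus_expr :: "expr \<Rightarrow> expr \<Rightarrow> expr" (infixl "+\<^sub>e" 65) where
  "a +\<^sub>e b \<equiv> Binop Add a b"
abbreviation minus_expr :: "expr \<Rightarrow> expr \<Rightarrow> expr" (infixl "-\<^sub>e" 65) where
  "a -\<^sub>e b \<equiv> Binop Sub a b"
abbreviation times_expr :: "expr \<Rightarrow> expr \<Rightarrow> expr" (infixl "*\<^sub>e" 70) where
  "a *\<^sub>e b \<equiv> Binop Mult a b"
abbreviation div_expr :: "expr \<Rightarrow> expr \<Rightarrow> expr" (infixl "div\<^sub>e" 70) where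
  "a div\<^sub>e b \<equiv> Binop Div a b"
abbreviation mod_expr :: "expr \<Rightarrow> expr \<Rightarrow> expr" (infixl "mod\<^sub>e" 70) where
  "a mod\<^sub>e b \<equiv> Binop Mod a b"
abbreviation less_expr :: "expr \<Rightarrow> expr \<Rightarrow> expr" (infix "<\<^sub>e" 50) where
  "a <\<^sub>e b \<equiv> Binop Less a b"
abbreviation equal_expr :: "expr \<Rightarrow> expr \<Rightarrow> expr" (infix "=\<^sub>e" 50) where
  "a =\<^sub>e b \<equiv> Binop Equal a b"
abbreviation and_expr :: "expr \<Rightarrow> expr \<Rightarrow> expr" (infixr "&\<^sub>e" 35) where
  "a &\<^sub>e b \<equiv> Binop And a b"
abbreviation or_expr :: "expr \<Rightarrow> expr \<Rightarrow> expr" (infixr "|\<^sub>e" 30) where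
  "a |\<^sub>e b \<equiv> Binop Or a b"

abbreviation seq_program :: "program \<Rightarrow> program \<Rightarrow> program" (infixr ";;" 20) where
  "p ;; q \<equiv> Seq p q"

text \<open>Word subtraction wraps around. It agrees with subtraction of numbers only if
  \<open>b \<le> a\<close>, so most uses carry that side condition; where a collision may violate
  it, as in \<open>mid_center\<close>, the wrapped value itself is specified.\<close>

definition wsub :: "nat \<Rightarrow> nat \<Rightarrow> nat \<Rightarrow> nat" where
  "wsub w a b = (a + (word_bound w - b)) mod word_bound w"

lemma wsub_eq [simp]:
  assumes "b \<le> a" "a < word_bound w"
  shows "wsub w a b = a - b"
proof -
  have "a + (word_bound w - b) = (a - b) + word_bound w"
    using assms by simp
  then show ?thesis
    unfolding wsub_def using assms by (simp only: mod_add_self2) simp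
qed

text \<open>Messages arrive sorted by sender and, for each sender, in the order of sending, so the
  index of a word identifies it. Tags are read in the first round only, where they are positions of
  letters.\<close>

definition inwords :: "machine \<Rightarrow> nat list" where
  "inwords M = map snd (inbox M)"

lemma inwords_update [simp]:
  "inwords (M\<lparr>regs := a\<rparr>) = inwords M"
  "inwords (M\<lparr>memory := b\<rparr>) = inwords M"
  "inwords (M\<lparr>extent := c\<rparr>) = inwords M"
  "inwords (M\<lparr>outbox := d\<rparr>) = inwords M"
  "inwords (M\<lparr>outputs := d\<rparr>) = inwords M"
  "inwords (M\<lparr>finished := e\<rparr>) = inwords M"
  "inwords (M\<lparr>steps := c\<rparr>) = inwords M"
  "inwords (M\<lparr>peak := c\<rparr>) = inwords M"
  by (simp_all add: inwords_def)

lemma and_indicators: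
  "Bit_Operations.and (if P then 1 else 0) (if Q then 1 else (0::nat)) = (if P \<and> Q then 1 else 0)"
  by auto

lemma or_indicators:
  "Bit_Operations.or (if P then 1 else 0) (if Q then 1 else (0::nat)) = (if P \<or> Q then 1 else 0)"
  by auto

lemma eval_rules:
  "eval w (Const k) M = k mod word_bound w"
  "eval w (Reg x) M = regs M x"
  "eval w Inbox_Length M = length (inwords M) mod word_bound w"
  "eval w (Inbox_Tag e) M = (let i = eval w e M in if i < length (inbox M) then fst (inbox M ! i) else 0)"
  "eval w (Inbox_Word e) M =
     (let i = eval w e M in if i < length (inwords M) then inwords M ! i else 0)"
  "eval w (a +\<^sub>e b) M = (eval w a M + eval w b M) mod word_bound w"
  "eval w (a -\<^sub>e b) M = wsub w (eval w a M) (eval w b M)"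
  "eval w (a *\<^sub>e b) M = (eval w a M * eval w b M) mod word_bound w"
  "eval w (a div\<^sub>e b) M = eval w a M div eval w b M"
  "eval w (a mod\<^sub>e b) M = eval w a M mod eval w b M"
  "eval w (a <\<^sub>e b) M = (if eval w a M < eval w b M then 1 else 0)"
  "eval w (a =\<^sub>e b) M = (if eval w a M = eval w b M then 1 else 0)"
  "eval w (a &\<^sub>e b) M = Bit_Operations.and (eval w a M) (eval w b M)"
  "eval w (a |\<^sub>e b) M = Bit_Operations.or (eval w a M) (eval w b M)"
  by (simp_all add: word_bound_def wsub_def inwords_def Let_def)

declare eval.simps [simp del] eval_binop.simps [simp del]

text \<open>Meant for deterministic executions: \<open>Rand\<close> gets the condition
  \<open>False\<close>, and the one round that draws words is executed by hand. A loop has no closed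
  condition, so its clause refers to the execution itself; \<open>wp_While\<close> makes it
  usable.\<close>

primrec wp :: "nat \<Rightarrow> program \<Rightarrow> (machine \<Rightarrow> bool) \<Rightarrow> machine \<Rightarrow> bool" where
  "wp w Skip Q M = Q (tick M)"
| "wp w (Assign x e) Q M = Q (tick (set_reg x (eval w e M) M))"
| "wp w (Load x e) Q M = Q (tick (touch (eval w e M) (set_reg x (memory M (eval w e M)) M)))"
| "wp w (Store e1 e2) Q M =
     Q (tick (touch (eval w e1 M) (M\<lparr>memory := (memory M)(eval w e1 M := eval w e2 M)\<rparr>)))"
| "wp w (Rand x) Q M = False"
| "wp w (Send e1 e2) Q M = Q (tick (M\<lparr>outbox := outbox M @ [(eval w e1 M, eval w e2 M)]\<rparr>))"
| "wp w (Output e1 e2) Q M = Q (tick (M\<lparr>outputs := outputs M @ [(eval w e1 M, eval w e2 M)]\<rparr>))"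
| "wp w Finish Q M = Q (tick (M\<lparr>finished := True\<rparr>))"
| "wp w (Seq p q) Q M = wp w p (wp w q Q) M"
| "wp w (If e p q) Q M = (if eval w e M \<noteq> 0 then wp w p Q (tick M) else wp w q Q (tick M))"
| "wp w (While e p) Q M = (\<exists>M'. exec w (While e p) M = return_spmf M' \<and> Q M')"

lemma wp_exec: "wp w p Q M \<Longrightarrow> \<exists>M'. exec w p M = return_spmf M' \<and> Q M'"
proof (induction p arbitrary: Q M)
  case (Seq p q)
  from Seq.IH(1)[of "wp w q Q" M] Seq.prems
  obtain M' where M': "exec w p M = return_spmf M'" "wp w q Q M'"
    by auto
  from Seq.IH(2)[OF M'(2)] obtain M'' where "exec w q M' = return_spmf M''" "Q M''"
    by blast
  with M' show ?case
    by auto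
next
  case (If e p q)
  then show ?case
    by (cases "eval w e M = 0") auto
qed (auto simp: Let_def)

lemma wp_mono: "wp w p Q M \<Longrightarrow> (\<And>M'. Q M' \<Longrightarrow> R M') \<Longrightarrow> wp w p R M"
proof (induction p arbitrary: Q R M)
  case (Seq p q)
  show ?case
    using Seq.prems Seq.IH(1)[of "wp w q Q" M "wp w q R"] Seq.IH(2)[of Q _ R] by auto
next
  case (If e p q)
  then show ?case
    by (cases "eval w e M = 0") auto
qed auto

text \<open>Total correctness: along the measure \<open>\<mu>\<close> the recursion of
  \<open>while_spmf\<close> unfolds finitely often, so the loop is a point mass and loses no
  probability.\<close>

lemma wp_While:
  fixes Inv :: "machine \<Rightarrow> bool" and \<mu> :: "machine \<Rightarrow> nat"
  assumes "Inv M"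
    and step: "\<And>M. Inv M \<Longrightarrow> eval w e M \<noteq> 0 \<Longrightarrow> wp w p (\<lambda>M'. Inv M' \<and> \<mu> M' < \<mu> M) (tick M)"
    and exit: "\<And>M. Inv M \<Longrightarrow> eval w e M = 0 \<Longrightarrow> Q (tick M)"
  shows "wp w (While e p) Q M"
proof -
  have "\<exists>M'. while_spmf (\<lambda>M. eval w e M \<noteq> 0) (\<lambda>M. exec w p (tick M)) M = return_spmf M'
             \<and> Inv M' \<and> eval w e M' = 0"
    using assms(1)
  proof (induction "\<mu> M" arbitrary: M rule: less_induct)
    case less
    show ?case
    proof (cases "eval w e M = 0")
      case True
      then show ?thesis
        using less.prems by (subst while_spmf.simps) auto
    next
      case False
      from wp_exec[OF step[OF less.prems False]] obtain M' where
        M': "exec w p (tick M) = return_spmf M'" "Inv M'" "\<mu> M' < \<mu> M"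
        by blast
      show ?thesis
        using less.hyps[OF M'(3,2)] M'(1) False by (subst while_spmf.simps) auto
    qed
  qed
  then show ?thesis
    using exit by auto
qed

definition For :: "nat \<Rightarrow> expr \<Rightarrow> program \<Rightarrow> program" where
  "For x e p = (Assign x (Const 0) ;; While (Reg x <\<^sub>e e) (p ;; Assign x (Reg x +\<^sub>e Const 1)))"

text \<open>The bound is evaluated again before every iteration and the body may write registers,
  hence the premises that the bound still yields \<open>N\<close> and that the body hands back the
  counter. \<open>J i\<close> is established with the counter already equal to
  \<open>i\<close>.\<close>

lemma wp_For:
  fixes J :: "nat \<Rightarrow> machine \<Rightarrow> bool"
  assumes N: "N < word_bound w"
    and init: "J 0 (tick (set_reg x 0 M))"
    and bound: "\<And>i M. J i M \<Longrightarrow> i \<le> N \<Longrightarrow> regs M x = i \<Longrightarrow> eval w e M = N"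
    and step: "\<And>i M. J i M \<Longrightarrow> i < N \<Longrightarrow> regs M x = i \<Longrightarrow>
      wp w p (\<lambda>M'. regs M' x = i \<and> J (Suc i) (tick (set_reg x (Suc i) M'))) (tick M)"
    and exit: "\<And>M. J N M \<Longrightarrow> Q (tick M)"
  shows "wp w (For x e p) Q M"
  unfolding For_def wp.simps(2,9)
proof (rule wp_While[where Inv = "\<lambda>M. regs M x \<le> N \<and> J (regs M x) M"
        and \<mu> = "\<lambda>M. N - regs M x"])
  show "regs (tick (set_reg x (eval w (Const 0) M) M)) x \<le> N \<and>
    J (regs (tick (set_reg x (eval w (Const 0) M) M)) x) (tick (set_reg x (eval w (Const 0) M) M))"
    using init by (simp add: eval_rules tick_def set_reg_def)
next
  fix M
  assume J: "regs M x \<le> N \<and> J (regs M x) M" and e: "eval w (Reg x <\<^sub>e e) M \<noteq> 0"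
  have b: "eval w e M = N"
    using bound J by blast
  with e have i: "regs M x < N"
    by (auto simp: eval_rules split: if_splits)
  have one: "1 mod word_bound w = 1"
    using i N by simp
  show "wp w (p ;; Assign x (Reg x +\<^sub>e Const 1))
      (\<lambda>M'. (regs M' x \<le> N \<and> J (regs M' x) M') \<and> N - regs M' x < N - regs M x) (tick M)"
    unfolding wp.simps
    by (rule wp_mono[OF step[of "regs M x" M]])
       (use J i N one in \<open>auto simp: eval_rules tick_def set_reg_def\<close>)
next
  fix M
  assume J: "regs M x \<le> N \<and> J (regs M x) M" and e: "eval w (Reg x <\<^sub>e e) M = 0"
  have "eval w e M = N"
    using bound J by blast
  with e J have "regs M x = N"
    by (auto simp: eval_rules split: if_splits)
  with J show "Q (tick M)"
    using exit by simp
qed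

text \<open>
  Registers below 20 hold values that live across loops and rounds; loops only change registers
  from 20 on.
\<close>

definition low :: "(nat \<Rightarrow> nat) \<Rightarrow> nat \<Rightarrow> nat" where
  "low f = (\<lambda>x. if x < 20 then f x else 0)"

lemma low_upd [simp]: "20 \<le> x \<Longrightarrow> low (f(x := v)) = low f"
  by (auto simp: low_def)

lemma low_cong: "low f = low g \<Longrightarrow> x < 20 \<Longrightarrow> f x = g x"
  by (metis low_def)

lemma low_eqD:
  assumes "low f = low g"
  shows "f 0 = g 0" "f (Suc 0) = g (Suc 0)" "f 2 = g 2" "f 3 = g 3" "f 4 = g 4" "f 5 = g 5" "f 6 = g 6"
    "f 7 = g 7" "f 8 = g 8" "f 9 = g 9" "f 10 = g 10" "f 11 = g 11" "f 12 = g 12" "f 13 = g 13"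
    "f 14 = g 14" "f 15 = g 15" "f 16 = g 16" "f 17 = g 17" "f 18 = g 18" "f 19 = g 19"
  by (auto intro!: low_cong[OF assms])

lemmas machine_defs = tick_def set_reg_def touch_def


section \<open>Palindromes around a center\<close>

text \<open>
  A center is represented by the sum \<open>s\<close> of the end positions; \<open>pal T s x\<close> says that the
  (possibly empty) fragment with center \<open>s\<close> whose exclusive right end is \<open>x\<close> is palindromic.
\<close>

definition pal :: "'a list \<Rightarrow> nat \<Rightarrow> nat \<Rightarrow> bool" where
  "pal T s x \<longleftrightarrow> x \<le> length T \<and> x \<le> s + 1 \<and> (\<forall>u v. u + v = s \<longrightarrow> u < x \<longrightarrow> v < x \<longrightarrow> T ! u = T ! v)"

text \<open>The exclusive right end; the left end is \<open>s + 1 - pal_end T s\<close>. Values up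
  to half of \<open>s + 1\<close> describe an empty palindrome, for which the letter condition of
  \<open>pal\<close> is vacuous.\<close>

definition pal_end :: "'a list \<Rightarrow> nat \<Rightarrow> nat" where
  "pal_end T s = Max {x. pal T s x}"

lemma pal_mono: "pal T s x \<Longrightarrow> y \<le> x \<Longrightarrow> pal T s y"
  by (auto simp: pal_def)

lemma finite_pal: "finite {x. pal T s x}"
  by (rule finite_subset[of _ "{..length T}"]) (auto simp: pal_def)

lemma pal_pal_end: "pal T s (pal_end T s)"
proof -
  have "pal T s 0"
    by (simp add: pal_def)
  then show ?thesis
    unfolding pal_end_def using Max_in[OF finite_pal[of T s]] by blast
qed

lemma pal_endD: "u + v = s \<Longrightarrow> u < pal_end T s \<Longrightarrow> v < pal_end T s \<Longrightarrow> T ! u = T ! v"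
  using pal_pal_end[of T s] by (auto simp: pal_def)

lemma pal_iff: "pal T s x \<longleftrightarrow> x \<le> pal_end T s"
  using pal_pal_end pal_mono Max_ge[OF finite_pal, of x T s] unfolding pal_end_def by blast

lemma pal_end_eqI: "pal T s x \<Longrightarrow> \<not> pal T s (Suc x) \<Longrightarrow> pal_end T s = x"
  unfolding pal_iff by simp

lemma pal_end_le: "pal_end T s \<le> length T" "pal_end T s \<le> s + 1"
  using pal_pal_end[of T s] by (auto simp: pal_def)

text \<open>Two numbers below \<open>s div 2 + 1\<close> with sum \<open>s\<close> must be equal, so
  up to there no letters have to agree.\<close>

lemma pal_end_ge:
  assumes "s + 1 < 2 * length T"
  shows "s div 2 + 1 \<le> pal_end T s"
proof -
  have "pal T s (s div 2 + 1)"
    unfolding pal_def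
  proof (intro conjI allI impI)
    fix u v
    assume uv: "u + v = s" "u < s div 2 + 1" "v < s div 2 + 1"
    then have "u = v"
      by presburger
    then show "T ! u = T ! v"
      by simp
  qed (use assms in auto)
  then show ?thesis
    by (simp add: pal_iff)
qed

text \<open>\<open>s \<le> 2 * x\<close> puts the new position at or beyond the center, so its
  partner \<open>s - x\<close> is already in range and one comparison decides.\<close>

lemma pal_Suc:
  assumes "pal T s x" "s \<le> 2 * x"
  shows "pal T s (Suc x) \<longleftrightarrow> x < length T \<and> x \<le> s \<and> T ! x = T ! (s - x)"
proof
  assume "pal T s (Suc x)"
  moreover from this have "x \<le> s"
    by (simp add: pal_def)
  moreover have "x + (s - x) = s" "s - x < Suc x"
    using \<open>x \<le> s\<close> assms by auto
  ultimately show "x < length T \<and> x \<le> s \<and> T ! x = T ! (s - x)"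
    unfolding pal_def by (metis Suc_le_lessD lessI)
next
  assume R: "x < length T \<and> x \<le> s \<and> T ! x = T ! (s - x)"
  show "pal T s (Suc x)"
    unfolding pal_def
  proof (intro conjI allI impI)
    fix u v
    assume uv: "u + v = s" "u < Suc x" "v < Suc x"
    consider "u = x" | "v = x" | "u < x" "v < x"
      using uv by linarith
    then show "T ! u = T ! v"
    proof cases
      case 1
      with uv R show ?thesis by (metis add_diff_cancel_left')
    next
      case 2
      with uv R show ?thesis by (metis add_diff_cancel_right')
    next
      case 3
      with uv assms show ?thesis by (auto simp: pal_def)
    qed
  qed (use R in auto)
qed

text \<open>Sending \<open>u\<close> to \<open>s0 - u\<close> is a symmetry of the letters inside
  the palindrome around \<open>s0\<close>. It carries pairs with sum \<open>s\<close> to pairs with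
  sum \<open>2 * s0 - s\<close>; this is the copying step of Manacher's algorithm.\<close>

lemma pal_mirror:
  assumes "pal T s0 e" "s0 < s" "s \<le> 2 * s0" "x \<le> e" "s \<le> x + s0"
  shows "pal T s x \<longleftrightarrow> pal T (2 * s0 - s) (x + s0 - s)"
proof -
  have e: "e \<le> length T" "e \<le> s0 + 1"
    and eq: "\<And>u v. u + v = s0 \<Longrightarrow> u < e \<Longrightarrow> v < e \<Longrightarrow> T ! u = T ! v"
    using assms(1) by (auto simp: pal_def)
  have "(\<forall>u v. u + v = s \<longrightarrow> u < x \<longrightarrow> v < x \<longrightarrow> T ! u = T ! v) \<longleftrightarrow>
        (\<forall>u v. u + v = 2 * s0 - s \<longrightarrow> u < x + s0 - s \<longrightarrow> v < x + s0 - s \<longrightarrow> T ! u = T ! v)"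
    (is "?l \<longleftrightarrow> ?r")
  proof
    assume ?l
    show ?r
    proof (intro allI impI)
      fix u v
      assume uv: "u + v = 2 * s0 - s" "u < x + s0 - s" "v < x + s0 - s"
      have "T ! u = T ! (s0 - u)"
        by (rule eq) (use uv assms e in auto)
      moreover have "T ! v = T ! (s0 - v)"
        by (rule eq) (use uv assms e in auto)
      moreover have "T ! (s0 - u) = T ! (s0 - v)"
        using \<open>?l\<close> uv assms e by auto
      ultimately show "T ! u = T ! v"
        by simp
    qed
  next
    assume ?r
    show ?l
    proof (intro allI impI)
      fix u v
      assume uv: "u + v = s" "u < x" "v < x"
      have "T ! u = T ! (s0 - u)"
        by (rule eq) (use uv assms e in auto)
      moreover have "T ! v = T ! (s0 - v)"
        by (rule eq) (use uv assms e in auto)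
      moreover have "T ! (s0 - u) = T ! (s0 - v)"
        using \<open>?r\<close> uv assms e by auto
      ultimately show "T ! u = T ! v"
        by simp
    qed
  qed
  then show ?thesis
    using assms e unfolding pal_def by auto
qed

lemma palindromic_fragment_iff:
  "palindromic_fragment S a b \<longleftrightarrow> a \<le> b \<and> pal S (a + b) (Suc b)"
proof -
  have "palindrome (fragment S a b) \<longleftrightarrow> (\<forall>u v. u + v = a + b \<longrightarrow> u < Suc b \<longrightarrow> v < Suc b \<longrightarrow> S ! u = S ! v)"
    if ab: "a \<le> b" "b < length S"
  proof -
    have len: "length (fragment S a b) = Suc b - a"
      using ab by (simp add: fragment_def)
    have nth: "fragment S a b ! i = S ! (a + i)" if "i < Suc b - a" for i
      using ab that by (simp add: fragment_def)
    have "palindrome (fragment S a b) \<longleftrightarrow> (\<forall>i < Suc b - a. S ! (b - i) = S ! (a + i))"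
      unfolding palindrome_def list_eq_iff_nth_eq using ab
      by (auto simp: len nth rev_nth Suc_diff_le algebra_simps)
    also have "\<dots> \<longleftrightarrow> (\<forall>u v. u + v = a + b \<longrightarrow> u < Suc b \<longrightarrow> v < Suc b \<longrightarrow> S ! u = S ! v)"
    proof
      assume L: "\<forall>i < Suc b - a. S ! (b - i) = S ! (a + i)"
      show "\<forall>u v. u + v = a + b \<longrightarrow> u < Suc b \<longrightarrow> v < Suc b \<longrightarrow> S ! u = S ! v"
      proof (intro allI impI)
        fix u v
        assume uv: "u + v = a + b" "u < Suc b" "v < Suc b"
        have "S ! (b - (b - u)) = S ! (a + (b - u))"
          by (rule L[rule_format]) (use uv in auto)
        moreover have "b - (b - u) = u" "a + (b - u) = v"
          using uv by auto
        ultimately show "S ! u = S ! v"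
          by simp
      qed
    next
      assume R: "\<forall>u v. u + v = a + b \<longrightarrow> u < Suc b \<longrightarrow> v < Suc b \<longrightarrow> S ! u = S ! v"
      show "\<forall>i < Suc b - a. S ! (b - i) = S ! (a + i)"
        by (intro allI impI R[rule_format]) (use ab in auto)
    qed
    finally show ?thesis .
  qed
  then show ?thesis
    unfolding palindromic_fragment_def pal_def by auto
qed

text \<open>Translates the specification, with its real centers and lengths, into sums of end
  positions. The second condition on \<open>s\<close> removes the centers whose longest palindrome
  is empty, as fragments are nonempty.\<close>

lemma maximal_palindromes_eq:
  "maximal_palindromes S =
     (\<lambda>s. (s + 1 - pal_end S s, pal_end S s - 1)) `
     {s. s + 1 < 2 * length S \<and> s + 1 < 2 * pal_end S s}" (is "_ = ?R")
proof -
  have *: "(a, b) \<in> maximal_palindromes S \<longleftrightarrow> a \<le> b \<and> Suc b = pal_end S (a + b)" for a b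
  proof -
    have len: "length (fragment S a b) = Suc b - a" if "palindromic_fragment S a b" for a b
      using that by (auto simp: fragment_def palindromic_fragment_def)
    have "(a, b) \<in> maximal_palindromes S \<longleftrightarrow> palindromic_fragment S a b \<and>
        (\<forall>a' b'. palindromic_fragment S a' b' \<and> a' + b' = a + b \<longrightarrow> b' \<le> b)"
    proof -
      have "length (fragment S a b) < length (fragment S a' b') \<longleftrightarrow> b < b'"
        if "palindromic_fragment S a b" "palindromic_fragment S a' b'" "a' + b' = a + b" for a' b'
        using that len[OF that(1)] len[OF that(2)] unfolding palindromic_fragment_def by linarith
      moreover have "center a' b' = center a b \<longleftrightarrow> a' + b' = a + b" for a' b'
        unfolding center_def by (simp add: of_nat_add[symmetric] del: of_nat_add)
      ultimately show ?thesis
        unfolding maximal_palindromes_def by (simp add: not_less) (metis not_le)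
    qed
    also have "\<dots> \<longleftrightarrow> a \<le> b \<and> Suc b = pal_end S (a + b)"
    proof
      assume L: "palindromic_fragment S a b \<and>
        (\<forall>a' b'. palindromic_fragment S a' b' \<and> a' + b' = a + b \<longrightarrow> b' \<le> b)"
      then have ab: "a \<le> b" "Suc b \<le> pal_end S (a + b)"
        by (auto simp: palindromic_fragment_iff pal_iff)
      let ?b = "pal_end S (a + b) - 1"
      have eq: "a + b - ?b + ?b = a + b"
        using pal_end_le(2)[of S "a + b"] by simp
      have "palindromic_fragment S (a + b - ?b) ?b"
        unfolding palindromic_fragment_iff eq using ab by (auto simp: pal_iff)
      with L eq have "?b \<le> b"
        by blast
      with ab show "a \<le> b \<and> Suc b = pal_end S (a + b)"
        by auto
    next
      assume R: "a \<le> b \<and> Suc b = pal_end S (a + b)"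
      then show "palindromic_fragment S a b \<and>
        (\<forall>a' b'. palindromic_fragment S a' b' \<and> a' + b' = a + b \<longrightarrow> b' \<le> b)"
        unfolding palindromic_fragment_iff pal_iff by (metis Suc_le_mono order_refl)
    qed
    finally show ?thesis .
  qed
  show ?thesis
  proof (intro equalityI subrelI)
    fix a b
    assume "(a, b) \<in> maximal_palindromes S"
    with * have ab: "a \<le> b" "Suc b = pal_end S (a + b)"
      by auto
    moreover have "Suc b \<le> length S"
      using pal_end_le(1)[of S "a + b"] ab by simp
    ultimately show "(a, b) \<in> ?R"
      by (intro image_eqI[of _ _ "a + b"]) auto
  next
    fix a b
    assume "(a, b) \<in> ?R"
    then obtain s where s: "s + 1 < 2 * pal_end S s" "a = s + 1 - pal_end S s" "b = pal_end S s - 1"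
      by auto
    then have "a + b = s"
      using pal_end_le(2)[of S s] by auto
    then show "(a, b) \<in> maximal_palindromes S"
      unfolding * using s by auto
  qed
qed

lemma pal_window:
  assumes "lo + len \<le> length S" "x \<le> len" "x \<le> t + 1"
  shows "pal (take len (drop lo S)) t x \<longleftrightarrow> pal S (t + 2 * lo) (x + lo)"
proof -
  have "(\<forall>u v. u + v = t \<longrightarrow> u < x \<longrightarrow> v < x \<longrightarrow> take len (drop lo S) ! u = take len (drop lo S) ! v) \<longleftrightarrow>
    (\<forall>u v. u + v = t + 2 * lo \<longrightarrow> u < x + lo \<longrightarrow> v < x + lo \<longrightarrow> S ! u = S ! v)" (is "?l \<longleftrightarrow> ?r")
  proof
    assume ?l
    show ?r
    proof (intro allI impI)
      fix u v
      assume uv: "u + v = t + 2 * lo" "u < x + lo" "v < x + lo"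
      have "take len (drop lo S) ! (u - lo) = take len (drop lo S) ! (v - lo)"
        by (rule \<open>?l\<close>[rule_format]) (use uv assms in auto)
      then show "S ! u = S ! v"
        using uv assms by simp
    qed
  next
    assume ?r
    show ?l
    proof (intro allI impI)
      fix u v
      assume uv: "u + v = t" "u < x" "v < x"
      have "S ! (lo + u) = S ! (lo + v)"
        by (rule \<open>?r\<close>[rule_format]) (use uv in auto)
      then show "take len (drop lo S) ! u = take len (drop lo S) ! v"
        using uv assms by simp
    qed
  qed
  then show ?thesis
    unfolding pal_def using assms by auto
qed

text \<open>A palindrome that stops strictly inside the window stops at a mismatch, and the mismatch
  is also one of \<open>S\<close>. At an end of the window the argument needs that end to be an end
  of \<open>S\<close>.\<close>

lemma pal_end_window:
  assumes "lo + len \<le> length S" "x = pal_end (take len (drop lo S)) t"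
    and "x = len \<Longrightarrow> lo + len = length S" "x = t + 1 \<Longrightarrow> lo = 0"
  shows "pal_end S (t + 2 * lo) = x + lo"
proof (rule pal_end_eqI)
  let ?T = "take len (drop lo S)"
  have x: "x \<le> len" "x \<le> t + 1" "pal ?T t x" "\<not> pal ?T t (Suc x)"
    using assms(1,2) pal_end_le[of ?T t] by (auto simp: pal_iff)
  show "pal S (t + 2 * lo) (x + lo)"
    using x pal_window[OF assms(1)] by blast
  show "\<not> pal S (t + 2 * lo) (Suc (x + lo))"
  proof
    assume *: "pal S (t + 2 * lo) (Suc (x + lo))"
    have "x \<noteq> len" "x \<noteq> t + 1"
      using assms(3,4) * by (auto simp: pal_def)
    then have "x < len" "x \<noteq> t + 1"
      using x by auto
    with x * pal_window[OF assms(1), of "Suc x" t] show False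
      by simp
  qed
qed


section \<open>Long palindromes around nearby centers\<close>

text \<open>
  Two long palindromes with centers \<open>sx < sy\<close> make the string locally periodic with period
  \<open>sy - sx\<close>. Any other long palindrome around a center in between extends to the nearer end
  of the run, unless its center is the center of the run.
\<close>

lemma run_symmetric:
  fixes f :: "nat \<Rightarrow> 'a"
  assumes per: "\<And>y. L \<le> y \<Longrightarrow> y + P < R \<Longrightarrow> f y = f (y + P)"
    and core: "L \<le> a" "b \<le> R" "2 * a + 2 * P \<le> s" "s + 2 * P \<le> 2 * b" "0 < P"
    and sym: "\<And>u v. u + v = s \<Longrightarrow> a \<le> u \<Longrightarrow> a \<le> v \<Longrightarrow> u < b \<Longrightarrow> v < b \<Longrightarrow> f u = f v"
    and uv: "u + v = s" "L \<le> u" "L \<le> v" "u < R" "v < R"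
  shows "f u = f v"
proof -
  have *: "f u = f v" if "u \<le> v" "u + v = s" "L \<le> u" "v < R" for u v
    using that
  proof (induction "v - u" arbitrary: u v rule: less_induct)
    case less
    show ?case
    proof (cases "a \<le> u \<and> v < b")
      case True
      then show ?thesis
        using less.prems sym by auto
    next
      case False
      \<comment> \<open>A position outside the core is at least one period away from the center,
        because the core extends by a period beyond it on both sides; so both positions can move
        inwards by \<open>P\<close> without crossing.\<close>
      have le: "u + P \<le> v - P" "P \<le> v"
        using False less.prems core by linarith+
      have "f (u + P) = f (v - P)"
        by (rule less.hyps) (use less.prems le core in auto)
      moreover have "f u = f (u + P)"
        by (rule per) (use less.prems le core in auto)
      moreover have "f (v - P) = f (v - P + P)"
        by (rule per) (use less.prems le core in auto)
      ultimately show ?thesis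
        using le by simp
    qed
  qed
  show ?thesis
  proof (cases "u \<le> v")
    case True
    then show ?thesis
      using * uv by blast
  next
    case False
    then have "f v = f u"
      using *[of v u] uv by simp
    then show ?thesis
      by simp
  qed
qed

text \<open>Inside the run the symmetry is complete by \<open>run_symmetric\<close>. At the nearer
  end of the run the palindrome stops, since one more step would carry the mismatch that ends the
  period to letters that agree. Only if both ends are reached at once may it continue.\<close>

lemma pal_end_run:
  fixes S :: "'a list"
  assumes per: "\<And>y. L \<le> y \<Longrightarrow> y + P < R \<Longrightarrow> S ! y = S ! (y + P)"
    and left: "0 < L \<Longrightarrow> S ! (L - 1) \<noteq> S ! (L - 1 + P)"
    and right: "R < length S \<Longrightarrow> S ! (R - P) \<noteq> S ! R"
    and core: "L \<le> a" "b \<le> R" "R \<le> length S" "2 * a + 2 * P \<le> s" "s + 2 * P \<le> 2 * b" "0 < P"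
    and sym: "\<And>u v. u + v = s \<Longrightarrow> a \<le> u \<Longrightarrow> a \<le> v \<Longrightarrow> u < b \<Longrightarrow> v < b \<Longrightarrow> S ! u = S ! v"
  shows "s + 1 \<noteq> L + R \<Longrightarrow> pal_end S s = min (s + 1 - L) R" "s + 1 = L + R \<Longrightarrow> R \<le> pal_end S s"
proof -
  have sym': "S ! u = S ! v" if "u + v = s" "L \<le> u" "L \<le> v" "u < R" "v < R" for u v
    by (rule run_symmetric[where L = L and P = P and R = R and a = a and b = b and s = s])
      (fact per core sym that)+
  have ab: "a + 2 * P \<le> b" "L + P \<le> s"
    using core by linarith+
  have pal: "pal S s (min (s + 1 - L) R)"
    unfolding pal_def
  proof (intro conjI allI impI)
    fix u v
    assume "u + v = s" "u < min (s + 1 - L) R" "v < min (s + 1 - L) R"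
    then show "S ! u = S ! v"
      by (intro sym') auto
  qed (use core in auto)
  show "R \<le> pal_end S s" if "s + 1 = L + R"
    using pal that by (simp add: pal_iff)
  show "pal_end S s = min (s + 1 - L) R" if ne: "s + 1 \<noteq> L + R"
  proof (rule pal_end_eqI[OF pal], rule notI)
    assume p: "pal S s (Suc (min (s + 1 - L) R))"
    show False
    proof (cases "s + 1 < L + R")
      case True
      then have x: "min (s + 1 - L) R = s + 1 - L"
        by auto
      from p x have L: "0 < L"
        using ab by (auto simp: pal_def)
      \<comment> \<open>The left end is reached first, so the mirror image of \<open>L - 1\<close>
        still lies in the run. Periodicity and symmetry then equate the two letters whose difference
        ends the run.\<close>
      let ?v = "s + 1 - L"
      have "S ! (L - 1) = S ! ?v"
        using p x L ab core unfolding pal_def by auto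
      moreover have "S ! (?v - P) = S ! (?v - P + P)"
        by (rule per) (use True ab core in auto)
      moreover have "S ! (L - 1 + P) = S ! (?v - P)"
        by (rule sym') (use True L ab core in auto)
      moreover have "?v - P + P = ?v"
        using ab by simp
      ultimately show False
        using left L by simp
    next
      case False
      then have x: "min (s + 1 - L) R = R" and s: "L + R \<le> s"
        using ne by auto
      from p x have R: "R < length S"
        by (auto simp: pal_def)
      have "S ! (s - R) = S ! R"
        using p x s R ab core unfolding pal_def by auto
      moreover have "S ! (s - R) = S ! (s - R + P)"
        by (rule per) (use s ab core in auto)
      moreover have "S ! (s - R + P) = S ! (R - P)"
        by (rule sym') (use s ab core in auto)
      ultimately show False
        using right R by simp
    qed
  qed
qed

text \<open>Reflection at \<open>sx\<close> followed by reflection at \<open>sy\<close> is a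
  translation by \<open>sy - sx\<close>, so the common core has this period. In the maximal run
  around the core, a palindrome centered left of the middle ends where its left end leaves the run,
  one right of the middle ends with the run; both ends can be read off from \<open>sx\<close> and
  \<open>sy\<close>.\<close>

lemma pal_end_between:
  fixes S :: "'a list"
  assumes bounds: "b \<le> length S" "2 * a + 2 * (sy - sx) \<le> sx" "sy + 2 * (sy - sx) \<le> 2 * b"
    and c: "sx < c" "c < sy"
    and long: "\<And>s. s \<in> {sx, c, sy} \<Longrightarrow> b \<le> pal_end S s \<and> s + 1 \<le> a + pal_end S s"
    and mid: "c + pal_end S sx \<noteq> sx + pal_end S sy"
  shows "pal_end S c = min (c + pal_end S sx - sx) (pal_end S sy)"
proof -
  define P where "P = sy - sx"
  have sym: "S ! u = S ! v" if "s \<in> {sx, c, sy}" "u + v = s" "a \<le> u" "a \<le> v" for s u v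
    by (rule pal_endD[of _ _ s]) (use long[OF that(1)] that(2-4) in auto)
  have core: "S ! y = S ! (y + P)" if "a \<le> y" "y + P < b" for y
  proof -
    have "y \<le> sx"
      using that(2) long[of sx] pal_end_le(2)[of S sx] by auto
    have "S ! y = S ! (sx - y)"
      by (rule pal_endD[of _ _ sx]) (use that bounds long[of sx] c \<open>y \<le> sx\<close> in \<open>auto simp: P_def\<close>)
    moreover have "S ! (y + P) = S ! (sx - y)"
      by (rule pal_endD[of _ _ sy]) (use that bounds long[of sy] c \<open>y \<le> sx\<close> in \<open>auto simp: P_def\<close>)
    ultimately show ?thesis
      by simp
  qed
  \<comment> \<open>\<open>L\<close> is minimal for the fixed right bound \<open>b\<close>, and
    \<open>R\<close> below is maximal for the fixed left bound \<open>a\<close>. The two half-runs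
    overlap in the core and together form one run.\<close>
  define L where "L = (LEAST l. \<forall>y. l \<le> y \<and> y + P < b \<longrightarrow> S ! y = S ! (y + P))"
  have L0: "\<forall>y. a \<le> y \<and> y + P < b \<longrightarrow> S ! y = S ! (y + P)"
    using core by blast
  have L: "\<And>y. L \<le> y \<Longrightarrow> y + P < b \<Longrightarrow> S ! y = S ! (y + P)" "L \<le> a"
    using LeastI[of "\<lambda>l. \<forall>y. l \<le> y \<and> y + P < b \<longrightarrow> S ! y = S ! (y + P)", OF L0]
      Least_le[of "\<lambda>l. \<forall>y. l \<le> y \<and> y + P < b \<longrightarrow> S ! y = S ! (y + P)", OF L0]
    unfolding L_def by blast+
  have Lmax: "S ! (L - 1) \<noteq> S ! (L - 1 + P)" if "0 < L"
  proof
    assume eq: "S ! (L - 1) = S ! (L - 1 + P)"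
    have "\<forall>y. L - 1 \<le> y \<and> y + P < b \<longrightarrow> S ! y = S ! (y + P)"
      using L(1) eq by (metis Suc_pred' le_less_Suc_eq not_less that le_neq_implies_less Suc_leI)
    then have "L \<le> L - 1"
      unfolding L_def by (rule Least_le)
    with that show False
      by simp
  qed
  define Q where "Q r \<longleftrightarrow> r \<le> length S \<and> (\<forall>y. a \<le> y \<and> y + P < r \<longrightarrow> S ! y = S ! (y + P))" for r
  define R where "R = (GREATEST r. Q r)"
  have Qb: "Q b"
    using core bounds by (auto simp: Q_def)
  have QR: "Q R" and bR: "b \<le> R"
    unfolding R_def
    using GreatestI_nat[of Q b "length S", OF Qb] Greatest_le_nat[of Q b "length S", OF Qb]
    by (auto simp: Q_def)
  have Rmax: "S ! (R - P) \<noteq> S ! R" if "R < length S"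
  proof
    assume eq: "S ! (R - P) = S ! R"
    have "Q (Suc R)"
      unfolding Q_def
    proof (intro conjI allI impI)
      fix y
      assume y: "a \<le> y \<and> y + P < Suc R"
      show "S ! y = S ! (y + P)"
      proof (cases "y + P = R")
        case True
        then have "y = R - P"
          by simp
        with True eq show ?thesis
          by simp
      next
        case False
        with y QR show ?thesis
          by (auto simp: Q_def)
      qed
    qed (use that in auto)
    then have "Suc R \<le> R"
      unfolding R_def by (rule Greatest_le_nat[where b = "length S"]) (auto simp: Q_def)
    then show False
      by simp
  qed
  have P: "0 < P" and ab: "a + P \<le> b"
    using c bounds by (auto simp: P_def)
  have per: "S ! y = S ! (y + P)" if "L \<le> y" "y + P < R" for y
    using that L(1) QR ab by (cases "a \<le> y") (auto simp: Q_def)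
  have RS: "R \<le> length S"
    using QR by (simp add: Q_def)
  have ends: "(s + 1 \<noteq> L + R \<longrightarrow> pal_end S s = min (s + 1 - L) R) \<and> (s + 1 = L + R \<longrightarrow> R \<le> pal_end S s)"
    if s: "s \<in> {sx, c, sy}" for s
  proof -
    have s': "2 * a + 2 * P \<le> s" "s + 2 * P \<le> 2 * b"
      using s bounds c by (auto simp: P_def)
    have symab: "\<And>u v. u + v = s \<Longrightarrow> a \<le> u \<Longrightarrow> a \<le> v \<Longrightarrow> u < b \<Longrightarrow> v < b \<Longrightarrow> S ! u = S ! v"
      using sym[OF s] by blast
    have "pal_end S s = min (s + 1 - L) R" if "s + 1 \<noteq> L + R"
      by (rule pal_end_run(1)[where P = P and a = a and b = b])
        (fact per Lmax Rmax L(2) bR RS s' P symab that)+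
    moreover have "R \<le> pal_end S s" if "s + 1 = L + R"
      by (rule pal_end_run(2)[where L = L and P = P and a = a and b = b])
        (fact per Lmax Rmax L(2) bR RS s' P symab that)+
    ultimately show ?thesis
      by blast
  qed
  have La: "L \<le> sx"
    using L(2) bounds by linarith
  have x: "(sx + 1 < L + R \<longrightarrow> pal_end S sx = sx + 1 - L) \<and> (L + R < sx + 1 \<longrightarrow> pal_end S sx = R)
      \<and> (sx + 1 = L + R \<longrightarrow> R \<le> pal_end S sx)"
    using ends[of sx] by auto
  have y: "(sy + 1 < L + R \<longrightarrow> pal_end S sy = sy + 1 - L) \<and> (L + R < sy + 1 \<longrightarrow> pal_end S sy = R)
      \<and> (sy + 1 = L + R \<longrightarrow> R \<le> pal_end S sy)"
    using ends[of sy] by auto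
  have z: "(c + 1 < L + R \<longrightarrow> pal_end S c = c + 1 - L) \<and> (L + R < c + 1 \<longrightarrow> pal_end S c = R)"
    using ends[of c] by auto
  consider "c + 1 < L + R" | "L + R < c + 1" | "c + 1 = L + R"
    by linarith
  then show ?thesis
  proof cases
    case 1
    then have "pal_end S c = c + 1 - L" "pal_end S sx = sx + 1 - L"
      using x z c by auto
    moreover have "c + 1 - L \<le> pal_end S sy"
      using y c 1 La by (cases "sy + 1" "L + R" rule: linorder_cases) auto
    ultimately show ?thesis
      using c La by simp
  next
    case 2
    then have "pal_end S c = R" "pal_end S sy = R"
      using y z c by auto
    moreover have "R \<le> c + pal_end S sx - sx"
      using x c 2 La by (cases "sx + 1" "L + R" rule: linorder_cases) auto
    ultimately show ?thesis
      by simp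
  next
    \<comment> \<open>At the center of the run, \<open>sx\<close> lies to the left and
      \<open>sy\<close> to the right of it, and their ends satisfy exactly the equation that
      \<open>mid\<close> excludes.\<close>
    case 3
    then have "pal_end S sx = sx + 1 - L" "pal_end S sy = R"
      using x y c by auto
    with mid 3 c La show ?thesis
      by simp
  qed
qed


section \<open>Local programs\<close>

text \<open>Registers from 20 on, memory, extent, outbox and step count are left out on purpose:
  every program states its own effect on them.\<close>

definition frame :: "machine \<Rightarrow> machine \<Rightarrow> bool" where
  "frame M M' \<longleftrightarrow> low (regs M') = low (regs M) \<and> inbox M' = inbox M \<and> outputs M' = outputs M \<and>
     finished M' = finished M \<and> peak M' = peak M"

lemma frame_refl [simp]: "frame M M"
  by (simp add: frame_def)

lemma frame_trans: "frame M1 M2 \<Longrightarrow> frame M2 M3 \<Longrightarrow> frame M1 M3"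
  by (simp add: frame_def)

lemma frameD:
  assumes "frame M M'"
  shows "regs M' 0 = regs M 0" "regs M' (Suc 0) = regs M (Suc 0)" "regs M' 2 = regs M 2"
    "regs M' 3 = regs M 3" "regs M' 4 = regs M 4" "regs M' 5 = regs M 5" "regs M' 6 = regs M 6"
    "regs M' 7 = regs M 7" "regs M' 8 = regs M 8" "regs M' 9 = regs M 9" "regs M' 10 = regs M 10"
    "regs M' 11 = regs M 11" "regs M' 12 = regs M 12" "regs M' 13 = regs M 13"
    "regs M' 14 = regs M 14" "regs M' 15 = regs M 15" "regs M' 16 = regs M 16"
    "regs M' 17 = regs M 17" "regs M' 18 = regs M 18" "regs M' 19 = regs M 19"
    "inbox M' = inbox M" "outputs M' = outputs M" "finished M' = finished M" "peak M' = peak M"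
    "inwords M' = inwords M"
  using assms low_eqD[of "regs M'" "regs M"] by (auto simp: frame_def inwords_def)

lemma frame_update [simp]:
  "20 \<le> x \<Longrightarrow> frame M (M'\<lparr>regs := r(x := v)\<rparr>) = frame M (M'\<lparr>regs := r\<rparr>)"
  "frame M (M'\<lparr>regs := regs M'\<rparr>) = frame M M'"
  "frame M (M'\<lparr>memory := f\<rparr>) = frame M M'"
  "frame M (M'\<lparr>extent := k\<rparr>) = frame M M'"
  "frame M (M'\<lparr>outbox := l\<rparr>) = frame M M'"
  "frame M (M'\<lparr>steps := k\<rparr>) = frame M M'"
  by (auto simp: frame_def)

section \<open>Manacher's algorithm on a window\<close>

definition extend_loop :: program where
  "extend_loop =
     (Assign 27 (Const 1) ;;
      While (Reg 27)
        (If (Reg 21 <\<^sub>e Reg 18 &\<^sub>e Reg 21 <\<^sub>e Reg 22 +\<^sub>e Const 1)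
           (Load 28 (Reg 21) ;; Load 29 (Reg 22 -\<^sub>e Reg 21) ;;
            If (Reg 28 =\<^sub>e Reg 29) (Assign 21 (Reg 21 +\<^sub>e Const 1)) (Assign 27 (Const 0)))
           (Assign 27 (Const 0))))"

text \<open>Loads are instructions and cannot occur in a guard, so register 27 carries the outcome
  of the comparison. The steps are charged to the growth from \<open>e\<close> to
  \<open>pal_end T s\<close>, which is what makes the total time linear.\<close>

lemma wp_extend_loop:
  assumes T: "regs M 18 = length T" "\<And>u. u < length T \<Longrightarrow> memory M u = T ! u"
    and s: "regs M 22 = s" "s < 2 * length T" and e: "regs M 21 = e" "pal T s e" "s \<le> 2 * e"
    and W: "4 * length T + 10 < word_bound w"
    and Q: "\<And>M'. frame M M' \<Longrightarrow> outbox M' = outbox M \<Longrightarrow> memory M' = memory M \<Longrightarrow>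
      regs M' 20 = regs M 20 \<Longrightarrow> regs M' 21 = pal_end T s \<Longrightarrow> regs M' 22 = s \<Longrightarrow>
      regs M' 23 = regs M 23 \<Longrightarrow> extent M' \<le> max (extent M) (2 * length T) \<Longrightarrow>
      steps M' + 8 * e \<le> steps M + 20 + 8 * pal_end T s \<Longrightarrow> Q M'"
  shows "wp w extend_loop Q M"
  unfolding extend_loop_def wp.simps(2,9)
proof (rule wp_While[where \<mu> = "\<lambda>M. regs M 27 + (length T - regs M 21)" and
      Inv = "\<lambda>M'. frame M M' \<and> outbox M' = outbox M \<and> memory M' = memory M \<and>
        regs M' 20 = regs M 20 \<and> regs M' 22 = s \<and> regs M' 23 = regs M 23 \<and>
        e \<le> regs M' 21 \<and> regs M' 27 \<le> 1 \<and> pal T s (regs M' 21) \<and>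
        (regs M' 27 = 0 \<longrightarrow> \<not> pal T s (Suc (regs M' 21))) \<and>
        extent M' \<le> max (extent M) (2 * length T) \<and>
        steps M' + 8 * e + 7 * regs M' 27 \<le> steps M + 8 * regs M' 21 + 10"], goal_cases)
  case 1
  then show ?case
    using assms by (simp add: eval_rules machine_defs)
next
  case (2 M')
  then have r: "regs M' 18 = length T" "regs M' 27 = 1"
    using T frameD[of M M'] by (auto simp: eval_rules)
  have le: "regs M' 21 \<le> length T" "regs M' 21 \<le> s + 1"
    using 2 by (auto simp: pal_def)
  have Suc: "pal T s (Suc (regs M' 21)) \<longleftrightarrow>
      regs M' 21 < length T \<and> regs M' 21 \<le> s \<and> T ! regs M' 21 = T ! (s - regs M' 21)"
    by (rule pal_Suc) (use 2 e in auto)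
  have lt: "s - regs M' 21 < length T" if "regs M' 21 < length T"
    using 2 e s that by auto
  show ?case
    using 2 r le W s Suc lt T by (auto simp: eval_rules machine_defs and_indicators)
next
  case (3 M')
  then have "pal_end T s = regs M' 21"
    by (intro pal_end_eqI) (auto simp: eval_rules)
  with 3 show ?case
    by (intro Q) (auto simp: eval_rules machine_defs)
qed


text \<open>Memory layout in units of \<open>B\<close>: the window from 0, letters and left hashes
  of a residue class from 9 and 10, hashes of all right pieces from 11, this table from 12 to at
  most 30. Registers 20 and 21 hold the center whose known palindrome reaches furthest, and its end.
  Register 24 defaults to that end, which selects the extending branch.\<close>

definition manacher_step :: program where
  "manacher_step =
     (Assign 24 (Reg 21) ;;
      If (Reg 20 <\<^sub>e Reg 22 &\<^sub>e Reg 22 <\<^sub>e Reg 20 +\<^sub>e Reg 20 +\<^sub>e Const 1)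
        (Load 25 (Const 12 *\<^sub>e Reg 5 +\<^sub>e (Reg 20 +\<^sub>e Reg 20 -\<^sub>e Reg 22)) ;;
         Assign 24 (Reg 25 +\<^sub>e Reg 22 -\<^sub>e Reg 20))
        Skip ;;
      If (Reg 24 <\<^sub>e Reg 21)
        (Store (Const 12 *\<^sub>e Reg 5 +\<^sub>e Reg 22) (Reg 24))
        (extend_loop ;; Store (Const 12 *\<^sub>e Reg 5 +\<^sub>e Reg 22) (Reg 21) ;; Assign 20 (Reg 22)))"

text \<open>An empty window is treated separately, because \<open>2 * 0 - 1\<close> would wrap
  around to the largest word.\<close>

definition manacher :: program where
  "manacher =
     (If (Reg 18 =\<^sub>e Const 0) (Assign 23 (Const 0)) (Assign 23 (Reg 18 +\<^sub>e Reg 18 -\<^sub>e Const 1)) ;;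
      Assign 20 (Const 0) ;; Assign 21 (Const 0) ;;
      For 22 (Reg 23) manacher_step)"

text \<open>If the copied palindrome stops strictly before \<open>e\<close>, the mismatch that stops
  it is mirrored as well, so its end is final. Otherwise only the part up to \<open>e\<close> is
  certain, and the comparison goes on from there.\<close>

lemma pal_end_mirror:
  assumes "e = pal_end T s0" "s0 < s" "s \<le> 2 * s0"
    and x: "x = pal_end T (2 * s0 - s) + s - s0"
  shows "x < e \<Longrightarrow> pal_end T s = x" "e \<le> x \<Longrightarrow> s \<le> e + s0 \<Longrightarrow> pal T s e"
proof -
  have p: "pal T s0 e"
    using assms pal_pal_end by auto
  show "pal_end T s = x" if "x < e"
  proof (rule pal_end_eqI)
    show "pal T s x"
      unfolding pal_mirror[OF p assms(2,3) less_imp_le[OF that], of] using that assms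
      by (subst pal_mirror[OF p]) (auto simp: pal_iff)
    show "\<not> pal T s (Suc x)"
      using that assms by (subst pal_mirror[OF p]) (auto simp: pal_iff)
  qed
  show "pal T s e" if "e \<le> x" "s \<le> e + s0"
    using that assms by (subst pal_mirror[OF p]) (auto simp: pal_iff)
qed

lemma wp_manacher:
  fixes M :: machine
  assumes T: "regs M 18 = length T" "\<And>u. u < length T \<Longrightarrow> memory M u = T ! u"
    and B: "regs M 5 = B" "length T \<le> 9 * B" "100 * B + 100 < word_bound w"
    and Q: "\<And>M'. frame M M' \<Longrightarrow> outbox M' = outbox M \<Longrightarrow>
      (\<And>a. a < 12 * B \<Longrightarrow> memory M' a = memory M a) \<Longrightarrow>
      (\<And>t. t < 2 * length T - 1 \<Longrightarrow> memory M' (12 * B + t) = pal_end T t) \<Longrightarrow>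
      extent M' \<le> max (extent M) (30 * B) \<Longrightarrow> steps M' \<le> steps M + 1000 * B + 100 \<Longrightarrow> Q M'"
  shows "wp w manacher Q M"
proof -
  define N where "N = 2 * length T - 1"
  \<comment> \<open>Before the first center there is no palindrome to mirror in, hence the case
    \<open>s = 0\<close>. The summand \<open>8 * regs M' 21\<close> is the potential of the
    amortized analysis: the known end never decreases and never exceeds
    \<open>length T\<close>.\<close>
  let ?J = "\<lambda>s M'. frame M M' \<and> outbox M' = outbox M \<and> regs M' 23 = N \<and>
    (\<forall>a < 12 * B. memory M' a = memory M a) \<and> (\<forall>t < s. memory M' (12 * B + t) = pal_end T t) \<and>
    regs M' 22 = s \<and> (if s = 0 then regs M' 20 = 0 \<and> regs M' 21 = 0
       else regs M' 20 < s \<and> regs M' 21 = pal_end T (regs M' 20)) \<and>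
    (\<forall>t < s. pal_end T t \<le> regs M' 21) \<and>
    extent M' \<le> max (extent M) (30 * B) \<and> steps M' \<le> steps M + 20 + 40 * s + 8 * regs M' 21"
  have len: "2 * length T \<le> 18 * B" and NB: "N \<le> 18 * B"
    using B by (auto simp: N_def)
  have pre: "wp w (For 22 (Reg 23) manacher_step) Q M1"
    if M1: "frame M M1" "outbox M1 = outbox M" "memory M1 = memory M" "extent M1 = extent M"
      "regs M1 20 = 0" "regs M1 21 = 0" "regs M1 23 = N" "steps M1 \<le> steps M + 10" for M1
  proof (rule wp_For[where N = N and J = ?J], goal_cases)
    case 1
    then show ?case
      using NB B by simp
  next
    case 2
    then show ?case
      using M1 by (simp add: machine_defs)
  next
    case (3 s M')
    then show ?case
      by (simp add: eval_rules)
  next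
    case (4 s M')
    then have r: "regs M' 18 = length T" "regs M' 5 = B" "inbox M' = inbox M"
      using T B frameD[of M M'] by auto
    have mem: "memory M' u = T ! u" if "u < length T" for u
      using 4 T B that by auto
    have sT: "s + 1 < 2 * length T"
      using 4 by (simp add: N_def)
    \<comment> \<open>The known end is at least that of the previous center, which already reaches
      the current center; \<open>wp_extend_loop\<close> needs to start there or beyond.\<close>
    have s2: "s \<le> 2 * regs M' 21"
    proof (cases "s = 0")
      case False
      then have "(s - 1) div 2 + 1 \<le> pal_end T (s - 1)"
        using sT by (intro pal_end_ge) auto
      moreover have "pal_end T (s - 1) \<le> regs M' 21"
        using 4 False by auto
      ultimately show ?thesis
        using False by presburger
    qed simp
    have eT: "regs M' 21 \<le> length T"
      using 4 pal_end_le(1) by (auto split: if_splits)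
    have e0: "regs M' 21 \<le> regs M' 20 + 1" if "s \<noteq> 0"
      using 4 that pal_end_le(2) by auto
    define R where "R = (\<lambda>M'. regs M' 22 = s \<and> ?J (Suc s) (tick (set_reg 22 (Suc s) M')))"
    have ext: "wp w (extend_loop ;; Store (Const 12 *\<^sub>e Reg 5 +\<^sub>e Reg 22) (Reg 21) ;; Assign 20 (Reg 22))
       R M2"
      if p: "pal T s (regs M' 21)" and M2: "frame M' M2" "outbox M2 = outbox M'" "memory M2 = memory M'"
        "extent M2 \<le> max (extent M) (30 * B)"
        "regs M2 20 = regs M' 20" "regs M2 21 = regs M' 21" "regs M2 22 = s"
        "regs M2 23 = N" "steps M2 \<le> steps M' + 10" for M2
      unfolding wp.simps(9)
    proof (rule wp_extend_loop[where T = T and s = s and e = "regs M' 21"], goal_cases)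
      case (9 M3)
      have fr: "frame M M3"
        using 4 M2 9 frame_trans by blast
      note r3 = frameD[OF fr]
      have "regs M' 21 \<le> pal_end T s"
        using p by (simp add: pal_iff)
      then show ?case
        using 4 M2 9 fr r3 B sT len unfolding R_def
        by (auto simp: eval_rules machine_defs less_Suc_eq intro: order_trans)
    qed (use M2 p s2 sT B len r mem frameD[OF M2(1)] in auto)
    show ?case
    proof (cases "regs M' 20 < s \<and> s \<le> 2 * regs M' 20")
      case True
      define s0 where "s0 = regs M' 20"
      define x where "x = pal_end T (2 * s0 - s) + s - s0"
      have s0: "s0 < s" "s \<le> s0 + s0"
        using True by (auto simp: s0_def)
      have M': "frame M M'" "outbox M' = outbox M" "regs M' 23 = N"
        "\<forall>a<12 * B. memory M' a = memory M a" "\<forall>t<s. memory M' (12 * B + t) = pal_end T t"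
        "regs M' 22 = s" "regs M' 20 = s0" "regs M' 21 = pal_end T s0"
        "\<forall>t<s. pal_end T t \<le> pal_end T s0" "extent M' \<le> max (extent M) (30 * B)"
        "steps M' \<le> steps M + 20 + 40 * s + 8 * pal_end T s0"
        using 4 s0 by (auto simp: s0_def)
      define q where "q = 2 * s0 - s"
      have q: "s0 + s0 - s = q" "2 * s0 - s = q" "q < s" "q + s = s0 + s0"
        using s0 by (auto simp: q_def)
      have le: "pal_end T q \<le> length T" "pal_end T s0 \<le> length T"
        by (rule pal_end_le)+
      have a: "memory M' (12 * B + q) = pal_end T q"
        using M'(5) q by simp
      have xB: "pal_end T q + s - s0 = x" "s0 \<le> pal_end T q + s"
        using s0 by (simp_all add: x_def q)
      have small: "s0 + s0 < word_bound w" "12 * B + q < word_bound w"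
        "pal_end T q + s < word_bound w" "12 < word_bound w" "1 < word_bound w"
        "12 * B < word_bound w" "s0 + s0 + 1 < word_bound w" "12 * B + s < word_bound w"
        using s0 sT len B le q by auto
      have e1: "Suc (12 * B + q) \<le> max (extent M) (30 * B)"
        using q sT len by auto
      note ev = eval_rules machine_defs and_indicators
      have s2': "s \<le> s0 + s0" and "s0 < s" "s \<le> 2 * s0"
        using s0 by auto
      note mirror = pal_end_mirror[OF refl this(2,3) x_def]
      show ?thesis
      proof (cases "x < pal_end T s0")
        case x: True
        show ?thesis
          unfolding manacher_step_def using small s0 xB x mirror(1)[OF x] M' sT len B e1
          by (simp add: ev r a q xB less_Suc_eq) auto
      next
        case x: False
        have p: "pal T s (regs M' 21)"
          unfolding M' by (rule mirror(2)) (use x s2 True M' in linarith)+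
        show ?thesis
          using small s0 xB x M' sT len B e1
          unfolding R_def[symmetric] manacher_step_def by (simp add: ev r a q xB) (rule ext[OF p, unfolded wp.simps(9)[where p = extend_loop]]; simp add: frame_def)
      qed
    next
      case False
      \<comment> \<open>Without a mirror image the known end is at most one more than register 20,
        so no two positions with sum \<open>s\<close> lie below it and the starting palindrome is
        vacuous.\<close>
      have p: "pal T s (regs M' 21)"
      proof (cases "s = 0")
        case True
        with 4 show ?thesis
          by (simp add: pal_def)
      next
        case F: False
        with 4 False have "2 * regs M' 20 < s"
          by auto
        then show ?thesis
          using e0[OF F] eT unfolding pal_def by auto
      qed
      have M': "frame M M'" "outbox M' = outbox M" "regs M' 23 = N"
        "\<forall>a<12 * B. memory M' a = memory M a" "\<forall>t<s. memory M' (12 * B + t) = pal_end T t"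
        "regs M' 22 = s" "regs M' 20 \<le> s" "extent M' \<le> max (extent M) (30 * B)"
        using 4 by (auto split: if_splits)
      have small: "regs M' 20 + regs M' 20 + 1 < word_bound w" "1 < word_bound w"
        using M'(7) sT len B by auto
      have F: "eval w (Reg 20 <\<^sub>e Reg 22 &\<^sub>e Reg 22 <\<^sub>e Reg 20 +\<^sub>e Reg 20 +\<^sub>e Const 1) M2 = 0"
        if "regs M2 20 = regs M' 20" "regs M2 22 = s" for M2
        using False small that by (auto simp: eval_rules and_indicators)
      have G: "eval w (Reg 24 <\<^sub>e Reg 21) M2 = 0" if "regs M2 24 = regs M2 21" for M2
        using that by (simp add: eval_rules)
      show ?thesis
        unfolding R_def[symmetric] manacher_step_def using F G M' B
        by (simp add: machine_defs eval_rules(2))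
          (rule ext[OF p, unfolded wp.simps(9)[where p = extend_loop]]; simp add: frame_def)
    qed
  next
    case (5 M')
    have "regs M' 21 \<le> length T"
      using 5 pal_end_le(1) by (auto split: if_splits)
    with 5 show ?case
      using B NB by (intro Q) (auto simp: machine_defs N_def)
  qed
  show ?thesis
  proof (cases "length T = 0")
    case True
    then show ?thesis
      unfolding manacher_def using T B
      by (simp add: eval_rules machine_defs) (rule pre; simp add: frame_def N_def)
  next
    case False
    then have "1 \<le> length T + length T" "length T + length T < word_bound w"
      using B by linarith+
    from wsub_eq[OF this] have "eval w (Reg 18 +\<^sub>e Reg 18 -\<^sub>e Const 1) (tick M) = N"
      using T B len by (simp add: eval_rules machine_defs N_def)
    then show ?thesis
      unfolding manacher_def using T B False
      by (simp add: machine_defs eval_rules(1,2,12)) (rule pre; simp add: frame_def)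
  qed
qed


section \<open>Programs that distribute the letters and hash the pieces\<close>

definition scatter_letter :: program where
  "scatter_letter =
     For 24 (Const 9)
       (Assign 25 (Reg 23 +\<^sub>e Reg 24) ;;
        If (Const 3 <\<^sub>e Reg 25 &\<^sub>e Reg 25 <\<^sub>e Reg 2 +\<^sub>e Const 4)
          (Send (Reg 25 -\<^sub>e Const 4) (Reg 21) ;; Send (Reg 25 -\<^sub>e Const 4) (Reg 22))
          Skip)"

text \<open>The quotient by \<open>m * m\<close> is rounded up, and the block length is a multiple
  of \<open>m\<close>: blocks then consist of whole pieces of \<open>m\<close> letters, start at
  multiples of \<open>m\<close>, and meet every residue class modulo \<open>m\<close> equally
  often.\<close>

definition scatter_round :: program where
  "scatter_round =
     (Assign 6 ((Reg 0 +\<^sub>e Reg 2 *\<^sub>e Reg 2 -\<^sub>e Const 1) div\<^sub>e (Reg 2 *\<^sub>e Reg 2)) ;;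
      Assign 5 (Reg 2 *\<^sub>e Reg 6) ;;
      If (Reg 3 <\<^sub>e Const 4) (Assign 7 (Const 0)) (Assign 7 ((Reg 3 -\<^sub>e Const 4) *\<^sub>e Reg 5)) ;;
      For 20 Inbox_Length
        (Assign 21 (Inbox_Tag (Reg 20)) ;;
         Assign 22 (Inbox_Word (Reg 20)) ;;
         Assign 23 (Reg 21 div\<^sub>e Reg 5) ;;
         scatter_letter))"

definition store_window :: program where
  "store_window =
     For 20 (Inbox_Length div\<^sub>e Const 2)
       (Store (Inbox_Word (Const 2 *\<^sub>e Reg 20) -\<^sub>e Reg 7) (Inbox_Word (Const 2 *\<^sub>e Reg 20 +\<^sub>e Const 1)))"

abbreviation hash_expr :: "expr \<Rightarrow> expr" where
  "hash_expr e \<equiv> Reg 10 *\<^sub>e e div\<^sub>e Reg 11"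

definition first_hash :: program where
  "first_hash =
     (Assign 21 (Const 0) ;; Assign 22 (Const 1) ;;
      For 20 (Reg 2)
        (Load 23 (Reg 26 +\<^sub>e Reg 20) ;;
         Assign 21 ((Reg 21 *\<^sub>e Reg 9 +\<^sub>e hash_expr (Reg 23)) mod\<^sub>e Reg 8) ;;
         Assign 22 (Reg 22 *\<^sub>e Reg 9 mod\<^sub>e Reg 8)))"

text \<open>Rolling hash: register 22 holds the power of the base that belongs to the letter leaving
  the piece. Its term is removed by adding the complement to the modulus, so that no subtraction
  wraps around.\<close>

definition slide_expr :: expr where
  "slide_expr =
     (Reg 21 *\<^sub>e Reg 9 +\<^sub>e hash_expr (Reg 25)
       +\<^sub>e (Reg 8 -\<^sub>e (hash_expr (Reg 23) *\<^sub>e Reg 22) mod\<^sub>e Reg 8)) mod\<^sub>e Reg 8"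

text \<open>Block starts are multiples of \<open>m\<close>, so the offset in the block already
  determines the residue class of the position and thus the receiver.\<close>

definition slide_hash :: program where
  "slide_hash =
     For 20 (Reg 5)
       (Load 23 (Reg 26 +\<^sub>e Reg 20) ;;
        Send (Reg 20 mod\<^sub>e Reg 2) (Reg 23) ;;
        Send (Reg 20 mod\<^sub>e Reg 2) (Reg 21) ;;
        Load 25 (Reg 26 +\<^sub>e Reg 20 +\<^sub>e Reg 2) ;;
        Assign 21 slide_expr)"

definition hash_round :: program where
  "hash_round =
     (Assign 8 (Inbox_Word (Const 0)) ;; Assign 9 (Inbox_Word (Const 1)) ;;
      Assign 10 (Inbox_Word (Const 2)) ;; Assign 11 (Inbox_Word (Const 3)) ;;
      Assign 26 (Reg 3 *\<^sub>e Reg 5 -\<^sub>e Reg 7) ;;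
      first_hash ;; slide_hash)"

text \<open>Powers of the base rise with the position here and fall with it in
  \<open>first_hash\<close>, so that a piece and its mirrored copy get the same value.\<close>

definition piece_hash :: program where
  "piece_hash =
     (Assign 21 (Const 0) ;; Assign 22 (Const 1) ;;
      For 23 (Reg 2)
        (Load 24 (Reg 26 +\<^sub>e Reg 20 *\<^sub>e Reg 2 +\<^sub>e Reg 23) ;;
         Assign 21 ((Reg 21 +\<^sub>e hash_expr (Reg 24) *\<^sub>e Reg 22) mod\<^sub>e Reg 8) ;;
         Assign 22 (Reg 22 *\<^sub>e Reg 9 mod\<^sub>e Reg 8)))"

definition broadcast_piece :: program where
  "broadcast_piece = For 23 (Reg 2) (Send (Reg 23) (Reg 21))"

definition store_class :: program where
  "store_class =
     For 20 (Reg 5)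
       (Store (Const 9 *\<^sub>e Reg 5 +\<^sub>e Reg 20) (Inbox_Word (Const 2 *\<^sub>e Reg 20)) ;;
        Store (Const 10 *\<^sub>e Reg 5 +\<^sub>e Reg 20) (Inbox_Word (Const 2 *\<^sub>e Reg 20 +\<^sub>e Const 1)))"

definition piece_round :: program where
  "piece_round =
     (store_class ;;
      Assign 26 (Reg 3 *\<^sub>e Reg 5 -\<^sub>e Reg 7) ;;
      For 20 (Reg 6) (piece_hash ;; broadcast_piece))"

section \<open>Parameters and the distribution of letters\<close>

locale params =
  fixes n \<sigma> m \<beta> B w :: nat and S :: "nat list"
  assumes n: "1 \<le> n" "length S = n"
    and m: "1 \<le> m" "1 \<le> \<beta>" "n \<le> m * B"
    and \<beta>_def: "\<beta> = (n + m * m - 1) div (m * m)" and B_def: "B = m * \<beta>"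
    and W: "1000 * (m * B) + 1000 * (m * m) + 1000 * \<sigma> + 10000 < word_bound w"
    and letters: "set S \<subseteq> {..<\<sigma>}"
begin

lemma m_le_B: "m \<le> B" and B_le: "B \<le> m * B" and B_pos: "1 \<le> B"
  using m by (auto simp: B_def)

lemma block_le: "j < m \<Longrightarrow> j * B + B \<le> m * B"
  by (metis add.commute mult_Suc mult_le_mono1 Suc_leI)

lemma small: "1000 * (m * B) + 10000 < word_bound w" "1000 * B + 10000 < word_bound w"
  "1000 * m + 10000 < word_bound w" "1000 * n + 10000 < word_bound w"
  "1000 * (m * m) + 10000 < word_bound w" "1000 * \<sigma> + 10000 < word_bound w"
  using W m_le_B B_le m by linarith+

text \<open>Unwritten memory is 0, so reading past the end of the string yields this padding. It may
  coincide with the letter 0; \<open>lim\<close> and \<open>far_end\<close> keep padded positions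
  out of the comparisons that decide a query.\<close>

definition Sp :: "nat \<Rightarrow> nat" where
  "Sp p = (if p < n then S ! p else 0)"

definition lo :: "nat \<Rightarrow> nat" where
  "lo j = (if j < 4 then 0 else (j - 4) * B)"

lemma lo_le: "lo j \<le> j * B" "j * B \<le> lo j + 4 * B"
  by (auto simp: lo_def diff_mult_distrib not_less intro: order_trans[OF mult_le_mono1])

lemma window_less: "lo j + u < (j + 5) * B \<Longrightarrow> u < 9 * B"
  using lo_le(2)[of j] by (simp add: add_mult_distrib)

lemma window_less_block: "lo j + u < j * B + 3 * B \<Longrightarrow> lo j + u < (j + 5) * B"
  by (simp add: add_mult_distrib)

definition scatter :: "nat \<Rightarrow> nat \<Rightarrow> (nat \<times> nat) list" where
  "scatter p a = concat (map (\<lambda>d. if 3 < p div B + d \<and> p div B + d < m + 4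
     then [(p div B + d - 4, p), (p div B + d - 4, a)] else []) [0..<9])"

lemma wp_scatter_letter:
  assumes r: "regs M 2 = m" "regs M 21 = p" "regs M 22 = a" "regs M 23 = p div B" and p: "p < n"
    and Q: "\<And>M'. frame M M' \<Longrightarrow> outbox M' = outbox M @ scatter p a \<Longrightarrow> memory M' = memory M \<Longrightarrow>
      extent M' = extent M \<Longrightarrow> regs M' 20 = regs M 20 \<Longrightarrow> steps M' \<le> steps M + 100 \<Longrightarrow> Q M'"
  shows "wp w scatter_letter Q M"
  unfolding scatter_letter_def
proof (rule wp_For[where N = 9 and
      J = "\<lambda>i M'. frame M M' \<and> memory M' = memory M \<and> extent M' = extent M \<and>
        regs M' 20 = regs M 20 \<and> regs M' 21 = p \<and> regs M' 22 = a \<and> regs M' 23 = p div B \<and>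
        outbox M' = outbox M @ concat (map (\<lambda>d. if 3 < p div B + d \<and> p div B + d < m + 4
          then [(p div B + d - 4, p), (p div B + d - 4, a)] else []) [0..<i]) \<and>
        steps M' \<le> steps M + 2 + 8 * i"], goal_cases)
  case (4 i M')
  define q where "q = p div B"
  have "q \<le> p"
    by (simp add: q_def)
  then have q: "q + i + 100 < word_bound w" "m + 100 < word_bound w"
    using small p 4 by linarith+
  have ev: "regs M' 2 = m" "regs M' 21 = p" "regs M' 22 = a" "regs M' 23 = q" "regs M' 24 = i"
    using 4 r frameD[of M M'] by (auto simp: q_def)
  note M' = conjunct1[OF 4(1)] conjunct2[OF 4(1), unfolded q_def[symmetric]]
  show ?case
  proof (cases "3 < q + i \<and> q + i < m + 4")
    case True
    then show ?thesis
      using M' q unfolding q_def[symmetric]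
      by (simp add: eval_rules machine_defs and_indicators frame_def ev)
  next
    case False
    then show ?thesis
      using M' q unfolding q_def[symmetric]
      by (simp add: eval_rules machine_defs and_indicators frame_def ev)
  qed
qed (use small r Q in \<open>auto simp: eval_rules machine_defs frame_def scatter_def\<close>)

definition base :: "nat \<Rightarrow> machine \<Rightarrow> bool" where
  "base j M \<longleftrightarrow> regs M 0 = n \<and> regs M (Suc 0) = \<sigma> \<and> regs M 2 = m \<and> regs M 3 = j \<and> regs M 5 = B \<and> regs M 6 = \<beta> \<and>
     regs M 7 = lo j"

lemma base_frame: "frame M M' \<Longrightarrow> base j M \<Longrightarrow> base j M'"
  using frameD[of M M'] by (simp add: base_def)

lemma wp_scatter_round:
  assumes r: "regs M 0 = n" "regs M (Suc 0) = \<sigma>" "regs M 2 = m" "regs M 3 = j" and j: "j < m"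
    and inb: "\<And>p a. (p, a) \<in> set (inbox M) \<Longrightarrow> p < n" "length (inbox M) \<le> 3 * B"
    and Q: "\<And>M'. base j M' \<Longrightarrow> regs M' 4 = regs M 4 \<Longrightarrow>
      inbox M' = inbox M \<Longrightarrow> outputs M' = outputs M \<Longrightarrow> finished M' = finished M \<Longrightarrow> peak M' = peak M \<Longrightarrow>
      outbox M' = outbox M @ concat (map (\<lambda>(p, a). scatter p a) (inbox M)) \<Longrightarrow>
      memory M' = memory M \<Longrightarrow> extent M' = extent M \<Longrightarrow> steps M' \<le> steps M + 1000 * B \<Longrightarrow> Q M'"
  shows "wp w scatter_round Q M"
proof -
  have loop: "wp w (For 20 Inbox_Length
        (Assign 21 (Inbox_Tag (Reg 20)) ;;
         Assign 22 (Inbox_Word (Reg 20)) ;;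
         Assign 23 (Reg 21 div\<^sub>e Reg 5) ;;
         scatter_letter)) Q M1"
    if M1: "base j M1" "regs M1 4 = regs M 4" "inbox M1 = inbox M" "outputs M1 = outputs M" "finished M1 = finished M"
      "peak M1 = peak M" "outbox M1 = outbox M" "memory M1 = memory M" "extent M1 = extent M"
      "steps M1 \<le> steps M + 10" for M1
  proof (rule wp_For[where N = "length (inbox M)" and
        J = "\<lambda>i M'. frame M1 M' \<and> memory M' = memory M \<and> extent M' = extent M \<and>
          outbox M' = outbox M @ concat (map (\<lambda>(p, a). scatter p a) (take i (inbox M))) \<and>
          steps M' \<le> steps M + 20 + 110 * i"], goal_cases)
    case 1
    then show ?case
      using inb small by linarith
  next
    case 2
    then show ?case
      using M1 by (simp add: machine_defs frame_def)
  next
    case (3 i M')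
    then show ?case
      using inb small M1 frameD[of M1 M'] by (simp add: eval_rules inwords_def)
  next
    case (4 i M')
    have i: "i < length (inbox M')" "inbox M' = inbox M"
      using 4 M1 frameD[of M1 M'] by auto
    obtain p a where pa: "inbox M ! i = (p, a)"
      by force
    have p: "p < n"
      using inb(1)[of p a] pa i by (metis nth_mem)
    have b: "base j M'"
      using 4 M1 base_frame by blast
    define R where "R = (\<lambda>M'. regs M' 20 = i \<and> frame M1 (tick (set_reg 20 (Suc i) M')) \<and>
          memory (tick (set_reg 20 (Suc i) M')) = memory M \<and>
          extent (tick (set_reg 20 (Suc i) M')) = extent M \<and>
          outbox (tick (set_reg 20 (Suc i) M')) =
            outbox M @ concat (map (\<lambda>(p, a). scatter p a) (take (Suc i) (inbox M))) \<and>
          steps (tick (set_reg 20 (Suc i) M')) \<le> steps M + 20 + 110 * Suc i)"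
    show ?case
      using b i pa 4(3) unfolding R_def[symmetric]
      apply (simp add: eval_rules machine_defs inwords_def base_def)
      apply (rule wp_scatter_letter[where p = p and a = a])
      using p 4 b i pa
      by (auto simp: R_def machine_defs frame_def base_def take_Suc_conv_app_nth)
  next
    case (5 M')
    have b: "base j M'"
      using 5 M1 base_frame by blast
    show ?case
      by (rule Q) (use 5 b M1 frameD[of M1 M'] inb B_pos in \<open>auto simp: machine_defs base_def\<close>)
  qed
  have e: "(n + m * m - 1) div (m * m) = \<beta>" "m * \<beta> = B"
    by (simp_all add: \<beta>_def B_def)
  have "(j - 4) * B \<le> m * B"
    using j by (intro mult_le_mono1) auto
  then have lo4: "(j - 4) * B mod word_bound w = (j - 4) * B"
    using small(1) by (intro mod_less) linarith
  have "wsub w (n + m * m) (Suc 0) = n + m * m - 1"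
    using n small by (subst wsub_eq) auto
  then show ?thesis
    unfolding scatter_round_def using small j
    apply (simp add: eval_rules machine_defs e[simplified] lo4 B_pos r)
    apply (intro conjI impI; rule loop)
    by (auto simp: base_def lo_def e[simplified] lo4 r)
qed

lemma wp_store_window:
  assumes b: "base j M"
    and L: "inwords M = concat (map (\<lambda>(p, a). [p, a]) L)" "length L \<le> 9 * B"
      "\<And>p a. (p, a) \<in> set L \<Longrightarrow> p < n \<and> a = S ! p \<and> lo j \<le> p \<and> p < lo j + 9 * B"
    and Q: "\<And>M'. frame M M' \<Longrightarrow> outbox M' = outbox M \<Longrightarrow>
      (\<And>u. memory M' u = (if u + lo j \<in> fst ` set L then S ! (u + lo j) else memory M u)) \<Longrightarrow>
      extent M' \<le> max (extent M) (9 * B) \<Longrightarrow> steps M' \<le> steps M + 40 * B \<Longrightarrow> Q M'"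
  shows "wp w store_window Q M"
proof -
  have len: "length (inwords M) = 2 * length L"
    unfolding L(1) by (induction L) auto
  have nth: "inwords M ! (2 * i) = fst (L ! i) \<and> inwords M ! Suc (2 * i) = snd (L ! i)" if "i < length L" for i
    using that unfolding L(1)
  proof (induction L arbitrary: i)
    case (Cons x L)
    then show ?case
      by (cases i) (auto split: prod.split)
  qed simp
  show ?thesis
    unfolding store_window_def
  proof (rule wp_For[where N = "length L" and
      J = "\<lambda>i M'. frame M M' \<and> outbox M' = outbox M \<and>
        (\<forall>u. memory M' u = (if u + lo j \<in> fst ` set (take i L) then S ! (u + lo j) else memory M u)) \<and>
        extent M' \<le> max (extent M) (9 * B) \<and> steps M' \<le> steps M + 2 + 4 * i"], goal_cases)
    case (3 i M')
    then show ?case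
      using frameD[of M M'] L small len by (simp add: eval_rules)
  next
    case (4 i M')
    obtain p a where pa: "L ! i = (p, a)"
      by force
    have "(p, a) \<in> set L"
      using pa 4 by (metis nth_mem)
    with L(3) have p: "p < n" "a = S ! p" "lo j \<le> p" "p < lo j + 9 * B"
      by blast+
    have i: "Suc (2 * i) < length (inwords M)" "2 * i < length (inwords M)"
      using 4 len by auto
    have r: "regs M' 7 = lo j" "inwords M' = inwords M"
      using frameD[of M M'] 4 b by (auto simp: base_def)
    have bd: "Suc (2 * i) < word_bound w" "p < word_bound w" "p - lo j < 9 * B"
      using p small 4 L B_pos by auto
    have t: "take (Suc i) L = take i L @ [(p, a)]"
      using 4 pa by (simp add: take_Suc_conv_app_nth)
    show ?case
      using 4 r i nth[of i] bd p pa small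
      by (auto simp: eval_rules machine_defs frame_def t)
  qed (use b L small B_pos in \<open>auto simp: machine_defs frame_def intro: Q\<close>)
qed

end

section \<open>Rolling hash values of blocks and pieces\<close>

locale hashed = params +
  fixes \<alpha> b q Mo :: nat
  assumes hash: "0 < q" "0 < Mo" "b < Mo" "\<alpha> < word_bound w"
    and g_bound: "(word_bound w - 1) div q < Mo"
    and Mo: "4 * (Mo * Mo) < word_bound w"
begin

text \<open>Multiplicative hashing: the quotient by \<open>q\<close> keeps the leading part of the
  product modulo the word bound. The range thus depends on \<open>q\<close> and not on the
  alphabet.\<close>

definition g :: "nat \<Rightarrow> nat" where
  "g x = (\<alpha> * Sp x mod word_bound w) div q"

text \<open>Horner's scheme: the last letter gets the power 0, in contrast to \<open>bwd\<close>,
  where the first letter does.\<close>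

primrec fwd :: "nat \<Rightarrow> nat \<Rightarrow> nat" where
  "fwd y 0 = 0"
| "fwd y (Suc i) = fwd y i * b + g (y + i)"

definition fwd_hash :: "nat \<Rightarrow> nat" where
  "fwd_hash y = fwd y m mod Mo"

definition bwd :: "nat \<Rightarrow> nat \<Rightarrow> nat" where
  "bwd y i = (\<Sum>o'<i. g (y + o') * b ^ o')"

definition bwd_hash :: "nat \<Rightarrow> nat" where
  "bwd_hash k = bwd (k * m) m mod Mo"

lemma g_less: "g x < Mo"
proof -
  have "g x \<le> (word_bound w - 1) div q"
    unfolding g_def by (intro div_le_mono) (simp add: Suc_leI flip: less_Suc_eq_le)
  with g_bound show ?thesis
    by simp
qed

lemma mult_small: "x < Mo \<Longrightarrow> y < Mo \<Longrightarrow> x * y \<le> Mo * Mo"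
  by (intro mult_le_mono) auto

lemma Mo_le: "Mo \<le> Mo * Mo"
  using hash by simp

lemma fwd_Suc: "fwd (Suc y) i + g y * b ^ i = fwd y (Suc i)"
proof (induction i)
  case (Suc i)
  have "fwd (Suc y) (Suc i) + g y * b ^ Suc i = (fwd (Suc y) i + g y * b ^ i) * b + g (y + Suc i)"
    by (simp add: algebra_simps)
  also have "\<dots> = fwd y (Suc (Suc i))"
    unfolding Suc.IH by simp
  finally show ?case .
qed simp

text \<open>Justifies \<open>slide_expr\<close>, including the complement that replaces a
  subtraction of residues.\<close>

lemma fwd_hash_Suc:
  "fwd_hash (Suc y) =
     (fwd_hash y * b + g (y + m) + (Mo - g y * (b ^ m mod Mo) mod Mo)) mod Mo"
proof -
  define r where "r = g y * (b ^ m mod Mo) mod Mo"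
  have r: "r < Mo" "r = g y * b ^ m mod Mo"
    using hash by (simp_all add: r_def mod_mult_right_eq)
  have "[fwd_hash y * b + g (y + m) = fwd (Suc y) m + g y * b ^ m] (mod Mo)"
    unfolding fwd_Suc fwd_hash_def cong_def fwd.simps by (metis mod_add_left_eq mod_mult_left_eq)
  then have "[fwd_hash y * b + g (y + m) + (Mo - r) = fwd (Suc y) m + g y * b ^ m + (Mo - r)] (mod Mo)"
    by (rule cong_add) simp
  also have "[fwd (Suc y) m + g y * b ^ m + (Mo - r) = fwd (Suc y) m + r + (Mo - r)] (mod Mo)"
    unfolding r(2) cong_def by (metis mod_add_left_eq mod_add_right_eq)
  also have "fwd (Suc y) m + r + (Mo - r) = fwd (Suc y) m + Mo"
    using r by simp
  finally show ?thesis
    by (simp add: cong_def fwd_hash_def r_def)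
qed

definition hbase :: "nat \<Rightarrow> machine \<Rightarrow> bool" where
  "hbase j M \<longleftrightarrow> base j M \<and> regs M 8 = Mo \<and> regs M 9 = b \<and> regs M 10 = \<alpha> \<and> regs M 11 = q"

lemma hbase_frame: "frame M M' \<Longrightarrow> hbase j M \<Longrightarrow> hbase j M'"
  using frameD[of M M'] by (simp add: hbase_def base_def)

lemma hbaseD:
  assumes "hbase j M"
  shows "regs M 0 = n" "regs M (Suc 0) = \<sigma>" "regs M 2 = m" "regs M 3 = j" "regs M 5 = B" "regs M 6 = \<beta>"
     "regs M 7 = lo j" "regs M 8 = Mo" "regs M 9 = b" "regs M 10 = \<alpha>" "regs M 11 = q"
  using assms by (auto simp: hbase_def base_def)

lemma wp_first_hash:
  assumes b: "hbase j M" "regs M 26 = off" "lo j + off = j * B"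
    and win: "\<And>u. lo j + u < (j + 5) * B \<Longrightarrow> memory M u = Sp (lo j + u)"
    and Q: "\<And>M'. frame M M' \<Longrightarrow> outbox M' = outbox M \<Longrightarrow> memory M' = memory M \<Longrightarrow>
      extent M' \<le> max (extent M) (9 * B) \<Longrightarrow> regs M' 21 = fwd_hash (j * B) \<Longrightarrow> regs M' 22 = b ^ m mod Mo \<Longrightarrow>
      regs M' 26 = off \<Longrightarrow> steps M' \<le> steps M + 20 * B \<Longrightarrow> Q M'"
  shows "wp w first_hash Q M"
  unfolding first_hash_def wp.simps(2,9)
\<comment> \<open>Register 22 starts as 1, which is not reduced if \<open>Mo = 1\<close>. Hence the
  invariant has a congruence and a weak bound, and the strict bound only after the first
  iteration.\<close>
proof (rule wp_For[where N = m and
      J = "\<lambda>i M'. frame M M' \<and> outbox M' = outbox M \<and> memory M' = memory M \<and>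
        extent M' \<le> max (extent M) (9 * B) \<and> regs M' 21 = fwd (j * B) i mod Mo \<and>
        regs M' 22 mod Mo = b ^ i mod Mo \<and> regs M' 22 \<le> Mo \<and> regs M' 26 = off \<and> (0 < i \<longrightarrow> regs M' 22 < Mo) \<and>
        steps M' \<le> steps M + 5 + 6 * i"], goal_cases)
  case 1
  then show ?case
    using small by linarith
next
  case 2
  then show ?case
    using b hash small by (simp add: eval_rules machine_defs frame_def Suc_leI)
next
  case (3 i M')
  then show ?case
    using hbase_frame[of M M'] b by (simp add: eval_rules hbase_def base_def)
next
  case (4 i M')
  note r = hbaseD[OF hbase_frame[OF _ b(1)]]
  have fr: "frame M M'"
    using 4 by simp
  note r = hbaseD[OF hbase_frame[OF fr b(1)]]
  have off: "off \<le> 4 * B" "off + i < 9 * B" "lo j + (off + i) < j * B + 3 * B"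
    using b(3) lo_le[of j] 4 m_le_B B_pos by linarith+
  note wn = win[OF window_less_block[OF off(3)]]
  from off have mem: "memory M' (off + i) = Sp (j * B + i)" "(off + i) mod word_bound w = off + i"
    using 4 wn b(3) small(2) by (simp_all flip: add.assoc)
  define h where "h = regs M' 21"
  define p where "p = regs M' 22"
  have h: "h < Mo" "h = fwd (j * B) i mod Mo" "h * b \<le> Mo * Mo" "p * b \<le> Mo * Mo"
    "p mod Mo = b ^ i mod Mo"
    using 4 hash mult_small[of h b] by (auto simp: h_def p_def intro!: mult_le_mono)
  have G: "(\<alpha> * Sp (j * B + i) mod word_bound w) div q = g (j * B + i)"
    by (simp add: g_def)
  have lt: "h * b < word_bound w" "p * b < word_bound w" "h * b + g (j * B + i) < word_bound w"
    using h Mo g_less[of "j * B + i"] Mo_le by linarith+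
  have h': "(h * b + g (j * B + i)) mod Mo = (fwd (j * B) i * b + g (j * B + i)) mod Mo"
    unfolding h(2) by (metis mod_add_left_eq mod_mult_left_eq)
  have p': "p * b mod Mo = b * b ^ i mod Mo"
    by (metis h(5) mod_mult_left_eq mult.commute)
  show ?case
    using 4 r off mem h_def[symmetric] p_def[symmetric] G lt h' p' hash
    by (simp add: eval_rules machine_defs frame_def less_imp_le)
next
  case (5 M')
  then show ?case
    using m m_le_B by (intro Q) (auto simp: machine_defs fwd_hash_def frame_def)
qed

end


context hashed
begin

lemma wp_slide_hash:
  assumes b: "hbase j M" "regs M 26 = off" "lo j + off = j * B"
    and h: "regs M 21 = fwd_hash (j * B)" "regs M 22 = b ^ m mod Mo"
    and win: "\<And>u. lo j + u < (j + 5) * B \<Longrightarrow> memory M u = Sp (lo j + u)"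
    and Q: "\<And>M'. frame M M' \<Longrightarrow>
      outbox M' = outbox M @ concat (map (\<lambda>z. [(z mod m, Sp (j * B + z)), (z mod m, fwd_hash (j * B + z))]) [0..<B]) \<Longrightarrow>
      memory M' = memory M \<Longrightarrow> extent M' \<le> max (extent M) (9 * B) \<Longrightarrow> steps M' \<le> steps M + 20 * B \<Longrightarrow> Q M'"
  shows "wp w slide_hash Q M"
  unfolding slide_hash_def
proof (rule wp_For[where N = B and
      J = "\<lambda>i M'. frame M M' \<and> memory M' = memory M \<and>
        outbox M' = outbox M @ concat (map (\<lambda>z. [(z mod m, Sp (j * B + z)), (z mod m, fwd_hash (j * B + z))]) [0..<i]) \<and>
        extent M' \<le> max (extent M) (9 * B) \<and> regs M' 21 = fwd_hash (j * B + i) \<and>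
        regs M' 22 = b ^ m mod Mo \<and> regs M' 26 = off \<and> steps M' \<le> steps M + 5 + 8 * i"], goal_cases)
  case 1
  then show ?case
    using small by linarith
next
  case 2
  then show ?case
    using b h by (simp add: machine_defs frame_def)
next
  case (3 i M')
  then show ?case
    using hbase_frame[of M M'] b by (simp add: eval_rules hbase_def base_def)
next
  case (4 i M')
  have fr: "frame M M'"
    using 4 by simp
  note r = hbaseD[OF hbase_frame[OF fr b(1)]]
  have off: "off \<le> 4 * B" "off + i < 9 * B" "off + i + m < 9 * B"
    using b(3) lo_le[of j] 4 m_le_B B_pos by linarith+
  have lo: "lo j + (off + i) = j * B + i" "lo j + (off + i + m) = j * B + i + m"
    using b(3) by linarith+
  have mem: "memory M' (off + i) = Sp (j * B + i)" "memory M' (off + i + m) = Sp (j * B + i + m)"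
    "(off + i) mod word_bound w = off + i" "(off + i + m) mod word_bound w = off + i + m"
    using 4 win[OF window_less_block, of "off + i"] win[OF window_less_block, of "off + i + m"] m_le_B B_pos lo small(2) off by (simp_all del: add.assoc)
  define P where "P = b ^ m mod Mo"
  define h where "h = fwd_hash (j * B + i)"
  define d where "d = g (j * B + i) * P mod Mo"
  have bd: "h < Mo" "P < Mo" "d < Mo"
    using hash by (simp_all add: P_def h_def d_def fwd_hash_def)
  have G: "(\<alpha> * Sp (j * B + i) mod word_bound w) div q = g (j * B + i)"
    "(\<alpha> * Sp (j * B + i + m) mod word_bound w) div q = g (j * B + i + m)"
    by (simp_all add: g_def)
  have lt: "h * b < word_bound w" "h * b + g (j * B + i + m) < word_bound w"
    "h * b + g (j * B + i + m) + (Mo - d) < word_bound w" "g (j * B + i) * P < word_bound w"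
    "Mo < word_bound w"
    using mult_small[of h b] mult_small[of "g (j * B + i)" P] bd hash Mo
      g_less[of "j * B + i"] g_less[of "j * B + i + m"] Mo_le by linarith+
  have S: "fwd_hash (Suc (j * B + i)) = (h * b + g (j * B + i + m) + (Mo - d)) mod Mo"
    unfolding fwd_hash_Suc h_def d_def P_def ..
  have M': "memory M' = memory M" "outbox M' = outbox M @ concat (map (\<lambda>z. [(z mod m, Sp (j * B + z)), (z mod m, fwd_hash (j * B + z))]) [0..<i])"
    "extent M' \<le> max (extent M) (9 * B)" "regs M' 21 = fwd_hash (j * B + i)" "regs M' 22 = P" "regs M' 26 = off"
    "steps M' \<le> steps M + 5 + 8 * i" "regs M' 20 = i" "frame M M'"
    using 4 by (auto simp: P_def)
  have ds: "wsub w Mo d = Mo - d"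
    using bd lt by simp
  have ev: "eval w slide_expr M2 = fwd_hash (Suc (j * B + i))"
    if "regs M2 8 = Mo" "regs M2 9 = b" "regs M2 10 = \<alpha>" "regs M2 11 = q" "regs M2 21 = fwd_hash (j * B + i)"
      "regs M2 22 = P" "regs M2 23 = Sp (j * B + i)" "regs M2 25 = Sp (j * B + i + m)" for M2
    using lt by (simp add: slide_expr_def eval_rules that G ds h_def[symmetric] d_def[symmetric] S del: wsub_eq)
  define E where "E = max (extent M) (9 * B)"
  have E: "extent M' \<le> E" "Suc (off + i) \<le> E" "Suc (off + i + m) \<le> E"
    using off M'(3) by (auto simp: E_def)
  define ob where "ob l = concat (map (\<lambda>z. [(z mod m, Sp (j * B + z)), (z mod m, fwd_hash (j * B + z))]) l)" for l
  have ob: "ob [0..<Suc i] = ob [0..<i] @ [(i mod m, Sp (j * B + i)), (i mod m, fwd_hash (j * B + i))]"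
    by (simp add: ob_def)
  define R where "R = (\<lambda>M'. regs M' 20 = i \<and> frame M (tick (set_reg 20 (Suc i) M')) \<and>
     memory (tick (set_reg 20 (Suc i) M')) = memory M \<and>
     outbox (tick (set_reg 20 (Suc i) M')) = outbox M @ ob [0..<Suc i] \<and>
     extent (tick (set_reg 20 (Suc i) M')) \<le> E \<and>
     regs (tick (set_reg 20 (Suc i) M')) 21 = fwd_hash (j * B + Suc i) \<and>
     regs (tick (set_reg 20 (Suc i) M')) 22 = P \<and> regs (tick (set_reg 20 (Suc i) M')) 26 = off \<and>
     steps (tick (set_reg 20 (Suc i) M')) \<le> steps M + 5 + 8 * Suc i)"
  show ?case
    unfolding ob_def[symmetric] E_def[symmetric] P_def[symmetric] R_def[symmetric]
    using M'(2-8)[folded ob_def] 4(2) E fr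
    apply (simp add: eval_rules machine_defs r mem ev)
    apply (simp add: R_def machine_defs frame_def M'(1) ob_def)
    done
next
  case (5 M')
  then show ?case
    using B_pos by (intro Q) (auto simp: machine_defs frame_def)
qed

lemma off_eq: "wsub w (j * B) (lo j) = j * B - lo j" "lo j + (j * B - lo j) = j * B" if "j < m"
  using lo_le(1)[of j] block_le[OF that] small(1) by simp_all

lemma wp_hash_round:
  assumes b: "base j M" "j < m"
    and inw: "4 \<le> length (inwords M)" "inwords M ! 0 = Mo" "inwords M ! 1 = b" "inwords M ! 2 = \<alpha>" "inwords M ! 3 = q"
    and win: "\<And>u. lo j + u < (j + 5) * B \<Longrightarrow> memory M u = Sp (lo j + u)"
    and Q: "\<And>M'. hbase j M' \<Longrightarrow> regs M' 4 = regs M 4 \<Longrightarrow> inbox M' = inbox M \<Longrightarrow> outputs M' = outputs M \<Longrightarrow>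
      finished M' = finished M \<Longrightarrow> peak M' = peak M \<Longrightarrow>
      outbox M' = outbox M @ concat (map (\<lambda>z. [(z mod m, Sp (j * B + z)), (z mod m, fwd_hash (j * B + z))]) [0..<B]) \<Longrightarrow>
      memory M' = memory M \<Longrightarrow> extent M' \<le> max (extent M) (9 * B) \<Longrightarrow> steps M' \<le> steps M + 50 * B \<Longrightarrow> Q M'"
  shows "wp w hash_round Q M"
proof -
  have *: "wp w first_hash (wp w slide_hash Q) M1"
    if M1: "hbase j M1" "regs M1 26 = j * B - lo j" "regs M1 4 = regs M 4" "inbox M1 = inbox M" "outputs M1 = outputs M"
      "finished M1 = finished M" "peak M1 = peak M" "outbox M1 = outbox M" "memory M1 = memory M"
      "extent M1 = extent M" "steps M1 \<le> steps M + 5" for M1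
  proof (rule wp_first_hash[OF M1(1,2) off_eq(2)[OF b(2)]], goal_cases)
    case 1
    then show ?case
      using win M1 by simp
  next
    case (2 M2)
    note A = 2
    note hb = hbase_frame[OF A(1) M1(1)] and fr = frameD[OF A(1)]
    show ?case
    proof (rule wp_slide_hash[OF hb A(7) off_eq(2)[OF b(2)] A(5,6)], goal_cases)
      case 1
      then show ?case
        using win M1 A by simp
    next
      case (2 M3)
      note hb3 = hbase_frame[OF 2(1) hb] and fr3 = frameD[OF 2(1)]
      have x: "extent M3 \<le> max (extent M) (9 * B)"
        using A(4) 2(4) M1(10) by simp
      have st: "steps M3 \<le> steps M + 50 * B"
        using A(8) 2(5) M1(11) B_pos by linarith
      show ?case
        by (rule Q[OF hb3 _ _ _ _ _ _ _ x st]) (use fr fr3 M1 in \<open>simp_all add: 2 A\<close>)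
    qed
  qed
  have bl: "j * B mod word_bound w = j * B"
    using block_le[OF b(2)] small(1) by (intro mod_less) linarith
  have i: "0 < length (inwords M)" "Suc 0 < length (inwords M)" "2 < length (inwords M)" "3 < length (inwords M)"
    using inw by auto
  show ?thesis
    unfolding hash_round_def using b inw small i
    by (simp add: eval_rules machine_defs base_def bl off_eq[OF b(2)] del: wsub_eq)
      (rule *; simp add: hbase_def base_def)
qed

end


section \<open>Programs that answer a query\<close>

definition store_pieces :: program where
  "store_pieces = For 20 (Reg 5) (Store (Const 11 *\<^sub>e Reg 5 +\<^sub>e Reg 20) (Inbox_Word (Reg 20)))"

definition broadcast_query :: program where
  "broadcast_query = For 20 (Reg 2) (Send (Reg 20) (Reg 14))"

text \<open>A block of \<open>B\<close> positions owns \<open>2 * B\<close> sums, as centers may lie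
  between letters; sums beyond the string are skipped. The body finds the sum, its value relative to
  the window and the table entry in registers 21, 23 and 22.\<close>

definition visit :: "program \<Rightarrow> program" where
  "visit p =
     For 20 (Const 2 *\<^sub>e Reg 5)
       (Assign 21 (Const 2 *\<^sub>e (Reg 3 *\<^sub>e Reg 5) +\<^sub>e Reg 20) ;;
        If (Reg 21 +\<^sub>e Const 1 <\<^sub>e Const 2 *\<^sub>e Reg 0)
          (Assign 23 (Reg 21 -\<^sub>e Const 2 *\<^sub>e Reg 7) ;;
           Load 22 (Const 12 *\<^sub>e Reg 5 +\<^sub>e Reg 23) ;; p)
          Skip)"

text \<open>The left pieces of one query start \<open>m\<close> apart, so they occupy consecutive
  entries in the table of their residue class, read backwards while the right pieces
  advance.\<close>

definition locate_loop :: program where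
  "locate_loop =
      While (Reg 25)
        (If (Reg 22 <\<^sub>e Reg 24)
           (Load 26 (Const 11 *\<^sub>e Reg 5 +\<^sub>e Reg 22) ;;
            Load 27 (Const 10 *\<^sub>e Reg 5 +\<^sub>e (Reg 23 -\<^sub>e (Reg 22 +\<^sub>e Const 1))) ;;
            If (Reg 26 =\<^sub>e Reg 27) (Assign 22 (Reg 22 +\<^sub>e Const 1)) (Assign 25 (Const 0)))
           (Assign 25 (Const 0)))"

text \<open>The search starts with the first piece that lies entirely to the right of the center;
  what precedes it is covered by the palindrome known from the window. Register 24 limits the search
  to whole pieces that fit on both sides.\<close>

definition locate :: program where
  "locate =
     (Assign 22 (Reg 21 div\<^sub>e (Const 2 *\<^sub>e Reg 2) +\<^sub>e Const 1) ;;
      Assign 23 ((Reg 21 +\<^sub>e Const 1) div\<^sub>e Reg 2) ;;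
      Assign 24 (Reg 0 div\<^sub>e Reg 2) ;;
      If (Reg 23 <\<^sub>e Reg 24) (Assign 24 (Reg 23)) Skip ;;
      Assign 25 (Const 1) ;;
      locate_loop)"

text \<open>The left piece mirrored to piece \<open>k\<close> starts at
  \<open>s + 1 - (k + 1) * m\<close>, so machine \<open>(s + 1) mod m\<close> stores all of them.
  The other machines send a dummy 0, which lets the asker find the answer by its index.\<close>

definition answer_round :: program where
  "answer_round =
     For 20 (Reg 2)
       (Assign 21 (Inbox_Word (Reg 20)) ;;
        If ((Reg 21 +\<^sub>e Const 1) mod\<^sub>e Reg 2 =\<^sub>e Reg 3)
          (locate ;; Send (Reg 20) (Reg 22))
          (Send (Reg 20) (Const 0)))"

definition relay_round :: program where
  "relay_round =
     (Assign 15 (Inbox_Word ((Reg 14 +\<^sub>e Const 1) mod\<^sub>e Reg 2)) ;;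
      For 20 (Reg 2) (Send (Reg 20) (Reg 14) ;; Send (Reg 20) (Reg 15)))"

text \<open>A piece and its mirror image consist of \<open>m\<close> consecutive positions each, so
  every residue class, hence every machine, contributes exactly one letter to either of
  them.\<close>

definition letters_round :: program where
  "letters_round =
     For 20 (Reg 2)
       (Assign 21 (Inbox_Word (Const 2 *\<^sub>e Reg 20)) ;;
        Assign 22 (Inbox_Word (Const 2 *\<^sub>e Reg 20 +\<^sub>e Const 1)) ;;
        Assign 23 (Const 0) ;;
        If (Reg 22 <\<^sub>e Reg 5) (Load 23 (Const 9 *\<^sub>e Reg 5 +\<^sub>e Reg 22)) Skip ;;
        Send (Reg 20) (Reg 23) ;;
        Assign 23 (Const 0) ;;
        If (Reg 22 *\<^sub>e Reg 2 +\<^sub>e Reg 3 <\<^sub>e Reg 21 +\<^sub>e Const 1)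
          (Assign 24 ((Reg 21 -\<^sub>e (Reg 22 *\<^sub>e Reg 2 +\<^sub>e Reg 3)) div\<^sub>e Reg 2) ;;
           If (Reg 24 <\<^sub>e Reg 5) (Load 23 (Const 9 *\<^sub>e Reg 5 +\<^sub>e Reg 24)) Skip)
          Skip ;;
        Send (Reg 20) (Reg 23))"

text \<open>The letter at offset \<open>d\<close> of the piece comes from machine \<open>d\<close>,
  its mirror image from the machine of the residue class of \<open>s - x\<close>. All conjuncts of
  the guard are evaluated every time; the range checks make the guard 0 when the subtraction has
  wrapped around.\<close>

definition resolve :: program where
  "resolve =
     (Assign 21 (Reg 15 *\<^sub>e Reg 2) ;; Assign 22 (Const 0) ;;
      While ((Reg 22 <\<^sub>e Reg 2) &\<^sub>e ((Reg 21 <\<^sub>e Reg 0) &\<^sub>e ((Reg 21 <\<^sub>e Reg 14 +\<^sub>e Const 1) &\<^sub>e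
             (Inbox_Word (Const 2 *\<^sub>e Reg 22) =\<^sub>e
              Inbox_Word (Const 2 *\<^sub>e ((Reg 14 -\<^sub>e Reg 21) mod\<^sub>e Reg 2) +\<^sub>e Const 1)))))
        (Assign 22 (Reg 22 +\<^sub>e Const 1) ;; Assign 21 (Reg 21 +\<^sub>e Const 1)))"

definition first :: "(nat \<Rightarrow> bool) \<Rightarrow> nat \<Rightarrow> nat" where
  "first P a = (LEAST k. a \<le> k \<and> P k)"

lemma first_eqI: "a \<le> k \<Longrightarrow> P k \<Longrightarrow> (\<And>i. a \<le> i \<Longrightarrow> i < k \<Longrightarrow> \<not> P i) \<Longrightarrow> first P a = k"
  unfolding first_def by (rule Least_equality) (auto simp: not_less[symmetric])

lemma first_props:
  assumes "P c"  "a \<le> c"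
  shows "a \<le> first P a" "P (first P a)" "first P a \<le> c" "\<And>i. a \<le> i \<Longrightarrow> i < first P a \<Longrightarrow> \<not> P i"
  using LeastI[of "\<lambda>k. a \<le> k \<and> P k" c] Least_le[of "\<lambda>k. a \<le> k \<and> P k" c] not_less_Least[of _ "\<lambda>k. a \<le> k \<and> P k"] assms
  unfolding first_def by blast+

context hashed
begin

lemma small': "1000 * (m * B) < word_bound w" "1000 * B < word_bound w" "1000 * m < word_bound w"
  "1000 * n < word_bound w" "10000 < word_bound w"
  using small by linarith+

lemma wp_store_class:
  assumes b: "base j M" and inw: "length (inwords M) = 2 * B"
    and Q: "\<And>M'. frame M M' \<Longrightarrow> outbox M' = outbox M \<Longrightarrow> (\<And>a. a < 9 * B \<Longrightarrow> memory M' a = memory M a) \<Longrightarrow>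
      (\<And>u. u < B \<Longrightarrow> memory M' (9 * B + u) = inwords M ! (2 * u)) \<Longrightarrow>
      (\<And>u. u < B \<Longrightarrow> memory M' (10 * B + u) = inwords M ! (2 * u + 1)) \<Longrightarrow>
      extent M' \<le> max (extent M) (11 * B) \<Longrightarrow> steps M' \<le> steps M + 10 * B \<Longrightarrow> Q M'"
  shows "wp w store_class Q M"
proof -
  define J where "J i M' \<longleftrightarrow> frame M M' \<and> outbox M' = outbox M \<and> (\<forall>a < 9 * B. memory M' a = memory M a) \<and>
      (\<forall>u<i. memory M' (9 * B + u) = inwords M ! (2 * u)) \<and>
      (\<forall>u<i. memory M' (10 * B + u) = inwords M ! (2 * u + 1)) \<and>
      extent M' \<le> max (extent M) (11 * B) \<and> steps M' \<le> steps M + 2 + 5 * i" for i M'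
  show ?thesis
    unfolding store_class_def
  proof (rule wp_For[where N = B and J = J], goal_cases)
    case 1 show ?case using small' by linarith
  next
    case 2 show ?case by (simp add: J_def machine_defs frame_def)
  next
    case (3 i M')
    then show ?case using b frameD[of M M'] by (simp add: J_def eval_rules base_def)
  next
    case (4 i M')
    then have fr: "frame M M'" by (simp add: J_def)
    have r: "regs M' 5 = B" "inwords M' = inwords M"
      using b frameD[OF fr] by (auto simp: base_def)
    have x: "Suc (9 * B + i) \<le> max (extent M) (11 * B)" "Suc (10 * B + i) \<le> max (extent M) (11 * B)"
      using 4 by auto
    show ?case
      using r 4(2,3) small' inw
      apply (simp add: eval_rules machine_defs)
      using 4(1) x apply (auto simp: J_def frame_def less_Suc_eq)
      done
  next
    case (5 M')
    then show ?case using B_pos by (intro Q) (auto simp: J_def machine_defs frame_def)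
  qed
qed

lemma wp_piece_hash:
  assumes b: "hbase j M" "regs M 26 = off" "lo j + off = j * B" and t: "regs M 20 = t" "t < \<beta>"
    and win: "\<And>u. lo j + u < (j + 5) * B \<Longrightarrow> memory M u = Sp (lo j + u)"
    and Q: "\<And>M'. frame M M' \<Longrightarrow> outbox M' = outbox M \<Longrightarrow> memory M' = memory M \<Longrightarrow>
      extent M' \<le> max (extent M) (9 * B) \<Longrightarrow> regs M' 20 = t \<Longrightarrow> regs M' 21 = bwd_hash (j * \<beta> + t) \<Longrightarrow>
      regs M' 26 = off \<Longrightarrow> steps M' \<le> steps M + 20 * m \<Longrightarrow> Q M'"
  shows "wp w piece_hash Q M"
proof -
  define y where "y = (j * \<beta> + t) * m"
  define J where "J i M' \<longleftrightarrow> frame M M' \<and> outbox M' = outbox M \<and> memory M' = memory M \<and>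
        extent M' \<le> max (extent M) (9 * B) \<and> regs M' 20 = t \<and> regs M' 21 = bwd y i mod Mo \<and>
        regs M' 22 mod Mo = b ^ i mod Mo \<and> regs M' 22 \<le> Mo \<and> regs M' 26 = off \<and>
        steps M' \<le> steps M + 5 + 6 * i" for i M'
  have tm: "t * m + m \<le> B"
    using t(2) B_def by (metis Suc_leI add.commute mult.commute mult_Suc mult_le_mono2)
  have y: "y = j * B + t * m"
    by (simp add: y_def B_def algebra_simps)
  have off: "off \<le> 4 * B"
    using b(3) lo_le[of j] by linarith
  show ?thesis
    unfolding piece_hash_def wp.simps(2,9)
  proof (rule wp_For[where N = m and J = J], goal_cases)
    case 1 show ?case using small' by linarith
  next
    case 2 show ?case using small' hash b t by (simp add: J_def machine_defs frame_def eval_rules bwd_def Suc_leI)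
  next
    case (3 i M')
    then show ?case using hbase_frame[of M M'] b by (simp add: J_def eval_rules hbase_def base_def)
  next
    case (4 i M')
    then have M': "frame M M'" "outbox M' = outbox M" "memory M' = memory M"
        "extent M' \<le> max (extent M) (9 * B)" "regs M' 20 = t" "regs M' 21 = bwd y i mod Mo"
        "regs M' 22 mod Mo = b ^ i mod Mo" "regs M' 22 \<le> Mo" "regs M' 26 = off"
        "steps M' \<le> steps M + 5 + 6 * i"
      by (simp_all add: J_def)
    note r = hbaseD[OF hbase_frame[OF M'(1) b(1)]]
    define u where "u = off + t * m + i"
    have u: "u < 9 * B" "lo j + u = y + i"
      using off tm 4(2) b(3) B_pos y by (auto simp: u_def)
    have ad: "((off + t * m mod word_bound w) mod word_bound w + i) mod word_bound w = u"
      using u small' by (simp add: u_def mod_add_left_eq mod_add_right_eq)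
    have mem: "memory M' u = Sp (y + i)"
      using win[OF window_less_block, of u] u(2) M'(3) 4(2) tm y by simp
    define p where "p = regs M' 22"
    have p: "p \<le> Mo" "p mod Mo = b ^ i mod Mo" "regs M' 22 = p"
      using M' by (simp_all add: p_def)
    have le: "p * b \<le> Mo * Mo" "g (y + i) * p \<le> Mo * Mo"
      using p hash g_less[of "y + i"] by (auto intro!: mult_le_mono)
    have ev: "eval w ((Reg 21 +\<^sub>e hash_expr (Reg 24) *\<^sub>e Reg 22) mod\<^sub>e Reg 8) M2 = bwd y (Suc i) mod Mo"
      if "regs M2 8 = Mo" "regs M2 10 = \<alpha>" "regs M2 11 = q" "regs M2 21 = bwd y i mod Mo" "regs M2 22 = p"
        "regs M2 24 = Sp (y + i)" for M2
    proof -
      have "bwd y i mod Mo < Mo"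
        using hash by simp
      then have lt: "g (y + i) * p < word_bound w" "bwd y i mod Mo + g (y + i) * p < word_bound w"
        using le Mo Mo_le by linarith+
      have "(bwd y i mod Mo + g (y + i) * p) mod Mo = (bwd y i + g (y + i) * b ^ i) mod Mo"
        by (metis p(2) mod_add_left_eq mod_add_right_eq mod_mult_right_eq)
      then show ?thesis
        using lt that by (simp add: eval_rules g_def[symmetric] bwd_def)
    qed
    have ev2: "eval w (Reg 22 *\<^sub>e Reg 9 mod\<^sub>e Reg 8) M2 = p * b mod Mo"
      if "regs M2 8 = Mo" "regs M2 9 = b" "regs M2 22 = p" for M2
      using that le Mo Mo_le hash by (simp add: eval_rules)
    have pb: "p * b mod Mo = b * b ^ i mod Mo" "p * b mod Mo \<le> Mo"
      using p(2) hash by (metis mod_mult_left_eq mult.commute, simp add: less_imp_le)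
    define e where "e = max (extent M) (9 * B)"
    have e: "Suc u \<le> e" "extent M' \<le> e"
      using u M' by (auto simp: e_def)
    have el: "eval w (Reg 26 +\<^sub>e Reg 20 *\<^sub>e Reg 2 +\<^sub>e Reg 23) M2 = u"
      if "regs M2 26 = off" "regs M2 20 = t" "regs M2 2 = m" "regs M2 23 = i" for M2
      using ad that by (simp add: eval_rules)
    show ?case
      using r M'(5,6,9) p(3) 4(3) mem
      apply (simp add: ev ev2 el machine_defs)
      using M' pb e unfolding e_def[symmetric] apply (simp add: J_def frame_def e_def[symmetric])
      done
  next
    case (5 M')
    then show ?case
      using m by (intro Q) (auto simp: J_def machine_defs bwd_hash_def y_def frame_def)
  qed
qed

lemma wp_broadcast_piece:
  assumes b: "regs M 2 = m" "regs M 21 = h"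
    and Q: "\<And>M'. frame M M' \<Longrightarrow> outbox M' = outbox M @ map (\<lambda>r. (r, h)) [0..<m] \<Longrightarrow> memory M' = memory M \<Longrightarrow>
      extent M' = extent M \<Longrightarrow> regs M' 20 = regs M 20 \<Longrightarrow> regs M' 26 = regs M 26 \<Longrightarrow> steps M' \<le> steps M + 10 * m \<Longrightarrow> Q M'"
  shows "wp w broadcast_piece Q M"
proof -
  define J where "J i M' \<longleftrightarrow> frame M M' \<and> outbox M' = outbox M @ map (\<lambda>r. (r, h)) [0..<i] \<and>
      memory M' = memory M \<and> extent M' = extent M \<and> regs M' 20 = regs M 20 \<and> regs M' 26 = regs M 26 \<and>
      regs M' 21 = h \<and> steps M' \<le> steps M + 3 + 4 * i" for i M'
  show ?thesis
    unfolding broadcast_piece_def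
  proof (rule wp_For[where N = m and J = J], goal_cases)
    case 1 show ?case using small' by linarith
  next
    case 2 show ?case using b by (simp add: J_def machine_defs frame_def)
  next
    case (3 i M')
    then show ?case using b frameD[of M M'] by (simp add: J_def eval_rules)
  next
    case (4 i M')
    then show ?case by (simp add: J_def machine_defs eval_rules frame_def)
  next
    case (5 M')
    then show ?case using m by (intro Q) (auto simp: J_def machine_defs frame_def)
  qed
qed

text \<open>Hashing a piece and broadcasting its hash cost a multiple of \<open>m\<close> each, and
  \<open>m * \<beta> = B\<close>, so every machine stays linear in its block.\<close>

lemma wp_piece_round:
  assumes b: "hbase j M" "j < m" and inw: "length (inwords M) = 2 * B"
    and win: "\<And>u. lo j + u < (j + 5) * B \<Longrightarrow> memory M u = Sp (lo j + u)"
    and Q: "\<And>M'. frame M M' \<Longrightarrow>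
      outbox M' = outbox M @ concat (map (\<lambda>t. map (\<lambda>r. (r, bwd_hash (j * \<beta> + t))) [0..<m]) [0..<\<beta>]) \<Longrightarrow>
      (\<And>a. a < 9 * B \<Longrightarrow> memory M' a = memory M a) \<Longrightarrow>
      (\<And>u. u < B \<Longrightarrow> memory M' (9 * B + u) = inwords M ! (2 * u)) \<Longrightarrow>
      (\<And>u. u < B \<Longrightarrow> memory M' (10 * B + u) = inwords M ! (2 * u + 1)) \<Longrightarrow>
      extent M' \<le> max (extent M) (11 * B) \<Longrightarrow> steps M' \<le> steps M + 100 * B \<Longrightarrow> Q M'"
  shows "wp w piece_round Q M"
proof -
  define off where "off = j * B - lo j"
  have off: "lo j + off = j * B"
    using off_eq[OF b(2)] by (simp add: off_def)
  have lt: "j * B < word_bound w"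
    using block_le[OF b(2)] small' by linarith
  have bj: "base j M"
    using b by (simp add: hbase_def)
  have main: "wp w (Assign 26 (Reg 3 *\<^sub>e Reg 5 -\<^sub>e Reg 7) ;; For 20 (Reg 6) (piece_hash ;; broadcast_piece)) Q M1"
    if M1: "frame M M1" "outbox M1 = outbox M" "\<And>a. a < 9 * B \<Longrightarrow> memory M1 a = memory M a"
      "\<And>u. u < B \<Longrightarrow> memory M1 (9 * B + u) = inwords M ! (2 * u)"
      "\<And>u. u < B \<Longrightarrow> memory M1 (10 * B + u) = inwords M ! (2 * u + 1)"
      "extent M1 \<le> max (extent M) (11 * B)" "steps M1 \<le> steps M + 10 * B" for M1
  proof -
    have hb1: "hbase j M1"
      using hbase_frame[OF M1(1)] b by blast
    define J where "J i M' \<longleftrightarrow> frame M M' \<and>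
        outbox M' = outbox M @ concat (map (\<lambda>t. map (\<lambda>r. (r, bwd_hash (j * \<beta> + t))) [0..<m]) [0..<i]) \<and>
        memory M' = memory M1 \<and> extent M' \<le> max (extent M) (11 * B) \<and> regs M' 26 = off \<and>
        steps M' \<le> steps M1 + 5 + (30 * m + 10) * i" for i M'
    have body: "wp w (piece_hash ;; broadcast_piece)
        (\<lambda>M'. regs M' 20 = i \<and> J (Suc i) (tick (set_reg 20 (Suc i) M'))) (tick M')"
      if "J i M'" "i < \<beta>" "regs M' 20 = i" for i M'
    proof -
      have M': "frame M M'" "memory M' = memory M1" "regs M' 26 = off"
        "outbox M' = outbox M @ concat (map (\<lambda>t. map (\<lambda>r. (r, bwd_hash (j * \<beta> + t))) [0..<m]) [0..<i])"
        "extent M' \<le> max (extent M) (11 * B)" "steps M' \<le> steps M1 + 5 + (30 * m + 10) * i"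
        using that(1) by (simp_all add: J_def)
      have tk: "frame M (tick M')"
        using M'(1) by (simp add: frame_def machine_defs)
      have hb: "hbase j (tick M')"
        by (rule hbase_frame[OF tk b(1)])
      have tk2: "regs (tick M') 26 = off" "regs (tick M') 20 = i"
        "\<And>u. lo j + u < (j + 5) * B \<Longrightarrow> memory (tick M') u = Sp (lo j + u)"
        using M' that M1 win window_less by (simp_all add: machine_defs)
      have fin: "wp w broadcast_piece (\<lambda>M'. regs M' 20 = i \<and> J (Suc i) (tick (set_reg 20 (Suc i) M'))) M2"
        if M2: "frame (tick M') M2" "outbox M2 = outbox (tick M')" "memory M2 = memory (tick M')"
          "extent M2 \<le> max (extent (tick M')) (9 * B)" "regs M2 20 = i" "regs M2 21 = bwd_hash (j * \<beta> + i)"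
          "regs M2 26 = off" "steps M2 \<le> steps (tick M') + 20 * m" for M2
      proof -
        have fr2: "frame M M2"
          by (rule frame_trans[OF tk M2(1)])
        have m2: "regs M2 2 = m"
          using hbaseD[OF hbase_frame[OF fr2 b(1)]] by simp
        have post: "regs M3 20 = i \<and> J (Suc i) (tick (set_reg 20 (Suc i) M3))"
          if M3: "frame M2 M3" "outbox M3 = outbox M2 @ map (\<lambda>r. (r, bwd_hash (j * \<beta> + i))) [0..<m]"
            "memory M3 = memory M2" "extent M3 = extent M2" "regs M3 20 = regs M2 20" "regs M3 26 = regs M2 26"
            "steps M3 \<le> steps M2 + 10 * m" for M3
        proof -
          have fr3: "frame M M3"
            by (rule frame_trans[OF fr2 M3(1)])
          have st: "steps M3 \<le> steps M1 + 5 + (30 * m + 10) * i + 1 + 30 * m"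
            using M3(7) M2(8) M'(6) by (simp add: machine_defs)
          have ex: "extent M3 \<le> max (extent M) (11 * B)"
            using M3(4) M2(4) M'(5) by (simp add: machine_defs)
          show ?thesis
            using M3(2,3,5,6) M2(2,3,5,7) M'(2,4) fr3 st ex
            by (simp add: J_def machine_defs frame_def)
        qed
        show ?thesis
          by (rule wp_broadcast_piece[OF m2 M2(6)]) (rule post)
      qed
      show ?thesis
        unfolding wp.simps(9)
        by (rule wp_piece_hash[OF hb tk2(1) off tk2(2) that(2) tk2(3)], assumption) (rule fin)
    qed
    have bB: "\<beta> \<le> B" "(30 * m + 10) * \<beta> = 30 * B + 10 * \<beta>"
      using m by (simp_all add: B_def algebra_simps)
    have "wp w (For 20 (Reg 6) (piece_hash ;; broadcast_piece)) Q (tick (set_reg 26 off M1))"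
    proof (rule wp_For[where N = \<beta> and J = J])
      show "\<beta> < word_bound w"
        using bB small' by linarith
      show "J 0 (tick (set_reg 20 0 (tick (set_reg 26 off M1))))"
        using M1(1,2,6) by (simp add: J_def machine_defs frame_def)
      show "eval w (Reg 6) M' = \<beta>" if "J i M'" for i M'
        using hbaseD[OF hbase_frame[OF _ b(1)], of M'] that by (simp add: J_def eval_rules)
      show "Q (tick M')" if "J \<beta> M'" for M'
        by (rule Q) (use that M1 bB B_pos in \<open>auto simp: J_def machine_defs frame_def\<close>)
    qed (rule body)
    then show ?thesis
      using hbaseD[OF hb1] lt off_eq[OF b(2)] by (simp add: eval_rules off_def del: wsub_eq)
  qed
  show ?thesis
    unfolding piece_round_def wp.simps(9)[where p = store_class]
    by (rule wp_store_class[OF bj inw]) (rule main)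
qed

lemma wp_broadcast_query:
  assumes b: "regs M 2 = m" "regs M 14 = s"
    and Q: "\<And>M'. frame M M' \<Longrightarrow> outbox M' = outbox M @ map (\<lambda>r. (r, s)) [0..<m] \<Longrightarrow> memory M' = memory M \<Longrightarrow>
      extent M' = extent M \<Longrightarrow> steps M' \<le> steps M + 10 * B \<Longrightarrow> Q M'"
  shows "wp w broadcast_query Q M"
proof -
  define J where "J i M' \<longleftrightarrow> frame M M' \<and> outbox M' = outbox M @ map (\<lambda>r. (r, s)) [0..<i] \<and>
      memory M' = memory M \<and> extent M' = extent M \<and> steps M' \<le> steps M + 3 + 4 * i" for i M'
  show ?thesis
    unfolding broadcast_query_def
  proof (rule wp_For[where N = m and J = J], goal_cases)
    case 1 show ?case using small' by linarith
  next
    case 2 show ?case by (simp add: J_def machine_defs frame_def)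
  next
    case (3 i M')
    then show ?case using b frameD[of M M'] by (simp add: J_def eval_rules)
  next
    case (4 i M')
    then have "frame M M'" by (simp add: J_def)
    from frameD(15)[OF this] 4 show ?case using b by (simp add: J_def machine_defs eval_rules frame_def)
  next
    case (5 M')
    then show ?case using B_pos m_le_B by (intro Q) (auto simp: J_def machine_defs frame_def)
  qed
qed

lemma wp_store_pieces:
  assumes b: "base j M" and inw: "length (inwords M) = B"
    and Q: "\<And>M'. frame M M' \<Longrightarrow> outbox M' = outbox M \<Longrightarrow> (\<And>a. a < 11 * B \<Longrightarrow> memory M' a = memory M a) \<Longrightarrow>
      (\<And>u. u < B \<Longrightarrow> memory M' (11 * B + u) = inwords M ! u) \<Longrightarrow>
      extent M' \<le> max (extent M) (12 * B) \<Longrightarrow> steps M' \<le> steps M + 10 * B \<Longrightarrow> Q M'"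
  shows "wp w store_pieces Q M"
proof -
  define J where "J i M' \<longleftrightarrow> frame M M' \<and> outbox M' = outbox M \<and> (\<forall>a < 11 * B. memory M' a = memory M a) \<and>
      (\<forall>u<i. memory M' (11 * B + u) = inwords M ! u) \<and>
      extent M' \<le> max (extent M) (12 * B) \<and> steps M' \<le> steps M + 2 + 5 * i" for i M'
  show ?thesis
    unfolding store_pieces_def
  proof (rule wp_For[where N = B and J = J], goal_cases)
    case 1 show ?case using small' by linarith
  next
    case 2 show ?case by (simp add: J_def machine_defs frame_def)
  next
    case (3 i M')
    then show ?case using b frameD[of M M'] by (simp add: J_def eval_rules base_def)
  next
    case (4 i M')
    then have fr: "frame M M'" by (simp add: J_def)
    have r: "regs M' 5 = B" "inwords M' = inwords M"
      using b frameD[OF fr] by (auto simp: base_def)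
    have x: "Suc (11 * B + i) \<le> max (extent M) (12 * B)"
      using 4 by auto
    show ?case
      using r 4(2,3) small' inw
      apply (simp add: eval_rules machine_defs)
      using 4(1) x apply (auto simp: J_def frame_def less_Suc_eq)
      done
  next
    case (5 M')
    then show ?case using B_pos by (intro Q) (auto simp: J_def machine_defs frame_def)
  qed
qed

end


text \<open>Touching the right end counts only if the string continues there, touching the left end
  only if the window does not start at position 0. A palindrome with relative center
  \<open>t\<close> starts at the left end iff its exclusive end is \<open>t + 1\<close>.\<close>

definition long_expr :: expr where
  "long_expr =
     ((Reg 22 =\<^sub>e Reg 18 &\<^sub>e Reg 7 +\<^sub>e Reg 18 <\<^sub>e Reg 0) |\<^sub>e
      (Reg 22 =\<^sub>e Reg 23 +\<^sub>e Const 1 &\<^sub>e Const 0 <\<^sub>e Reg 7))"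

context hashed
begin

definition wlen :: "nat \<Rightarrow> nat" where
  "wlen j = min n ((j + 5) * B) - lo j"

definition win :: "nat \<Rightarrow> nat list" where
  "win j = take (wlen j) (drop (lo j) S)"

definition wend :: "nat \<Rightarrow> nat \<Rightarrow> nat" where
  "wend j s = pal_end (win j) (s - 2 * lo j)"

definition long :: "nat \<Rightarrow> nat \<Rightarrow> bool" where
  "long j s \<longleftrightarrow> wend j s = wlen j \<and> lo j + wlen j < n \<or> wend j s = s - 2 * lo j + 1 \<and> 0 < lo j"

text \<open>The second argument is the number of sums visited so far, so that the list can serve in
  a loop invariant.\<close>

definition longs :: "nat \<Rightarrow> nat \<Rightarrow> nat list" where
  "longs j i = filter (\<lambda>s. s + 1 < 2 * n \<and> long j s) [2 * (j * B)..<2 * (j * B) + i]"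

definition lim :: "nat \<Rightarrow> nat" where
  "lim s = min (n div m) ((s + 1) div m)"

definition stop :: "nat \<Rightarrow> nat \<Rightarrow> bool" where
  "stop s k \<longleftrightarrow> \<not> k < lim s \<or> bwd_hash k \<noteq> fwd_hash (s + 1 - (k + 1) * m)"

definition loc :: "nat \<Rightarrow> nat" where
  "loc s = first (stop s) (s div (2 * m) + 1)"

text \<open>Describes the answer to a query whether or not hash values collide, so that machine
  states can be specified for every draw; \<open>far_end_correct\<close> relates it to palindromes.
  Beyond the start of the located piece at most \<open>m\<close> letters are compared.\<close>

definition far_end :: "nat \<Rightarrow> nat" where
  "far_end s = first (\<lambda>x. loc s * m + m \<le> x \<or> n \<le> x \<or> s < x \<or> Sp x \<noteq> Sp (s - x)) (loc s * m)"

lemma length_win: "length (win j) = wlen j"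
  using n by (simp add: win_def wlen_def)

lemma wlen_le: "j < m \<Longrightarrow> wlen j \<le> 9 * B"
  using lo_le(2)[of j] by (simp add: wlen_def algebra_simps)

lemma center_window:
  assumes "i < 2 * B" "2 * (j * B) + i + 1 < 2 * n"
  shows "2 * lo j \<le> 2 * (j * B) + i" "2 * (j * B) + i - 2 * lo j < 2 * wlen j - 1"
    "2 * (j * B) + i + 1 - 2 * lo j < 2 * wlen j"
  using assms lo_le(1)[of j] by (auto simp: wlen_def min_def algebra_simps)

lemma wp_visit:
  assumes j: "j < m" and N: "\<And>i M. J i M \<Longrightarrow> hbase j M"
    and mem: "\<And>i M t. J i M \<Longrightarrow> t < 2 * wlen j - 1 \<Longrightarrow> memory M (12 * B + t) = pal_end (win j) t"
    and init: "J 0 (tick (set_reg 20 0 M))"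
    and skip: "\<And>i M'. J i M' \<Longrightarrow> i < 2 * B \<Longrightarrow> regs M' 20 = i \<Longrightarrow> \<not> 2 * (j * B) + i + 1 < 2 * n \<Longrightarrow>
      J (Suc i) (M'\<lparr>regs := (regs M')(21 := 2 * (j * B) + i, 20 := Suc i), steps := Suc (Suc (Suc (Suc (Suc (steps M')))))\<rparr>)"
    and body: "\<And>i M'. J i M' \<Longrightarrow> i < 2 * B \<Longrightarrow> regs M' 20 = i \<Longrightarrow> 2 * (j * B) + i + 1 < 2 * n \<Longrightarrow>
      wp w p (\<lambda>M'. regs M' 20 = i \<and> J (Suc i) (tick (set_reg 20 (Suc i) M')))
        (M'\<lparr>regs := (regs M')(21 := 2 * (j * B) + i, 23 := 2 * (j * B) + i - 2 * lo j, 22 := wend j (2 * (j * B) + i)),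
            extent := max (extent M') (Suc (12 * B + (2 * (j * B) + i - 2 * lo j))), steps := Suc (Suc (Suc (Suc (Suc (steps M')))))\<rparr>)"
    and exit: "\<And>M'. J (2 * B) M' \<Longrightarrow> Q (tick M')"
  shows "wp w (visit p) Q M"
  unfolding visit_def
proof (rule wp_For[where N = "2 * B" and J = J], goal_cases)
  case 1 show ?case using small' by linarith
next
  case 2 show ?case by (rule init)
next
  case (3 i M')
  then show ?case using hbaseD[OF N] small' by (simp add: eval_rules)
next
  case (4 i M')
  note r = hbaseD[OF N[OF 4(1)]]
  define s where "s = 2 * (j * B) + i"
  have jB: "j * B + B \<le> m * B"
    by (rule block_le[OF j])
  have lt: "j * B < word_bound w" "2 * (j * B) < word_bound w" "s < word_bound w" "Suc s < word_bound w" "2 * n < word_bound w"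
    "2 < word_bound w" "1 < word_bound w" "12 < word_bound w" "12 * B < word_bound w" "2 * lo j < word_bound w"
    using jB small' 4(2) lo_le(1)[of j] by (auto simp: s_def)
  have ev: "eval w (Const 2 *\<^sub>e (Reg 3 *\<^sub>e Reg 5) +\<^sub>e Reg 20) M2 = s"
    if "regs M2 3 = j" "regs M2 5 = B" "regs M2 20 = i" for M2
    using lt that by (simp add: eval_rules s_def)
  have ev2: "eval w (Reg 21 +\<^sub>e Const 1 <\<^sub>e Const 2 *\<^sub>e Reg 0) M2 = (if s + 1 < 2 * n then 1 else 0)"
    if "regs M2 21 = s" "regs M2 0 = n" for M2
    using lt that by (simp add: eval_rules)
  show ?case
  proof (cases "s + 1 < 2 * n")
    case True
    have c: "2 * lo j \<le> s" "s - 2 * lo j < 2 * wlen j - 1"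
      using center_window[of i j] 4(2) True by (auto simp: s_def)
    have x: "memory M' (12 * B + (s - 2 * lo j)) = wend j s"
      unfolding wend_def by (rule mem[OF 4(1) c(2)])
    have ev3: "eval w (Reg 21 -\<^sub>e Const 2 *\<^sub>e Reg 7) M2 = s - 2 * lo j" if "regs M2 21 = s" "regs M2 7 = lo j" for M2
      using lt that c by (simp add: eval_rules)
    define t where "t = s - 2 * lo j"
    have ev4: "eval w (Const 12 *\<^sub>e Reg 5 +\<^sub>e Reg 23) M2 = 12 * B + t" if "regs M2 5 = B" "regs M2 23 = t" for M2
    proof -
      have "12 * B + t < word_bound w"
        using c wlen_le[OF j] small' by (simp add: t_def)
      then show ?thesis using lt that by (simp add: eval_rules)
    qed
    note b = body[OF 4(1-3), unfolded s_def[symmetric], OF True, folded t_def]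
    show ?thesis
      using r 4(3) True b x[folded t_def]
      by (simp add: ev ev2[unfolded One_nat_def] ev3[folded t_def] ev4 machine_defs)
  next
    case False
    note b = skip[OF 4(1-3), folded s_def, OF False]
    show ?thesis
      using r 4(3) False b
      by (simp add: ev ev2[unfolded One_nat_def] machine_defs fun_upd_twist)
  qed
next
  case (5 M')
  then show ?case by (rule exit)
qed

lemma eval_long_expr:
  assumes "hbase j M" "regs M 18 = wlen j" "regs M 22 = wend j s" "regs M 23 = s - 2 * lo j" "j < m" "s < 4 * (m * B)"
  shows "eval w long_expr M = (if long j s then 1 else 0)"
proof -
  have "lo j + wlen j < word_bound w" "s - 2 * lo j + 1 < word_bound w" "1 < word_bound w"
    using lo_le(1)[of j] block_le[OF assms(5)] wlen_le[OF assms(5)] small' assms(6) B_le by linarith+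
  then show ?thesis
    using assms hbaseD[OF assms(1)]
    by (simp add: long_expr_def eval_rules and_indicators or_indicators long_def)
qed

lemma wp_locate:
  assumes b: "hbase j M" and s: "regs M 21 = s" "s + 1 < 2 * n" "(s + 1) mod m = j"
    and mem: "\<And>u. u < B \<Longrightarrow> memory M (11 * B + u) = bwd_hash u"
      "\<And>u. u < B \<Longrightarrow> memory M (10 * B + u) = fwd_hash (j + u * m)"
    and Q: "\<And>M'. frame M M' \<Longrightarrow> outbox M' = outbox M \<Longrightarrow> memory M' = memory M \<Longrightarrow>
      extent M' \<le> max (extent M) (12 * B) \<Longrightarrow> regs M' 20 = regs M 20 \<Longrightarrow> regs M' 22 = loc s \<Longrightarrow>
      steps M' \<le> steps M + 30 * B + 20 \<Longrightarrow> Q M'"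
  shows "wp w locate Q M"
proof -
  define a where "a = s div (2 * m) + 1"
  define k0 where "k0 = (s + 1) div m"
  note r = hbaseD[OF b]
  have nB: "n div m \<le> B"
    using m div_le_mono[OF m(3), of m] by simp
  have limB: "lim s \<le> B"
    using nB by (simp add: lim_def)
  have as: "a \<le> s + 1" "k0 \<le> s + 1"
    unfolding a_def k0_def using div_le_dividend[of s "2 * m"] div_le_dividend[of "s+1" m] by linarith+
  have bd: "n div m \<le> n" by simp
  have lt: "s + 1 < word_bound w" "2 * m < word_bound w" "2 < word_bound w" "1 < word_bound w" "a < word_bound w"
    using small' s(2) as by linarith+
  then have lt': "s div (2 * m) + 1 < word_bound w"
    by (simp add: a_def)
  \<comment> \<open>The right piece lies beyond the center, so the left one starts at or before the
    center and hence below \<open>n\<close>; its index in the residue class is therefore within the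
    stored table.\<close>
  have idx: "k0 - (k + 1) < B" "j + (k0 - (k + 1)) * m = s + 1 - (k + 1) * m" "k + 1 \<le> k0" if "a \<le> k" "k < lim s" for k
  proof -
    show kk: "k + 1 \<le> k0"
      using that by (simp add: lim_def k0_def)
    have k0m: "s + 1 = j + k0 * m"
      using s(3) by (metis k0_def add.commute mod_mult_div_eq mult.commute)
    have "(k + 1) * m \<le> k0 * m"
      using kk by (rule mult_le_mono1)
    then show e: "j + (k0 - (k + 1)) * m = s + 1 - (k + 1) * m"
      unfolding k0m diff_mult_distrib by simp
    have "s < (s div (2 * m) + 1) * (2 * m)"
      using m by (simp add: dividend_less_div_times)
    also have "\<dots> \<le> k * (2 * m)"
      using that(1) unfolding a_def by (rule mult_le_mono1)
    finally have "s + 1 - (k + 1) * m < n"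
      using s(2) m by (simp add: algebra_simps)
    then have "j + (k0 - (k + 1)) * m < B * m"
      unfolding e using m(3) by (simp only: mult.commute[of B])
    then have "(k0 - (k + 1)) * m < B * m"
      by linarith
    then show "k0 - (k + 1) < B"
      by simp
  qed
  \<comment> \<open>The first piece may already lie beyond the limit, hence the alternative for
    register 22. The multiple of register 25 in the step bound pays for the last, unsuccessful
    iteration.\<close>
  define cond where "cond M' \<longleftrightarrow> frame M M' \<and> outbox M' = outbox M \<and> memory M' = memory M \<and> regs M' 20 = regs M 20 \<and>
     regs M' 23 = k0 \<and> regs M' 24 = lim s \<and> regs M' 25 \<le> 1 \<and> a \<le> regs M' 22 \<and>
     (\<forall>k. a \<le> k \<and> k < regs M' 22 \<longrightarrow> \<not> stop s k) \<and> (regs M' 25 = 0 \<longrightarrow> stop s (regs M' 22)) \<and>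
     extent M' \<le> max (extent M) (12 * B) \<and> (regs M' 22 = a \<or> regs M' 22 \<le> lim s) \<and>
     steps M' + 8 * a + 7 * regs M' 25 \<le> steps M + 20 + 8 * regs M' 22" for M'
  have loop: "wp w locate_loop Q M1" if "cond M1" for M1
    unfolding locate_loop_def
  proof (rule wp_While[where Inv = cond and \<mu> = "\<lambda>M. regs M 25 + (lim s - regs M 22)"])
    show "cond M1" by (rule that)
    show "wp w (If (Reg 22 <\<^sub>e Reg 24)
           (Load 26 (Const 11 *\<^sub>e Reg 5 +\<^sub>e Reg 22) ;;
            Load 27 (Const 10 *\<^sub>e Reg 5 +\<^sub>e (Reg 23 -\<^sub>e (Reg 22 +\<^sub>e Const 1))) ;;
            If (Reg 26 =\<^sub>e Reg 27) (Assign 22 (Reg 22 +\<^sub>e Const 1)) (Assign 25 (Const 0)))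
           (Assign 25 (Const 0)))
        (\<lambda>Ma. cond Ma \<and> regs Ma 25 + (lim s - regs Ma 22) < regs M' 25 + (lim s - regs M' 22)) (tick M')"
      if c: "cond M'" and e: "eval w (Reg 25) M' \<noteq> 0" for M'
    proof -
      have M': "frame M M'" "outbox M' = outbox M" "memory M' = memory M" "regs M' 20 = regs M 20"
        "regs M' 23 = k0" "regs M' 24 = lim s" "regs M' 25 = 1" "a \<le> regs M' 22"
        "\<And>k. a \<le> k \<Longrightarrow> k < regs M' 22 \<Longrightarrow> \<not> stop s k"
        "extent M' \<le> max (extent M) (12 * B)" "(regs M' 22 = a \<or> regs M' 22 \<le> lim s)"
        "steps M' + 8 * a + 7 \<le> steps M + 20 + 8 * regs M' 22"
        using c e by (auto simp: cond_def eval_rules)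
      define k where "k = regs M' 22"
      note rr = hbaseD[OF hbase_frame[OF M'(1) b]]
      show ?thesis
      proof (cases "k < lim s")
        case True
        have i: "k0 - (k + 1) < B" "j + (k0 - (k + 1)) * m = s + 1 - (k + 1) * m" "k + 1 \<le> k0"
          by (rule idx; use True M'(8) k_def in simp)+
        define u where "u = k0 - (k + 1)"
        have kB: "k < B" using True limB by simp
        have e1: "eval w (Const 11 *\<^sub>e Reg 5 +\<^sub>e Reg 22) M2 = 11 * B + k" if "regs M2 22 = k" "regs M2 5 = B" for M2
          using that small' kB by (simp add: eval_rules)
        have e2: "eval w (Const 10 *\<^sub>e Reg 5 +\<^sub>e (Reg 23 -\<^sub>e (Reg 22 +\<^sub>e Const 1))) M2 = 10 * B + u"
          if "regs M2 22 = k" "regs M2 5 = B" "regs M2 23 = k0" for M2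
        proof -
          have "k0 < word_bound w" "k + 1 < word_bound w" "10 * B + u < word_bound w"
            using as lt small' kB i(1) by (auto simp: u_def)
          moreover from this have "wsub w k0 (Suc k) = u"
            using i(3) by (simp add: u_def)
          ultimately show ?thesis
            using that small' by (simp add: eval_rules del: wsub_eq)
        qed
        have m1: "memory M' (11 * B + k) = bwd_hash k" "memory M' (10 * B + u) = fwd_hash (s + 1 - (k + 1) * m)"
          using M'(3) mem kB i(1,2) by (simp_all add: u_def)
        have st: "stop s k \<longleftrightarrow> bwd_hash k \<noteq> fwd_hash (s + 1 - (k + 1) * m)"
          using True by (simp add: stop_def)
        have ex: "extent M' \<le> max (extent M) (12 * B)" "Suc (11 * B + k) \<le> max (extent M) (12 * B)" "Suc (10 * B + u) \<le> max (extent M) (12 * B)"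
          using M' kB i(1) by (auto simp: u_def)
        have w1: "eval w (Reg 22 +\<^sub>e Const 1) M2 = k + 1" if "regs M2 22 = k" for M2
          using that small' kB by (simp add: eval_rules)
        have pr: "\<And>k'. a \<le> k' \<Longrightarrow> k' < Suc k \<Longrightarrow> \<not> stop s k" if "\<not> stop s k"
          using that by blast
        show ?thesis
        proof (cases "stop s k")
          case ST: True
          show ?thesis
            using rr(5) M'(5,6) True ST st m1
            apply (simp add: eval_rules(2,11,12) e1 e2[unfolded One_nat_def] k_def[symmetric] machine_defs)
            using M' ex ST apply (simp add: cond_def frame_def eval_rules k_def[symmetric])
            done
        next
          case ST: False
          have a1: "\<And>k'. a \<le> k' \<Longrightarrow> k' < Suc k \<Longrightarrow> \<not> stop s k'"
            using ST M'(9) by (auto simp: k_def less_Suc_eq)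
          show ?thesis
            using rr(5) M'(5,6) True ST st m1
            apply (simp add: eval_rules(2,11,12) e1 e2[unfolded One_nat_def] w1[unfolded One_nat_def] k_def[symmetric] machine_defs)
            using M' ex ST True a1 apply (simp add: cond_def frame_def eval_rules k_def[symmetric])
            done
        qed
      next
        case False
        then have "stop s k" by (simp add: stop_def)
        with False show ?thesis
          using M'(6)
          apply (simp add: eval_rules(1,2,11) k_def[symmetric] machine_defs)
          using M' apply (simp add: cond_def frame_def k_def[symmetric])
          done
      qed
    qed
    show "Q (tick M')" if c: "cond M'" and e: "eval w (Reg 25) M' = 0" for M'
    proof -
      have M': "frame M M'" "outbox M' = outbox M" "memory M' = memory M" "regs M' 20 = regs M 20"
        "a \<le> regs M' 22" "\<And>k. a \<le> k \<Longrightarrow> k < regs M' 22 \<Longrightarrow> \<not> stop s k" "stop s (regs M' 22)"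
        "extent M' \<le> max (extent M) (12 * B)" "(regs M' 22 = a \<or> regs M' 22 \<le> lim s)"
        "steps M' + 8 * a \<le> steps M + 20 + 8 * regs M' 22"
        using c e by (auto simp: cond_def eval_rules)
      have "loc s = regs M' 22"
        unfolding loc_def a_def[symmetric] by (rule first_eqI) (use M' in auto)
      moreover have "steps M' + 1 \<le> steps M + 30 * B + 20"
        using M'(9,10) limB B_pos by auto
      ultimately show ?thesis
        by (intro Q) (use M' in \<open>auto simp: machine_defs frame_def\<close>)
    qed
  qed
  have e: "eval w (Reg 21 div\<^sub>e (Const 2 *\<^sub>e Reg 2) +\<^sub>e Const 1) M = a"
    "\<And>M2. regs M2 21 = s \<Longrightarrow> regs M2 2 = m \<Longrightarrow> eval w ((Reg 21 +\<^sub>e Const 1) div\<^sub>e Reg 2) M2 = k0"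
    "\<And>M2. regs M2 2 = m \<Longrightarrow> regs M2 0 = n \<Longrightarrow> eval w (Reg 0 div\<^sub>e Reg 2) M2 = n div m"
    using r s lt lt' by (simp_all add: eval_rules a_def k0_def)
  have W1: "word_bound w \<noteq> Suc 0"
    using small' by simp
  show ?thesis
    unfolding locate_def using r s(1)
    apply (simp add: e[unfolded One_nat_def] eval_rules(1,2,11) machine_defs lt[simplified] W1)
    apply (intro conjI impI; rule loop)
    by (auto simp: cond_def frame_def lim_def k0_def min_def)
qed

end


section \<open>Programs of the local, resolving and final rounds\<close>

definition window_length :: program where
  "window_length =
     (Assign 25 ((Reg 3 +\<^sub>e Const 5) *\<^sub>e Reg 5) ;;
      If (Reg 0 <\<^sub>e Reg 25) (Assign 25 (Reg 0)) Skip ;;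
      If (Reg 7 <\<^sub>e Reg 25) (Assign 18 (Reg 25 -\<^sub>e Reg 7)) (Assign 18 (Const 0)))"

text \<open>Only the extreme long centers are remembered, in registers 28 and 29; register 27 tells
  whether one has been seen.\<close>

definition note_long :: program where
  "note_long =
     If long_expr
       (If (Reg 27 =\<^sub>e Const 0) (Assign 28 (Reg 21) ;; Assign 27 (Const 1)) Skip ;; Assign 29 (Reg 21))
       Skip"

definition scan :: program where
  "scan = (Assign 27 (Const 0) ;; Assign 28 (Const 0) ;; Assign 29 (Const 0) ;; visit note_long)"

definition local_round :: program where
  "local_round =
     (store_pieces ;; window_length ;; manacher ;; scan ;;
      Assign 12 (Reg 28) ;; Assign 13 (Reg 29) ;; Assign 14 (Reg 12) ;;
      broadcast_query)"

definition first_round :: program where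
  "first_round = (resolve ;; Assign 16 (Reg 21) ;; Assign 14 (Reg 13) ;; broadcast_query)"

text \<open>Register 19 is the presumed center of the periodic run. Unless it lies strictly between
  the first and the last long center there is nothing to ask, and the valid center 0 is broadcast
  instead.\<close>

definition second_round :: program where
  "second_round =
     (resolve ;; Assign 17 (Reg 21) ;; Assign 19 (Reg 12 +\<^sub>e Reg 17 -\<^sub>e Reg 16) ;;
      If (Reg 12 <\<^sub>e Reg 19 &\<^sub>e Reg 19 <\<^sub>e Reg 13) (Assign 14 (Reg 19)) (Assign 14 (Const 0)) ;;
      broadcast_query)"

definition choose_end :: program where
  "choose_end =
     If long_expr
        (If (Reg 21 =\<^sub>e Reg 12) (Assign 22 (Reg 16))
          (If (Reg 21 =\<^sub>e Reg 13) (Assign 22 (Reg 17))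
            (If (Reg 21 =\<^sub>e Reg 19) (Assign 22 (Reg 30))
              (Assign 22 (Reg 21 +\<^sub>e Reg 16 -\<^sub>e Reg 12) ;;
               If (Reg 17 <\<^sub>e Reg 22) (Assign 22 (Reg 17)) Skip))))
        (Assign 22 (Reg 22 +\<^sub>e Reg 7))"

definition emit :: program where
  "emit =
     (choose_end ;;
      If (Reg 21 +\<^sub>e Const 1 <\<^sub>e Reg 22 +\<^sub>e Reg 22)
        (Output (Reg 21 +\<^sub>e Const 1 -\<^sub>e Reg 22) (Reg 22 -\<^sub>e Const 1)) Skip)"

definition last_round :: program where
  "last_round = (resolve ;; Assign 30 (Reg 21) ;; visit emit ;; Finish)"

context hashed
begin

lemma loc_bounds:
  assumes "s + 1 < 2 * n"
  shows "s div (2 * m) + 1 \<le> loc s" "stop s (loc s)" "loc s \<le> B + 1" "loc s * m \<le> m * B + m"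
    "\<And>k. s div (2 * m) + 1 \<le> k \<Longrightarrow> k < loc s \<Longrightarrow> \<not> stop s k"
proof -
  have "n div m \<le> B"
    using m div_le_mono[OF m(3), of m] by simp
  then have l: "lim s \<le> B" by (simp add: lim_def)
  have "s div (2 * m) \<le> (2 * n) div (2 * m)"
    by (rule div_le_mono) (use assms in simp)
  also have "\<dots> = n div m" by simp
  finally have a: "s div (2 * m) + 1 \<le> B + 1" using \<open>n div m \<le> B\<close> by simp
  have st: "stop s (B + 1)" using l by (simp add: stop_def)
  show "s div (2 * m) + 1 \<le> loc s" "stop s (loc s)" "loc s \<le> B + 1"
    "\<And>k. s div (2 * m) + 1 \<le> k \<Longrightarrow> k < loc s \<Longrightarrow> \<not> stop s k"
    unfolding loc_def using first_props[of "stop s" "B + 1", OF st a] by blast+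
  then show "loc s * m \<le> m * B + m"
    using mult_le_mono1[of "loc s" "B + 1" m] by (simp add: algebra_simps)
qed

text \<open>One machine may have to answer all \<open>m\<close> queries, so its time is not linear
  in \<open>B\<close>. The cost is charged per query instead; every query has a single answering
  machine, which bounds the sum over the machines.\<close>

lemma wp_answer_round:
  assumes b: "hbase j M" and j: "j < m"
    and qs: "length (inwords M) = m" "\<And>i. i < m \<Longrightarrow> inwords M ! i = qs i" "\<And>i. i < m \<Longrightarrow> qs i + 1 < 2 * n"
    and mem: "\<And>u. u < B \<Longrightarrow> memory M (11 * B + u) = bwd_hash u"
      "\<And>u. u < B \<Longrightarrow> memory M (10 * B + u) = fwd_hash (j + u * m)"
    and Q: "\<And>M'. frame M M' \<Longrightarrow>
      outbox M' = outbox M @ map (\<lambda>i. (i, if (qs i + 1) mod m = j then loc (qs i) else 0)) [0..<m] \<Longrightarrow>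
      memory M' = memory M \<Longrightarrow> extent M' \<le> max (extent M) (12 * B) \<Longrightarrow>
      steps M' \<le> steps M + 30 * B + 60 * B * card {i. i < m \<and> (qs i + 1) mod m = j} \<Longrightarrow> Q M'"
  shows "wp w answer_round Q M"
proof -
  define C where "C i = card {i'. i' < i \<and> (qs i' + 1) mod m = j}" for i
  have C0: "C 0 = 0" by (simp add: C_def)
  have CS: "C (Suc i) = (if (qs i + 1) mod m = j then Suc (C i) else C i)" for i
  proof -
    have "{i'. i' < Suc i \<and> (qs i' + 1) mod m = j} =
       (if (qs i + 1) mod m = j then insert i {i'. i' < i \<and> (qs i' + 1) mod m = j} else {i'. i' < i \<and> (qs i' + 1) mod m = j})"
      by (auto simp: less_Suc_eq)
    then show ?thesis by (auto simp: C_def)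
  qed
  define J where "J i M' \<longleftrightarrow> frame M M' \<and>
      outbox M' = outbox M @ map (\<lambda>i. (i, if (qs i + 1) mod m = j then loc (qs i) else 0)) [0..<i] \<and>
      memory M' = memory M \<and> extent M' \<le> max (extent M) (12 * B) \<and>
      steps M' \<le> steps M + 2 + 10 * i + 60 * B * C i" for i M'
  show ?thesis
    unfolding answer_round_def
  proof (rule wp_For[where N = m and J = J], goal_cases)
    case 1 show ?case using small' by linarith
  next
    case 2 show ?case by (simp add: J_def machine_defs frame_def C0)
  next
    case (3 i M')
    then show ?case using hbaseD[OF hbase_frame[OF _ b], of M'] by (simp add: J_def eval_rules)
  next
    case (4 i M')
    then have M': "frame M M'" "outbox M' = outbox M @ map (\<lambda>i. (i, if (qs i + 1) mod m = j then loc (qs i) else 0)) [0..<i]"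
      "memory M' = memory M" "extent M' \<le> max (extent M) (12 * B)" "steps M' \<le> steps M + 2 + 10 * i + 60 * B * C i"
      by (simp_all add: J_def)
    note r = hbaseD[OF hbase_frame[OF M'(1) b]]
    have iw: "inwords M' = inwords M" using frameD[OF M'(1)] by simp
    have ev: "eval w (Inbox_Word (Reg 20)) M2 = qs i" if "regs M2 20 = i" "inwords M2 = inwords M'" for M2
      using that 4(2) qs iw by (simp add: eval_rules)
    have q1: "Suc (qs i) < word_bound w" "Suc 0 < word_bound w" using qs(3)[OF 4(2)] small' by linarith+
    have ev2: "eval w ((Reg 21 +\<^sub>e Const 1) mod\<^sub>e Reg 2 =\<^sub>e Reg 3) M2 = (if (qs i + 1) mod m = j then 1 else 0)"
      if "regs M2 21 = qs i" "regs M2 2 = m" "regs M2 3 = j" for M2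
      using that q1 by (simp add: eval_rules)
    show ?case
    proof (cases "(qs i + 1) mod m = j")
      case True
      define M2 where "M2 = tick (tick (set_reg 21 (qs i) (tick M')))"
      have fr2: "frame M M2"
        using M'(1) by (simp add: M2_def frame_def machine_defs)
      have loc: "wp w locate (wp w (Send (Reg 20) (Reg 22)) (\<lambda>M'. regs M' 20 = i \<and> J (Suc i) (tick (set_reg 20 (Suc i) M')))) M2"
      proof (rule wp_locate[where j = j and s = "qs i"])
        show "hbase j M2" by (rule hbase_frame[OF fr2 b])
        show "regs M2 21 = qs i" by (simp add: M2_def machine_defs)
        show "memory M2 (11 * B + u) = bwd_hash u" "memory M2 (10 * B + u) = fwd_hash (j + u * m)" if "u < B" for u
          using mem[OF that] M'(3) by (simp_all add: M2_def machine_defs)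
        fix M3
        assume M3: "frame M2 M3" "outbox M3 = outbox M2" "memory M3 = memory M2" "extent M3 \<le> max (extent M2) (12 * B)"
          "regs M3 20 = regs M2 20" "regs M3 22 = loc (qs i)" "steps M3 \<le> steps M2 + 30 * B + 20"
        have "frame M M3" by (rule frame_trans[OF fr2 M3(1)])
        moreover have "steps M3 + 2 \<le> steps M + 2 + 10 * Suc i + 60 * B * Suc (C i)"
          using M3(7) M'(5) B_pos by (simp add: M2_def machine_defs)
        ultimately show "wp w (Send (Reg 20) (Reg 22)) (\<lambda>M'. regs M' 20 = i \<and> J (Suc i) (tick (set_reg 20 (Suc i) M'))) M3"
          using M3 M' 4(3) True by (simp add: J_def M2_def machine_defs frame_def eval_rules CS)
      qed (use True qs(3)[OF 4(2)] in auto)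
      show ?thesis
        using r 4(3) True loc[unfolded M2_def]
        by (simp add: ev ev2[unfolded One_nat_def] machine_defs)
    next
      case False
      show ?thesis
        using r 4(3) False
        apply (simp add: ev ev2[unfolded One_nat_def] machine_defs eval_rules(1,2))
        using M' apply (simp add: J_def frame_def CS)
        done
    qed
  next
    case (5 M')
    then show ?case using B_pos m_le_B by (intro Q) (auto simp: J_def machine_defs frame_def C_def)
  qed
qed

lemma wp_relay_round:
  assumes b: "hbase j M" and s: "regs M 14 = s" "s + 1 < 2 * n"
    and inw: "length (inwords M) = m" "inwords M ! ((s + 1) mod m) = k"
    and Q: "\<And>M'. regs M' = (regs M)(15 := k, 20 := m) \<Longrightarrow> hbase j M' \<Longrightarrow> inbox M' = inbox M \<Longrightarrow> outputs M' = outputs M \<Longrightarrow> finished M' = finished M \<Longrightarrow>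
      peak M' = peak M \<Longrightarrow> outbox M' = outbox M @ concat (map (\<lambda>r. [(r, s), (r, k)]) [0..<m]) \<Longrightarrow> memory M' = memory M \<Longrightarrow>
      extent M' = extent M \<Longrightarrow> steps M' \<le> steps M + 10 * B \<Longrightarrow> Q M'"
  shows "wp w relay_round Q M"
proof -
  define M1 where "M1 = tick (set_reg 15 k M)"
  define J where "J i M' \<longleftrightarrow> regs M' = (regs M)(15 := k, 20 := i) \<and> inbox M' = inbox M \<and> outputs M' = outputs M \<and>
      finished M' = finished M \<and> peak M' = peak M \<and>
      outbox M' = outbox M @ concat (map (\<lambda>r. [(r, s), (r, k)]) [0..<i]) \<and>
      memory M' = memory M \<and> extent M' = extent M \<and> steps M' \<le> steps M + 4 + 4 * i" for i and M' :: machine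
  note r = hbaseD[OF b]
  have "wp w (For 20 (Reg 2) (Send (Reg 20) (Reg 14) ;; Send (Reg 20) (Reg 15))) Q M1"
  proof (rule wp_For[where N = m and J = J], goal_cases)
    case 1 show ?case using small' by linarith
  next
    case 2 show ?case by (simp add: J_def machine_defs M1_def fun_upd_twist)
  next
    case (3 i M')
    then show ?case using r by (simp add: J_def eval_rules)
  next
    case (4 i M')
    then show ?case using s by (simp add: J_def machine_defs eval_rules)
  next
    case (5 M')
    then show ?case using B_pos m_le_B r by (intro Q) (auto simp: J_def machine_defs hbase_def base_def)
  qed
  moreover have "eval w (Inbox_Word ((Reg 14 +\<^sub>e Const 1) mod\<^sub>e Reg 2)) M = k"
  proof -
    have "s + 1 < word_bound w" "(s + 1) mod m < m" using s small' m by auto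
    then show ?thesis using s inw r by (simp add: eval_rules)
  qed
  ultimately show ?thesis
    unfolding relay_round_def by (simp add: M1_def)
qed

text \<open>In the nonzero case the position is the largest one congruent to \<open>j\<close> modulo
  \<open>m\<close> (for \<open>j < m\<close>) that does not exceed \<open>s - k * m\<close>, the
  last position of the mirrored piece.\<close>

definition mirror_letter :: "nat \<Rightarrow> nat \<Rightarrow> nat \<Rightarrow> nat" where
  "mirror_letter j s k = (if k * m + j \<le> s then Sp (j + (s - (k * m + j)) div m * m) else 0)"

lemma Sp_zero: "B \<le> u \<Longrightarrow> Sp (j + u * m) = 0"
proof -
  assume "B \<le> u"
  then have "m * B \<le> u * m" by (metis mult.commute mult_le_mono1)
  then have "\<not> j + u * m < n" using m by linarith
  then show ?thesis by (simp add: Sp_def)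
qed

lemma wp_letters_round:
  assumes b: "hbase j M" and j: "j < m"
    and inw: "length (inwords M) = 2 * m" "\<And>i. i < m \<Longrightarrow> inwords M ! (2 * i) = qs i" "\<And>i. i < m \<Longrightarrow> inwords M ! (2 * i + 1) = ks i"
      "\<And>i. i < m \<Longrightarrow> qs i + 1 < 2 * n" "\<And>i. i < m \<Longrightarrow> ks i \<le> B + 1"
    and mem: "\<And>u. u < B \<Longrightarrow> memory M (9 * B + u) = Sp (j + u * m)"
    and Q: "\<And>M'. frame M M' \<Longrightarrow>
      outbox M' = outbox M @ concat (map (\<lambda>i. [(i, Sp (j + ks i * m)), (i, mirror_letter j (qs i) (ks i))]) [0..<m]) \<Longrightarrow>
      memory M' = memory M \<Longrightarrow> extent M' \<le> max (extent M) (12 * B) \<Longrightarrow> steps M' \<le> steps M + 30 * B \<Longrightarrow> Q M'"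
  shows "wp w letters_round Q M"
proof -
  define J where "J i M' \<longleftrightarrow> frame M M' \<and>
      outbox M' = outbox M @ concat (map (\<lambda>i. [(i, Sp (j + ks i * m)), (i, mirror_letter j (qs i) (ks i))]) [0..<i]) \<and>
      memory M' = memory M \<and> extent M' \<le> max (extent M) (12 * B) \<and> steps M' \<le> steps M + 2 + 20 * i" for i M'
  show ?thesis
    unfolding letters_round_def
  proof (rule wp_For[where N = m and J = J], goal_cases)
    case 1 show ?case using small' by linarith
  next
    case 2 show ?case by (simp add: J_def machine_defs frame_def)
  next
    case (3 i M')
    then show ?case using hbaseD[OF hbase_frame[OF _ b], of M'] by (simp add: J_def eval_rules)
  next
    case (4 i M')
    then have M': "frame M M'" "outbox M' = outbox M @ concat (map (\<lambda>i. [(i, Sp (j + ks i * m)), (i, mirror_letter j (qs i) (ks i))]) [0..<i])"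
      "memory M' = memory M" "extent M' \<le> max (extent M) (12 * B)" "steps M' \<le> steps M + 2 + 20 * i"
      by (simp_all add: J_def)
    note r = hbaseD[OF hbase_frame[OF M'(1) b]]
    have iw: "inwords M' = inwords M" using frameD[OF M'(1)] by simp
    define s where "s = qs i"
    define k where "k = ks i"
    have sk: "s + 1 < 2 * n" "k \<le> B + 1" using inw 4(2) by (auto simp: s_def k_def)
    have km: "k * m \<le> m * B + m" using mult_le_mono1[OF sk(2), of m] by (simp add: algebra_simps)
    have ii: "2 * i < 2 * m" "Suc (2 * i) < 2 * m" "2 < word_bound w" "Suc 0 < word_bound w" "2 * i < word_bound w" "Suc (2 * i) < word_bound w"
      using 4(2) small' by auto
    have e1: "eval w (Inbox_Word (Const 2 *\<^sub>e Reg 20)) M2 = s" "eval w (Inbox_Word (Const 2 *\<^sub>e Reg 20 +\<^sub>e Const 1)) M2 = k"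
      if "regs M2 20 = i" "inwords M2 = inwords M'" for M2
      using that ii inw iw 4(2) by (simp_all add: eval_rules s_def k_def)
    define x where "x = s - (k * m + j)"
    define u where "u = x div m"
    have bnd: "k * m < word_bound w" "k * m + j < word_bound w" "s + 1 < word_bound w" "9 < word_bound w" "9 * B < word_bound w"
      "9 * B + k < word_bound w"
      using km sk j small' by linarith+
    have e2: "eval w (Reg 22 <\<^sub>e Reg 5) M2 = (if k < B then 1 else 0)" "eval w (Const 9 *\<^sub>e Reg 5 +\<^sub>e Reg 22) M2 = 9 * B + k"
      "eval w (Reg 22 *\<^sub>e Reg 2 +\<^sub>e Reg 3 <\<^sub>e Reg 21 +\<^sub>e Const 1) M2 = (if k * m + j \<le> s then 1 else 0)"
      "k * m + j \<le> s \<Longrightarrow> eval w ((Reg 21 -\<^sub>e (Reg 22 *\<^sub>e Reg 2 +\<^sub>e Reg 3)) div\<^sub>e Reg 2) M2 = u"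
      if "regs M2 22 = k" "regs M2 21 = s" "regs M2 5 = B" "regs M2 2 = m" "regs M2 3 = j" for M2
      using that bnd ii by (simp_all add: eval_rules less_Suc_eq_le u_def x_def)
    have e3: "eval w (Reg 24 <\<^sub>e Reg 5) M2 = (if u < B then 1 else 0)" "u < B \<Longrightarrow> eval w (Const 9 *\<^sub>e Reg 5 +\<^sub>e Reg 24) M2 = 9 * B + u"
      if "regs M2 24 = u" "regs M2 5 = B" for M2
      using that small' by (simp_all add: eval_rules)
    have e4: "eval w (Const 0) M2 = 0" "eval w (Reg y) M2 = regs M2 y" for M2 y
      by (simp_all add: eval_rules)
    have Sk: "Sp (j + k * m) = (if k < B then memory M' (9 * B + k) else 0)"
      using mem M'(3) Sp_zero by auto
    have Su: "mirror_letter j s k = (if k * m + j \<le> s then if u < B then memory M' (9 * B + u) else 0 else 0)"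
      using mem M'(3) Sp_zero by (auto simp: mirror_letter_def u_def x_def)
    define e where "e = max (extent M) (12 * B)"
    have e: "extent M' \<le> e" "k < B \<Longrightarrow> Suc (9 * B + k) \<le> e" "u < B \<Longrightarrow> Suc (9 * B + u) \<le> e"
      using M'(4) by (auto simp: e_def)
    have post: "regs M2 20 = i \<and> J (Suc i) (tick (set_reg 20 (Suc i) M2))"
      if "regs M2 20 = i" "frame M' M2" "memory M2 = memory M'" "extent M2 \<le> e"
        "outbox M2 = outbox M' @ [(i, Sp (j + k * m)), (i, mirror_letter j s k)]" "steps M2 \<le> steps M' + 18" for M2
      using that M' frame_trans[OF M'(1) that(2)] by (simp add: J_def machine_defs frame_def e_def s_def k_def)
    define R where "R = (\<lambda>M'. regs M' 20 = i \<and> J (Suc i) (tick (set_reg 20 (Suc i) M')))"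
    have Rp: "R M2" if "regs M2 20 = i" "frame M' M2" "memory M2 = memory M'" "extent M2 \<le> e"
        "outbox M2 = outbox M' @ [(i, Sp (j + k * m)), (i, mirror_letter j s k)]" "steps M2 \<le> steps M' + 18" for M2
      unfolding R_def by (rule post[OF that])
    show ?case
      unfolding R_def[symmetric]
      using r 4(3)
      apply (cases "k < B"; cases "k * m + j \<le> s"; cases "u < B")
             apply (simp_all add: e1[unfolded One_nat_def] e2[unfolded One_nat_def] e3 e4 machine_defs)
             apply (rule Rp; simp add: frame_def Sk Su e)+
      done
  next
    case (5 M')
    then show ?case using B_pos m_le_B by (intro Q) (auto simp: J_def machine_defs frame_def)
  qed
qed

lemma wp_resolve:
  assumes b: "hbase j M" and s: "regs M 14 = s" "regs M 15 = loc s" "s + 1 < 2 * n"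
    and inw: "length (inwords M) = 2 * m" "\<And>r. r < m \<Longrightarrow> inwords M ! (2 * r) = Sp (r + loc s * m)"
      "\<And>r. r < m \<Longrightarrow> inwords M ! (2 * r + 1) = mirror_letter r s (loc s)"
    and Q: "\<And>M'. frame M M' \<Longrightarrow> outbox M' = outbox M \<Longrightarrow> memory M' = memory M \<Longrightarrow> extent M' = extent M \<Longrightarrow>
      regs M' 21 = far_end s \<Longrightarrow> steps M' \<le> steps M + 10 * B \<Longrightarrow> Q M'"
  shows "wp w resolve Q M"
proof -
  define a where "a = loc s * m"
  define P where "P x \<longleftrightarrow> a + m \<le> x \<or> n \<le> x \<or> s < x \<or> Sp x \<noteq> Sp (s - x)" for x
  note lb = loc_bounds[OF s(3)]
  have aB: "a \<le> m * B + m" unfolding a_def by (rule lb)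
  note r = hbaseD[OF b]
  define cond where "cond M' \<longleftrightarrow> frame M M' \<and> outbox M' = outbox M \<and> memory M' = memory M \<and> extent M' = extent M \<and>
     regs M' 21 = a + regs M' 22 \<and> regs M' 22 \<le> m \<and> (\<forall>x. a \<le> x \<and> x < regs M' 21 \<longrightarrow> \<not> P x) \<and>
     steps M' \<le> steps M + 2 + 3 * regs M' 22" for M'
  have ev: "eval w ((Reg 22 <\<^sub>e Reg 2) &\<^sub>e ((Reg 21 <\<^sub>e Reg 0) &\<^sub>e ((Reg 21 <\<^sub>e Reg 14 +\<^sub>e Const 1) &\<^sub>e
             (Inbox_Word (Const 2 *\<^sub>e Reg 22) =\<^sub>e
              Inbox_Word (Const 2 *\<^sub>e ((Reg 14 -\<^sub>e Reg 21) mod\<^sub>e Reg 2) +\<^sub>e Const 1))))) M' =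
       (if P (regs M' 21) then 0 else 1)" if c: "cond M'" for M'
  proof -
    have M': "frame M M'" "regs M' 21 = a + regs M' 22" "regs M' 22 \<le> m"
      using c by (auto simp: cond_def)
    define x where "x = regs M' 21"
    define d where "d = regs M' 22"
    have x: "x = a + d" "d \<le> m" using M' by (auto simp: x_def d_def)
    note rr = hbaseD[OF hbase_frame[OF M'(1) b]]
    have r14: "regs M' 14 = s" "inwords M' = inwords M" using frameD[OF M'(1)] s by auto
    have lt: "2 * d < word_bound w" "x < word_bound w" "s + 1 < word_bound w" "2 < word_bound w" "1 < word_bound w"
      using x aB s small' m_le_B B_le by linarith+
    show ?thesis
    proof (cases "d < m \<and> x < n \<and> x \<le> s")
      case True
      define y where "y = s - x"
      define v where "v = y mod m"
      have v: "v < m" using m by (simp add: v_def)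
      then have v2: "2 * v + 1 < word_bound w" "2 * v < word_bound w" using small' by linarith+
      have e1: "inwords M ! (2 * d) = Sp x"
        using inw(2)[of d] True x by (simp add: a_def add.commute)
      \<comment> \<open>Position \<open>y = s - x\<close> belongs to class \<open>v\<close>. The
        offset \<open>d < m\<close> of \<open>x\<close> in its piece does not change the quotient by
        \<open>m\<close>, so the letter sent by machine \<open>v\<close> is the one at
        \<open>y\<close>.\<close>
      have vy: "v + y div m * m = y" unfolding v_def by (simp add: mult.commute)
      have "loc s * m + v \<le> s" "s - (loc s * m + v) = d + y div m * m"
        using vy True x y_def a_def by linarith+
      then have "mirror_letter v s (loc s) = Sp (v + (d + y div m * m) div m * m)"
        by (simp add: mirror_letter_def)
      also have "(d + y div m * m) div m = y div m"
        using True m by simp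
      finally have e2: "inwords M ! (2 * v + 1) = Sp y"
        using inw(3)[OF v] vy by simp
      have "eval w (Inbox_Word (Const 2 *\<^sub>e Reg 22)) M' = Sp x"
        using e1 r14 inw(1) lt True by (simp add: eval_rules d_def[symmetric])
      moreover have "eval w (Inbox_Word (Const 2 *\<^sub>e ((Reg 14 -\<^sub>e Reg 21) mod\<^sub>e Reg 2) +\<^sub>e Const 1)) M' = Sp y"
        using e2 r14 inw(1) lt True rr v v2 by (simp add: eval_rules x_def[symmetric] y_def[symmetric] v_def[symmetric])
      ultimately show ?thesis
        using True lt rr r14 x(1)
        by (simp add: eval_rules(2,6,11,12,13) x_def[symmetric] d_def[symmetric] and_indicators P_def y_def eval_rules(1))
    next
      case False
      \<comment> \<open>The comparison of letters may be meaningless here, because the subtraction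
        can wrap around, but one of the range checks already yields 0.\<close>
      have "P x" using False x by (auto simp: P_def)
      moreover have "\<not> (d < m \<and> x < n \<and> x < (s + 1) mod word_bound w)"
        using False lt by auto
      ultimately show ?thesis
        using lt rr r14
        by (auto simp: eval_rules(1,2,6,11,12,13) x_def[symmetric] d_def[symmetric] and_indicators)
    qed
  qed
  have loop: "wp w (While ((Reg 22 <\<^sub>e Reg 2) &\<^sub>e ((Reg 21 <\<^sub>e Reg 0) &\<^sub>e ((Reg 21 <\<^sub>e Reg 14 +\<^sub>e Const 1) &\<^sub>e
             (Inbox_Word (Const 2 *\<^sub>e Reg 22) =\<^sub>e
              Inbox_Word (Const 2 *\<^sub>e ((Reg 14 -\<^sub>e Reg 21) mod\<^sub>e Reg 2) +\<^sub>e Const 1)))))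
        (Assign 22 (Reg 22 +\<^sub>e Const 1) ;; Assign 21 (Reg 21 +\<^sub>e Const 1))) Q M1" if "cond M1" for M1
  proof (rule wp_While[where Inv = cond and \<mu> = "\<lambda>M. m - regs M 22"], fact that, goal_cases)
    case (1 M')
    have nP: "\<not> P (regs M' 21)" using 1 ev[OF 1(1)] by auto
    have c: "frame M M'" "outbox M' = outbox M" "memory M' = memory M" "extent M' = extent M"
     "regs M' 21 = a + regs M' 22" "regs M' 22 \<le> m" "\<forall>x. a \<le> x \<and> x < regs M' 21 \<longrightarrow> \<not> P x"
     "steps M' \<le> steps M + 2 + 3 * regs M' 22"
      using 1(1) by (auto simp: cond_def)
    have d: "regs M' 22 < m" using nP c(5) by (auto simp: P_def)
    have lt: "Suc (regs M' 22) < word_bound w" "Suc (regs M' 21) < word_bound w" "Suc 0 < word_bound w"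
      using d c(5) aB small' by linarith+
    have c7: "\<forall>x. a \<le> x \<and> x < Suc (regs M' 21) \<longrightarrow> \<not> P x"
      using c(7) nP by (auto simp: less_Suc_eq)
    show ?case
      using lt d
      apply (simp add: eval_rules machine_defs)
      using c c7 apply (simp add: cond_def frame_def)
      done
  next
    case (2 M')
    have P: "P (regs M' 21)" using 2 ev[OF 2(1)] by (auto split: if_splits)
    have c: "frame M M'" "outbox M' = outbox M" "memory M' = memory M" "extent M' = extent M"
     "regs M' 21 = a + regs M' 22" "regs M' 22 \<le> m" "\<And>x. a \<le> x \<Longrightarrow> x < regs M' 21 \<Longrightarrow> \<not> P x"
     "steps M' \<le> steps M + 2 + 3 * regs M' 22"
      using 2(1) by (auto simp: cond_def)
    have "first P a = regs M' 21"
      by (rule first_eqI) (use c P in auto)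
    moreover have "P = (\<lambda>x. loc s * m + m \<le> x \<or> n \<le> x \<or> s < x \<or> Sp x \<noteq> Sp (s - x))"
      by (simp add: P_def fun_eq_iff a_def)
    ultimately have "far_end s = regs M' 21"
      by (simp add: far_end_def a_def)
    then show ?case
      using c m_le_B B_pos by (intro Q) (auto simp: machine_defs frame_def)
  qed
  have "a < word_bound w" using aB small' by linarith
  then show ?thesis
    unfolding resolve_def unfolding wp.simps(2,9)
    by (intro loop) (use s r in \<open>auto simp: cond_def eval_rules machine_defs frame_def a_def[symmetric]\<close>)
qed

end


section \<open>Extreme long centers and assembly of the results\<close>

context hashed
begin

text \<open>Without long centers the query defaults to 0, a valid center, so that every machine asks
  the same number of queries and the positions of messages stay fixed.\<close>

definition fst_long :: "nat \<Rightarrow> nat" where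
  "fst_long j = (if longs j (2 * B) = [] then 0 else hd (longs j (2 * B)))"

definition lst_long :: "nat \<Rightarrow> nat" where
  "lst_long j = (if longs j (2 * B) = [] then 0 else last (longs j (2 * B)))"

lemma longs_Suc:
  "longs j (Suc i) = longs j i @
     (if 2 * (j * B) + i + 1 < 2 * n \<and> long j (2 * (j * B) + i) then [2 * (j * B) + i] else [])"
  by (simp add: longs_def)

lemma center_le: "j < m \<Longrightarrow> i < 2 * B \<Longrightarrow> 2 * (j * B) + i < 4 * (m * B)"
  using block_le[of j] by linarith

lemma wp_scan:
  assumes b: "hbase j M" "regs M 18 = wlen j" and j: "j < m"
    and mem: "\<And>t. t < 2 * wlen j - 1 \<Longrightarrow> memory M (12 * B + t) = pal_end (win j) t"
    and Q: "\<And>M'. frame M M' \<Longrightarrow> outbox M' = outbox M \<Longrightarrow> memory M' = memory M \<Longrightarrow>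
      extent M' \<le> max (extent M) (30 * B) \<Longrightarrow> regs M' 28 = fst_long j \<Longrightarrow> regs M' 29 = lst_long j \<Longrightarrow>
      steps M' \<le> steps M + 100 * B \<Longrightarrow> Q M'"
  shows "wp w scan Q M"
proof -
  define J where "J i M' \<longleftrightarrow> frame M M' \<and> outbox M' = outbox M \<and> memory M' = memory M \<and>
      extent M' \<le> max (extent M) (30 * B) \<and>
      regs M' 27 = (if longs j i = [] then 0 else 1) \<and>
      regs M' 28 = (if longs j i = [] then 0 else hd (longs j i)) \<and>
      regs M' 29 = (if longs j i = [] then 0 else last (longs j i)) \<and>
      steps M' \<le> steps M + 10 + 20 * i" for i M'
  define M1 where "M1 = tick (set_reg 29 0 (tick (set_reg 28 0 (tick (set_reg 27 0 M)))))"
  have "wp w (visit note_long) Q M1"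
  proof (rule wp_visit[OF j, where J = J], goal_cases)
    case (1 i M')
    then show ?case using hbase_frame[OF _ b(1), of M'] by (simp add: J_def)
  next
    case (2 i M' t)
    then show ?case using mem by (simp add: J_def)
  next
    case 3
    then show ?case by (simp add: J_def M1_def machine_defs frame_def longs_def)
  next
    case (4 i M')
    then show ?case by (simp add: J_def frame_def longs_Suc)
  next
    case (5 i M')
    define s where "s = 2 * (j * B) + i"
    have M': "frame M M'" "outbox M' = outbox M" "memory M' = memory M" "extent M' \<le> max (extent M) (30 * B)"
      "regs M' 27 = (if longs j i = [] then 0 else 1)" "regs M' 28 = (if longs j i = [] then 0 else hd (longs j i))"
      "regs M' 29 = (if longs j i = [] then 0 else last (longs j i))" "steps M' \<le> steps M + 10 + 20 * i"
      using 5(1) by (simp_all add: J_def)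
    note r = hbaseD[OF hbase_frame[OF M'(1) b(1)]]
    have r18: "regs M' 18 = wlen j" using frameD[OF M'(1)] b by simp
    have hb: "hbase j M2" if "frame M' M2" for M2
      using hbase_frame[OF frame_trans[OF M'(1) that] b(1)] .
    have sl: "s < 4 * (m * B)" using center_le[OF j 5(2)] by (simp add: s_def)
    have ev: "eval w long_expr M2 = (if long j s then 1 else 0)"
      if "frame M' M2" "regs M2 22 = wend j s" "regs M2 23 = s - 2 * lo j" for M2
      by (rule eval_long_expr[OF hb[OF that(1)]]) (use that frameD[OF that(1)] r18 j sl in auto)
    have t: "Suc (12 * B + (s - 2 * lo j)) \<le> 30 * B"
      using center_window(2)[OF 5(2,4)] wlen_le[OF j] by (simp add: s_def)
    define e where "e = max (extent M) (30 * B)"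
    have e: "extent M' \<le> e" "Suc (12 * B + (s - 2 * lo j)) \<le> e" using M'(4) t by (auto simp: e_def)
    have L: "longs j (Suc i) = longs j i @ (if long j s then [s] else [])"
      using 5(4) by (simp add: longs_Suc s_def)
    have e27: "eval w (Reg 27 =\<^sub>e Const 0) M2 = (if regs M2 27 = 0 then 1 else 0)" "eval w (Const 1) M2 = 1" "eval w (Reg x) M2 = regs M2 x" for M2 x
      using small' by (simp_all add: eval_rules)
    define R where "R = (\<lambda>M'. regs M' 20 = i \<and> J (Suc i) (tick (set_reg 20 (Suc i) M')))"
    show ?case
      unfolding s_def[symmetric] R_def[symmetric] note_long_def
    proof (cases "long j s")
      case True
      then show "wp w (If long_expr
         (If (Reg 27 =\<^sub>e Const 0) (Assign 28 (Reg 21) ;; Assign 27 (Const 1)) Skip ;; Assign 29 (Reg 21)) Skip) R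
         (M'\<lparr>regs := (regs M')(21 := s, 23 := s - 2 * lo j, 22 := wend j s),
            extent := max (extent M') (Suc (12 * B + (s - 2 * lo j))),
            steps := Suc (Suc (Suc (Suc (Suc (steps M')))))\<rparr>)"
        using 5(3) M'(5) apply (cases "longs j i = []"; simp add: ev frame_def e27[unfolded One_nat_def] machine_defs)
        unfolding R_def using M' e by (simp_all add: J_def L machine_defs frame_def e_def[symmetric])
    next
      case False
      then show "wp w (If long_expr
         (If (Reg 27 =\<^sub>e Const 0) (Assign 28 (Reg 21) ;; Assign 27 (Const 1)) Skip ;; Assign 29 (Reg 21)) Skip) R
         (M'\<lparr>regs := (regs M')(21 := s, 23 := s - 2 * lo j, 22 := wend j s),
            extent := max (extent M') (Suc (12 * B + (s - 2 * lo j))),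
            steps := Suc (Suc (Suc (Suc (Suc (steps M')))))\<rparr>)"
        using 5(3) apply (simp add: ev frame_def machine_defs)
        unfolding R_def using M' e by (simp add: J_def L machine_defs frame_def e_def[symmetric])
    qed
  next
    case (6 M')
    then show ?case using B_pos by (intro Q) (auto simp: J_def machine_defs frame_def fst_long_def lst_long_def)
  qed
  then show ?thesis
    by (simp add: scan_def M1_def eval_rules)
qed

lemma wp_window_length:
  assumes b: "hbase j M" and j: "j < m"
    and Q: "\<And>st v. st \<le> steps M + 6 \<Longrightarrow> Q (M\<lparr>regs := (regs M)(25 := v, 18 := wlen j), steps := st\<rparr>)"
  shows "wp w window_length Q M"
proof -
  have jB: "(j + 5) * B \<le> m * B + 5 * B" using block_le[OF j] unfolding add_mult_distrib by linarith
  have lt: "(j + 5) * B < word_bound w" "j + 5 < word_bound w" "5 < word_bound w" "n < word_bound w" "lo j < word_bound w"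
  proof -
    show "(j + 5) * B < word_bound w" using jB small'(1,2) by linarith
    show "j + 5 < word_bound w" using j small'(3,5) by linarith
    show "5 < word_bound w" using small'(5) by linarith
    show "n < word_bound w" using small'(4,5) by linarith
    show "lo j < word_bound w" using lo_le(1)[of j] block_le[OF j] small'(1,5) by linarith
  qed
  note r = hbaseD[OF b]
  have e: "\<And>M2. regs M2 3 = j \<Longrightarrow> regs M2 5 = B \<Longrightarrow> eval w ((Reg 3 +\<^sub>e Const 5) *\<^sub>e Reg 5) M2 = (j + 5) * B"
    using lt by (simp add: eval_rules)
  define h where "h = (j + 5) * B"
  have h1: "eval w (Reg 0 <\<^sub>e Reg 25) M2 = (if n < h then 1 else 0)" if "regs M2 0 = n" "regs M2 25 = h" for M2
    using that by (simp add: eval_rules)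
  define v where "v = min n h"
  have wl: "wlen j = v - lo j" by (simp add: wlen_def v_def h_def)
  have tail: "wp w (If (Reg 7 <\<^sub>e Reg 25) (Assign 18 (Reg 25 -\<^sub>e Reg 7)) (Assign 18 (Const 0))) Q
      (M\<lparr>regs := (regs M)(25 := v), steps := st\<rparr>)" if "st \<le> steps M + 4" for st
  proof (cases "lo j < v")
    case True
    have "wsub w v (lo j) = wlen j" using True lt by (simp add: wl v_def)
    then show ?thesis
      using True r Q[of "Suc (Suc st)" v] that by (simp add: eval_rules machine_defs del: wsub_eq)
  next
    case False
    then show ?thesis
      using r Q[of "Suc (Suc st)" v] that by (simp add: eval_rules machine_defs wl)
  qed
  show ?thesis
  proof (cases "n < h")
    case True
    then show ?thesis
      using tail[of "Suc (Suc (Suc (steps M)))"] r unfolding window_length_def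
      by (simp add: v_def e h_def[symmetric] h1 machine_defs eval_rules(2))
  next
    case False
    then show ?thesis
      using tail[of "Suc (Suc (Suc (steps M)))"] r unfolding window_length_def
      by (simp add: v_def e h_def[symmetric] h1 machine_defs)
  qed
qed

lemma nth_win: "u < wlen j \<Longrightarrow> win j ! u = Sp (lo j + u)"
  using n by (simp add: win_def wlen_def Sp_def)

lemma wp_local_round:
  assumes b: "hbase j M" and j: "j < m" and inw: "length (inwords M) = B"
    and winm: "\<And>u. lo j + u < (j + 5) * B \<Longrightarrow> memory M u = Sp (lo j + u)"
    and Q: "\<And>M'. hbase j M' \<Longrightarrow> regs M' 4 = regs M 4 \<Longrightarrow> inbox M' = inbox M \<Longrightarrow> outputs M' = outputs M \<Longrightarrow>
      finished M' = finished M \<Longrightarrow> peak M' = peak M \<Longrightarrow> regs M' 12 = fst_long j \<Longrightarrow> regs M' 13 = lst_long j \<Longrightarrow>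
      regs M' 14 = fst_long j \<Longrightarrow> regs M' 18 = wlen j \<Longrightarrow>
      outbox M' = outbox M @ map (\<lambda>r. (r, fst_long j)) [0..<m] \<Longrightarrow>
      (\<And>a. a < 11 * B \<Longrightarrow> memory M' a = memory M a) \<Longrightarrow>
      (\<And>u. u < B \<Longrightarrow> memory M' (11 * B + u) = inwords M ! u) \<Longrightarrow>
      (\<And>t. t < 2 * wlen j - 1 \<Longrightarrow> memory M' (12 * B + t) = pal_end (win j) t) \<Longrightarrow>
      extent M' \<le> max (extent M) (30 * B) \<Longrightarrow> steps M' \<le> steps M + 2000 * B \<Longrightarrow> Q M'"
  shows "wp w local_round Q M"
proof -
  have main: "wp w (manacher ;; scan ;; Assign 12 (Reg 28) ;; Assign 13 (Reg 29) ;; Assign 14 (Reg 12) ;; broadcast_query) Q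
      (M1\<lparr>regs := (regs M1)(25 := v, 18 := wlen j), steps := st\<rparr>)"
    if M1: "frame M M1" "outbox M1 = outbox M" "\<And>a. a < 11 * B \<Longrightarrow> memory M1 a = memory M a"
      "\<And>u. u < B \<Longrightarrow> memory M1 (11 * B + u) = inwords M ! u" "extent M1 \<le> max (extent M) (12 * B)"
      "steps M1 \<le> steps M + 10 * B" and k: "st \<le> steps M1 + 6" for M1 v st
  proof -
    define M2 where "M2 = M1\<lparr>regs := (regs M1)(25 := v, 18 := wlen j), steps := st\<rparr>"
    have hb1: "hbase j M1" by (rule hbase_frame[OF M1(1) b])
    have M2: "hbase j M2" "regs M2 4 = regs M 4" "regs M2 18 = wlen j" "inbox M2 = inbox M" "outputs M2 = outputs M"
      "finished M2 = finished M" "peak M2 = peak M" "outbox M2 = outbox M" "memory M2 = memory M1"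
      "extent M2 = extent M1" "steps M2 \<le> steps M + 10 * B + 6"
      using hb1 frameD[OF M1(1)] M1(2,6) k by (simp_all add: M2_def hbase_def base_def)
    have fin: "wp w (Assign 12 (Reg 28) ;; Assign 13 (Reg 29) ;; Assign 14 (Reg 12) ;; broadcast_query) Q M4"
      if M3: "frame M2 M3" "outbox M3 = outbox M2" "\<And>a. a < 12 * B \<Longrightarrow> memory M3 a = memory M2 a"
        "\<And>t. t < 2 * wlen j - 1 \<Longrightarrow> memory M3 (12 * B + t) = pal_end (win j) t"
        "extent M3 \<le> max (extent M2) (30 * B)" "steps M3 \<le> steps M2 + 1000 * B + 100"
      and M4: "frame M3 M4" "outbox M4 = outbox M3" "memory M4 = memory M3" "extent M4 \<le> max (extent M3) (30 * B)"
        "regs M4 28 = fst_long j" "regs M4 29 = lst_long j" "steps M4 \<le> steps M3 + 100 * B" for M3 M4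
    proof -
      define M5 where "M5 = M4\<lparr>regs := (regs M4)(12 := fst_long j, 13 := lst_long j, 14 := fst_long j), steps := Suc (Suc (Suc (steps M4)))\<rparr>"
      note f4 = frame_trans[OF M3(1) M4(1)]
      have hb4: "hbase j M4" by (rule hbase_frame[OF f4 M2(1)])
      have M5: "hbase j M5" "regs M5 4 = regs M 4" "inbox M5 = inbox M" "outputs M5 = outputs M"
        "finished M5 = finished M" "peak M5 = peak M" "regs M5 12 = fst_long j" "regs M5 13 = lst_long j"
        "regs M5 14 = fst_long j" "regs M5 18 = wlen j" "outbox M5 = outbox M" "memory M5 = memory M3"
        "extent M5 = extent M4" "steps M5 = steps M4 + 3"
        using hb4 frameD[OF f4] M2 M3(2) M4(2,3) by (simp_all add: M5_def hbase_def base_def)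
      have "wp w broadcast_query Q M5"
      proof (rule wp_broadcast_query[OF hbaseD(3)[OF M5(1)] M5(9)])
        fix M6
        assume M6: "frame M5 M6" "outbox M6 = outbox M5 @ map (\<lambda>r. (r, fst_long j)) [0..<m]" "memory M6 = memory M5"
          "extent M6 = extent M5" "steps M6 \<le> steps M5 + 10 * B"
        show "Q M6"
        proof (rule Q)
          show "hbase j M6" by (rule hbase_frame[OF M6(1) M5(1)])
          show "extent M6 \<le> max (extent M) (30 * B)"
            using M6(4) M5(13) M4(4) M3(5) M2(10) M1(5) by simp
          show "steps M6 \<le> steps M + 2000 * B"
            using M6(5) M5(14) M4(7) M3(6) M2(11) B_pos by linarith
          show "memory M6 a = memory M a" if "a < 11 * B" for a
            using that M6(3) M5(12) M3(3) M2(9) M1(3) by simp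
          show "memory M6 (11 * B + u) = inwords M ! u" if "u < B" for u
            using that M6(3) M5(12) M3(3) M2(9) M1(4) by simp
          show "memory M6 (12 * B + t) = pal_end (win j) t" if "t < 2 * wlen j - 1" for t
            using that M6(3) M5(12) M3(4) by simp
        qed (use frameD[OF M6(1)] M5 M6(2) in simp_all)
      qed
      then show ?thesis
        using M4(5,6) by (simp add: M5_def machine_defs eval_rules(2))
    qed
    have "wp w manacher (wp w (scan ;; Assign 12 (Reg 28) ;; Assign 13 (Reg 29) ;; Assign 14 (Reg 12) ;; broadcast_query) Q) M2"
    proof (rule wp_manacher[where T = "win j" and B = B])
      show "regs M2 18 = length (win j)" using M2 by (simp add: length_win)
      show "memory M2 u = win j ! u" if "u < length (win j)" for u
      proof -
        have u: "u < wlen j" using that by (simp add: length_win)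
        then have "lo j + u < (j + 5) * B" by (simp add: wlen_def)
        then show ?thesis
          using u winm[of u] M1(3)[of u] M2(9) window_less[of j u] by (simp add: nth_win)
      qed
      show "regs M2 5 = B" by (rule hbaseD(5)[OF M2(1)])
      show "length (win j) \<le> 9 * B" using wlen_le[OF j] by (simp add: length_win)
      show "100 * B + 100 < word_bound w" using small by linarith
      fix M3
      assume M3: "frame M2 M3" "outbox M3 = outbox M2" "\<And>a. a < 12 * B \<Longrightarrow> memory M3 a = memory M2 a"
        "\<And>t. t < 2 * length (win j) - 1 \<Longrightarrow> memory M3 (12 * B + t) = pal_end (win j) t"
        "extent M3 \<le> max (extent M2) (30 * B)" "steps M3 \<le> steps M2 + 1000 * B + 100"
      have hb3: "hbase j M3" by (rule hbase_frame[OF M3(1) M2(1)])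
      have r3: "regs M3 18 = wlen j" using frameD[OF M3(1)] M2 by simp
      show "wp w (scan ;; Assign 12 (Reg 28) ;; Assign 13 (Reg 29) ;; Assign 14 (Reg 12) ;; broadcast_query) Q M3"
        unfolding wp.simps(9)[where p = scan]
        by (rule wp_scan[OF hb3 r3 j M3(4)[unfolded length_win]], assumption)
           (rule fin[OF M3(1-3) M3(4)[unfolded length_win] M3(5,6)])
    qed
    then show ?thesis unfolding M2_def by simp
  qed
  have b': "base j M" using b by (simp add: hbase_def)
  show ?thesis
    unfolding local_round_def wp.simps(9)[where p = store_pieces] wp.simps(9)[where p = window_length]
    by (rule wp_store_pieces[OF b' inw], rule wp_window_length[OF hbase_frame[OF _ b] j], assumption)
       (rule main)
qed

lemma wp_first_round:
  assumes b: "hbase j M" and j: "j < m" and s: "regs M 14 = s" "regs M 15 = loc s" "s + 1 < 2 * n" "regs M 13 = t"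
    and inw: "length (inwords M) = 2 * m" "\<And>r. r < m \<Longrightarrow> inwords M ! (2 * r) = Sp (r + loc s * m)"
      "\<And>r. r < m \<Longrightarrow> inwords M ! (2 * r + 1) = mirror_letter r s (loc s)"
    and Q: "\<And>M'. hbase j M' \<Longrightarrow> regs M' 4 = regs M 4 \<Longrightarrow> inbox M' = inbox M \<Longrightarrow> outputs M' = outputs M \<Longrightarrow>
      finished M' = finished M \<Longrightarrow> peak M' = peak M \<Longrightarrow> regs M' 12 = regs M 12 \<Longrightarrow> regs M' 13 = t \<Longrightarrow>
      regs M' 14 = t \<Longrightarrow> regs M' 16 = far_end s \<Longrightarrow> regs M' 18 = regs M 18 \<Longrightarrow>
      outbox M' = outbox M @ map (\<lambda>r. (r, t)) [0..<m] \<Longrightarrow> memory M' = memory M \<Longrightarrow>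
      extent M' = extent M \<Longrightarrow> steps M' \<le> steps M + 30 * B \<Longrightarrow> Q M'"
  shows "wp w first_round Q M"
  unfolding first_round_def wp.simps(9)[where p = resolve]
proof (rule wp_resolve[OF b s(1-3) inw])
  fix M1
  assume M1: "frame M M1" "outbox M1 = outbox M" "memory M1 = memory M" "extent M1 = extent M" "regs M1 21 = far_end s"
    "steps M1 \<le> steps M + 10 * B"
  define M2 where "M2 = M1\<lparr>regs := (regs M1)(16 := far_end s, 14 := t), steps := Suc (Suc (steps M1))\<rparr>"
  have hb1: "hbase j M1" by (rule hbase_frame[OF M1(1) b])
  have M2: "hbase j M2" "regs M2 14 = t" using hb1 by (simp_all add: M2_def hbase_def base_def)
  have "wp w broadcast_query Q M2"
  proof (rule wp_broadcast_query[OF hbaseD(3)[OF M2(1)] M2(2)])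
    fix M3
    assume M3: "frame M2 M3" "outbox M3 = outbox M2 @ map (\<lambda>r. (r, t)) [0..<m]" "memory M3 = memory M2"
          "extent M3 = extent M2" "steps M3 \<le> steps M2 + 10 * B"
    have hb3: "hbase j M3" by (rule hbase_frame[OF M3(1) M2(1)])
    show "Q M3"
    proof (rule Q[OF hb3])
      show "steps M3 \<le> steps M + 30 * B" using M3(5) M1(6) B_pos by (simp add: M2_def)
    qed (simp_all add: frameD[OF M3(1)] M2_def frameD[OF M1(1)] M1 M3(2-4) s(4))
  qed
  then show "wp w (Assign 16 (Reg 21) ;; Assign 14 (Reg 13) ;; broadcast_query) Q M1"
    using M1(5) s(4) frameD(14)[OF M1(1)] by (simp add: M2_def machine_defs eval_rules(2))
qed simp_all

text \<open>Solves \<open>c + x1 = fst_long j + x2\<close> for \<open>c\<close>, the equation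
  excluded in \<open>pal_end_between\<close>; it locates the center of the run. The difference may
  wrap around if a collision has spoilt one of the ends.\<close>

definition mid_center :: "nat \<Rightarrow> nat \<Rightarrow> nat \<Rightarrow> nat" where
  "mid_center j x1 x2 = wsub w (fst_long j + x2) x1"

definition third_query :: "nat \<Rightarrow> nat \<Rightarrow> nat \<Rightarrow> nat" where
  "third_query j x1 x2 = (let s = mid_center j x1 x2 in if fst_long j < s \<and> s < lst_long j then s else 0)"

lemma far_end_le:
  assumes "s + 1 < 2 * n"
  shows "loc s * m \<le> far_end s" "far_end s \<le> loc s * m + m" "far_end s \<le> 3 * (m * B)"
proof -
  show 1: "loc s * m \<le> far_end s" "far_end s \<le> loc s * m + m"
    unfolding far_end_def
    by (rule first_props[where c = "loc s * m + m"]; simp)+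
  show "far_end s \<le> 3 * (m * B)"
    using 1(2) loc_bounds(4)[OF assms] m_le_B B_le by linarith
qed

lemma long_center_less: "s \<in> set (longs j i) \<Longrightarrow> s + 1 < 2 * n"
  by (auto simp: longs_def)

lemma fst_long_less: "fst_long j + 1 < 2 * n" and lst_long_less: "lst_long j + 1 < 2 * n"
  using n long_center_less[OF hd_in_set[of "longs j (2 * B)"]] long_center_less[OF last_in_set[of "longs j (2 * B)"]]
  by (auto simp: fst_long_def lst_long_def)

text \<open>Holds for arbitrary \<open>x1\<close> and \<open>x2\<close>: even after a collision the
  third query is a valid center, so the remaining rounds keep their bounds.\<close>

lemma third_query_less: "third_query j x1 x2 + 1 < 2 * n"
  using lst_long_less[of j] n by (auto simp: third_query_def Let_def)

lemma wp_second_round: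
  assumes b: "hbase j M" and j: "j < m" and s: "regs M 14 = s" "regs M 15 = loc s" "s + 1 < 2 * n"
    and r: "regs M 12 = fst_long j" "regs M 13 = lst_long j" "regs M 16 = x1"
    and inw: "length (inwords M) = 2 * m" "\<And>r. r < m \<Longrightarrow> inwords M ! (2 * r) = Sp (r + loc s * m)"
      "\<And>r. r < m \<Longrightarrow> inwords M ! (2 * r + 1) = mirror_letter r s (loc s)"
    and Q: "\<And>M'. hbase j M' \<Longrightarrow> regs M' 4 = regs M 4 \<Longrightarrow> inbox M' = inbox M \<Longrightarrow> outputs M' = outputs M \<Longrightarrow>
      finished M' = finished M \<Longrightarrow> peak M' = peak M \<Longrightarrow> regs M' 12 = fst_long j \<Longrightarrow> regs M' 13 = lst_long j \<Longrightarrow>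
      regs M' 14 = third_query j x1 (far_end s) \<Longrightarrow> regs M' 16 = x1 \<Longrightarrow> regs M' 17 = far_end s \<Longrightarrow> regs M' 18 = regs M 18 \<Longrightarrow>
      regs M' 19 = mid_center j x1 (far_end s) \<Longrightarrow>
      outbox M' = outbox M @ map (\<lambda>r. (r, third_query j x1 (far_end s))) [0..<m] \<Longrightarrow> memory M' = memory M \<Longrightarrow>
      extent M' = extent M \<Longrightarrow> steps M' \<le> steps M + 30 * B \<Longrightarrow> Q M'"
  shows "wp w second_round Q M"
  unfolding second_round_def wp.simps(9)[where p = resolve]
proof (rule wp_resolve[OF b s inw])
  fix M1
  assume M1: "frame M M1" "outbox M1 = outbox M" "memory M1 = memory M" "extent M1 = extent M" "regs M1 21 = far_end s"
    "steps M1 \<le> steps M + 10 * B"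
  define t where "t = third_query j x1 (far_end s)"
  define c where "c = mid_center j x1 (far_end s)"
  define M2 where "M2 = M1\<lparr>regs := (regs M1)(17 := far_end s, 19 := c, 14 := t), steps := Suc (Suc (Suc (Suc (steps M1))))\<rparr>"
  have hb1: "hbase j M1" by (rule hbase_frame[OF M1(1) b])
  have M2: "hbase j M2" "regs M2 14 = t" using hb1 by (simp_all add: M2_def hbase_def base_def)
  have bq: "wp w broadcast_query Q M2"
  proof (rule wp_broadcast_query[OF hbaseD(3)[OF M2(1)] M2(2)])
    fix M3
    assume M3: "frame M2 M3" "outbox M3 = outbox M2 @ map (\<lambda>r. (r, t)) [0..<m]" "memory M3 = memory M2"
          "extent M3 = extent M2" "steps M3 \<le> steps M2 + 10 * B"
    have hb3: "hbase j M3" by (rule hbase_frame[OF M3(1) M2(1)])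
    show "Q M3"
    proof (rule Q[OF hb3])
      show "steps M3 \<le> steps M + 30 * B" using M3(5) M1(6) B_pos by (simp add: M2_def)
    qed (simp_all add: frameD[OF M3(1)] M2_def frameD[OF M1(1)] M1 M3(2-4) r t_def[symmetric] c_def[symmetric])
  qed
  have "fst_long j + far_end s < word_bound w"
    using fst_long_less[of j] far_end_le(3)[OF s(3)] small' by linarith
  then have e: "eval w (Reg 12 +\<^sub>e Reg 17 -\<^sub>e Reg 16) M3 = c"
    if "regs M3 12 = fst_long j" "regs M3 17 = far_end s" "regs M3 16 = x1" for M3
    using that by (simp add: eval_rules c_def mid_center_def)
  have e2: "eval w (Reg 12 <\<^sub>e Reg 19 &\<^sub>e Reg 19 <\<^sub>e Reg 13) M3 = (if fst_long j < c \<and> c < lst_long j then 1 else 0)"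
    if "regs M3 12 = fst_long j" "regs M3 19 = c" "regs M3 13 = lst_long j" for M3
    using that by (simp add: eval_rules and_indicators)
  have t: "t = (if fst_long j < c \<and> c < lst_long j then c else 0)"
    by (simp add: t_def c_def third_query_def Let_def)
  have rr: "regs M1 12 = fst_long j" "regs M1 13 = lst_long j" "regs M1 16 = x1"
    using frameD[OF M1(1)] r by simp_all
  show "wp w (Assign 17 (Reg 21) ;; Assign 19 (Reg 12 +\<^sub>e Reg 17 -\<^sub>e Reg 16) ;;
      If (Reg 12 <\<^sub>e Reg 19 &\<^sub>e Reg 19 <\<^sub>e Reg 13) (Assign 14 (Reg 19)) (Assign 14 (Const 0)) ;; broadcast_query) Q M1"
  proof (cases "fst_long j < c \<and> c < lst_long j")
    case True
    then show ?thesis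
      using bq M1(5) rr by (simp add: M2_def machine_defs e e2 t eval_rules(1,2))
  next
    case False
    then have "t = 0" by (auto simp: t)
    with False show ?thesis
      using bq M1(5) rr by (simp add: M2_def machine_defs e e2[unfolded if_not_P[OF False]] eval_rules(1,2))
  qed
qed simp_all

text \<open>The last case for a long center is the formula of \<open>pal_end_between\<close>, with
  the first and the last long center as the outer ones.\<close>

definition final_end :: "nat \<Rightarrow> nat \<Rightarrow> nat \<Rightarrow> nat \<Rightarrow> nat \<Rightarrow> nat" where
  "final_end j x1 x2 x3 s =
     (if long j s then
        if s = fst_long j then x1 else if s = lst_long j then x2 else if s = mid_center j x1 x2 then x3
        else min (wsub w (s + x1) (fst_long j)) x2
      else wend j s + lo j)"

definition emitted :: "nat \<Rightarrow> nat \<Rightarrow> nat \<Rightarrow> nat \<Rightarrow> nat \<Rightarrow> (nat \<times> nat) list" where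
  "emitted j x1 x2 x3 s = (let x = final_end j x1 x2 x3 s in
     if s + 1 < (x + x) mod word_bound w then [(wsub w (s + 1) x, wsub w x 1)] else [])"

lemma wp_choose_end:
  assumes ev: "eval w long_expr M = (if long j s then 1 else 0)"
    and r: "regs M 7 = lo j" "regs M 12 = fst_long j" "regs M 13 = lst_long j" "regs M 16 = x1" "regs M 17 = x2" "regs M 19 = mid_center j x1 x2"
      "regs M 21 = s" "regs M 22 = wend j s" "regs M 30 = x3"
    and lt: "s + x1 < word_bound w" "wend j s + lo j < word_bound w"
    and Q: "\<And>st. st \<le> steps M + 7 \<Longrightarrow> Q (M\<lparr>regs := (regs M)(22 := final_end j x1 x2 x3 s), steps := st\<rparr>)"
  shows "wp w choose_end Q M"
proof (cases "long j s")
  case L: True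
  note Ql = Q[unfolded final_end_def if_P[OF L]]
  have e: "eval w (Reg x =\<^sub>e Reg y) M2 = (if regs M2 x = regs M2 y then 1 else 0)"
    "eval w (Reg x <\<^sub>e Reg y) M2 = (if regs M2 x < regs M2 y then 1 else 0)" "eval w (Reg x) M2 = regs M2 x" for M2 x y
    by (simp_all add: eval_rules)
  show ?thesis
  proof (cases "s = fst_long j \<or> s = lst_long j \<or> s = mid_center j x1 x2")
    case True
    then consider "s = fst_long j" | "s \<noteq> fst_long j" "s = lst_long j" | "s \<noteq> fst_long j" "s \<noteq> lst_long j" "s = mid_center j x1 x2"
      by blast
    then show ?thesis
    proof cases
      case 1
      then show ?thesis unfolding choose_end_def using L Ql by (simp add: ev e r machine_defs)
    next
      case 2
      then show ?thesis unfolding choose_end_def using L Ql by (simp add: ev e r machine_defs)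
    next
      case 3
      then show ?thesis unfolding choose_end_def using L Ql by (simp add: ev e r machine_defs)
    qed
  next
    case False
    define y where "y = wsub w (s + x1) (fst_long j)"
    have y: "eval w (Reg 21 +\<^sub>e Reg 16 -\<^sub>e Reg 12) M2 = y"
      if "regs M2 21 = s" "regs M2 16 = x1" "regs M2 12 = fst_long j" for M2
      using that lt by (simp add: eval_rules y_def)
    have Qy: "\<And>st. st \<le> steps M + 7 \<Longrightarrow> Q (M\<lparr>regs := (regs M)(22 := min y x2), steps := st\<rparr>)"
      using Ql False by (simp add: y_def)
    show ?thesis
    proof (cases "x2 < y")
      case True
      then have "min y x2 = x2" by simp
      then show ?thesis
        using True Qy L False unfolding choose_end_def by (simp add: ev e r machine_defs y)
    next
      case F: False
      then have "min y x2 = y" by simp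
      then show ?thesis
        using F Qy L False unfolding choose_end_def by (simp add: ev e r machine_defs y)
    qed
  qed
next
  case False
  then show ?thesis
    unfolding choose_end_def using Q lt by (simp add: ev machine_defs eval_rules r final_end_def)
qed

lemma wp_last_round:
  assumes b: "hbase j M" and j: "j < m" and s: "regs M 14 = s3" "regs M 15 = loc s3" "s3 + 1 < 2 * n"
    and r: "regs M 12 = fst_long j" "regs M 13 = lst_long j" "regs M 16 = x1" "regs M 17 = x2" "regs M 18 = wlen j"
      "regs M 19 = mid_center j x1 x2" "x1 \<le> 3 * (m * B)"
    and inw: "length (inwords M) = 2 * m" "\<And>r. r < m \<Longrightarrow> inwords M ! (2 * r) = Sp (r + loc s3 * m)"
      "\<And>r. r < m \<Longrightarrow> inwords M ! (2 * r + 1) = mirror_letter r s3 (loc s3)"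
    and mem: "\<And>t. t < 2 * wlen j - 1 \<Longrightarrow> memory M (12 * B + t) = pal_end (win j) t"
    and Q: "\<And>M'. finished M' \<Longrightarrow> peak M' = peak M \<Longrightarrow> inbox M' = inbox M \<Longrightarrow> outbox M' = outbox M \<Longrightarrow>
      outputs M' = outputs M @ concat (map (emitted j x1 x2 (far_end s3)) (filter (\<lambda>s. s + 1 < 2 * n) [2 * (j * B)..<2 * (j * B) + 2 * B])) \<Longrightarrow>
      extent M' \<le> max (extent M) (30 * B) \<Longrightarrow> steps M' \<le> steps M + 200 * B \<Longrightarrow> regs M' 4 = regs M 4 \<Longrightarrow> Q M'"
  shows "wp w last_round Q M"
  unfolding last_round_def wp.simps(9)[where p = resolve]
proof (rule wp_resolve[OF b s inw])
  fix M1
  assume M1: "frame M M1" "outbox M1 = outbox M" "memory M1 = memory M" "extent M1 = extent M" "regs M1 21 = far_end s3"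
    "steps M1 \<le> steps M + 10 * B"
  define x3 where "x3 = far_end s3"
  define E where "E i = concat (map (emitted j x1 x2 x3) (filter (\<lambda>s. s + 1 < 2 * n) [2 * (j * B)..<2 * (j * B) + i]))" for i
  define J where "J i M' \<longleftrightarrow> low (regs M') = low (regs M) \<and> regs M' 30 = x3 \<and> inbox M' = inbox M \<and> outbox M' = outbox M \<and>
      outputs M' = outputs M @ E i \<and> finished M' = finished M \<and> peak M' = peak M \<and> memory M' = memory M \<and>
      extent M' \<le> max (extent M) (30 * B) \<and> steps M' \<le> steps M1 + 10 + 30 * i" for i and M' :: machine
  have Jb: "hbase j M'" "regs M' 7 = lo j" "regs M' 12 = fst_long j" "regs M' 13 = lst_long j" "regs M' 16 = x1" "regs M' 17 = x2" "regs M' 18 = wlen j"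
      "regs M' 19 = mid_center j x1 x2" if "low (regs M') = low (regs M)" for M'
    using low_eqD[OF that] r b by (simp_all add: hbase_def base_def)
  have E: "E (Suc i) = E i @ (if 2 * (j * B) + i + 1 < 2 * n then emitted j x1 x2 x3 (2 * (j * B) + i) else [])" for i
    by (simp add: E_def)
  have "wp w (visit emit) (wp w Finish Q) (tick (set_reg 30 x3 M1))"
  proof (rule wp_visit[OF j, where J = J], goal_cases)
    case (1 i M')
    then show ?case using Jb by (simp add: J_def)
  next
    case (2 i M' t)
    then show ?case using mem by (simp add: J_def)
  next
    case 3
    then show ?case using M1 frameD[OF M1(1)] by (simp add: J_def machine_defs E_def frame_def)
  next
    case (4 i M')
    then show ?case by (simp add: J_def E)
  next
    case (5 i M')
    define s where "s = 2 * (j * B) + i"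
    define t where "t = s - 2 * lo j"
    have M': "low (regs M') = low (regs M)" "regs M' 30 = x3" "inbox M' = inbox M" "outbox M' = outbox M"
      "outputs M' = outputs M @ E i" "finished M' = finished M" "peak M' = peak M" "memory M' = memory M"
      "extent M' \<le> max (extent M) (30 * B)" "steps M' \<le> steps M1 + 10 + 30 * i"
      using 5(1) by (simp_all add: J_def)
    have sl: "s < 4 * (m * B)" using center_le[OF j 5(2)] by (simp add: s_def)
    have tt: "Suc (12 * B + t) \<le> 30 * B"
      using center_window(2)[OF 5(2,4)] wlen_le[OF j] by (simp add: s_def t_def)
    define M2 where "M2 = M'\<lparr>regs := (regs M')(21 := s, 23 := t, 22 := wend j s),
            extent := max (extent M') (Suc (12 * B + t)), steps := Suc (Suc (Suc (Suc (Suc (steps M')))))\<rparr>"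
    have l2: "low (regs M2) = low (regs M)" using M' by (simp add: M2_def)
    note jb = Jb[OF l2]
    have ev: "eval w long_expr M2 = (if long j s then 1 else 0)"
      by (rule eval_long_expr[OF jb(1) jb(7)]) (use j sl in \<open>simp_all add: M2_def t_def\<close>)
    have we: "wend j s \<le> wlen j" unfolding wend_def using pal_end_le(1)[of "win j"] by (simp add: length_win)
    have lt: "s + x1 < word_bound w" "wend j s + lo j < word_bound w" "s + 1 < word_bound w" "1 < word_bound w"
      using sl r(7) small' we wlen_le[OF j] lo_le(1)[of j] block_le[OF j] B_le by linarith+
    define R where "R = (\<lambda>M'. regs M' 20 = i \<and> J (Suc i) (tick (set_reg 20 (Suc i) M')))"
    define x where "x = final_end j x1 x2 x3 s"
    have out: "wp w (If (Reg 21 +\<^sub>e Const 1 <\<^sub>e Reg 22 +\<^sub>e Reg 22)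
        (Output (Reg 21 +\<^sub>e Const 1 -\<^sub>e Reg 22) (Reg 22 -\<^sub>e Const 1)) Skip) R
        (M2\<lparr>regs := (regs M2)(22 := x), steps := st\<rparr>)" if "st \<le> steps M2 + 7" for st
    proof -
      have ex: "max (extent M') (Suc (12 * B + t)) \<le> max (extent M) (30 * B)" using M'(9) tt by auto
      have em: "emitted j x1 x2 x3 s = (if s + 1 < (x + x) mod word_bound w then [(wsub w (s + 1) x, wsub w x 1)] else [])"
        by (simp add: emitted_def x_def Let_def)
      have E': "E (Suc i) = E i @ emitted j x1 x2 x3 s" using 5(4) by (simp add: E s_def)
      have Rr: "R (M2\<lparr>regs := (regs M2)(22 := x), outputs := outputs M2 @ emitted j x1 x2 x3 s, steps := Suc (Suc st)\<rparr>)"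
        unfolding R_def using M' ex 5(3) that by (simp add: J_def M2_def machine_defs E')
      show ?thesis
      proof (cases "s + 1 < (x + x) mod word_bound w")
        case True
        then show ?thesis using Rr lt by (simp add: em eval_rules machine_defs M2_def del: wsub_eq)
      next
        case False
        then show ?thesis using Rr lt by (simp add: em eval_rules machine_defs M2_def del: wsub_eq)
      qed
    qed
    have "wp w emit R M2"
      unfolding emit_def wp.simps(9)
    proof (rule wp_choose_end[OF ev jb(2-6) jb(8)])
      show "regs M2 21 = s" "regs M2 22 = wend j s" "regs M2 30 = x3"
        using M'(2) by (simp_all add: M2_def)
    qed (fact lt, fact lt, rule out[unfolded x_def])
    then show ?case unfolding M2_def R_def s_def t_def .
  next
    case (6 M')
    have "E (2 * B) = concat (map (emitted j x1 x2 (far_end s3)) (filter (\<lambda>s. s + 1 < 2 * n) [2 * (j * B)..<2 * (j * B) + 2 * B]))"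
      by (simp add: E_def x3_def)
    moreover have "regs M' 4 = regs M 4" using 6 low_eqD(5)[of "regs M'" "regs M"] by (simp add: J_def)
    ultimately show ?case
      unfolding wp.simps using 6 M1(6) B_pos by (intro Q) (auto simp: J_def machine_defs)
  qed
  then show "wp w (Assign 30 (Reg 21) ;; visit emit ;; Finish) Q M1"
    using M1(5) by (simp add: eval_rules(2) x3_def)
qed simp_all

end


section \<open>Primes\<close>

text \<open>
  Leibniz' harmonic triangle: \<open>1 / (k * (n choose k))\<close> is an integral combination of
  \<open>1 / 1, \<dots>, 1 / n\<close>.
\<close>

lemma binomial_dvd_Lcm:
  "1 \<le> k \<Longrightarrow> k \<le> n \<Longrightarrow> n \<le> N \<Longrightarrow> k * (n choose k) dvd Lcm {1..N::nat}"
proof (induction k arbitrary: n rule: nat_induct_at_least)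
  case base
  then show ?case by (auto intro: dvd_Lcm)
next
  case (Suc k)
  define L where "L = Lcm {1..N}"
  define a where "a = k * (n - 1 choose k)"
  define b where "b = k * (n choose k)"
  define d where "d = Suc k * (n choose Suc k)"
  have "a dvd L" "b dvd L"
    using Suc.IH[of "n - 1"] Suc.IH[of n] Suc.prems by (auto simp: a_def b_def L_def)
  then obtain x y where xy: "L = a * x" "L = b * y" unfolding dvd_def by blast
  define c where "c = real (n - 1 choose k)"
  have pos: "0 < c" "0 < real (n choose k)" "0 < real k" "0 < real n" using Suc by (auto simp: c_def)
  have d: "real d = real n * c"
    unfolding d_def c_def using binomial_absorption[of k n] by (metis of_nat_mult)
  have ab: "real a = real k * c" by (simp add: a_def c_def)
  have "real ((n - k) * (n choose k)) = real (n * ((n - 1) choose k))"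
    by (simp only: binomial_absorb_comp)
  then have "(real n - real k) * real (n choose k) = real n * c"
    using Suc.prems by (simp add: c_def of_nat_diff)
  then have b2: "(real n - real k) * real b = real k * (real n * c)"
    by (simp add: b_def)
  have nk: "real n - real k > 0" using Suc.prems by simp
  have bpos: "0 < real b" using pos by (simp add: b_def)
  \<comment> \<open>Neighbouring entries of the triangle: \<open>1 / d\<close> is the difference of
    \<open>1 / a\<close> and \<open>1 / b\<close>, so multiplication by \<open>L\<close> leaves a
    difference of integers.\<close>
  have "real L / real d = real L / real a - real L / real b"
  proof -
    have "1 / real a - 1 / real b = 1 / (real n * c)"
    proof -
      have "real b = real k * (real n * c) / (real n - real k)" using b2 nk by (simp add: field_simps)
      then have b1: "1 / real b = (real n - real k) / (real k * (real n * c))" by simp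
      have "1 / (real k * c) - (real n - real k) / (real k * (real n * c)) = 1 / (real n * c)"
        using pos by (simp add: field_simps)
      then show ?thesis unfolding ab b1 .
    qed
    then have "real L * (1 / real a - 1 / real b) = real L * (1 / real d)" by (simp add: d)
    then show ?thesis by (simp add: right_diff_distrib)
  qed
  also have "\<dots> = real x - real y"
    using xy pos bpos ab by (metis of_nat_mult nonzero_mult_div_cancel_left less_irrefl mult_pos_pos)
  finally have "real L = real d * (real x - real y)"
    using d pos by (simp add: field_simps)
  then have "real_of_int (int L) = real_of_int (int d * (int x - int y))" by simp
  then have "int L = int d * (int x - int y)" by linarith
  then have "int d dvd int L" by simp
  then have "d dvd L" by (simp only: int_dvd_int_iff)
  then show ?case by (simp only: d_def L_def)
qed

text \<open>The multiplicity of a prime in a least common multiple is the maximum of its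
  multiplicities, so it is attained by one of the numbers.\<close>

lemma prime_power_dvd_Lcm:
  assumes "finite A" "0 \<notin> A" "prime p" "p ^ a dvd Lcm A" "0 < a"
  shows "\<exists>i \<in> A. p ^ a dvd (i::nat)"
  using assms
proof (induction A rule: finite_induct)
  case (insert x A)
  have nz: "Lcm A \<noteq> 0" "x \<noteq> 0" using insert by (auto simp: Lcm_0_iff)
  have "a \<le> multiplicity p (lcm x (Lcm A))"
    using insert.prems nz by (subst power_dvd_iff_le_multiplicity[symmetric]) auto
  also have "\<dots> = max (multiplicity p x) (multiplicity p (Lcm A))"
    using nz by (simp add: multiplicity_lcm insert.prems)
  finally consider "a \<le> multiplicity p x" | "a \<le> multiplicity p (Lcm A)" by linarith
  then show ?case
  proof cases
    case 1
    then show ?thesis using multiplicity_dvd' by blast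
  next
    case 2
    then have "p ^ a dvd Lcm A" using multiplicity_dvd' by blast
    then show ?thesis using insert by auto
  qed
qed auto

text \<open>Each full prime power in the least common multiple divides one of the numbers up to
  \<open>N\<close>, hence is at most \<open>N\<close>.\<close>

lemma Lcm_le_power_primes: "Lcm {1..N} \<le> N ^ card {p::nat. prime p \<and> p \<le> N}"
proof -
  define L where "L = Lcm {1..N}"
  have L: "L \<noteq> 0" by (simp add: L_def Lcm_0_iff)
  have fin: "finite {p::nat. prime p \<and> p \<le> N}" by simp
  have le: "p \<le> N" "p ^ multiplicity p L \<le> N" if p: "p \<in> prime_factors L" for p
  proof -
    have pr: "prime p" "p dvd L" using p by auto
    then have "0 < multiplicity p L" using L by (simp add: prime_multiplicity_gt_zero_iff)
    moreover have "p ^ multiplicity p L dvd Lcm {1..N}" using multiplicity_dvd L_def by metis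
    ultimately obtain i where i: "i \<in> {1..N}" "p ^ multiplicity p L dvd i"
      using prime_power_dvd_Lcm[of "{1..N}" p "multiplicity p L"] pr by auto
    then show A: "p ^ multiplicity p L \<le> N" by (auto dest!: dvd_imp_le)
    have "p ^ 1 \<le> p ^ multiplicity p L"
      using \<open>0 < multiplicity p L\<close> prime_gt_0_nat[OF pr(1)] by (intro power_increasing) auto
    with A show "p \<le> N" by simp
  qed
  have "L = (\<Prod>p\<in>prime_factors L. p ^ multiplicity p L)"
    using L by (intro prime_factorization_nat) simp
  also have "\<dots> \<le> (\<Prod>p\<in>prime_factors L. N)"
    using le by (intro prod_mono) auto
  also have "\<dots> = N ^ card (prime_factors L)" by simp
  also have "\<dots> \<le> N ^ card {p::nat. prime p \<and> p \<le> N}"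
  proof (cases "N = 0")
    case False
    have "prime_factors L \<subseteq> {p. prime p \<and> p \<le> N}" using le by auto
    then have "card (prime_factors L) \<le> card {p::nat. prime p \<and> p \<le> N}" by (rule card_mono[OF fin])
    with False show ?thesis by (intro power_increasing) auto
  next
    case True
    then have "{p::nat. prime p \<and> p \<le> N} = {}" by auto
    then have c0: "card {p::nat. prime p \<and> p \<le> N} = 0" by (simp only: card.empty)
    show ?thesis unfolding c0 using True by (simp add: L_def)
  qed
  finally show ?thesis by (simp add: L_def)
qed

text \<open>\<open>N\<close> times the central binomial coefficient is at least \<open>2 ^ N\<close>
  and divides the least common multiple, a product of prime powers that are at most
  \<open>2 * N\<close>.\<close>

lemma two_power_le_power_primes:
  assumes "1 \<le> N"
  shows "2 ^ N \<le> (2 * N) ^ card {p::nat. prime p \<and> p \<le> 2 * N}"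
proof -
  have "(4::real) ^ N / (2 * real N) \<le> real ((2 * N) choose N)"
    using central_binomial_lower_bound[of N] assms by simp
  then have "(4::real) ^ N / 2 \<le> real (N * ((2 * N) choose N))"
    using assms by (simp add: field_simps)
  moreover have "(2::real) ^ N \<le> 4 ^ N / 2"
  proof -
    have "(2::real) \<le> 2 ^ N" using assms power_increasing[of 1 N "2::real"] by simp
    then have "2 * (2::real) ^ N \<le> 2 ^ N * 2 ^ N" by simp
    then show ?thesis by (simp add: power_mult_distrib[symmetric])
  qed
  ultimately have "2 ^ N \<le> N * ((2 * N) choose N)"
    by (metis (mono_tags, lifting) of_nat_le_iff of_nat_numeral of_nat_power order_trans)
  also have "\<dots> \<le> Lcm {1..2 * N}"
    using assms by (intro dvd_imp_le binomial_dvd_Lcm) (auto simp: Lcm_0_iff intro!: Nat.gr0I)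
  also have "\<dots> \<le> (2 * N) ^ card {p::nat. prime p \<and> p \<le> 2 * N}" by (rule Lcm_le_power_primes)
  finally show ?thesis .
qed

definition primes_between :: "nat \<Rightarrow> nat \<Rightarrow> nat set" where
  "primes_between a b = {p. prime p \<and> a < p \<and> p \<le> b}"

lemma finite_primes_between [simp]: "finite (primes_between a b)"
  by (rule finite_subset[of _ "{..b}"]) (auto simp: primes_between_def)

text \<open>With fewer than \<open>k\<close> primes in the range, at most
  \<open>256 * v ^ 7 + k\<close> primes would be at most \<open>X\<close>, too few for
  \<open>two_power_le_power_primes\<close>. The exponent \<open>k + 10\<close> is large enough to
  dominate \<open>256 + k\<close> and the constants in the logarithm of \<open>X\<close>. The upper
  bound is a square because its root bounds the trial divisors.\<close>

lemma many_primes: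
  assumes v: "1 \<le> v"
  shows "k \<le> card (primes_between (256 * v ^ 7) ((2 ^ (k + 10) * v ^ 4) ^ 2))"
proof (rule ccontr)
  assume less: "\<not> ?thesis"
  define e where "e = k + 10"
  define X where "X = (2 ^ e * v ^ 4) ^ 2"
  define N where "N = 2 ^ (2 * e - 1) * v ^ 8"
  define a where "a = 256 * v ^ 7 + k"
  have "2 * e = Suc (2 * e - 1)" by (simp add: e_def)
  then have X: "X = 2 ^ (2 * e) * v ^ 8" "X = 2 * N"
    by (simp_all add: X_def N_def power_mult_distrib power_mult[symmetric] mult.commute flip: power_Suc)
  have N1: "1 \<le> N" using v by (simp add: N_def)
  \<comment> \<open>Up to the lower end of the range every number is counted as if it were
    prime.\<close>
  have "{p. prime p \<and> p \<le> X} \<subseteq> {1..256 * v ^ 7} \<union> primes_between (256 * v ^ 7) X"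
    by (auto simp: primes_between_def not_less dest: prime_gt_0_nat)
  then have "card {p. prime p \<and> p \<le> X} \<le> card ({1..256 * v ^ 7} \<union> primes_between (256 * v ^ 7) X)"
    by (rule card_mono[rotated]) simp
  also have "\<dots> \<le> 256 * v ^ 7 + card (primes_between (256 * v ^ 7) X)"
    by (rule order_trans[OF card_Un_le]) simp
  also have "\<dots> \<le> a" using less by (simp add: a_def X_def e_def)
  finally have card: "card {p. prime p \<and> p \<le> X} \<le> a" .
  have "2 ^ N \<le> X ^ card {p. prime p \<and> p \<le> X}"
    using two_power_le_power_primes[OF N1] by (simp add: X(2))
  also have "\<dots> \<le> X ^ a"
    using card N1 X(2) by (intro power_increasing) auto
  \<comment> \<open>A crude estimate with \<open>v\<close> in place of its logarithm; it uses up the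
    gap between \<open>v ^ 7\<close> and \<open>v ^ 8\<close>.\<close>
  also have "X < 2 ^ (2 * e + 8 * v)"
  proof -
    have "v ^ 8 < (2 ^ v) ^ 8" by (intro power_strict_mono less_exp) auto
    then have "v ^ 8 < 2 ^ (8 * v)" by (simp add: power_mult[symmetric] mult.commute)
    then show ?thesis by (simp add: X(1) power_add)
  qed
  then have "X ^ a < (2 ^ (2 * e + 8 * v)) ^ a"
    using v by (intro power_strict_mono) (auto simp: a_def)
  also have "\<dots> = 2 ^ ((2 * e + 8 * v) * a)" by (simp add: power_mult)
  also have "\<dots> \<le> 2 ^ N"
  proof (intro power_increasing)
    have "2 * e + 8 * v \<le> (2 * e + 8) * v" "a \<le> (256 + k) * v ^ 7"
      using v by (simp_all add: a_def algebra_simps)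
    then have "(2 * e + 8 * v) * a \<le> ((2 * e + 8) * v) * ((256 + k) * v ^ 7)" by (rule mult_le_mono)
    also have "\<dots> = (2 * e + 8) * (256 + k) * v ^ 8"
    proof -
      have "v ^ 8 = v * v ^ 7" by (simp flip: power_Suc)
      then show ?thesis by (simp only: ac_simps)
    qed
    also have "(2 * e + 8) * (256 + k) \<le> 2 ^ (k + 5) * 2 ^ (k + 8)"
    proof (rule mult_le_mono)
      have "k < 2 ^ k" "1 \<le> (2::nat) ^ k" by (simp_all add: less_exp)
      then have "2 * k + 28 \<le> 32 * 2 ^ k" "256 + k \<le> 256 * 2 ^ k" by linarith+
      then show "2 * e + 8 \<le> 2 ^ (k + 5)" "256 + k \<le> 2 ^ (k + 8)" by (simp_all add: e_def power_add)
    qed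
    also have "\<dots> = 2 ^ (2 * k + 13)" by (simp add: power_add[symmetric])
    also have "\<dots> \<le> 2 ^ (2 * e - 1)" by (intro power_increasing) (auto simp: e_def)
    finally show "(2 * e + 8 * v) * a \<le> N" by (simp add: N_def)
  qed simp
  finally show False by simp
qed


section \<open>Search for the modulus\<close>

text \<open>The exponents are constants of the program, so the expression has constant size.\<close>

primrec power_expr :: "nat \<Rightarrow> expr \<Rightarrow> expr" where
  "power_expr 0 e = Const 1"
| "power_expr (Suc i) e = e *\<^sub>e power_expr i e"

lemma eval_power_expr:
  assumes "eval w e M = x" "x ^ i < word_bound w" "1 < word_bound w" "1 \<le> x"
  shows "eval w (power_expr i e) M = x ^ i"
  using assms(2)
proof (induction i)
  case (Suc i)
  have "x ^ i \<le> x ^ Suc i" using assms(4) by simp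
  with Suc show ?case using assms(1) by (simp add: eval_rules)
qed (use assms in \<open>simp add: eval_rules\<close>)

definition root_loop :: program where
  "root_loop =
     While (power_expr 12 (Reg 20 +\<^sub>e Const 1) <\<^sub>e Reg 0 +\<^sub>e Const 1) (Assign 20 (Reg 20 +\<^sub>e Const 1))"

definition divisor_loop :: program where
  "divisor_loop =
     While ((Reg 25 *\<^sub>e Reg 25 <\<^sub>e Reg 22 +\<^sub>e Const 1) &\<^sub>e (Const 0 <\<^sub>e Reg 22 mod\<^sub>e Reg 25))
       (Assign 25 (Reg 25 +\<^sub>e Const 1))"

definition prime_loop :: "nat \<Rightarrow> program" where
  "prime_loop k =
     While (Reg 23 <\<^sub>e Const k)
       (Assign 22 (Reg 22 +\<^sub>e Const 1) ;; Assign 25 (Const 2) ;; divisor_loop ;;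
        If (Reg 22 <\<^sub>e Reg 25 *\<^sub>e Reg 25)
          (Assign 24 (Reg 24 *\<^sub>e Reg 22) ;; Assign 23 (Reg 23 +\<^sub>e Const 1)) Skip)"

text \<open>Covers both exits of \<open>divisor_loop\<close>: the divisors have passed the square
  root of \<open>r\<close>, or the current one divides \<open>r\<close>.\<close>

lemma prime_iff_no_divisor:
  assumes r: "2 \<le> r" and d: "2 \<le> d" "\<And>e. 2 \<le> e \<Longrightarrow> e < d \<Longrightarrow> \<not> e dvd r" and stop: "r < d * d \<or> d dvd (r::nat)"
  shows "prime r \<longleftrightarrow> r < d * d"
proof
  assume p: "prime r"
  show "r < d * d"
  proof (rule ccontr)
    assume "\<not> r < d * d"
    then have "d dvd r" "d * d \<le> r" using stop by auto
    then have "d = r" using p d(1) by (auto simp: prime_nat_iff)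
    with \<open>d * d \<le> r\<close> d(1) show False by auto
  qed
next
  assume lt: "r < d * d"
  show "prime r"
  proof (rule ccontr)
    assume "\<not> prime r"
    then obtain a where a: "a dvd r" "a \<noteq> 1" "a \<noteq> r"
      using r by (auto simp: prime_nat_iff)
    then obtain c where c: "r = a * c" by (auto elim: dvdE)
    have "2 \<le> a" "2 \<le> c" using a c r by (cases a; cases c; force simp: Suc_le_eq)+
    moreover have "a < d \<or> c < d"
    proof (rule ccontr)
      assume "\<not> ?thesis"
      then have "d * d \<le> a * c" by (intro mult_le_mono) auto
      with lt c show False by simp
    qed
    ultimately show False using d(2) c by (metis dvd_triv_left dvd_triv_right)
  qed
qed

lemma wp_divisor_loop:
  assumes r: "regs M 22 = r" "regs M 25 = 2" "2 \<le> r" "r \<le> D * D" "2 \<le> D" and W: "(D + 2) * (D + 2) < word_bound w"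
    and Q: "\<And>M' d. regs M' = (regs M)(25 := d) \<Longrightarrow> memory M' = memory M \<Longrightarrow> extent M' = extent M \<Longrightarrow> inbox M' = inbox M \<Longrightarrow>
      outbox M' = outbox M \<Longrightarrow> outputs M' = outputs M \<Longrightarrow> finished M' = finished M \<Longrightarrow> peak M' = peak M \<Longrightarrow>
      d \<le> D + 1 \<Longrightarrow> (prime r \<longleftrightarrow> r < d * d) \<Longrightarrow> steps M' \<le> steps M + 10 + 3 * D \<Longrightarrow> Q M'"
  shows "wp w divisor_loop Q M"
proof -
  define cond where "cond M' \<longleftrightarrow> (\<exists>d. regs M' = (regs M)(25 := d) \<and> 2 \<le> d \<and> d \<le> D + 1 \<and> (\<forall>e. 2 \<le> e \<and> e < d \<longrightarrow> \<not> e dvd r) \<and>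
     steps M' \<le> steps M + 3 * d) \<and> memory M' = memory M \<and> extent M' = extent M \<and> inbox M' = inbox M \<and>
      outbox M' = outbox M \<and> outputs M' = outputs M \<and> finished M' = finished M \<and> peak M' = peak M" for M' :: machine
  have ev: "eval w ((Reg 25 *\<^sub>e Reg 25 <\<^sub>e Reg 22 +\<^sub>e Const 1) &\<^sub>e (Const 0 <\<^sub>e Reg 22 mod\<^sub>e Reg 25)) M'
      = (if d * d \<le> r \<and> \<not> d dvd r then 1 else 0)" if "regs M' 25 = d" "regs M' 22 = r" "d \<le> D + 1" for M' d
  proof -
    have "d * d \<le> (D + 1) * (D + 1)" using that(3) by (intro mult_le_mono)
    then have "d * d < word_bound w" "r + 1 < word_bound w" "1 < word_bound w" using W r by (simp_all add: algebra_simps)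
    then show ?thesis using that by (simp add: eval_rules and_indicators less_Suc_eq_le dvd_eq_mod_eq_0)
  qed
  show ?thesis
    unfolding divisor_loop_def
  proof (rule wp_While[where Inv = cond and \<mu> = "\<lambda>M. D + 2 - regs M 25"], goal_cases)
    case 1
    have "regs M = (regs M)(25 := 2)" using r by (simp add: fun_eq_iff)
    then show ?case using r by (auto simp: cond_def intro!: exI[of _ 2])
  next
    case (2 M')
    then obtain d where d: "regs M' = (regs M)(25 := d)" "2 \<le> d" "d \<le> D + 1" "\<And>e. 2 \<le> e \<Longrightarrow> e < d \<Longrightarrow> \<not> e dvd r"
      "steps M' \<le> steps M + 3 * d" and o: "memory M' = memory M" "extent M' = extent M" "inbox M' = inbox M"
      "outbox M' = outbox M" "outputs M' = outputs M" "finished M' = finished M" "peak M' = peak M"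
      by (auto simp: cond_def)
    have e: "d * d \<le> r" "\<not> d dvd r" using 2(2) ev[of M' d] d r by (auto split: if_splits)
    have "d * d \<le> D * D" using e(1) r(4) by linarith
    have dD: "d \<le> D"
    proof (rule ccontr)
      assume "\<not> d \<le> D"
      then have "D * D < d * d" by (intro mult_strict_mono) auto
      with \<open>d * d \<le> D * D\<close> show False by simp
    qed
    have lt: "Suc d < word_bound w" "Suc 0 < word_bound w"
    proof -
      have "D + 2 \<le> (D + 2) * (D + 2)" by simp
      then show "Suc d < word_bound w" "Suc 0 < word_bound w" using W dD by linarith+
    qed
    have nd: "\<forall>e. 2 \<le> e \<and> e < Suc d \<longrightarrow> \<not> e dvd r" using d(4) e(2) by (auto simp: less_Suc_eq)
    show ?case
      using d(1) lt dD
      apply (simp add: eval_rules machine_defs)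
      using d(5,2) nd dD o apply (auto simp: cond_def intro!: exI[of _ "Suc d"])
      done
  next
    case (3 M')
    then obtain d where d: "regs M' = (regs M)(25 := d)" "2 \<le> d" "d \<le> D + 1" "\<And>e. 2 \<le> e \<Longrightarrow> e < d \<Longrightarrow> \<not> e dvd r"
      "steps M' \<le> steps M + 3 * d" and o: "memory M' = memory M" "extent M' = extent M" "inbox M' = inbox M"
      "outbox M' = outbox M" "outputs M' = outputs M" "finished M' = finished M" "peak M' = peak M"
      by (auto simp: cond_def)
    have e: "r < d * d \<or> d dvd r" using 3(2) ev[of M' d] d r by (auto split: if_splits)
    show ?case
      by (rule Q[of _ d]) (use d o prime_iff_no_divisor[OF r(3) d(2,4) e] in \<open>simp_all add: machine_defs\<close>)
  qed
qed

lemma prod_primes_between_le: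
  "card (primes_between Y r) \<le> k \<Longrightarrow> r \<le> X \<Longrightarrow> 1 \<le> X \<Longrightarrow> \<Prod>(primes_between Y r) \<le> X ^ k"
proof -
  assume a: "card (primes_between Y r) \<le> k" "r \<le> X" "1 \<le> X"
  have "\<Prod>(primes_between Y r) \<le> (\<Prod>p\<in>primes_between Y r. X)"
    using a by (intro prod_mono) (auto simp: primes_between_def)
  also have "\<dots> \<le> X ^ k" using a by (simp add: power_increasing)
  finally show ?thesis .
qed

lemma primes_between_Suc:
  assumes "Y \<le> r"
  shows "primes_between Y (Suc r) = (if prime (Suc r) then insert (Suc r) (primes_between Y r) else primes_between Y r)"
    "Suc r \<notin> primes_between Y r"
  using assms by (auto simp: primes_between_def le_Suc_eq)

text \<open>The assumption on \<open>k\<close>, provided by \<open>many_primes\<close>, makes the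
  count reach \<open>k\<close> no later than at \<open>D * D\<close>; this ends the loop and keeps
  the product a word. Up to \<open>D * D\<close> candidates with up to about \<open>D\<close>
  divisors each give the cubic cost.\<close>

lemma wp_prime_loop:
  assumes k: "k \<le> card (primes_between Y (D * D))" "k < word_bound w" and Y: "2 \<le> Y" "Y \<le> D * D" "2 \<le> D"
    and W: "(D + 2) * (D + 2) < word_bound w" "(D * D) ^ k < word_bound w"
    and r: "regs M 22 = Y" "regs M 23 = 0" "regs M 24 = 1"
    and Q: "\<And>M' r. frame M M' \<Longrightarrow> outbox M' = outbox M \<Longrightarrow> memory M' = memory M \<Longrightarrow> extent M' = extent M \<Longrightarrow>
      regs M' 21 = regs M 21 \<Longrightarrow> regs M' 24 = \<Prod>(primes_between Y r) \<Longrightarrow> card (primes_between Y r) = k \<Longrightarrow> r \<le> D * D \<Longrightarrow>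
      steps M' \<le> steps M + D * D * (30 + 3 * D) + 2 \<Longrightarrow> Q M'"
  shows "wp w (prime_loop k) Q M"
proof -
  define cond where "cond M' \<longleftrightarrow> (\<exists>r. frame M M' \<and> outbox M' = outbox M \<and> memory M' = memory M \<and> extent M' = extent M \<and>
     regs M' 21 = regs M 21 \<and> regs M' 22 = r \<and> Y \<le> r \<and> r \<le> D * D \<and> regs M' 23 = card (primes_between Y r) \<and> regs M' 23 \<le> k \<and>
     regs M' 24 = \<Prod>(primes_between Y r) \<and> steps M' + Y * (30 + 3 * D) \<le> steps M + r * (30 + 3 * D))" for M' :: machine
  show ?thesis
    unfolding prime_loop_def
  proof (rule wp_While[where Inv = cond and \<mu> = "\<lambda>M. D * D - regs M 22"], goal_cases)
    case 1
    have "primes_between Y Y = {}" by (auto simp: primes_between_def)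
    then show ?case using r Y by (auto simp: cond_def frame_def)
  next
    case (2 M')
    then obtain r' where c: "frame M M'" "outbox M' = outbox M" "memory M' = memory M" "extent M' = extent M"
       "regs M' 21 = regs M 21" "regs M' 22 = r'" "Y \<le> r'" "r' \<le> D * D" "regs M' 23 = card (primes_between Y r')"
       "regs M' 24 = \<Prod>(primes_between Y r')" "steps M' + Y * (30 + 3 * D) \<le> steps M + r' * (30 + 3 * D)"
      by (auto simp: cond_def)
    have ck: "card (primes_between Y r') < k" using 2(2) c(9) k(2) by (auto simp: eval_rules split: if_splits)
    then have "r' \<noteq> D * D" using k(1) by auto
    then have rD: "Suc r' \<le> D * D" using c(8) by simp
    have DW: "D * D + 10 < word_bound w" using W(1) Y(3) by (simp add: algebra_simps)
    then have lt: "Suc r' < word_bound w" "2 < word_bound w" "Suc 0 < word_bound w" using rD by linarith+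
    note PS = primes_between_Suc[OF c(7)]
    define M2 where "M2 = M'\<lparr>regs := (regs M')(22 := Suc r', 25 := 2), steps := Suc (Suc (Suc (steps M')))\<rparr>"
    define R where "R = (\<lambda>Ma. cond Ma \<and> D * D - regs Ma 22 < D * D - regs M' 22)"
    have ev: "eval w (Reg 22 <\<^sub>e Reg 25 *\<^sub>e Reg 25) M3 = (if Suc r' < d * d then 1 else 0)"
      if "regs M3 22 = Suc r'" "regs M3 25 = d" "d \<le> D + 1" for M3 d
    proof -
      have "d * d \<le> (D + 1) * (D + 1)" using that(3) by (intro mult_le_mono)
      then have "d * d < word_bound w" using W by (simp add: algebra_simps)
      then show ?thesis using that by (simp add: eval_rules)
    qed
    have "wp w divisor_loop (wp w (If (Reg 22 <\<^sub>e Reg 25 *\<^sub>e Reg 25)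
          (Assign 24 (Reg 24 *\<^sub>e Reg 22) ;; Assign 23 (Reg 23 +\<^sub>e Const 1)) Skip) R) M2"
    proof (rule wp_divisor_loop[where r = "Suc r'" and D = D])
      fix M3 :: machine and d
      assume M3: "regs M3 = (regs M2)(25 := d)" "memory M3 = memory M2" "extent M3 = extent M2" "inbox M3 = inbox M2"
        "outbox M3 = outbox M2" "outputs M3 = outputs M2" "finished M3 = finished M2" "peak M3 = peak M2"
        "d \<le> D + 1" "prime (Suc r') \<longleftrightarrow> Suc r' < d * d" "steps M3 \<le> steps M2 + 10 + 3 * D"
      have st: "steps M3 + 5 + Y * (30 + 3 * D) \<le> steps M + Suc r' * (30 + 3 * D)"
        using M3(11) c(11) by (simp add: M2_def)
      have Sr: "D * D - Suc r' < D * D - regs M' 22" using rD c(6) by simp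
      show "wp w (If (Reg 22 <\<^sub>e Reg 25 *\<^sub>e Reg 25)
          (Assign 24 (Reg 24 *\<^sub>e Reg 22) ;; Assign 23 (Reg 23 +\<^sub>e Const 1)) Skip) R M3"
      proof (cases "prime (Suc r')")
        case True
        have cS: "card (primes_between Y (Suc r')) = Suc (card (primes_between Y r'))"
          "\<Prod>(primes_between Y (Suc r')) = \<Prod>(primes_between Y r') * Suc r'"
          using PS True by (simp_all add: mult.commute)
        have "\<Prod>(primes_between Y (Suc r')) \<le> (D * D) ^ k"
          using cS ck rD Y by (intro prod_primes_between_le) auto
        then have pl: "\<Prod>(primes_between Y r') * Suc r' < word_bound w" using W(2) cS by simp
        have kl: "Suc (card (primes_between Y r')) < word_bound w" using ck k(2) by simp
        show ?thesis
          using True M3(1,9,10) c(6,9,10) pl kl lt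
          apply (simp add: ev M2_def eval_rules(2) machine_defs)
          apply (simp add: eval_rules)
          unfolding R_def using M3 c cS rD st ck Sr
          apply (simp add: cond_def M2_def frame_def)
          done
      next
        case False
        have "primes_between Y (Suc r') = primes_between Y r'" using PS False by simp
        then show ?thesis
          using False M3(1,9,10)
          apply (simp add: ev M2_def machine_defs)
          unfolding R_def using M3 c rD st ck Sr
          apply (simp add: cond_def M2_def frame_def)
          done
      qed
    qed (use Y rD c W in \<open>simp_all add: M2_def\<close>)
    then show ?case
      using c(6) lt by (simp add: M2_def R_def machine_defs eval_rules(1,2,6))
  next
    case (3 M')
    then obtain r' where c: "frame M M'" "outbox M' = outbox M" "memory M' = memory M" "extent M' = extent M"
       "regs M' 21 = regs M 21" "regs M' 22 = r'" "Y \<le> r'" "r' \<le> D * D" "regs M' 23 = card (primes_between Y r')" "regs M' 23 \<le> k"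
       "regs M' 24 = \<Prod>(primes_between Y r')" "steps M' + Y * (30 + 3 * D) \<le> steps M + r' * (30 + 3 * D)"
      by (auto simp: cond_def)
    have ck: "card (primes_between Y r') = k" using 3(2) c(9,10) k(2) by (auto simp: eval_rules split: if_splits)
    have "r' * (30 + 3 * D) \<le> D * D * (30 + 3 * D)" by (rule mult_le_mono1[OF c(8)])
    then have "steps M' \<le> steps M + D * D * (30 + 3 * D)" using c(12) by linarith
    then show ?case
      by (intro Q[of _ r']) (use c ck in \<open>simp_all add: machine_defs frame_def\<close>)
  qed
qed


text \<open>Taking the least \<open>r\<close> makes the set a function of \<open>Y\<close> and
  \<open>k\<close>; by \<open>first_primes_eq\<close> the set found does not depend on the exact
  number at which the search stops.\<close>

definition first_primes :: "nat \<Rightarrow> nat \<Rightarrow> nat set" where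
  "first_primes Y k = primes_between Y (LEAST r. card (primes_between Y r) = k)"

lemma first_primes_eq: "card (primes_between Y r) = k \<Longrightarrow> primes_between Y r = first_primes Y k"
proof -
  assume r: "card (primes_between Y r) = k"
  define r0 where "r0 = (LEAST r. card (primes_between Y r) = k)"
  have r0: "card (primes_between Y r0) = k" "r0 \<le> r"
    unfolding r0_def using r by (auto intro: LeastI Least_le)
  then have "primes_between Y r0 \<subseteq> primes_between Y r" by (auto simp: primes_between_def)
  then have "primes_between Y r0 = primes_between Y r"
    using r r0 by (intro card_subset_eq) auto
  then show ?thesis by (simp add: first_primes_def r0_def)
qed

definition send_modulus :: program where
  "send_modulus =
     For 20 (Reg 2)
       (Send (Reg 20) (Reg 8) ;; Send (Reg 20) (Reg 9) ;; Send (Reg 20) (Reg 10) ;; Send (Reg 20) (Reg 11))"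

text \<open>\<open>Const 0 -\<^sub>e Const 1\<close> is the largest word; the word bound itself is
  not a word. Register 11 becomes a divisor large enough to keep letter hashes below the
  \<open>J\<close>-th power of register 21.\<close>

definition choose_modulus :: "nat \<Rightarrow> nat \<Rightarrow> program" where
  "choose_modulus k J =
     (Assign 20 (Const 1) ;; root_loop ;;
      Assign 21 (Const 256 *\<^sub>e power_expr 7 (Reg 20)) ;; Assign 22 (Reg 21) ;;
      Assign 23 (Const 0) ;; Assign 24 (Const 1) ;;
      prime_loop k ;;
      Assign 8 (Reg 24) ;; Assign 9 (Reg 9 mod\<^sub>e Reg 8) ;;
      Assign 11 ((Const 0 -\<^sub>e Const 1) div\<^sub>e power_expr J (Reg 21) +\<^sub>e Const 1) ;;
      send_modulus)"

lemma wp_root_loop: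
  assumes r: "regs M 0 = n" "regs M 20 = 1" and v: "1 \<le> v" "v ^ 12 \<le> n" "n < (v + 1) ^ 12"
    and W: "4096 * n + 1 < word_bound w"
    and Q: "\<And>M'. frame M M' \<Longrightarrow> outbox M' = outbox M \<Longrightarrow> memory M' = memory M \<Longrightarrow> extent M' = extent M \<Longrightarrow>
      regs M' 20 = v \<Longrightarrow> steps M' \<le> steps M + 3 * n + 5 \<Longrightarrow> Q M'"
  shows "wp w root_loop Q M"
proof -
  define cond where "cond M' \<longleftrightarrow> frame M M' \<and> outbox M' = outbox M \<and> memory M' = memory M \<and> extent M' = extent M \<and>
     1 \<le> regs M' 20 \<and> regs M' 20 \<le> v \<and> steps M' \<le> steps M + 3 * regs M' 20" for M'
  have vn: "v \<le> n" using v(1,2) self_le_power[of v 12] by linarith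
  have ev: "eval w (power_expr 12 (Reg 20 +\<^sub>e Const 1) <\<^sub>e Reg 0 +\<^sub>e Const 1) M' = (if regs M' 20 < v then 1 else 0)"
    if c: "cond M'" for M'
  proof -
    define u where "u = regs M' 20"
    have u: "1 \<le> u" "u \<le> v" using c by (auto simp: cond_def u_def)
    \<comment> \<open>\<open>4096\<close> is two to the twelfth: the guard evaluates the power one
      beyond the root, and that value must still be a word.\<close>
    have "(u + 1) ^ 12 \<le> (2 * u) ^ 12" using u by (intro power_mono) auto
    also have "\<dots> = 4096 * u ^ 12" by (simp add: power_mult_distrib)
    also have "\<dots> \<le> 4096 * v ^ 12" using u by (intro mult_left_mono power_mono) auto
    finally have pu: "(u + 1) ^ 12 \<le> 4096 * n" using v(2) by linarith
    have uW: "u + 1 < word_bound w" "1 < word_bound w" using u vn W v(1) by linarith+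
    have e: "eval w (Reg 20 +\<^sub>e Const 1) M' = u + 1"
      using uW by (simp add: eval_rules u_def[symmetric])
    have "eval w (power_expr 12 (Reg 20 +\<^sub>e Const 1)) M' = (u + 1) ^ 12"
      using pu W uW by (intro eval_power_expr[OF e]) auto
    moreover have "(u + 1) ^ 12 < n + 1 \<longleftrightarrow> u < v"
    proof
      assume "u < v"
      then have "(u + 1) ^ 12 \<le> v ^ 12" by (intro power_mono) auto
      with v show "(u + 1) ^ 12 < n + 1" by linarith
    next
      assume "(u + 1) ^ 12 < n + 1"
      then have "u + 1 < v + 1" using v(3) u by (metis Suc_eq_plus1 less_Suc_eq_le not_less order.strict_trans1 le_antisym)
      then show "u < v" by simp
    qed
    moreover have "regs M' 0 = n" using c frameD[of M M'] r by (simp add: cond_def)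
    ultimately show ?thesis using W uW by (simp add: eval_rules(1,2,6,11) u_def)
  qed
  show ?thesis
    unfolding root_loop_def
  proof (rule wp_While[where Inv = cond and \<mu> = "\<lambda>M. v - regs M 20"], goal_cases)
    case 1
    show ?case using r v by (simp add: cond_def)
  next
    case (2 M')
    have lt: "regs M' 20 < v" using 2 ev[OF 2(1)] by (auto split: if_splits)
    then have l: "Suc (regs M' 20) < word_bound w" "Suc 0 < word_bound w" using vn W by linarith+
    show ?case
      using l apply (simp add: eval_rules machine_defs)
      using 2(1) lt apply (auto simp: cond_def frame_def)
      done
  next
    case (3 M')
    have "regs M' 20 = v" using 3 ev[OF 3(1)] by (auto simp: cond_def split: if_splits)
    then show ?case using 3(1) vn by (intro Q) (auto simp: cond_def machine_defs frame_def)
  qed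
qed

context params
begin

lemma wp_send_modulus:
  assumes r: "regs M 2 = m" "regs M 8 = a" "regs M 9 = b" "regs M 10 = c" "regs M 11 = d"
    and Q: "\<And>M'. frame M M' \<Longrightarrow> memory M' = memory M \<Longrightarrow> extent M' = extent M \<Longrightarrow>
      outbox M' = outbox M @ concat (map (\<lambda>r. [(r, a), (r, b), (r, c), (r, d)]) [0..<m]) \<Longrightarrow> steps M' \<le> steps M + 10 * B \<Longrightarrow> Q M'"
  shows "wp w send_modulus Q M"
proof -
  define J where "J i M' \<longleftrightarrow> frame M M' \<and> memory M' = memory M \<and> extent M' = extent M \<and>
      outbox M' = outbox M @ concat (map (\<lambda>r. [(r, a), (r, b), (r, c), (r, d)]) [0..<i]) \<and> steps M' \<le> steps M + 2 + 6 * i" for i M'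
  show ?thesis
    unfolding send_modulus_def
  proof (rule wp_For[where N = m and J = J], goal_cases)
    case 1 show ?case using small by linarith
  next
    case 2 show ?case by (simp add: J_def machine_defs frame_def)
  next
    case (3 i M')
    then have "frame M M'" by (simp add: J_def)
    from frameD[OF this] show ?case using r by (simp add: eval_rules)
  next
    case (4 i M')
    then have "frame M M'" by (simp add: J_def)
    note r' = frameD(9-12)[OF this]
    show ?case
      apply (simp add: machine_defs eval_rules r' r)
      using 4 apply (simp add: J_def frame_def)
      done
  next
    case (5 M')
    then show ?case using m_le_B B_pos by (intro Q) (auto simp: J_def machine_defs frame_def)
  qed
qed

lemma wp_choose_modulus:
  assumes D_def: "D = 2 ^ (k + 10) * v ^ 4"
    and r: "regs M 0 = n" "regs M 2 = m" "regs M 9 = x" "regs M 10 = \<alpha>"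
    and v: "1 \<le> v" "v ^ 12 \<le> n" "n < (v + 1) ^ 12"
    and W': "4096 * n + 1 < word_bound w" "(D + 2) * (D + 2) < word_bound w" "(D * D) ^ k < word_bound w" "k < word_bound w"
      "(256 * v ^ 7) ^ J < word_bound w" "(word_bound w - 1) div ((256 * v ^ 7) ^ J) + 1 < word_bound w"
    and Q: "\<And>M' Mo. Mo = \<Prod>(first_primes (256 * v ^ 7) k) \<Longrightarrow>
      regs M' = (regs M')(0 := regs M 0, Suc 0 := regs M (Suc 0), 2 := regs M 2, 3 := regs M 3, 4 := regs M 4, 5 := regs M 5, 6 := regs M 6, 7 := regs M 7) \<Longrightarrow>
      memory M' = memory M \<Longrightarrow> extent M' = extent M \<Longrightarrow> inbox M' = inbox M \<Longrightarrow> outputs M' = outputs M \<Longrightarrow>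
      finished M' = finished M \<Longrightarrow> peak M' = peak M \<Longrightarrow>
      outbox M' = outbox M @ concat (map (\<lambda>r. [(r, Mo), (r, x mod Mo), (r, \<alpha>), (r, (word_bound w - 1) div ((256 * v ^ 7) ^ J) + 1)]) [0..<m]) \<Longrightarrow>
      card (first_primes (256 * v ^ 7) k) = k \<Longrightarrow> (\<And>p. p \<in> first_primes (256 * v ^ 7) k \<Longrightarrow> prime p \<and> 256 * v ^ 7 < p \<and> p \<le> D * D) \<Longrightarrow>
      steps M' \<le> steps M + 3 * n + D * D * (30 + 3 * D) + 20 * B + 20 \<Longrightarrow> Q M'"
  shows "wp w (choose_modulus k J) Q M"
proof -
  define Y where "Y = 256 * v ^ 7"
  have k: "k \<le> card (primes_between Y (D * D))"
    using many_primes[OF v(1), of k] by (simp add: D_def Y_def power2_eq_square)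
  have v7: "1 \<le> v ^ 7" "1 \<le> v ^ 4" using v(1) by simp_all
  have Y: "2 \<le> Y" using v7 by (simp add: Y_def)
  have D2: "2 \<le> D"
  proof -
    have "(2::nat) ^ 1 * 1 \<le> 2 ^ (k + 10) * v ^ 4" using v7 by (intro mult_le_mono power_increasing) auto
    then show ?thesis by (simp add: D_def)
  qed
  have YD: "Y \<le> D * D"
  proof -
    have "(256::nat) \<le> 2 ^ (2 * k + 20)"
      using power_increasing[of 8 "2 * k + 20" "2::nat"] by simp
    moreover have "v ^ 7 \<le> v ^ 8" using v(1) by (intro power_increasing) auto
    ultimately have "Y \<le> 2 ^ (2 * k + 20) * v ^ 8" unfolding Y_def by (rule mult_le_mono)
    also have "2 ^ (2 * k + 20) * v ^ 8 = (2 ^ (k + 10) * 2 ^ (k + 10)) * (v ^ 4 * v ^ 4)"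
      unfolding power_add[symmetric] by (intro arg_cong2[where f = times] arg_cong2[where f = power]) auto
    also have "\<dots> = D * D" by (simp add: D_def ac_simps)
    finally show ?thesis .
  qed
  have DW: "D * D + 10 < word_bound w" using W'(2) D2 by (simp add: algebra_simps)
  have YW: "Y < word_bound w" "256 < word_bound w" "v ^ 7 < word_bound w" "1 < word_bound w"
    using YD DW v7 by (auto simp: Y_def)
  define Wq where "Wq = (word_bound w - 1) div (Y ^ J) + 1"
  have s1: "wp w root_loop (wp w (Assign 21 (Const 256 *\<^sub>e power_expr 7 (Reg 20)) ;; Assign 22 (Reg 21) ;;
      Assign 23 (Const 0) ;; Assign 24 (Const 1) ;; prime_loop k ;;
      Assign 8 (Reg 24) ;; Assign 9 (Reg 9 mod\<^sub>e Reg 8) ;;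
      Assign 11 ((Const 0 -\<^sub>e Const 1) div\<^sub>e power_expr J (Reg 21) +\<^sub>e Const 1) ;; send_modulus) Q) (tick (set_reg 20 1 M))"
  proof (rule wp_root_loop[OF _ _ v W'(1)])
    fix M1
    assume M1: "frame (tick (set_reg 20 1 M)) M1" "outbox M1 = outbox (tick (set_reg 20 1 M))" "memory M1 = memory (tick (set_reg 20 1 M))"
      "extent M1 = extent (tick (set_reg 20 1 M))" "regs M1 20 = v" "steps M1 \<le> steps (tick (set_reg 20 1 M)) + 3 * n + 5"
    have f1: "frame M M1" using M1(1) by (simp add: frame_def machine_defs)
    have e1: "eval w (Const 256 *\<^sub>e power_expr 7 (Reg 20)) M1 = Y"
    proof -
      have "eval w (power_expr 7 (Reg 20)) M1 = v ^ 7"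
        using YW v(1) M1(5) by (intro eval_power_expr) (simp_all add: eval_rules)
      then show ?thesis using YW by (simp add: eval_rules(1,8) Y_def)
    qed
    define M2 where "M2 = M1\<lparr>regs := (regs M1)(21 := Y, 22 := Y, 23 := 0, 24 := 1), steps := Suc (Suc (Suc (Suc (steps M1))))\<rparr>"
    have f2: "frame M M2" using f1 by (simp add: M2_def frame_def)
    have s2: "wp w (prime_loop k) (wp w (Assign 8 (Reg 24) ;; Assign 9 (Reg 9 mod\<^sub>e Reg 8) ;;
      Assign 11 ((Const 0 -\<^sub>e Const 1) div\<^sub>e power_expr J (Reg 21) +\<^sub>e Const 1) ;; send_modulus) Q) M2"
    proof (rule wp_prime_loop[OF k W'(4) Y YD D2 W'(2,3)])
      fix M3 r'
      assume M3: "frame M2 M3" "outbox M3 = outbox M2" "memory M3 = memory M2" "extent M3 = extent M2"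
       "regs M3 21 = regs M2 21" "regs M3 24 = \<Prod>(primes_between Y r')" "card (primes_between Y r') = k" "r' \<le> D * D"
       "steps M3 \<le> steps M2 + D * D * (30 + 3 * D) + 2"
      note fp = first_primes_eq[OF M3(7)]
      define Mo where "Mo = \<Prod>(first_primes Y k)"
      have f3: "frame M M3" by (rule frame_trans[OF f2 M3(1)])
      have r24: "regs M3 24 = Mo" using M3(6) fp by (simp add: Mo_def)
      have r3: "regs M3 9 = x" "regs M3 10 = \<alpha>" "regs M3 2 = m" "regs M3 21 = Y"
        using frameD[OF f3] r M3(5) by (simp_all add: M2_def)
      define M4 where "M4 = M3\<lparr>regs := (regs M3)(8 := Mo, 9 := x mod Mo, 11 := Wq), steps := Suc (Suc (Suc (steps M3)))\<rparr>"
      have e4: "eval w ((Const 0 -\<^sub>e Const 1) div\<^sub>e power_expr J (Reg 21) +\<^sub>e Const 1) M5 = Wq" if "regs M5 21 = Y" for M5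
      proof -
        have p: "eval w (power_expr J (Reg 21)) M5 = Y ^ J"
          using that W'(5) Y YW by (intro eval_power_expr) (simp_all add: eval_rules Y_def)
        have "wsub w 0 1 = word_bound w - 1" using YW by (simp add: wsub_def)
        then show ?thesis using p W'(6) YW by (simp add: eval_rules(1,6,7,9) Wq_def Y_def)
      qed
      have "wp w send_modulus Q M4"
      proof (rule wp_send_modulus[where a = Mo and b = "x mod Mo" and c = \<alpha> and d = Wq])
        fix M5
        assume M5: "frame M4 M5" "memory M5 = memory M4" "extent M5 = extent M4"
          "outbox M5 = outbox M4 @ concat (map (\<lambda>r. [(r, Mo), (r, x mod Mo), (r, \<alpha>), (r, Wq)]) [0..<m])" "steps M5 \<le> steps M4 + 10 * B"
        note a3 = frameD[OF f3] and a5 = frameD[OF M5(1)]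
        show "Q M5"
        proof (rule Q[of Mo])
          show "Mo = \<Prod>(first_primes (256 * v ^ 7) k)" by (simp add: Mo_def Y_def)
          show "regs M5 = (regs M5)(0 := regs M 0, Suc 0 := regs M (Suc 0), 2 := regs M 2, 3 := regs M 3, 4 := regs M 4, 5 := regs M 5, 6 := regs M 6, 7 := regs M 7)"
            using a3 a5 by (simp add: M4_def fun_eq_iff)
          show "outbox M5 = outbox M @ concat (map (\<lambda>r. [(r, Mo), (r, x mod Mo), (r, \<alpha>), (r, (word_bound w - 1) div ((256 * v ^ 7) ^ J) + 1)]) [0..<m])"
            using M5(4) M3(2) M1(2) by (simp add: M4_def M2_def Wq_def Y_def machine_defs)
          show "card (first_primes (256 * v ^ 7) k) = k" using M3(7) fp by (simp add: Y_def)
          show "prime p \<and> 256 * v ^ 7 < p \<and> p \<le> D * D" if "p \<in> first_primes (256 * v ^ 7) k" for p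
          proof -
            have "p \<in> primes_between Y r'" using that fp by (simp add: Y_def)
            then show ?thesis using M3(8) by (auto simp: primes_between_def Y_def)
          qed
          show "steps M5 \<le> steps M + 3 * n + D * D * (30 + 3 * D) + 20 * B + 20"
            using M5(5) M3(9) M1(6) B_pos by (simp add: M4_def M2_def machine_defs)
        qed (use a3 a5 M5 M3 M1 in \<open>simp_all add: M4_def M2_def machine_defs\<close>)
      qed (use r3 in \<open>simp_all add: M4_def\<close>)
      then show "wp w (Assign 8 (Reg 24) ;; Assign 9 (Reg 9 mod\<^sub>e Reg 8) ;;
          Assign 11 ((Const 0 -\<^sub>e Const 1) div\<^sub>e power_expr J (Reg 21) +\<^sub>e Const 1) ;; send_modulus) Q M3"
        using r24 r3 by (simp add: M4_def machine_defs e4[unfolded One_nat_def] eval_rules(2,10))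
    qed (simp_all add: M2_def)
    then show "wp w (Assign 21 (Const 256 *\<^sub>e power_expr 7 (Reg 20)) ;; Assign 22 (Reg 21) ;;
      Assign 23 (Const 0) ;; Assign 24 (Const 1) ;; prime_loop k ;;
      Assign 8 (Reg 24) ;; Assign 9 (Reg 9 mod\<^sub>e Reg 8) ;;
      Assign 11 ((Const 0 -\<^sub>e Const 1) div\<^sub>e power_expr J (Reg 21) +\<^sub>e Const 1) ;; send_modulus) Q M1"
      using YW by (simp add: M2_def machine_defs e1 eval_rules(1,2))
  qed (use r in \<open>simp_all add: machine_defs\<close>)
  then show ?thesis
    unfolding choose_modulus_def using YW by (simp add: eval_rules(1) machine_defs)
qed

end

section \<open>Collisions\<close>

text \<open>Lagrange's bound, by splitting off a root: modulo a prime a product vanishes only if a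
  factor does. Working with divisibility in the integers lets one polynomial be used for all primes
  at once.\<close>

lemma card_poly_roots_mod_prime:
  assumes p: "prime (p::nat)" and f: "\<not> [:int p:] dvd f"
  shows "card {x. x < p \<and> int p dvd poly f (int x)} \<le> degree f"
  using f
proof (induction "degree f" arbitrary: f)
  case 0
  then obtain c where c: "f = [:c:]" by (metis degree_eq_zeroE)
  then have "\<not> int p dvd c" using 0 by (auto simp: const_poly_dvd_const_poly_iff)
  then show ?case by (simp add: c)
next
  case (Suc d)
  show ?case
  proof (cases "\<exists>r. r < p \<and> int p dvd poly f (int r)")
    case True
    then obtain r where r: "r < p" "int p dvd poly f (int r)" by blast
    define h where "h = synthetic_div f (int r)"
    have f: "f = [:- int r, 1:] * h + [:poly f (int r):]"
      using synthetic_div_correct'[of "int r" f] by (simp add: h_def)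
    have dh: "d = degree h" using Suc.hyps(2) by (simp add: h_def degree_synthetic_div)
    have nh: "\<not> [:int p:] dvd h"
    proof
      assume "[:int p:] dvd h"
      moreover have "[:int p:] dvd [:poly f (int r):]" using r(2) by (simp add: const_poly_dvd_const_poly_iff)
      ultimately have "[:int p:] dvd [:- int r, 1:] * h + [:poly f (int r):]" by (intro dvd_add dvd_mult)
      with f Suc.prems show False by simp
    qed
    have "{x. x < p \<and> int p dvd poly f (int x)} \<subseteq> insert r {x. x < p \<and> int p dvd poly h (int x)}"
    proof
      fix x assume "x \<in> {x. x < p \<and> int p dvd poly f (int x)}"
      then have x: "x < p" "int p dvd poly f (int x)" by auto
      have "poly f (int x) = (int x - int r) * poly h (int x) + poly f (int r)"
        by (subst f) (simp add: algebra_simps)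
      then have "int p dvd (int x - int r) * poly h (int x)"
        using x(2) r(2) by (metis dvd_add_left_iff)
      then have "int p dvd int x - int r \<or> int p dvd poly h (int x)"
        using p by (simp add: prime_dvd_mult_iff)
      moreover have "x = r" if "int p dvd int x - int r"
        using that x(1) r(1) by (metis mod_eq_dvd_iff mod_less of_nat_eq_iff zmod_int)
      ultimately show "x \<in> insert r {x. x < p \<and> int p dvd poly h (int x)}" using x by auto
    qed
    then have "card {x. x < p \<and> int p dvd poly f (int x)} \<le> card (insert r {x. x < p \<and> int p dvd poly h (int x)})"
      by (rule card_mono[rotated]) simp
    also have "\<dots> \<le> Suc (card {x. x < p \<and> int p dvd poly h (int x)})"
      by (rule card_insert_le_m1) simp_all
    also have "\<dots> \<le> Suc d" using Suc.hyps(1)[OF dh nh] dh by simp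
    finally show ?thesis using Suc.hyps(2) by simp
  next
    case False
    then have "{x. x < p \<and> int p dvd poly f (int x)} = {}" by blast
    then show ?thesis by (simp only: card.empty le0)
  qed
qed

text \<open>Chinese remainder theorem: \<open>x\<close> is determined by its quotient by the product
  and its residues modulo the primes. The summand 1 accounts for the incomplete last period.\<close>

lemma card_simultaneous_residues:
  assumes fin: "finite A" and pr: "\<And>p. p \<in> A \<Longrightarrow> prime (p::nat)"
    and R: "\<And>p. p \<in> A \<Longrightarrow> finite (R p) \<and> card (R p) \<le> d"
  shows "card {x. x < N \<and> (\<forall>p\<in>A. x mod p \<in> R p)} \<le> (N div \<Prod>A + 1) * d ^ card A"
proof -
  define P where "P = \<Prod>A"
  have P: "0 < P" unfolding P_def using pr by (intro prod_pos) (auto dest: prime_gt_0_nat)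
  define h where "h x = (x div P, restrict (\<lambda>p. x mod p) A)" for x
  let ?X = "{x. x < N \<and> (\<forall>p\<in>A. x mod p \<in> R p)}"
  have inj: "inj_on h ?X"
  proof (rule inj_onI)
    fix x y assume "h x = h y"
    then have d: "x div P = y div P" and m: "\<And>p. p \<in> A \<Longrightarrow> x mod p = y mod p"
      unfolding h_def by (auto simp: restrict_def fun_eq_iff split: if_splits)
    have "[x = y] (mod P)"
      unfolding P_def
    proof (rule coprime_cong_prod_nat)
      show "coprime p q" if "p \<in> A" "q \<in> A" "p \<noteq> q" for p q
        using that pr primes_coprime by blast
    qed (use m in \<open>auto simp: cong_def\<close>)
    with d show "x = y" by (metis cong_def div_mult_mod_eq)
  qed
  have sub: "h ` ?X \<subseteq> {..N div P} \<times> Pi\<^sub>E A R"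
    by (auto simp: h_def intro!: div_le_mono)
  have finR: "finite (Pi\<^sub>E A R)" using fin R by (intro finite_PiE) auto
  have "card ?X = card (h ` ?X)" using inj by (simp add: card_image)
  also have "\<dots> \<le> card ({..N div P} \<times> Pi\<^sub>E A R)" using sub finR by (intro card_mono) auto
  also have "\<dots> = (N div P + 1) * (\<Prod>p\<in>A. card (R p))" by (simp add: card_cartesian_product card_PiE fin)
  also have "\<dots> \<le> (N div P + 1) * (\<Prod>p\<in>A. d)" using R by (intro mult_le_mono2 prod_mono) auto
  finally show ?thesis by (simp add: P_def)
qed

lemma card_interval_multiples:
  assumes "0 < (\<delta>::nat)"
  shows "finite {a. u \<le> \<delta> * a \<and> \<delta> * a < u + q}" "card {a. u \<le> \<delta> * a \<and> \<delta> * a < u + q} \<le> q div \<delta> + 1"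
proof -
  define a0 where "a0 = (u + \<delta> - 1) div \<delta>"
  have a0: "a0 \<le> a" if "u \<le> \<delta> * a" for a
  proof -
    have "u + \<delta> - 1 < \<delta> * (a + 1)" using that assms by (simp add: algebra_simps)
    then have "a0 < a + 1" unfolding a0_def using assms by (simp add: less_mult_imp_div_less mult.commute)
    then show ?thesis by simp
  qed
  have ua0: "u \<le> \<delta> * a0"
  proof -
    have "u + \<delta> - 1 < \<delta> * a0 + \<delta>" unfolding a0_def using assms
      by (metis add.commute div_mod_decomp mod_less_divisor mult.commute nat_add_left_cancel_less)
    then show ?thesis using assms by simp
  qed
  have sub: "{a. u \<le> \<delta> * a \<and> \<delta> * a < u + q} \<subseteq> {a0..a0 + q div \<delta>}"
  proof
    fix a assume "a \<in> {a. u \<le> \<delta> * a \<and> \<delta> * a < u + q}"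
    then have a: "u \<le> \<delta> * a" "\<delta> * a < u + q" by auto
    have "a0 \<le> a" by (rule a0[OF a(1)])
    moreover have "\<delta> * (a - a0) \<le> q" using a ua0 by (simp add: diff_mult_distrib2)
    then have "a - a0 \<le> q div \<delta>" using assms by (simp add: less_eq_div_iff_mult_less_eq mult.commute)
    ultimately show "a \<in> {a0..a0 + q div \<delta>}" by auto
  qed
  show "finite {a. u \<le> \<delta> * a \<and> \<delta> * a < u + q}" by (rule finite_subset[OF sub]) simp
  show "card {a. u \<le> \<delta> * a \<and> \<delta> * a < u + q} \<le> q div \<delta> + 1"
    using card_mono[OF _ sub] by simp
qed

text \<open>While \<open>a\<close> runs below \<open>W\<close>, the number
  \<open>\<delta> * a + c\<close> completes at most \<open>\<delta> + c div W\<close> turns modulo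
  \<open>W\<close>; in each turn the admissible multiples of \<open>\<delta>\<close> lie in an
  interval of length \<open>q\<close>.\<close>

lemma card_small_residue:
  assumes "0 < (\<delta>::nat)" "0 < W"
  shows "card {a. a < W \<and> (\<delta> * a + c) mod W < q} \<le> (\<delta> + 1 + c div W) * (q div \<delta> + 1)"
proof -
  define I where "I h = {a. h * W - c \<le> \<delta> * a \<and> \<delta> * a < h * W - c + q}" for h
  have sub: "{a. a < W \<and> (\<delta> * a + c) mod W < q} \<subseteq> (\<Union>h\<in>{..\<delta> + c div W}. I h)"
  proof
    fix a assume "a \<in> {a. a < W \<and> (\<delta> * a + c) mod W < q}"
    then have a: "a < W" "(\<delta> * a + c) mod W < q" by auto
    define h where "h = (\<delta> * a + c) div W"
    have e: "\<delta> * a + c = h * W + (\<delta> * a + c) mod W" by (simp add: h_def)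
    have "\<delta> * a \<le> \<delta> * W" using a by simp
    then have "h \<le> (\<delta> * W + c) div W" unfolding h_def by (intro div_le_mono) simp
    then have "h \<le> \<delta> + c div W" using assms by (simp add: div_mult_self1 add.commute)
    moreover have "a \<in> I h" using e a(2) by (auto simp: I_def)
    ultimately show "a \<in> (\<Union>h\<in>{..\<delta> + c div W}. I h)" by auto
  qed
  have fin: "finite (I h)" and cI: "card (I h) \<le> q div \<delta> + 1" for h
    using card_interval_multiples[OF assms(1)] by (auto simp: I_def)
  have "card {a. a < W \<and> (\<delta> * a + c) mod W < q} \<le> card (\<Union>h\<in>{..\<delta> + c div W}. I h)"
    by (rule card_mono[OF _ sub]) (use fin in auto)
  also have "\<dots> \<le> (\<Sum>h\<in>{..\<delta> + c div W}. card (I h))" by (rule card_UN_le) simp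
  also have "\<dots> \<le> (\<Sum>h\<in>{..\<delta> + c div W}. q div \<delta> + 1)" by (intro sum_mono cI)
  also have "\<dots> = (\<delta> + 1 + c div W) * (q div \<delta> + 1)" by simp
  finally show ?thesis .
qed

text \<open>Equal quotients put the two residues within \<open>q\<close> of each other, so
  \<open>\<delta> * \<alpha>\<close> is within \<open>q\<close> of a multiple of \<open>W\<close>;
  adding \<open>q\<close> turns this into a residue below \<open>2 * q\<close>. A larger difference
  \<open>\<delta>\<close> means more turns but fewer hits per turn, so the bound is of order
  \<open>q + s\<close> and not \<open>q * s\<close>.\<close>

lemma card_quotient_collisions:
  assumes "a < b" "b \<le> s" "0 < W" "0 < q" "q < W"
  shows "card {\<alpha>. \<alpha> < W \<and> (\<alpha> * a mod W) div q = (\<alpha> * b mod W) div q} \<le> 12 * (q + s)"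
proof -
  define \<delta> where "\<delta> = b - a"
  have \<delta>: "0 < \<delta>" "\<delta> \<le> s" "b = a + \<delta>" using assms by (auto simp: \<delta>_def)
  have sub: "{\<alpha>. \<alpha> < W \<and> (\<alpha> * a mod W) div q = (\<alpha> * b mod W) div q} \<subseteq> {\<alpha>. \<alpha> < W \<and> (\<delta> * \<alpha> + q) mod W < 2 * q}"
  proof
    fix \<alpha> assume "\<alpha> \<in> {\<alpha>. \<alpha> < W \<and> (\<alpha> * a mod W) div q = (\<alpha> * b mod W) div q}"
    then have al: "\<alpha> < W" "(\<alpha> * a mod W) div q = (\<alpha> * b mod W) div q" by auto
    define x where "x = \<alpha> * a mod W"
    define y where "y = \<alpha> * b mod W"
    have xy: "y < x + q" "x < y + q"
    proof -
      have "x div q = y div q" using al(2) by (simp add: x_def y_def)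
      then have "x = x div q * q + x mod q" "y = x div q * q + y mod q" by (metis div_mult_mod_eq)+
      moreover have "x mod q < q" "y mod q < q" using assms by simp_all
      ultimately show "y < x + q" "x < y + q" by linarith+
    qed
    have "[x + \<delta> * \<alpha> = y] (mod W)"
      unfolding x_def y_def \<delta>(3) by (simp add: cong_def mod_add_right_eq algebra_simps)
    then have "[\<delta> * \<alpha> + q + x = (y + q - x) + x] (mod W)"
      using xy cong_add[of "x + \<delta> * \<alpha>" y W q q] by (simp add: algebra_simps)
    then have "[\<delta> * \<alpha> + q = y + q - x] (mod W)" by (simp only: cong_add_rcancel_nat)
    then have "(\<delta> * \<alpha> + q) mod W = (y + q - x) mod W" by (simp add: cong_def)
    also have "\<dots> \<le> y + q - x" by (rule mod_less_eq_dividend)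
    also have "\<dots> < 2 * q" using xy by linarith
    finally show "\<alpha> \<in> {\<alpha>. \<alpha> < W \<and> (\<delta> * \<alpha> + q) mod W < 2 * q}" using al by simp
  qed
  have "card {\<alpha>. \<alpha> < W \<and> (\<alpha> * a mod W) div q = (\<alpha> * b mod W) div q} \<le> card {\<alpha>. \<alpha> < W \<and> (\<delta> * \<alpha> + q) mod W < 2 * q}"
    by (rule card_mono[OF _ sub]) simp
  also have "\<dots> \<le> (\<delta> + 1 + q div W) * (2 * q div \<delta> + 1)" by (rule card_small_residue[OF \<delta>(1) assms(3)])
  also have "\<dots> = (\<delta> + 1) * (2 * q div \<delta> + 1)" using assms by simp
  also have "\<dots> \<le> 2 * \<delta> * (2 * q div \<delta> + 1)" using \<delta> by (intro mult_le_mono1) simp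
  also have "\<dots> = 2 * (\<delta> * (2 * q div \<delta>)) + 2 * \<delta>" by (simp add: algebra_simps)
  also have "\<delta> * (2 * q div \<delta>) \<le> 2 * q" by simp
  also have "2 * (2 * q) + 2 * \<delta> \<le> 12 * (q + s)" using \<delta> by simp
  finally show ?thesis by simp
qed


section \<open>Rounds\<close>

definition msgs :: "(nat \<times> nat) list \<Rightarrow> nat \<Rightarrow> nat list" where
  "msgs ob j = map snd (filter (\<lambda>(d, v). d = j) ob)"

lemma msgs_Nil [simp]: "msgs [] j = []"
  and msgs_Cons [simp]: "msgs ((d, v) # ob) j = (if d = j then v # msgs ob j else msgs ob j)"
  and msgs_append [simp]: "msgs (a @ b) j = msgs a j @ msgs b j"
  by (auto simp: msgs_def)

lemma msgs_concat: "msgs (concat xs) j = concat (map (\<lambda>x. msgs x j) xs)"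
  by (induction xs) auto

lemma msgs_map: "msgs (map f xs) j = concat (map (\<lambda>x. msgs [f x] j) xs)"
  by (induction xs) (auto split: prod.split simp: msgs_def)

lemma concat_map_single:
  "distinct xs \<Longrightarrow> a \<in> set xs \<Longrightarrow> (\<And>x. x \<in> set xs \<Longrightarrow> x \<noteq> a \<Longrightarrow> f x = []) \<Longrightarrow> concat (map f xs) = f a"
proof (induction xs)
  case (Cons x xs)
  show ?case
  proof (cases "x = a")
    case True
    then have "\<forall>y\<in>set xs. f y = []" using Cons.prems by auto
    then have "concat (map f xs) = []" by simp
    with True show ?thesis by simp
  next
    case False
    then show ?thesis using Cons by simp
  qed
qed simp

lemma msgs_all_to_all:
  "j < m \<Longrightarrow> (\<And>i. i < m \<Longrightarrow> msgs (L i) j = (if i = j then K else [])) \<Longrightarrow> msgs (concat (map L [0..<m])) j = K"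
  unfolding msgs_concat map_map o_def
  by (subst concat_map_single[where a = j]) auto

lemma snd_incoming: "map snd (incoming Ms j) = concat (map (\<lambda>i. msgs (outbox (Ms ! i)) j) [0..<length Ms])"
  unfolding incoming_def msgs_def map_concat map_map o_def by (simp add: case_prod_unfold)

lemma map_list_spmf_return:
  "length Ns = length Ms \<Longrightarrow> (\<And>i. i < length Ms \<Longrightarrow> f (Ms ! i) = return_spmf (Ns ! i)) \<Longrightarrow>
   map_list_spmf f Ms = return_spmf Ns"
proof (induction Ms arbitrary: Ns)
  case (Cons M Ms)
  then obtain N Ns' where Ns: "Ns = N # Ns'" by (cases Ns) auto
  have "f M = return_spmf N" using Cons.prems(2)[of 0] by (simp add: Ns)
  moreover have "map_list_spmf f Ms = return_spmf Ns'"
    using Cons.prems Cons.prems(2)[of "Suc _"] by (intro Cons.IH) (auto simp: Ns)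
  ultimately show ?case by (simp add: Ns)
qed simp

text \<open>The same program runs in every round; register 4, the number of the round, selects the
  part to be executed and is preserved by all parts.\<close>

primrec dispatch :: "nat \<Rightarrow> program list \<Rightarrow> program" where
  "dispatch i [] = Skip"
| "dispatch i (p # ps) = If (Reg 4 =\<^sub>e Const i) p (dispatch (Suc i) ps)"

lemma exec_dispatch:
  "regs M 4 = i + d \<Longrightarrow> d < length ps \<Longrightarrow> i + length ps < word_bound w \<Longrightarrow>
   exec w (dispatch i ps) M = exec w (ps ! d) (M\<lparr>steps := steps M + Suc d\<rparr>)"
proof (induction ps arbitrary: i d M)
  case (Cons p ps)
  show ?case
  proof (cases d)
    case 0
    then show ?thesis using Cons.prems by (simp add: eval_rules tick_def)
  next
    case (Suc d')
    then have "exec w (dispatch (Suc i) ps) (tick M) = exec w (ps ! d') ((tick M)\<lparr>steps := steps (tick M) + Suc d'\<rparr>)"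
      using Cons.prems by (intro Cons.IH) (auto simp: tick_def)
    then show ?thesis using Suc Cons.prems by (simp add: eval_rules tick_def)
  qed
qed simp

text \<open>Split off so that both draws come first and, for fixed words, the rest of the round is
  deterministic.\<close>

definition modulus_tail :: "nat \<Rightarrow> nat \<Rightarrow> program" where
  "modulus_tail k J = (store_window ;; If (Reg 3 =\<^sub>e Const 0) (choose_modulus k J) Skip)"

definition modulus_round :: "nat \<Rightarrow> nat \<Rightarrow> program" where
  "modulus_round k J = (If (Reg 3 =\<^sub>e Const 0) (Rand 9 ;; Rand 10) Skip ;; modulus_tail k J)"

text \<open>A query occupies three rounds; the round after them resolves it and, except for the last
  one, broadcasts the next query. The third center depends on the ends found for the first
  two.\<close>

definition round_programs :: "nat \<Rightarrow> nat \<Rightarrow> program list" where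
  "round_programs k J =
     [scatter_round, modulus_round k J, hash_round, piece_round, local_round,
      answer_round, relay_round, letters_round, first_round,
      answer_round, relay_round, letters_round, second_round,
      answer_round, relay_round, letters_round, last_round]"

definition palindrome_program :: "nat \<Rightarrow> nat \<Rightarrow> program" where
  "palindrome_program k J = (dispatch 0 (round_programs k J) ;; Assign 4 (Reg 4 +\<^sub>e Const 1))"

lemma length_round_programs [simp]: "length (round_programs k J) = 17"
  by (simp add: round_programs_def)

lemma exec_palindrome_program:
  assumes "regs M 4 = t" "t < 17" "100 < word_bound w"
  shows "exec w (palindrome_program k J) M =
    bind_spmf (exec w (round_programs k J ! t) (M\<lparr>steps := steps M + Suc t\<rparr>)) (exec w (Assign 4 (Reg 4 +\<^sub>e Const 1)))"
  unfolding palindrome_program_def using assms by (simp add: exec_dispatch[of M 0 t])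

section \<open>Stages of the computation between rounds\<close>

locale mpc_input = params +
  fixes I :: "(nat \<times> nat) list list" and k J :: nat
  assumes I: "length I = m" "mset (concat I) = mset (zip [0..<n] S)" "\<And>xs. xs \<in> set I \<Longrightarrow> length xs \<le> 3 * B"
begin

definition ready :: "nat \<Rightarrow> nat \<Rightarrow> machine \<Rightarrow> bool" where
  "ready t T M \<longleftrightarrow> regs M 4 = t \<and> outbox M = [] \<and> extent M \<le> 30 * B \<and> peak M \<le> 500 * B \<and> length (inbox M) \<le> 60 * B \<and> steps M \<le> T"

text \<open>Time is bounded separately for each machine: an answer round may burden one machine with
  most of the queries, and only the sum over the machines is linear.\<close>

definition stage :: "nat \<Rightarrow> (nat \<Rightarrow> nat) \<Rightarrow> (nat \<Rightarrow> machine \<Rightarrow> bool) \<Rightarrow> config \<Rightarrow> bool" where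
  "stage t T P cfg \<longleftrightarrow> fst cfg = t \<and> length (snd cfg) = m \<and> (\<forall>j<m. ready t (T j) (snd cfg ! j) \<and> P j (snd cfg ! j))"

definition local_post :: "nat \<Rightarrow> machine \<Rightarrow> (nat \<times> nat) list \<Rightarrow> nat \<Rightarrow> (machine \<Rightarrow> bool) \<Rightarrow> machine \<Rightarrow> bool" where
  "local_post t M ob c X M' \<longleftrightarrow> regs M' 4 = t \<and> extent M' \<le> 30 * B \<and> peak M' = peak M \<and> inbox M' = inbox M \<and> outbox M' = ob \<and>
     length (outputs M') \<le> 4 * B \<and> steps M' \<le> steps M + c \<and> X M'"

definition next_state :: "nat \<Rightarrow> (nat \<times> nat) list \<Rightarrow> nat \<Rightarrow> nat \<Rightarrow> machine \<Rightarrow> machine" where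
  "next_state t inb pk st M = M\<lparr>regs := (regs M)(4 := t), steps := st, inbox := inb, outbox := [], peak := pk\<rparr>"

lemma exchange_stage:
  assumes "length Ns = m" "t < 17"
    and N: "\<And>j. j < m \<Longrightarrow> \<exists>M M'. ready t (T j) M \<and> local_post t (M\<lparr>steps := s j\<rparr>) (ob j) (c j) (X j) M' \<and> s j \<le> steps M + Suc t \<and>
        Ns ! j = M'\<lparr>regs := (regs M')(4 := Suc t), steps := Suc (steps M')\<rparr>"
    and ob: "\<And>j. j < m \<Longrightarrow> length (ob j) \<le> 60 * B"
    and inw: "\<And>j. j < m \<Longrightarrow> concat (map (\<lambda>i. msgs (ob i) j) [0..<m]) = inw j"
    and inl: "\<And>j. j < m \<Longrightarrow> length (inw j) \<le> 60 * B"
    and P: "\<And>j M inb pk st. j < m \<Longrightarrow> X j M \<Longrightarrow> map snd inb = inw j \<Longrightarrow> P j (next_state (Suc t) inb pk st M)"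
  shows "stage (Suc t) (\<lambda>j. T j + c j + 20) P (Suc t, exchange Ns)"
  unfolding stage_def fst_conv snd_conv
proof (intro conjI allI impI)
  show "length (exchange Ns) = m" using assms(1) by (simp add: exchange_def)
  fix j assume j: "j < m"
  have oN: "outbox (Ns ! i) = ob i" if "i < m" for i using N[OF that] by (auto simp: local_post_def)
  have inc: "map snd (incoming Ns j) = inw j"
    unfolding snd_incoming assms(1) inw[OF j, symmetric] by (intro arg_cong[where f = concat] map_cong) (auto simp: oN)
  then have incl: "length (incoming Ns j) \<le> 60 * B" using inl[OF j] by (metis length_map)
  obtain M M' where M: "ready t (T j) M" "local_post t (M\<lparr>steps := s j\<rparr>) (ob j) (c j) (X j) M'" "s j \<le> steps M + Suc t"
        "Ns ! j = M'\<lparr>regs := (regs M')(4 := Suc t), steps := Suc (steps M')\<rparr>" using N[OF j] by blast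
  have e: "exchange Ns ! j = next_state (Suc t) (incoming Ns j) (max (peak M') (round_space Ns j)) (Suc (steps M')) M'"
    using j assms(1) M(4) by (simp add: exchange_def next_state_def Let_def)
  \<comment> \<open>In units of \<open>B\<close>: 30 for the memory, three times 120 for inbox,
    outbox and incoming messages, 8 for the output, in total 398.\<close>
  have rs: "round_space Ns j \<le> 500 * B"
    using M(1,2) incl ob[OF j] by (simp add: round_space_def Let_def M(4) local_post_def ready_def)
  show "ready (Suc t) (T j + c j + 20) (exchange Ns ! j)"
    unfolding e ready_def next_state_def using M incl rs assms(2) by (auto simp: local_post_def ready_def)
  show "P j (exchange Ns ! j)"
    unfolding e by (rule P[OF j]) (use M inc in \<open>auto simp: local_post_def\<close>)
qed simp

lemma exec_local:
  assumes "regs M 4 = t" "t < 17"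
    and "wp w (round_programs k J ! t) (local_post t (M\<lparr>steps := s\<rparr>) ob c X) (M\<lparr>steps := s\<rparr>)" "s = steps M + Suc t"
  shows "\<exists>M'. exec w (palindrome_program k J) M = return_spmf (M'\<lparr>regs := (regs M')(4 := Suc t), steps := Suc (steps M')\<rparr>) \<and>
    local_post t (M\<lparr>steps := s\<rparr>) ob c X M'"
proof -
  obtain M' where M': "exec w (round_programs k J ! t) (M\<lparr>steps := s\<rparr>) = return_spmf M'" "local_post t (M\<lparr>steps := s\<rparr>) ob c X M'"
    using wp_exec[OF assms(3)] by blast
  have "Suc t < word_bound w" "Suc 0 < word_bound w" "100 < word_bound w" using assms(2) small by linarith+
  then show ?thesis
    using M' assms(1,2,4) by (intro exI[of _ M']) (simp add: exec_palindrome_program local_post_def eval_rules machine_defs)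
qed

text \<open>Point masses combine to a point mass, so weakest preconditions of the single machines
  decide the whole round.\<close>

lemma det_round:
  assumes st: "stage t T P cfg" and t: "t < 17"
    and body: "\<And>j M. j < m \<Longrightarrow> P j M \<Longrightarrow> regs M 4 = t \<Longrightarrow> outbox M = [] \<Longrightarrow> extent M \<le> 30 * B \<Longrightarrow> 
       wp w (round_programs k J ! t) (local_post t M (ob j) (c j) (X j)) M"
    and Ps: "\<And>j M s. P j M \<Longrightarrow> P j (M\<lparr>steps := s\<rparr>)"
    and ob: "\<And>j. j < m \<Longrightarrow> length (ob j) \<le> 60 * B"
    and inw: "\<And>j. j < m \<Longrightarrow> concat (map (\<lambda>i. msgs (ob i) j) [0..<m]) = inw j"
    and inl: "\<And>j. j < m \<Longrightarrow> length (inw j) \<le> 60 * B"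
    and P': "\<And>j M inb pk st. j < m \<Longrightarrow> X j M \<Longrightarrow> map snd inb = inw j \<Longrightarrow> P' j (next_state (Suc t) inb pk st M)"
  shows "\<exists>cfg'. mpc_round w (palindrome_program k J) cfg = return_spmf cfg' \<and> stage (Suc t) (\<lambda>j. T j + c j + 20) P' cfg'"
proof -
  obtain Ms where cfg: "cfg = (t, Ms)" "length Ms = m" "\<And>j. j < m \<Longrightarrow> ready t (T j) (Ms ! j)" "\<And>j. j < m \<Longrightarrow> P j (Ms ! j)"
    using st by (cases cfg) (auto simp: stage_def)
  define s where "s j = steps (Ms ! j) + Suc t" for j
  have "\<forall>j<m. \<exists>M'. exec w (palindrome_program k J) (Ms ! j) = return_spmf (M'\<lparr>regs := (regs M')(4 := Suc t), steps := Suc (steps M')\<rparr>) \<and>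
    local_post t ((Ms ! j)\<lparr>steps := s j\<rparr>) (ob j) (c j) (X j) M'"
  proof (intro allI impI)
    fix j assume j: "j < m"
    have r: "regs (Ms ! j) 4 = t" "outbox (Ms ! j) = []" "extent (Ms ! j) \<le> 30 * B" using cfg(3)[OF j] by (auto simp: ready_def)
    have "wp w (round_programs k J ! t) (local_post t ((Ms ! j)\<lparr>steps := s j\<rparr>) (ob j) (c j) (X j)) ((Ms ! j)\<lparr>steps := s j\<rparr>)"
      using body[OF j Ps[OF cfg(4)[OF j], of "s j"]] r by simp
    then show "\<exists>M'. exec w (palindrome_program k J) (Ms ! j) = return_spmf (M'\<lparr>regs := (regs M')(4 := Suc t), steps := Suc (steps M')\<rparr>) \<and>
      local_post t ((Ms ! j)\<lparr>steps := s j\<rparr>) (ob j) (c j) (X j) M'"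
      using exec_local[OF r(1) t] by (simp add: s_def)
  qed
  then obtain F where F: "\<And>j. j < m \<Longrightarrow> exec w (palindrome_program k J) (Ms ! j) = return_spmf ((F j)\<lparr>regs := (regs (F j))(4 := Suc t), steps := Suc (steps (F j))\<rparr>)"
    "\<And>j. j < m \<Longrightarrow> local_post t ((Ms ! j)\<lparr>steps := s j\<rparr>) (ob j) (c j) (X j) (F j)"
    by metis
  define Ns where "Ns = map (\<lambda>j. (F j)\<lparr>regs := (regs (F j))(4 := Suc t), steps := Suc (steps (F j))\<rparr>) [0..<m]"
  have "map_list_spmf (exec w (palindrome_program k J)) Ms = return_spmf Ns"
    by (rule map_list_spmf_return) (simp_all add: Ns_def cfg(2) F(1))
  then have run: "mpc_round w (palindrome_program k J) cfg = return_spmf (Suc t, exchange Ns)"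
    by (simp add: mpc_round_def cfg(1))
  have "stage (Suc t) (\<lambda>j. T j + c j + 20) P' (Suc t, exchange Ns)"
  proof (rule exchange_stage[where s = s and ob = ob and inw = inw and X = X])
    show "\<exists>M M'. ready t (T j) M \<and> local_post t (M\<lparr>steps := s j\<rparr>) (ob j) (c j) (X j) M' \<and> s j \<le> steps M + Suc t \<and>
        Ns ! j = M'\<lparr>regs := (regs M')(4 := Suc t), steps := Suc (steps M')\<rparr>" if "j < m" for j
      by (rule exI[of _ "Ms ! j"], rule exI[of _ "F j"]) (use that cfg(3) F(2) in \<open>simp add: Ns_def s_def\<close>)
  qed (use t ob inw inl P' in \<open>simp_all add: Ns_def\<close>)
  with run show ?thesis by blast
qed


subsection \<open>Distribution of the letters\<close>

definition window_letters :: "nat \<Rightarrow> (nat \<times> nat) list" where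
  "window_letters j = filter (\<lambda>(p, a). p div B \<le> j + 4 \<and> j \<le> p div B + 4) (concat I)"

lemma set_concat_I: "set (concat I) = {(p, S ! p) | p. p < n}"
proof -
  have "zip [0..<n] S = map (\<lambda>p. (p, S ! p)) [0..<n]" by (rule nth_equalityI) (use n in auto)
  moreover have "set (concat I) = set (zip [0..<n] S)" using I(2) by (metis set_mset_mset)
  ultimately have "set (concat I) = set (map (\<lambda>p. (p, S ! p)) [0..<n])" by (simp only:)
  then show ?thesis by auto
qed

lemma distinct_fst_concat_I: "distinct (map fst (concat I))"
proof -
  have "mset (map fst (concat I)) = mset (map fst (zip [0..<n] S))" using I(2) by (metis mset_map)
  also have "map fst (zip [0..<n] S) = [0..<n]" using n by simp
  finally show ?thesis by (metis distinct_upt mset_eq_imp_distinct_iff)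
qed

lemma msgs_scatter:
  assumes "j < m"
  shows "msgs (scatter p a) j = (if p div B \<le> j + 4 \<and> j \<le> p div B + 4 then [p, a] else [])"
proof -
  define q where "q = p div B"
  define f where "f = (\<lambda>d. if 3 < q + d \<and> q + d < m + 4 then [(q + d - 4, p), (q + d - 4, a)] else [])"
  have s: "scatter p a = concat (map f [0..<9])" by (simp only: scatter_def q_def f_def)
  have fm: "msgs (f d) j = (if q + d = j + 4 then [p, a] else [])" for d
    using assms by (auto simp: f_def)
  show ?thesis
  proof (cases "q \<le> j + 4 \<and> j \<le> q + 4")
    case True
    then have "concat (map (\<lambda>x. msgs (f x) j) [0..<9]) = msgs (f (j + 4 - q)) j"
      by (intro concat_map_single) (auto simp: fm)
    then show ?thesis using True by (simp add: s msgs_concat o_def fm q_def[symmetric])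
  next
    case False
    then have "concat (map (\<lambda>x. msgs (f x) j) [0..<9]) = []" by (auto simp: fm)
    then have "msgs (scatter p a) j = []" by (simp only: s msgs_concat map_map o_def)
    then show ?thesis using False by (auto simp: q_def)
  qed
qed

lemma scatter_inwords:
  assumes "j < m"
  shows "concat (map (\<lambda>i. msgs (concat (map (\<lambda>(p, a). scatter p a) (I ! i))) j) [0..<m]) =
    concat (map (\<lambda>(p, a). [p, a]) (window_letters j))"
proof -
  have 1: "msgs (concat (map (\<lambda>(p, a). scatter p a) xs)) j =
     concat (map (\<lambda>(p, a). [p, a]) (filter (\<lambda>(p, a). p div B \<le> j + 4 \<and> j \<le> p div B + 4) xs))" for xs
    by (induction xs) (simp_all add: msgs_scatter[OF assms] case_prod_unfold)
  have "concat (map (\<lambda>i. msgs (concat (map (\<lambda>(p, a). scatter p a) (I ! i))) j) [0..<m]) =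
    concat (map (\<lambda>xs. concat (map (\<lambda>(p, a). [p, a]) (filter (\<lambda>(p, a). p div B \<le> j + 4 \<and> j \<le> p div B + 4) xs))) (map ((!) I) [0..<m]))"
    by (simp add: 1 o_def)
  also have "map ((!) I) [0..<m] = I" using I(1) map_nth by blast
  also have "concat (map (\<lambda>xs. concat (map (\<lambda>(p, a). [p, a]) (filter (\<lambda>(p, a). p div B \<le> j + 4 \<and> j \<le> p div B + 4) xs))) L) =
     concat (map (\<lambda>(p, a). [p, a]) (filter (\<lambda>(p, a). p div B \<le> j + 4 \<and> j \<le> p div B + 4) (concat L)))" for L
    by (induction L) auto
  finally show ?thesis by (simp add: window_letters_def)
qed

text \<open>Letters arrive in arbitrary order, so the bound on the length comes from distinctness of
  their positions, all of which lie within nine blocks.\<close>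

lemma window_letters_props:
  shows "(p, a) \<in> set (window_letters j) \<Longrightarrow> p < n \<and> a = S ! p \<and> lo j \<le> p \<and> p < lo j + 9 * B"
    "length (window_letters j) \<le> 9 * B"
    "p < n \<Longrightarrow> lo j \<le> p \<Longrightarrow> p < (j + 5) * B \<Longrightarrow> p \<in> fst ` set (window_letters j)"
proof -
  have set: "set (window_letters j) = {(p, S ! p) | p. p < n \<and> p div B \<le> j + 4 \<and> j \<le> p div B + 4}"
    unfolding window_letters_def set_filter set_concat_I by auto
  have pb: "p < (p div B + 1) * B" "p div B * B \<le> p" for p
    using B_pos dividend_less_times_div[of B p] by (simp_all add: algebra_simps)
  have rng: "lo j \<le> p \<and> p < lo j + 9 * B" if "p div B \<le> j + 4" "j \<le> p div B + 4" for p
  proof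
    have "(p div B + 1) * B \<le> (j + 5) * B" using that(1) by (intro mult_le_mono1) simp
    then have "p < j * B + 5 * B" using pb(1)[of p] by (simp add: add_mult_distrib)
    then show "p < lo j + 9 * B" using lo_le(2)[of j] by linarith
    have "(j - 4) * B \<le> p"
      by (rule order_trans[OF mult_le_mono1 pb(2)[of p]]) (use that(2) in simp)
    then show "lo j \<le> p" by (simp add: lo_def)
  qed
  show "(p, a) \<in> set (window_letters j) \<Longrightarrow> p < n \<and> a = S ! p \<and> lo j \<le> p \<and> p < lo j + 9 * B"
    using rng[of p] by (auto simp: set)
  have d: "distinct (map fst (window_letters j))"
    unfolding window_letters_def by (rule distinct_map_filter[OF distinct_fst_concat_I])
  have "set (map fst (window_letters j)) \<subseteq> {lo j..<lo j + 9 * B}" using rng by (auto simp: set)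
  then have "card (set (map fst (window_letters j))) \<le> card {lo j..<lo j + 9 * B}" by (rule card_mono[rotated]) simp
  then show "length (window_letters j) \<le> 9 * B" using distinct_card[OF d] by simp
  show "p \<in> fst ` set (window_letters j)" if "p < n" "lo j \<le> p" "p < (j + 5) * B"
  proof -
    have "p div B < j + 5" using that(3) B_pos by (simp add: less_mult_imp_div_less)
    moreover have "j - 4 \<le> p div B"
    proof (cases "j < 4")
      case False
      then have "(j - 4) * B div B \<le> p div B" using that(2) by (intro div_le_mono) (simp add: lo_def)
      then show ?thesis using B_pos by (simp add: Suc_le_eq)
    qed simp
    ultimately have "(p, S ! p) \<in> set (window_letters j)" using that(1) by (auto simp: set)
    then show ?thesis by force
  qed
qed

definition P0 :: "nat \<Rightarrow> machine \<Rightarrow> bool" where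
  "P0 j M \<longleftrightarrow> regs M 0 = n \<and> regs M (Suc 0) = \<sigma> \<and> regs M 2 = m \<and> regs M 3 = j \<and> inbox M = I ! j \<and> memory M = (\<lambda>_. 0) \<and>
     outputs M = [] \<and> \<not> finished M"

definition P1 :: "nat \<Rightarrow> machine \<Rightarrow> bool" where
  "P1 j M \<longleftrightarrow> base j M \<and> inwords M = concat (map (\<lambda>(p, a). [p, a]) (window_letters j)) \<and> memory M = (\<lambda>_. 0) \<and>
     outputs M = [] \<and> \<not> finished M"

lemma length_scatter: "length (scatter p a) \<le> 18"
proof -
  have "length (concat (map f [0..<N])) \<le> 2 * N" if "\<And>d. length (f d) \<le> 2" for f :: "nat \<Rightarrow> (nat \<times> nat) list" and N
    by (induction N) (use that in \<open>auto intro: order_trans[OF add_mono]\<close>)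
  from this[where N = 9] show ?thesis unfolding scatter_def by fastforce
qed

lemma first_stage: "stage 0 (\<lambda>_. 0) P0 (initial_config n \<sigma> I)"
  using I(1) order_trans[OF I(3)[OF nth_mem], of _ "60 * B"]
  by (auto simp: stage_def initial_config_def ready_def initial_machine_def P0_def)

lemma scatter_stage:
  assumes "stage 0 T P0 cfg"
  shows "\<exists>cfg'. mpc_round w (palindrome_program k J) cfg = return_spmf cfg' \<and> stage 1 (\<lambda>j. T j + 1000 * B + 20) P1 cfg'"
  unfolding One_nat_def
proof (rule det_round[OF assms, where inw = "\<lambda>j. concat (map (\<lambda>(p, a). [p, a]) (window_letters j))" and
      X = "\<lambda>j M. base j M \<and> memory M = (\<lambda>_. 0) \<and> outputs M = [] \<and> \<not> finished M" and
      ob = "\<lambda>j. concat (map (\<lambda>(p, a). scatter p a) (I ! j))"], goal_cases)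
  case (2 j M)
  have Ij: "I ! j \<in> set I" using 2(1) I by simp
  have sub: "set (I ! j) \<subseteq> set (concat I)" using Ij by auto
  show ?case
    unfolding round_programs_def nth_Cons_0
  proof (rule wp_scatter_round[of M j])
    show "p < n" if "(p, a) \<in> set (inbox M)" for p a
      using that sub 2(2) set_concat_I by (auto simp: P0_def)
  qed (use 2 I Ij in \<open>auto simp: P0_def local_post_def\<close>)
next
  case (4 j)
  have "length (concat (map (\<lambda>(p, a). scatter p a) xs)) \<le> 18 * length xs" for xs
    by (induction xs) (use length_scatter in \<open>auto intro: order_trans[OF add_mono]\<close>)
  from this[of "I ! j"] I(3)[of "I ! j"] 4 I(1) show ?case by force
next
  case (6 j)
  have "length (concat (map (\<lambda>(p, a). [p, a]) xs)) = 2 * length xs" for xs :: "(nat \<times> nat) list"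
    by (induction xs) auto
  with window_letters_props(2)[of j] show ?case by simp
qed (auto simp: P0_def P1_def next_state_def base_def inwords_def scatter_inwords)

end


section \<open>Runs\<close>

abbreviation unfinished :: "config \<Rightarrow> bool" where
  "unfinished \<equiv> \<lambda>(r, Ms). \<exists>M\<in>set Ms. \<not> finished M"

lemma nth_pairs:
  "i < N \<Longrightarrow> concat (map (\<lambda>i. [f i, g i]) [0..<N]) ! (2 * i) = f i"
  "i < N \<Longrightarrow> concat (map (\<lambda>i. [f i, g i]) [0..<N]) ! Suc (2 * i) = g i"
  "length (concat (map (\<lambda>i. [f i, g i]) [0..<N])) = 2 * N"
proof -
  show l: "length (concat (map (\<lambda>i. [f i, g i]) [0..<N])) = 2 * N" for N by (induction N) auto
  show "i < N \<Longrightarrow> concat (map (\<lambda>i. [f i, g i]) [0..<N]) ! (2 * i) = f i"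
    by (induction N) (use l in \<open>auto simp: nth_append less_Suc_eq simp del: length_concat\<close>)
  show "i < N \<Longrightarrow> concat (map (\<lambda>i. [f i, g i]) [0..<N]) ! Suc (2 * i) = g i"
    by (induction N) (use l in \<open>auto simp: nth_append less_Suc_eq simp del: length_concat\<close>)
qed

lemma upt_add_eq: "[0..<a + b] = [0..<a] @ map (\<lambda>u. a + u) [0..<b]"
  by (rule nth_equalityI) (auto simp: nth_append)

lemma exec_Rand: "exec w (Rand x) M = bind_spmf (spmf_of_set {..<word_bound w}) (\<lambda>v. return_spmf (tick (set_reg x v M)))"
  by (simp add: word_bound_def map_spmf_conv_bind_spmf)

lemma concat_blocks:
  "concat (map (\<lambda>i. concat (map (\<lambda>u. f (i * \<beta> + u)) [0..<\<beta>])) [0..<N]) = concat (map f [0..<N * \<beta>])"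
proof (induction N)
  case (Suc N)
  have "[0..<Suc N * \<beta>] = [0..<N * \<beta>] @ map (\<lambda>u. N * \<beta> + u) [0..<\<beta>]"
    using upt_add_eq[of "N * \<beta>" \<beta>] by (simp add: add.commute)
  then show ?case by (simp add: Suc o_def)
qed simp

text \<open>Order matters here: the members of a class arrive by increasing position, so that entry
  \<open>u\<close> of the table belongs to position \<open>j + u * m\<close>.\<close>

lemma concat_residue_class:
  assumes "j < m"
  shows "concat (map (\<lambda>z. if z mod m = j then F z else []) [0..<m * \<beta>]) = concat (map (\<lambda>u. F (j + u * m)) [0..<\<beta>])"
proof (induction \<beta>)
  case (Suc \<beta>)
  have e: "[0..<m * Suc \<beta>] = [0..<m * \<beta>] @ map (\<lambda>u. m * \<beta> + u) [0..<m]"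
    using upt_add_eq[of "m * \<beta>" m] by (simp add: add.commute)
  have "concat (map (\<lambda>u. if (m * \<beta> + u) mod m = j then F (m * \<beta> + u) else []) [0..<m]) =
      (if (m * \<beta> + j) mod m = j then F (m * \<beta> + j) else [])"
    using assms by (intro concat_map_single) auto
  also have "\<dots> = F (j + \<beta> * m)" using assms by (simp add: ac_simps)
  finally show ?case unfolding e map_append concat_append map_map o_def Suc by simp
qed simp

lemma msgs_spread: "j < m \<Longrightarrow> msgs (map (\<lambda>r. (r, f r)) [0..<m]) j = [f j]"
  unfolding msgs_map by (subst concat_map_single[where a = j]) auto

context mpc_input
begin

definition run :: "config \<Rightarrow> config spmf" where
  "run = while_spmf unfinished (mpc_round w (palindrome_program k J))"

lemma run_step: "unfinished cfg \<Longrightarrow> run cfg = bind_spmf (mpc_round w (palindrome_program k J) cfg) run"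
  and run_stop: "\<not> unfinished cfg \<Longrightarrow> run cfg = return_spmf cfg"
  unfolding run_def by (subst while_spmf.simps, simp)+

definition bounded_stage :: "nat \<Rightarrow> nat \<Rightarrow> (nat \<Rightarrow> machine \<Rightarrow> bool) \<Rightarrow> config \<Rightarrow> bool" where
  "bounded_stage N t P cfg \<longleftrightarrow> (\<exists>T. stage t T P cfg \<and> (\<Sum>j<m. T j) \<le> N)"

lemma stage_unfinished:
  assumes "stage t T P cfg" "\<And>j M. P j M \<Longrightarrow> \<not> finished M"
  shows "unfinished cfg"
proof -
  have "snd cfg ! 0 \<in> set (snd cfg)" "P 0 (snd cfg ! 0)" using assms(1) m(1) by (auto simp: stage_def)
  then show ?thesis using assms(2) by (cases cfg) auto
qed

lemma det_step:
  assumes st: "bounded_stage N t P cfg" and t: "t < 17" and prog: "round_programs k J ! t = p"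
    and body: "\<And>j M. j < m \<Longrightarrow> P j M \<Longrightarrow> regs M 4 = t \<Longrightarrow> outbox M = [] \<Longrightarrow> extent M \<le> 30 * B \<Longrightarrow> 
       wp w p (local_post t M (ob j) (c j) (X j)) M"
    and Ps: "\<And>j M s. P j M \<Longrightarrow> P j (M\<lparr>steps := s\<rparr>)" and unfin: "\<And>j M. P j M \<Longrightarrow> \<not> finished M"
    and ob: "\<And>j. j < m \<Longrightarrow> length (ob j) \<le> 60 * B"
    and inw: "\<And>j. j < m \<Longrightarrow> concat (map (\<lambda>i. msgs (ob i) j) [0..<m]) = inw j"
    and inl: "\<And>j. j < m \<Longrightarrow> length (inw j) \<le> 60 * B"
    and P': "\<And>j M inb pk st. j < m \<Longrightarrow> X j M \<Longrightarrow> map snd inb = inw j \<Longrightarrow> P' j (next_state (Suc t) inb pk st M)"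
    and c: "(\<Sum>j<m. c j) \<le> c' * (m * B)"
  shows "\<exists>cfg'. run cfg = run cfg' \<and> bounded_stage (N + (c' + 20) * (m * B)) (Suc t) P' cfg'"
proof -
  obtain T where T: "stage t T P cfg" "(\<Sum>j<m. T j) \<le> N" using st by (auto simp: bounded_stage_def)
  obtain cfg' where c': "mpc_round w (palindrome_program k J) cfg = return_spmf cfg'" "stage (Suc t) (\<lambda>j. T j + c j + 20) P' cfg'"
    using det_round[OF T(1) t, of ob c X inw P'] body Ps ob inw inl P' unfolding prog by blast
  have "run cfg = run cfg'"
    using run_step[OF stage_unfinished[OF T(1) unfin]] c'(1) by simp
  moreover have "(\<Sum>j<m. T j + c j + 20) \<le> N + (c' + 20) * (m * B)"
  proof -
    have "m \<le> m * B" using B_pos by simp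
    moreover have "(\<Sum>j<m. T j + c j + 20) = (\<Sum>j<m. T j) + (\<Sum>j<m. c j) + m * 20" by (simp add: sum.distrib)
    ultimately show ?thesis using T(2) c unfolding add_mult_distrib by linarith
  qed
  ultimately show ?thesis using c'(2) unfolding bounded_stage_def by blast
qed

end


section \<open>The round that draws the hash functions\<close>

text \<open>The count grows by at most one per step, hence takes every intermediate value.\<close>

lemma ex_card_primes_between: "k \<le> card (primes_between Y N) \<Longrightarrow> \<exists>r\<le>N. card (primes_between Y r) = k"
proof (induction N)
  case (Suc N)
  show ?case
  proof (cases "k \<le> card (primes_between Y N)")
    case False
    have "primes_between Y (Suc N) \<subseteq> insert (Suc N) (primes_between Y N)" by (auto simp: primes_between_def le_Suc_eq)
    moreover have "finite (primes_between Y N)" by (rule finite_subset[of _ "{..N}"]) (auto simp: primes_between_def)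
    ultimately have "card (primes_between Y (Suc N)) \<le> Suc (card (primes_between Y N))"
      using card_mono[of "insert (Suc N) (primes_between Y N)" "primes_between Y (Suc N)"]
        card_insert_if[of "primes_between Y N" "Suc N"] by (simp split: if_splits)
    then show ?thesis using False Suc.prems by (intro exI[of _ "Suc N"]) simp
  qed (use Suc in \<open>auto intro: le_SucI\<close>)
next
  case 0
  have "primes_between Y 0 = {}" by (auto simp: primes_between_def)
  with 0 show ?case by simp
qed

locale prime_input = mpc_input +
  fixes v D Y Mo q :: nat
  assumes D_def: "D = 2 ^ (k + 10) * v ^ 4" and Y_def: "Y = 256 * v ^ 7" and Mo_def: "Mo = \<Prod>(first_primes Y k)"
    and q_def: "q = (word_bound w - 1) div (Y ^ J) + 1"
    and v: "1 \<le> v" "v ^ 12 \<le> n" "n < (v + 1) ^ 12"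
    and W': "4096 * n + 1 < word_bound w" "(D + 2) * (D + 2) < word_bound w" "(D * D) ^ k < word_bound w" "k < word_bound w"
      "Y ^ J < word_bound w" "q < word_bound w"
begin

definition P2 :: "nat \<Rightarrow> nat \<Rightarrow> nat \<Rightarrow> machine \<Rightarrow> bool" where
  "P2 b \<alpha> j M \<longleftrightarrow> base j M \<and> (\<forall>u. lo j + u < (j + 5) * B \<longrightarrow> memory M u = Sp (lo j + u)) \<and> inwords M = [Mo, b, \<alpha>, q] \<and>
     outputs M = [] \<and> \<not> finished M"

definition X1 :: "nat \<Rightarrow> machine \<Rightarrow> bool" where
  "X1 j M \<longleftrightarrow> base j M \<and> (\<forall>u. lo j + u < (j + 5) * B \<longrightarrow> memory M u = Sp (lo j + u)) \<and> outputs M = [] \<and> \<not> finished M"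

definition ob1 :: "nat \<Rightarrow> nat \<Rightarrow> nat \<Rightarrow> (nat \<times> nat) list" where
  "ob1 b \<alpha> j = (if j = 0 then concat (map (\<lambda>r. [(r, Mo), (r, b), (r, \<alpha>), (r, q)]) [0..<m]) else [])"

definition c1 :: "nat \<Rightarrow> nat" where
  "c1 j = 100 * B + (if j = 0 then 3 * n + D * D * (30 + 3 * D) else 0)"

lemma first_primes_card: "card (first_primes Y k) = k"
  and first_primes_props: "p \<in> first_primes Y k \<Longrightarrow> prime p \<and> Y < p \<and> p \<le> D * D"
proof -
  have "k \<le> card (primes_between Y (D * D))"
    using many_primes[OF v(1), of k] by (simp add: D_def Y_def power2_eq_square)
  then obtain r where r: "r \<le> D * D" "card (primes_between Y r) = k"
    using ex_card_primes_between by blast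
  have l: "card (primes_between Y (LEAST r. card (primes_between Y r) = k)) = k" by (rule LeastI[where P = "\<lambda>r. card (primes_between Y r) = k", OF r(2)])
  then show "card (first_primes Y k) = k" by (simp add: first_primes_def)
  have "(LEAST r. card (primes_between Y r) = k) \<le> D * D" using Least_le[of "\<lambda>r. card (primes_between Y r) = k" r] r by simp
  then show "p \<in> first_primes Y k \<Longrightarrow> prime p \<and> Y < p \<and> p \<le> D * D"
    by (auto simp: first_primes_def primes_between_def)
qed

lemma wp_modulus_tail:
  assumes M: "P1 j M" "regs M 4 = 1" "outbox M = []" "extent M \<le> 30 * B" and r: "j = 0 \<Longrightarrow> regs M 9 = x \<and> regs M 10 = \<alpha>"
  shows "wp w (modulus_tail k J) (local_post 1 M (ob1 (x mod Mo) \<alpha> j) (c1 j - 10 * B) (X1 j)) M"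
  unfolding modulus_tail_def wp.simps(9)
proof (rule wp_store_window[where L = "window_letters j" and j = j])
  fix M' assume fr: "frame M M'" and ob: "outbox M' = outbox M"
    and mem: "\<And>u. memory M' u = (if u + lo j \<in> fst ` set (window_letters j) then S ! (u + lo j) else memory M u)"
    and ex: "extent M' \<le> max (extent M) (9 * B)" and st: "steps M' \<le> steps M + 40 * B"
  have sm: "0 < word_bound w" "Suc 0 < word_bound w" using small by linarith+
  have b: "base j M'" "outputs M' = []" "\<not> finished M'" and r4: "regs M' 4 = 1" "inbox M' = inbox M" "peak M' = peak M"
    using M frameD[OF fr] by (simp_all add: P1_def base_def)
  have window: "memory M' u = Sp (lo j + u)" if "lo j + u < (j + 5) * B" for u
  proof (cases "lo j + u < n")
    case True
    then show ?thesis using window_letters_props(3)[of "lo j + u" j] that by (simp add: mem Sp_def add.commute)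
  next
    case False
    then have "u + lo j \<notin> fst ` set (window_letters j)" using window_letters_props(1) by force
    then show ?thesis using False M(1) by (simp add: mem Sp_def P1_def)
  qed
  have X: "X1 j M'" using b window by (simp add: X1_def)
  have r3: "regs M' 3 = j" using b(1) by (simp add: base_def)
  show "wp w (If (Reg 3 =\<^sub>e Const 0) (choose_modulus k J) Skip) (local_post 1 M (ob1 (x mod Mo) \<alpha> j) (c1 j - 10 * B) (X1 j)) M'"
  proof (cases "j = 0")
    case True
    have "wp w (choose_modulus k J) (local_post 1 M (ob1 (x mod Mo) \<alpha> j) (c1 j - 10 * B) (X1 j)) (tick M')"
    proof (rule wp_choose_modulus[OF D_def, where x = x and \<alpha> = \<alpha>], goal_cases)
      case (14 M'' Mo')
      have Mo': "Mo' = Mo" using 14(1) by (simp add: Mo_def Y_def)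
      have rg: "regs M'' 0 = regs M' 0" "regs M'' (Suc 0) = regs M' (Suc 0)" "regs M'' 2 = regs M' 2" "regs M'' 3 = regs M' 3"
        "regs M'' 4 = regs M' 4" "regs M'' 5 = regs M' 5" "regs M'' 6 = regs M' 6" "regs M'' 7 = regs M' 7"
        by (subst 14(2), simp add: tick_def)+
      have "X1 j M''" using X 14 rg by (simp add: X1_def base_def tick_def)
      moreover have "outbox M'' = ob1 (x mod Mo) \<alpha> j"
        using 14(9) ob M(3) True unfolding Mo' Y_def[symmetric] q_def[symmetric] by (simp add: ob1_def tick_def)
      moreover have "steps M'' \<le> steps M + (c1 j - 10 * B)"
      proof -
        have "c1 j - 10 * B = 90 * B + (3 * n + D * D * (30 + 3 * D))" using True by (simp add: c1_def)
        moreover have "steps (tick M') = steps M' + 1" by (simp add: tick_def)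
        ultimately show ?thesis using 14(12) st B_pos by linarith
      qed
      ultimately show ?case
        using 14(3-8) ex M rg r4 B_pos by (simp add: local_post_def tick_def b)
    qed (use b(1) v W' r True frameD[OF fr] in \<open>simp_all add: tick_def base_def Y_def q_def\<close>)
    then show ?thesis using True sm r3 by (simp add: eval_rules)
  next
    case False
    then show ?thesis using sm r3 X ex st ob M r4 B_pos
      by (simp add: eval_rules machine_defs local_post_def ob1_def c1_def X1_def base_def b)
  qed
qed (use M window_letters_props in \<open>auto simp: P1_def\<close>)

lemma sum_c1: "(\<Sum>j<m. c1 j) \<le> 100 * (m * B) + 3 * n + D * D * (30 + 3 * D)"
proof -
  have "(\<Sum>j<m. if j = 0 then a else 0) = (a :: nat)" for a
    using m(1) by (subst sum.delta) auto
  then show ?thesis by (simp add: c1_def sum.distrib)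
qed

text \<open>The only random round. Machine 0 is the head of the list of machines, so its two draws
  come out in front; for fixed words everything else is a point mass obtained from weakest
  preconditions.\<close>

lemma modulus_step:
  assumes st: "stage 1 T P1 cfg"
  shows "\<exists>F. run cfg = bind_spmf (spmf_of_set {..<word_bound w}) (\<lambda>x. bind_spmf (spmf_of_set {..<word_bound w}) (\<lambda>\<alpha>. run (F x \<alpha>))) \<and>
    (\<forall>x \<alpha>. stage 2 (\<lambda>j. T j + c1 j + 20) (P2 (x mod Mo) \<alpha>) (F x \<alpha>))"
proof -
  obtain Ms where cfg: "cfg = (1, Ms)" "length Ms = m" "\<And>j. j < m \<Longrightarrow> ready 1 (T j) (Ms ! j)" "\<And>j. j < m \<Longrightarrow> P1 j (Ms ! j)"
    using st by (cases cfg) (auto simp: stage_def)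
  have R: "regs (Ms ! j) 4 = 1" "outbox (Ms ! j) = []" "extent (Ms ! j) \<le> 30 * B" "regs (Ms ! j) 3 = j" if "j < m" for j
    using cfg(3,4)[OF that] by (auto simp: ready_def P1_def base_def)
  have sm: "0 < word_bound w" "Suc 0 < word_bound w" "2 < word_bound w" "100 < word_bound w" using small by linarith+
  have prog: "round_programs k J ! 1 = modulus_round k J" by (simp add: round_programs_def)
  let ?U = "spmf_of_set {..<word_bound w}"
  let ?fin = "\<lambda>M. M\<lparr>regs := (regs M)(4 := Suc 1), steps := Suc (steps M)\<rparr>"
  have fin: "exec w (Assign 4 (Reg 4 +\<^sub>e Const 1)) M = return_spmf (?fin M)" if "regs M 4 = 1" for M
    using that sm by (simp add: eval_rules machine_defs)
  define E where "E j x \<alpha> = (if j = 0 then tick (set_reg 10 \<alpha> (tick (set_reg 9 x (tick ((Ms ! j)\<lparr>steps := steps (Ms ! j) + 2\<rparr>)))))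
     else tick (tick ((Ms ! j)\<lparr>steps := steps (Ms ! j) + 2\<rparr>)))" for j x \<alpha>
  have E: "P1 j (E j x \<alpha>)" "regs (E j x \<alpha>) 4 = 1" "outbox (E j x \<alpha>) = []" "extent (E j x \<alpha>) \<le> 30 * B"
    "j = 0 \<Longrightarrow> regs (E j x \<alpha>) 9 = x \<and> regs (E j x \<alpha>) 10 = \<alpha>" "peak (E j x \<alpha>) = peak (Ms ! j)" "inbox (E j x \<alpha>) = inbox (Ms ! j)"
    "steps (E j x \<alpha>) \<le> steps (Ms ! j) + 5" if "j < m" for j x \<alpha>
    using R[OF that] cfg(4)[OF that] by (cases "j = 0"; simp add: E_def P1_def base_def inwords_def machine_defs)+
  have "\<forall>j<m. \<forall>x \<alpha>. \<exists>M'. exec w (modulus_tail k J) (E j x \<alpha>) = return_spmf M' \<and> local_post 1 (E j x \<alpha>) (ob1 (x mod Mo) \<alpha> j) (c1 j - 10 * B) (X1 j) M'"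
  proof (intro allI impI)
    fix j x \<alpha> assume j: "j < m"
    have "wp w (modulus_tail k J) (local_post 1 (E j x \<alpha>) (ob1 (x mod Mo) \<alpha> j) (c1 j - 10 * B) (X1 j)) (E j x \<alpha>)"
      by (rule wp_modulus_tail) (use E[OF j] in auto)
    then show "\<exists>M'. exec w (modulus_tail k J) (E j x \<alpha>) = return_spmf M' \<and> local_post 1 (E j x \<alpha>) (ob1 (x mod Mo) \<alpha> j) (c1 j - 10 * B) (X1 j) M'"
      by (rule wp_exec)
  qed
  then obtain G where G: "\<And>j x \<alpha>. j < m \<Longrightarrow> exec w (modulus_tail k J) (E j x \<alpha>) = return_spmf (G j x \<alpha>)"
    "\<And>j x \<alpha>. j < m \<Longrightarrow> local_post 1 (E j x \<alpha>) (ob1 (x mod Mo) \<alpha> j) (c1 j - 10 * B) (X1 j) (G j x \<alpha>)"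
    by metis
  have G4: "regs (G j x \<alpha>) 4 = 1" if "j < m" for j x \<alpha> using G(2)[OF that] by (simp add: local_post_def)
  obtain M0 Ms' where Ms: "Ms = M0 # Ms'" using cfg(2) m(1) by (cases Ms) auto
  have M0: "Ms ! 0 = M0" by (simp add: Ms)
  have one17: "(1::nat) < 17" by simp
  note ep = exec_palindrome_program[where k = k and J = J and t = 1 and w = w, OF _ one17 sm(4), unfolded prog modulus_round_def exec.simps(9) Suc_1]
  have R0: "regs M0 4 = 1" "0 < m" using R(1)[of 0] m(1) by (simp_all add: M0)
  have head: "exec w (palindrome_program k J) M0 = bind_spmf ?U (\<lambda>x. bind_spmf ?U (\<lambda>\<alpha>. return_spmf (?fin (G 0 x \<alpha>))))"
  proof -
    have "exec w (If (Reg 3 =\<^sub>e Const 0) (Rand 9 ;; Rand 10) Skip) (M0\<lparr>steps := steps M0 + 2\<rparr>) =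
       bind_spmf ?U (\<lambda>x. bind_spmf ?U (\<lambda>\<alpha>. return_spmf (E 0 x \<alpha>)))"
      using R(4)[of 0] m(1) sm
      by (simp add: M0 E_def eval_rules exec_Rand del: exec.simps(5))
    then have "exec w (palindrome_program k J) M0 = bind_spmf ?U (\<lambda>x. bind_spmf ?U (\<lambda>\<alpha>. bind_spmf (exec w (modulus_tail k J) (E 0 x \<alpha>)) (exec w (Assign 4 (Reg 4 +\<^sub>e Const 1)))))"
      using ep[OF R0(1)] by (simp only: bind_spmf_assoc return_bind_spmf)
    also have "\<dots> = bind_spmf ?U (\<lambda>x. bind_spmf ?U (\<lambda>\<alpha>. return_spmf (?fin (G 0 x \<alpha>))))"
      by (simp only: G(1)[OF R0(2)] fin[OF G4[OF R0(2)]] return_bind_spmf)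
    finally show ?thesis .
  qed
  \<comment> \<open>The other machines draw nothing, so their states are the same for all
    \<open>x\<close> and \<alpha>; zeros stand in for both.\<close>
  have tail: "exec w (palindrome_program k J) (Ms ! j) = return_spmf (?fin (G j 0 0))" if j: "j < m" "j \<noteq> 0" for j
  proof -
    have "exec w (If (Reg 3 =\<^sub>e Const 0) (Rand 9 ;; Rand 10) Skip) ((Ms ! j)\<lparr>steps := steps (Ms ! j) + 2\<rparr>) = return_spmf (E j 0 0)"
      using R(4)[of j] j sm by (simp add: E_def eval_rules tick_def)
    then have "exec w (palindrome_program k J) (Ms ! j) = bind_spmf (exec w (modulus_tail k J) (E j 0 0)) (exec w (Assign 4 (Reg 4 +\<^sub>e Const 1)))"
      using ep[OF R(1)[OF j(1)]] by (simp only: return_bind_spmf)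
    also have "\<dots> = return_spmf (?fin (G j 0 0))" by (simp only: G(1)[OF j(1)] fin[OF G4[OF j(1)]] return_bind_spmf)
    finally show ?thesis .
  qed
  define N where "N x \<alpha> = ?fin (G 0 x \<alpha>) # map (\<lambda>j. ?fin (G (Suc j) 0 0)) [0..<m - 1]" for x \<alpha>
  have "map_list_spmf (exec w (palindrome_program k J)) Ms' = return_spmf (map (\<lambda>j. ?fin (G (Suc j) 0 0)) [0..<m - 1])"
  proof (rule map_list_spmf_return)
    fix i assume "i < length Ms'"
    then show "exec w (palindrome_program k J) (Ms' ! i) = return_spmf (map (\<lambda>j. ?fin (G (Suc j) 0 0)) [0..<m - 1] ! i)"
      using tail[of "Suc i"] cfg(2) by (auto simp: Ms)
  qed (use cfg(2) in \<open>auto simp: Ms\<close>)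
  then have run1: "mpc_round w (palindrome_program k J) cfg = bind_spmf ?U (\<lambda>x. bind_spmf ?U (\<lambda>\<alpha>. return_spmf (2, exchange (N x \<alpha>))))"
    by (simp add: mpc_round_def cfg(1) Ms head N_def map_spmf_conv_bind_spmf numeral_2_eq_2)
  have stg: "stage (Suc 1) (\<lambda>j. T j + c1 j + 20) (P2 (x mod Mo) \<alpha>) (Suc 1, exchange (N x \<alpha>))" for x \<alpha>
  proof (rule exchange_stage[where s = "\<lambda>j. steps (Ms ! j) + 2" and ob = "ob1 (x mod Mo) \<alpha>" and inw = "\<lambda>j. [Mo, x mod Mo, \<alpha>, q]" and X = X1], goal_cases)
    case (3 j)
    define G' where "G' = (if j = 0 then G 0 x \<alpha> else G j 0 0)"
    have "N x \<alpha> ! j = ?fin G'" using 3 by (cases j) (auto simp: N_def G'_def)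
    moreover have "local_post 1 ((Ms ! j)\<lparr>steps := steps (Ms ! j) + 2\<rparr>) (ob1 (x mod Mo) \<alpha> j) (c1 j) (X1 j) G'"
      using G(2)[OF 3, of x \<alpha>] G(2)[OF 3, of 0 0] B_pos E[OF 3, of x \<alpha>] E[OF 3, of 0 0]
      by (cases "j = 0") (auto simp: G'_def local_post_def E ob1_def c1_def)
    ultimately show ?case using cfg(3)[OF 3] by (intro exI[of _ "Ms ! j"] exI[of _ G']) simp
  next
    case (4 j)
    have "length (concat (map (\<lambda>r. [f r, g r, h r, i r]) [0..<N])) = 4 * N" for f g h i :: "nat \<Rightarrow> nat \<times> nat" and N
      by (induction N) auto
    then show ?case using m_le_B by (simp add: ob1_def)
  next
    case (5 j)
    have "concat (map (\<lambda>i. msgs (ob1 (x mod Mo) \<alpha> i) j) [0..<m]) = msgs (ob1 (x mod Mo) \<alpha> 0) j"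
      using m(1) by (intro concat_map_single) (auto simp: ob1_def)
    also have "\<dots> = [Mo, x mod Mo, \<alpha>, q]"
      unfolding ob1_def using 5 by (simp, intro msgs_all_to_all) auto
    finally show ?case .
  qed (use m(1) B_pos in \<open>auto simp: N_def P2_def X1_def base_def inwords_def next_state_def\<close>)
  have unf: "unfinished cfg" by (rule stage_unfinished[OF st]) (simp add: P1_def)
  show ?thesis
    by (rule exI[of _ "\<lambda>x \<alpha>. (2, exchange (N x \<alpha>))"]) (use stg run1 run_step[OF unf] in \<open>auto simp: numeral_2_eq_2\<close>)
qed

end


section \<open>Correctness without collisions\<close>

context hashed
begin

text \<open>Unrolling Horner's scheme exhibits coefficients that can be compared with those of
  \<open>bwd\<close>, taken in the opposite order of positions.\<close>

lemma fwd_sum: "fwd y i = (\<Sum>o'<i. g (y + i - 1 - o') * b ^ o')"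
proof (induction i)
  case (Suc i)
  have "(\<Sum>o'<Suc i. g (y + Suc i - 1 - o') * b ^ o') = g (y + i) + (\<Sum>o'<i. g (y + i - Suc o') * b ^ Suc o')"
    by (simp only: sum.lessThan_Suc_shift) simp
  also have "(\<Sum>o'<i. g (y + i - Suc o') * b ^ Suc o') = fwd y i * b"
    unfolding Suc sum_distrib_right by (intro sum.cong) simp_all
  finally show ?case by (simp add: add.commute)
qed simp

lemma hash_eqI:
  assumes "\<And>u. u < m \<Longrightarrow> Sp (k * m + u) = Sp (y + m - 1 - u)"
  shows "bwd_hash k = fwd_hash y"
proof -
  have "g (k * m + u) = g (y + m - 1 - u)" if "u < m" for u using assms[OF that] by (simp add: g_def)
  then have "bwd (k * m) m = fwd y m" unfolding bwd_def fwd_sum by (intro sum.cong) auto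
  then show ?thesis by (simp add: bwd_hash_def fwd_hash_def)
qed

abbreviation end1 :: "nat \<Rightarrow> nat" where "end1 j \<equiv> far_end (fst_long j)"
abbreviation end2 :: "nat \<Rightarrow> nat" where "end2 j \<equiv> far_end (lst_long j)"

definition result :: "nat \<Rightarrow> (nat \<times> nat) list" where
  "result j = concat (map (emitted j (end1 j) (end2 j) (far_end (third_query j (end1 j) (end2 j))))
     (filter (\<lambda>s. s + 1 < 2 * n) [2 * (j * B)..<2 * (j * B) + 2 * B]))"

end

text \<open>Both assumptions concern boundedly many pairs: letters that occur, and a right and a
  left piece inside the string, which is what a union bound can handle. Absence of collisions only
  gives equal letter hashes; \<open>inj\<close> turns these into equal letters.\<close>

locale good_hash = hashed +
  assumes inj: "\<And>x y. x \<in> set S \<Longrightarrow> y \<in> set S \<Longrightarrow> x \<noteq> y \<Longrightarrow> (\<alpha> * x mod word_bound w) div q \<noteq> (\<alpha> * y mod word_bound w) div q"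
    and no_collision: "\<And>k y u. (k + 1) * m \<le> n \<Longrightarrow> y + m \<le> n \<Longrightarrow> bwd_hash k = fwd_hash y \<Longrightarrow> u < m \<Longrightarrow> g (k * m + u) = g (y + m - 1 - u)"
begin

lemma g_inj: "x < n \<Longrightarrow> y < n \<Longrightarrow> g x = g y \<Longrightarrow> S ! x = S ! y"
  using inj[of "S ! x" "S ! y"] n by (auto simp: g_def Sp_def)

lemma pal_extend_block:
  assumes "pal S s (k * m)" "s < 2 * (k * m)" "(k + 1) * m \<le> n" "(k + 1) * m \<le> s + 1"
    and eq: "\<And>u. u < m \<Longrightarrow> S ! (k * m + u) = S ! (s - (k * m + u))"
  shows "pal S s ((k + 1) * m)"
  unfolding pal_def
proof (intro conjI allI impI)
  fix u v assume uv: "u + v = s" "u < (k + 1) * m" "v < (k + 1) * m"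
  show "S ! u = S ! v"
  proof (cases "u < k * m")
    case True
    show ?thesis
    proof (cases "v < k * m")
      case True
      then show ?thesis using assms(1) uv \<open>u < k * m\<close> by (simp add: pal_def)
    next
      case False
      then have "S ! (k * m + (v - k * m)) = S ! (s - (k * m + (v - k * m)))" using uv by (intro eq) simp
      moreover have "k * m + (v - k * m) = v" "s - (k * m + (v - k * m)) = u" using False uv by simp_all
      ultimately show ?thesis by simp
    qed
  next
    case False
    then have "S ! (k * m + (u - k * m)) = S ! (s - (k * m + (u - k * m)))" using uv by (intro eq) simp
    moreover have "k * m + (u - k * m) = u" "s - (k * m + (u - k * m)) = v" using False uv by simp_all
    ultimately show ?thesis by simp
  qed
qed (use assms n in auto)

lemma limD:
  assumes "k < lim s"
  shows "(k + 1) * m \<le> n" "(k + 1) * m \<le> s + 1"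
proof -
  have "k + 1 \<le> n div m" "k + 1 \<le> (s + 1) div m" using assms by (auto simp: lim_def)
  then show "(k + 1) * m \<le> n" "(k + 1) * m \<le> s + 1"
    using m(1) by (simp_all only: less_eq_div_iff_mult_less_eq Suc_le_eq One_nat_def)
qed

text \<open>Matching hash values extend the palindrome piece by piece. At the stop either the hash
  values differ, so some letter of the next piece does, or no further whole piece fits; in both
  cases the true end is within the \<open>m\<close> letters that \<open>far_end\<close>
  scans.\<close>

lemma far_end_correct:
  assumes s: "s + 1 < 2 * n" and start: "pal S s ((s div (2 * m) + 1) * m)"
  shows "far_end s = pal_end S s"
proof -
  have k2: "s < 2 * (k * m)" if "s div (2 * m) + 1 \<le> k" for k
  proof -
    have "s < (s div (2 * m) + 1) * (2 * m)" using m(1) dividend_less_div_times[of "2 * m" s] by simp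
    also have "\<dots> \<le> k * (2 * m)" using that by (rule mult_le_mono1)
    finally show ?thesis by simp
  qed
  note lb = loc_bounds[OF s]
  have "pal S s (k * m)" if "s div (2 * m) + 1 \<le> k" "k \<le> loc s" for k
    using that
  proof (induction k rule: dec_induct)
    case (step k)
    have ns: "\<not> stop s k" using lb(5)[of k] step by simp
    then have l: "(k + 1) * m \<le> n" "(k + 1) * m \<le> s + 1" "bwd_hash k = fwd_hash (s + 1 - (k + 1) * m)"
      using limD[of k s] by (auto simp: stop_def)
    have "S ! (k * m + u) = S ! (s - (k * m + u))" if u: "u < m" for u
    proof -
      have y: "s + 1 - (k + 1) * m + m = s + 1 - k * m" using l(2) by simp
      have "s + 1 - k * m \<le> n" using k2[OF step.hyps(1)] l(1) by simp
      then have "g (k * m + u) = g (s + 1 - (k + 1) * m + m - 1 - u)"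
        using no_collision[OF l(1) _ l(3) u] y by simp
      also have "s + 1 - (k + 1) * m + m - 1 - u = s - (k * m + u)" unfolding y by simp
      finally show ?thesis using l k2[OF step.hyps(1)] u by (intro g_inj) simp_all
    qed
    then show ?case using pal_extend_block[of s k] step l k2[OF step.hyps(1)] by simp
  qed (use start in simp)
  then have pL: "pal S s (loc s * m)" using lb(1) by blast
  define E where "E = pal_end S s"
  have LE: "loc s * m \<le> E" using pL by (simp add: pal_iff E_def)
  have E: "E \<le> n" "E \<le> s + 1" using pal_end_le[of S s] n by (simp_all add: E_def)
  have sL: "s < 2 * (loc s * m)" by (rule k2[OF lb(1)])
  have Eb: "E \<le> loc s * m + m"
  proof (cases "loc s < lim s")
    case True
    then have h: "bwd_hash (loc s) \<noteq> fwd_hash (s + 1 - (loc s + 1) * m)" using lb(2) by (simp add: stop_def)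
    note l = limD[OF True]
    show ?thesis
    proof (rule ccontr)
      assume "\<not> E \<le> loc s * m + m"
      then have "Sp (loc s * m + u) = Sp (s + 1 - (loc s + 1) * m + m - 1 - u)" if "u < m" for u
        using pal_endD[of "loc s * m + u" "s - (loc s * m + u)" s S] l sL that E
        by (simp add: Sp_def E_def[symmetric])
      with h hash_eqI show False by blast
    qed
  next
    case False
    then consider "n div m \<le> loc s" | "(s + 1) div m \<le> loc s" by (auto simp: lim_def)
    then show ?thesis
    proof cases
      case 1
      have "n < (n div m + 1) * m" using m(1) dividend_less_div_times[of m n] by simp
      also have "\<dots> \<le> (loc s + 1) * m" using 1 by (intro mult_le_mono1) simp
      finally show ?thesis using E by simp
    next
      case 2
      have "s + 1 < ((s + 1) div m + 1) * m" using m(1) dividend_less_div_times[of m "s + 1"] by simp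
      also have "\<dots> \<le> (loc s + 1) * m" using 2 by (intro mult_le_mono1) simp
      finally show ?thesis using E by simp
    qed
  qed
  have "far_end s = E"
    unfolding far_end_def
  proof (rule first_eqI[OF LE])
    show "loc s * m + m \<le> E \<or> n \<le> E \<or> s < E \<or> Sp E \<noteq> Sp (s - E)"
    proof (rule ccontr)
      assume c: "\<not> ?thesis"
      have "s - E < n" using c sL LE by linarith
      then have eq: "S ! E = S ! (s - E)" using c by (simp add: Sp_def split: if_splits)
      have "pal S s (E + 1)"
        unfolding pal_def
      proof (intro conjI allI impI)
        fix u v assume uv: "u + v = s" "u < E + 1" "v < E + 1"
        show "S ! u = S ! v"
        proof (cases "u = E \<or> v = E")
          case True
          then show ?thesis using eq uv by auto
        next
          case False
          then show ?thesis using uv pal_endD[of u v s S] by (simp add: E_def)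
        qed
      qed (use c n in auto)
      then show False by (simp add: pal_iff E_def)
    qed
  next
    fix x assume x: "loc s * m \<le> x" "x < E"
    then have "S ! x = S ! (s - x)"
      using pal_endD[of x "s - x" s S] sL E by (simp add: E_def[symmetric])
    then show "\<not> (loc s * m + m \<le> x \<or> n \<le> x \<or> s < x \<or> Sp x \<noteq> Sp (s - x))"
      using x E Eb sL by (simp add: Sp_def)
  qed
  then show ?thesis by (simp add: E_def)
qed

lemma window_end: "lo j + wlen j \<le> n \<or> wlen j = 0"
  by (auto simp: wlen_def)

text \<open>Touching the right end \<open>(j + 5) * B\<close> mirrors to a left end of at most
  \<open>(j - 3) * B\<close>; touching the left end \<open>(j - 4) * B\<close> mirrors to a right
  end beyond \<open>(j + 4) * B\<close>. The common core is what remains in either case, and it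
  contains the start of the first whole piece that a query compares.\<close>

lemma long_center:
  assumes s: "2 * (j * B) \<le> s" "s < 2 * (j * B) + 2 * B" "s + 1 < 2 * n" "long j s"
  shows "3 \<le> j" "(j + 4) * B \<le> pal_end S s" "s + 1 \<le> (j - 3) * B + pal_end S s" "far_end s = pal_end S s"
proof -
  have cw: "2 * lo j \<le> s" "s - 2 * lo j < 2 * wlen j - 1"
    using center_window[of "s - 2 * (j * B)" j] s by simp_all
  have we: "lo j + wlen j \<le> n" using window_end[of j] cw by auto
  have "wend j s \<le> wlen j" "wend j s \<le> s - 2 * lo j + 1"
    using pal_end_le[of "win j" "s - 2 * lo j"] we n by (simp_all add: wend_def win_def)
  then have "pal S (s - 2 * lo j + 2 * lo j) (wend j s + lo j)"
    using pal_window[of "lo j" "wlen j" S "wend j s" "s - 2 * lo j"] we n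
    by (simp add: wend_def win_def pal_iff)
  then have E: "wend j s + lo j \<le> pal_end S s" using cw by (simp add: pal_iff)
  have le: "pal_end S s \<le> s + 1" by (rule pal_end_le)
  from s(4) consider (right) "wend j s = wlen j" "lo j + wlen j < n" | (left) "wend j s = s - 2 * lo j + 1" "0 < lo j"
    by (auto simp: long_def)
  then have "3 \<le> j \<and> (j + 4) * B \<le> pal_end S s \<and> s + 1 \<le> (j - 3) * B + pal_end S s"
  proof cases
    case right
    then have "lo j + wlen j = (j + 5) * B" using cw by (auto simp: wlen_def)
    then have p: "(j + 5) * B \<le> pal_end S s" using E right by simp
    \<comment> \<open>A palindrome around block \<open>j\<close> that reaches
      \<open>(j + 5) * B\<close> needs as much room to its left, which forces
      \<open>3 \<le> j\<close>.\<close>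
    have "(j + 5) * B < (2 * j + 3) * B" using p le s(2) B_pos unfolding add_mult_distrib mult.assoc by linarith
    then have j3: "3 \<le> j" by simp
    then obtain i where i: "j = i + 3" using le_Suc_ex add.commute by metis
    show ?thesis using p s(2) B_pos unfolding i by (simp add: algebra_simps)
  next
    case left
    then have j4: "\<not> j < 4" and l: "lo j = (j - 4) * B" by (auto simp: lo_def)
    then obtain i where i: "j = i + 4" using le_Suc_ex add.commute not_less by metis
    have "(j + 4) * B = lo j + 8 * B" "(j - 3) * B = lo j + B" "2 * (j * B) = 2 * lo j + 8 * B"
      unfolding l unfolding i by (simp_all add: algebra_simps)
    then show ?thesis using E left(1) cw s(1) j4 by linarith
  qed
  then show *: "3 \<le> j" "(j + 4) * B \<le> pal_end S s" "s + 1 \<le> (j - 3) * B + pal_end S s" by auto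
  have "2 * ((s div (2 * m)) * m) \<le> s" using div_times_less_eq_dividend[of s "2 * m"] by (simp add: mult_ac)
  then have "(s div (2 * m) + 1) * m \<le> (j + 4) * B" using s(2) m_le_B by (simp add: algebra_simps)
  then have "(s div (2 * m) + 1) * m \<le> pal_end S s" using *(2) by simp
  then show "far_end s = pal_end S s" by (intro far_end_correct s) (simp add: pal_iff)
qed

lemma hd_last_sorted:
  fixes s :: nat
  assumes "sorted xs" "s \<in> set xs"
  shows "hd xs \<le> s" "s \<le> last xs"
  using assms by (induction xs) (auto simp: last_ConsR split: if_splits)

lemma final_end_correct:
  assumes s: "2 * (j * B) \<le> s" "s < 2 * (j * B) + 2 * B" "s + 1 < 2 * n" and j: "j < m"
  shows "final_end j (end1 j) (end2 j) (far_end (third_query j (end1 j) (end2 j))) s = pal_end S s"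
proof (cases "long j s")
  case False
  have cw: "2 * lo j \<le> s" "s - 2 * lo j < 2 * wlen j - 1"
    using center_window[of "s - 2 * (j * B)" j] s by simp_all
  have we: "lo j + wlen j \<le> n" using window_end[of j] cw by auto
  have "pal_end S (s - 2 * lo j + 2 * lo j) = wend j s + lo j"
    by (rule pal_end_window[of "lo j" "wlen j"]) (use False we n in \<open>auto simp: long_def wend_def win_def\<close>)
  then show ?thesis using False cw by (simp add: final_end_def)
next
  case True
  define L where "L = longs j (2 * B)"
  have Lset: "set L = {s. 2 * (j * B) \<le> s \<and> s < 2 * (j * B) + 2 * B \<and> s + 1 < 2 * n \<and> long j s}"
    by (auto simp: L_def longs_def)
  have sL: "s \<in> set L" using s True by (simp add: Lset)
  then have ne: "L \<noteq> []" by auto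
  have fl: "fst_long j = hd L" "lst_long j = last L" using ne by (simp_all add: fst_long_def lst_long_def L_def)
  have fin: "fst_long j \<in> set L" "lst_long j \<in> set L" using ne by (simp_all add: fl)
  have srt: "sorted L" by (simp add: L_def longs_def sorted_wrt_filter)
  have le: "fst_long j \<le> s" "s \<le> lst_long j" using hd_last_sorted[OF srt sL] by (simp_all add: fl)
  have x1: "end1 j = pal_end S (fst_long j)" and x2: "end2 j = pal_end S (lst_long j)"
    using fin by (auto simp: Lset intro!: long_center(4))
  note lc = long_center[OF s True]
  have bnd: "end1 j \<le> n" "end2 j \<le> n" "fst_long j < 2 * n" using pal_end_le(1)[of S] n fin by (auto simp: x1 x2 Lset)
  have w4: "4 * n < word_bound w" using small by linarith
  consider "s = fst_long j" | "s = lst_long j" "s \<noteq> fst_long j" | "fst_long j < s" "s < lst_long j" using le by linarith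
  then show ?thesis
  proof cases
    case 3
    show ?thesis
    proof (cases "s = mid_center j (end1 j) (end2 j)")
      case True
      then have "third_query j (end1 j) (end2 j) = s" using 3 by (simp add: third_query_def Let_def)
      then show ?thesis using \<open>long j s\<close> 3 True lc(4) by (simp add: final_end_def)
    next
      case False
      have mid: "s + end1 j \<noteq> fst_long j + end2 j"
      proof
        assume e: "s + end1 j = fst_long j + end2 j"
        then have "mid_center j (end1 j) (end2 j) = fst_long j + end2 j - end1 j"
          unfolding mid_center_def using bnd w4 by (intro wsub_eq) linarith+
        with e False show False by simp
      qed
      \<comment> \<open>The two extreme sums differ by less than \<open>2 * B\<close>, while the
        core has \<open>7 * B\<close> letters; so at least one period separates every center
        involved from either end of the core.\<close>
      have "pal_end S s = min (s + pal_end S (fst_long j) - fst_long j) (pal_end S (lst_long j))"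
      proof (rule pal_end_between[where a = "(j - 3) * B" and b = "(j + 4) * B"])
        show "(j + 4) * B \<le> length S" using lc(2) pal_end_le(1)[of S s] by simp
        have d: "fst_long j \<ge> 2 * (j * B)" "lst_long j < 2 * (j * B) + 2 * B" using fin by (auto simp: Lset)
        obtain i where i: "j = i + 3" using le_Suc_ex[OF lc(1)] add.commute by metis
        show "2 * ((j - 3) * B) + 2 * (lst_long j - fst_long j) \<le> fst_long j" using d unfolding i by (simp add: algebra_simps)
        show "lst_long j + 2 * (lst_long j - fst_long j) \<le> 2 * ((j + 4) * B)" using d unfolding i by (simp add: algebra_simps)
        show "(j + 4) * B \<le> pal_end S s' \<and> s' + 1 \<le> (j - 3) * B + pal_end S s'" if "s' \<in> {fst_long j, s, lst_long j}" for s'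
        proof -
          have "s' \<in> set L" using that fin sL by auto
          then show ?thesis using long_center(2,3)[of j s'] by (auto simp: Lset)
        qed
      qed (use 3 mid x1 x2 in auto)
      moreover have "wsub w (s + end1 j) (fst_long j) = s + end1 j - fst_long j"
        by (rule wsub_eq) (use 3 bnd w4 s(3) in linarith)+
      ultimately show ?thesis using \<open>long j s\<close> 3 False by (simp add: final_end_def x1 x2)
    qed
  qed (use True x1 x2 in \<open>simp_all add: final_end_def\<close>)
qed

definition extremes :: "nat \<Rightarrow> nat \<times> nat" where
  "extremes s = (s + 1 - pal_end S s, pal_end S s - 1)"

lemma concat_map_filter:
  "concat (map (\<lambda>s. if P s then [h s] else []) xs) = map h (filter P xs)"
  "concat (map f (filter P xs)) = concat (map (\<lambda>s. if P s then f s else []) xs)"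
  by (induction xs) auto

lemma results_correct:
  shows "distinct (concat (map result [0..<m]))" "set (concat (map result [0..<m])) = maximal_palindromes S"
proof -
  define P where "P s \<longleftrightarrow> s + 1 < 2 * n \<and> s + 1 < 2 * pal_end S s" for s
  have em: "emitted j (end1 j) (end2 j) (far_end (third_query j (end1 j) (end2 j))) s = (if P s then [extremes s] else [])"
    if "j < m" "2 * (j * B) \<le> s" "s < 2 * (j * B) + 2 * B" "s + 1 < 2 * n" for j s
  proof -
    define x where "x = pal_end S s"
    have x: "final_end j (end1 j) (end2 j) (far_end (third_query j (end1 j) (end2 j))) s = x"
      using final_end_correct that by (simp add: x_def)
    have xn: "x \<le> n" "x \<le> s + 1" using pal_end_le[of S s] n by (simp_all add: x_def)
    have w4: "4 * n < word_bound w" using small by linarith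
    have "(x + x) mod word_bound w = 2 * x" using xn w4 by simp
    moreover have "wsub w (s + 1) x = s + 1 - x" using xn w4 that by (intro wsub_eq) linarith+
    moreover have "wsub w x 1 = x - 1" if "s + 1 < 2 * x" using xn w4 that by (intro wsub_eq) linarith+
    ultimately show ?thesis using that
      by (simp add: emitted_def x Let_def P_def extremes_def x_def[symmetric])
  qed
  have "result j = concat (map (\<lambda>u. if P (j * (2 * B) + u) then [extremes (j * (2 * B) + u)] else []) [0..<2 * B])" if j: "j < m" for j
  proof -
    have "result j = concat (map (\<lambda>s. if P s then [extremes s] else []) [j * (2 * B)..<j * (2 * B) + 2 * B])"
      unfolding result_def concat_map_filter(2)
      by (intro arg_cong[where f = concat] map_cong) (use em[OF j] in \<open>auto simp: P_def mult_ac\<close>)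
    also have "[j * (2 * B)..<j * (2 * B) + 2 * B] = map (\<lambda>u. j * (2 * B) + u) [0..<2 * B]"
      by (simp add: map_add_upt add.commute)
    finally show ?thesis by (simp add: o_def)
  qed
  then have "concat (map result [0..<m]) = concat (map (\<lambda>j. concat (map (\<lambda>u. if P (j * (2 * B) + u) then [extremes (j * (2 * B) + u)] else []) [0..<2 * B])) [0..<m])"
    by (intro arg_cong[where f = concat] map_cong) auto
  also have "\<dots> = concat (map (\<lambda>s. if P s then [extremes s] else []) [0..<m * (2 * B)])"
    by (rule concat_blocks)
  also have "\<dots> = map extremes (filter P [0..<m * (2 * B)])" by (rule concat_map_filter)
  finally have r: "concat (map result [0..<m]) = map extremes (filter P [0..<m * (2 * B)])" .
  \<comment> \<open>The sum of the end positions recovers the center, so distinct centers give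
    distinct outputs.\<close>
  have "fst (extremes s) + snd (extremes s) = s" if "P s" for s
    using that pal_end_le(2)[of S s] by (auto simp: extremes_def P_def)
  then have "inj_on extremes {s. P s}" by (intro inj_onI) (metis mem_Collect_eq)
  then show "distinct (concat (map result [0..<m]))"
    unfolding r distinct_map by (auto intro: inj_on_subset)
  have "s < m * (2 * B)" if "P s" for s using that m(3) by (simp add: P_def)
  then have "set (filter P [0..<m * (2 * B)]) = {s. s + 1 < 2 * length S \<and> s + 1 < 2 * pal_end S s}"
    using n by (auto simp: P_def)
  then show "set (concat (map result [0..<m])) = maximal_palindromes S"
    unfolding r set_map maximal_palindromes_eq by (simp add: extremes_def[abs_def])
qed

end


section \<open>The deterministic rounds\<close>

lemma sum_card_fibres: "(\<Sum>j<m. card {i. i < m \<and> f i = j}) \<le> (m :: nat)"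
proof -
  have "(\<Sum>j<m. card {i. i < m \<and> f i = j}) = card (\<Union>j\<in>{..<m}. {i. i < m \<and> f i = j})"
    by (rule card_UN_disjoint[symmetric]) auto
  also have "\<dots> \<le> card {..<m}" by (rule card_mono) auto
  finally show ?thesis by simp
qed

lemma inwords_simps [simp]: "inwords (M\<lparr>steps := s\<rparr>) = inwords M" by (simp add: inwords_def)

locale hashed_input = mpc_input + hashed
begin

lemma next_simps [simp]: "inwords (next_state t inb pk st M) = map snd inb"
  "memory (next_state t inb pk st M) = memory M" "outputs (next_state t inb pk st M) = outputs M"
  "finished (next_state t inb pk st M) = finished M"
  "r \<noteq> 4 \<Longrightarrow> regs (next_state t inb pk st M) r = regs M r"
  by (simp_all add: next_state_def inwords_def)

lemma hbase_next [simp]: "hbase j (next_state t inb pk st M) = hbase j M"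
  and hbase_steps [simp]: "hbase j (M\<lparr>steps := s\<rparr>) = hbase j M"
  by (simp_all add: hbase_def base_def next_state_def)

definition distributed :: "nat \<Rightarrow> machine \<Rightarrow> bool" where
  "distributed j M \<longleftrightarrow> base j M \<and> (\<forall>u. lo j + u < (j + 5) * B \<longrightarrow> memory M u = Sp (lo j + u)) \<and> inwords M = [Mo, b, \<alpha>, q] \<and>
     outputs M = [] \<and> \<not> finished M"

definition windowed :: "nat \<Rightarrow> machine \<Rightarrow> bool" where
  "windowed j M \<longleftrightarrow> hbase j M \<and> (\<forall>u. lo j + u < (j + 5) * B \<longrightarrow> memory M u = Sp (lo j + u)) \<and> outputs M = [] \<and> \<not> finished M"

definition hash_received :: "nat \<Rightarrow> machine \<Rightarrow> bool" where
  "hash_received j M \<longleftrightarrow> windowed j M \<and> inwords M = concat (map (\<lambda>u. [Sp (j + u * m), fwd_hash (j + u * m)]) [0..<B])"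

definition sampled :: "nat \<Rightarrow> machine \<Rightarrow> bool" where
  "sampled j M \<longleftrightarrow> windowed j M \<and> (\<forall>u<B. memory M (9 * B + u) = Sp (j + u * m)) \<and> (\<forall>u<B. memory M (10 * B + u) = fwd_hash (j + u * m))"

definition pieces_received :: "nat \<Rightarrow> machine \<Rightarrow> bool" where
  "pieces_received j M \<longleftrightarrow> sampled j M \<and> inwords M = map bwd_hash [0..<B]"

definition stored :: "nat \<Rightarrow> machine \<Rightarrow> bool" where
  "stored j M \<longleftrightarrow> hbase j M \<and> outputs M = [] \<and> \<not> finished M \<and> regs M 12 = fst_long j \<and> regs M 13 = lst_long j \<and> regs M 18 = wlen j \<and>
     (\<forall>u<B. memory M (9 * B + u) = Sp (j + u * m)) \<and> (\<forall>u<B. memory M (10 * B + u) = fwd_hash (j + u * m)) \<and>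
     (\<forall>u<B. memory M (11 * B + u) = bwd_hash u) \<and> (\<forall>t<2 * wlen j - 1. memory M (12 * B + t) = pal_end (win j) t)"

text \<open>\<open>E\<close> records what earlier queries have left in registers 16, 17 and 19, so
  that the single lemma \<open>query_step\<close> serves all three queries.\<close>

definition asked :: "(nat \<Rightarrow> nat) \<Rightarrow> (nat \<Rightarrow> nat \<Rightarrow> nat \<Rightarrow> nat \<Rightarrow> bool) \<Rightarrow> nat \<Rightarrow> machine \<Rightarrow> bool" where
  "asked s E j M \<longleftrightarrow> stored j M \<and> regs M 14 = s j \<and> E j (regs M 16) (regs M 17) (regs M 19)"

definition queries_received where
  "queries_received s E j M \<longleftrightarrow> asked s E j M \<and> inwords M = map s [0..<m]"

definition answers_received where
  "answers_received s E j M \<longleftrightarrow> asked s E j M \<and> inwords M = map (\<lambda>r. if (s j + 1) mod m = r then loc (s j) else 0) [0..<m]"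

definition relays_received where
  "relays_received s E j M \<longleftrightarrow> asked s E j M \<and> regs M 15 = loc (s j) \<and> inwords M = concat (map (\<lambda>i. [s i, loc (s i)]) [0..<m])"

definition letters_received where
  "letters_received s E j M \<longleftrightarrow> asked s E j M \<and> regs M 15 = loc (s j) \<and>
     inwords M = concat (map (\<lambda>r. [Sp (r + loc (s j) * m), mirror_letter r (s j) (loc (s j))]) [0..<m])"

lemma asked_simps [simp]: "asked s E j (next_state t inb pk st M) = asked s E j M"
  "asked s E j (M\<lparr>steps := x\<rparr>) = asked s E j M"
  by (simp_all add: asked_def stored_def)

lemma asked_frame: "frame M M' \<Longrightarrow> memory M' = memory M \<Longrightarrow> asked s E j M \<Longrightarrow> asked s E j M'"
  using hbase_frame[of M M' j] by (simp add: asked_def stored_def frameD)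

lemma hash_inwords:
  assumes "j < m"
  shows "concat (map (\<lambda>i. msgs (concat (map (\<lambda>z. [(z mod m, Sp (i * B + z)), (z mod m, fwd_hash (i * B + z))]) [0..<B])) j) [0..<m]) =
    concat (map (\<lambda>u. [Sp (j + u * m), fwd_hash (j + u * m)]) [0..<B])"
proof -
  have "msgs (concat (map (\<lambda>z. [(z mod m, Sp (i * B + z)), (z mod m, fwd_hash (i * B + z))]) [0..<B])) j =
      concat (map (\<lambda>u. [Sp (j + (i * \<beta> + u) * m), fwd_hash (j + (i * \<beta> + u) * m)]) [0..<\<beta>])" for i
  proof -
    have "msgs (concat (map (\<lambda>z. [(z mod m, Sp (i * B + z)), (z mod m, fwd_hash (i * B + z))]) [0..<B])) j =
        concat (map (\<lambda>z. if z mod m = j then [Sp (i * B + z), fwd_hash (i * B + z)] else []) [0..<m * \<beta>])"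
      unfolding msgs_concat map_map o_def B_def[symmetric] by (intro arg_cong[where f = concat] map_cong) auto
    also have "\<dots> = concat (map (\<lambda>u. [Sp (i * B + (j + u * m)), fwd_hash (i * B + (j + u * m))]) [0..<\<beta>])"
      by (rule concat_residue_class[OF assms])
    finally have 1: "msgs (concat (map (\<lambda>z. [(z mod m, Sp (i * B + z)), (z mod m, fwd_hash (i * B + z))]) [0..<B])) j =
        concat (map (\<lambda>u. [Sp (i * B + (j + u * m)), fwd_hash (i * B + (j + u * m))]) [0..<\<beta>])" .
    have "i * B + (j + u * m) = j + (i * \<beta> + u) * m" for u by (simp add: B_def algebra_simps)
    then show ?thesis unfolding 1 by (simp only:)
  qed
  then show ?thesis
    using concat_blocks[of "\<lambda>u. [Sp (j + u * m), fwd_hash (j + u * m)]" \<beta> m] by (simp only: B_def)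
qed

lemma piece_inwords:
  assumes "r < m"
  shows "concat (map (\<lambda>j. msgs (concat (map (\<lambda>t. map (\<lambda>r. (r, bwd_hash (j * \<beta> + t))) [0..<m]) [0..<\<beta>])) r) [0..<m]) = map bwd_hash [0..<B]"
proof -
  have "msgs (concat (map (\<lambda>t. map (\<lambda>r. (r, bwd_hash (j * \<beta> + t))) [0..<m]) [0..<\<beta>])) r = concat (map (\<lambda>t. [bwd_hash (j * \<beta> + t)]) [0..<\<beta>])" for j
    unfolding msgs_concat map_map o_def msgs_spread[OF assms] ..
  then show ?thesis
    using concat_blocks[of "\<lambda>u. [bwd_hash u]" \<beta> m] by (simp add: B_def concat_map_singleton)
qed

lemma spread_inwords: "r < m \<Longrightarrow> concat (map (\<lambda>j. msgs (map (\<lambda>r. (r, s j)) [0..<m]) r) [0..<m]) = map s [0..<m]"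
  by (simp add: msgs_spread concat_map_singleton)

lemma hash_step:
  assumes "bounded_stage N 2 distributed cfg"
  shows "\<exists>cfg'. run cfg = run cfg' \<and> bounded_stage (N + (50 + 20) * (m * B)) 3 hash_received cfg'"
proof -
  have "\<exists>cfg'. run cfg = run cfg' \<and> bounded_stage (N + (50 + 20) * (m * B)) (Suc 2) hash_received cfg'"
  proof (rule det_step[OF assms, where p = hash_round and X = windowed and c = "\<lambda>_. 50 * B" and
      ob = "\<lambda>j. concat (map (\<lambda>z. [(z mod m, Sp (j * B + z)), (z mod m, fwd_hash (j * B + z))]) [0..<B])" and
      inw = "\<lambda>j. concat (map (\<lambda>u. [Sp (j + u * m), fwd_hash (j + u * m)]) [0..<B])"], goal_cases)
    case (3 j M)
    show ?case
      by (rule wp_hash_round[of j M]) (use 3 in \<open>auto simp: distributed_def windowed_def local_post_def\<close>)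
  qed (use B_pos in \<open>auto simp: round_programs_def distributed_def base_def hash_inwords nth_pairs hash_received_def windowed_def simp del: length_concat\<close>)
  then show ?thesis by (simp only: Suc_numeral semiring_norm)
qed

lemma piece_step:
  assumes "bounded_stage N 3 hash_received cfg"
  shows "\<exists>cfg'. run cfg = run cfg' \<and> bounded_stage (N + (100 + 20) * (m * B)) 4 pieces_received cfg'"
proof -
  have l: "length (concat (map (\<lambda>t. map (\<lambda>r. (r, f t)) [0..<m]) [0..<c])) = c * m" for f :: "nat \<Rightarrow> nat" and c
    by (induction c) auto
  have "\<exists>cfg'. run cfg = run cfg' \<and> bounded_stage (N + (100 + 20) * (m * B)) (Suc 3) pieces_received cfg'"
  proof (rule det_step[OF assms, where p = piece_round and X = sampled and c = "\<lambda>_. 100 * B" and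
      ob = "\<lambda>j. concat (map (\<lambda>t. map (\<lambda>r. (r, bwd_hash (j * \<beta> + t))) [0..<m]) [0..<\<beta>])" and
      inw = "\<lambda>j. map bwd_hash [0..<B]"], goal_cases)
    case (3 j M)
    show ?case
    proof (rule wp_piece_round[of j M], goal_cases)
      case (5 M')
      have "windowed j M'"
        using 3(2) 5(1,3) hbase_frame[OF 5(1)] window_less[of j]
        by (auto simp: hash_received_def windowed_def frameD[OF 5(1)])
      moreover have "memory M' (9 * B + u) = Sp (j + u * m)" "memory M' (10 * B + u) = fwd_hash (j + u * m)" if "u < B" for u
        using 5(4,5)[OF that] 3(2) nth_pairs(1,2)[OF that] by (simp_all add: hash_received_def)
      ultimately show ?case
        using 3 5 B_pos by (auto simp: local_post_def sampled_def frameD[OF 5(1)] hash_received_def windowed_def)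
    qed (use 3 nth_pairs(3) in \<open>auto simp: hash_received_def windowed_def simp del: length_concat\<close>)
  qed (use B_pos in \<open>auto simp: round_programs_def piece_inwords l B_def[symmetric] mult.commute[of \<beta>] hash_received_def pieces_received_def sampled_def windowed_def simp del: length_concat\<close>)
  then show ?thesis by (simp only: Suc_numeral semiring_norm)
qed

lemma local_step:
  assumes "bounded_stage N 4 pieces_received cfg"
  shows "\<exists>cfg'. run cfg = run cfg' \<and> bounded_stage (N + (2000 + 20) * (m * B)) 5 (queries_received fst_long (\<lambda>_ _ _ _. True)) cfg'"
proof -
  have "\<exists>cfg'. run cfg = run cfg' \<and> bounded_stage (N + (2000 + 20) * (m * B)) (Suc 4) (queries_received fst_long (\<lambda>_ _ _ _. True)) cfg'"
  proof (rule det_step[OF assms, where p = local_round and X = "asked fst_long (\<lambda>_ _ _ _. True)" and c = "\<lambda>_. 2000 * B" and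
      ob = "\<lambda>j. map (\<lambda>r. (r, fst_long j)) [0..<m]" and inw = "\<lambda>j. map fst_long [0..<m]"], goal_cases)
    case (3 j M)
    show ?case
    proof (rule wp_local_round[of j M], goal_cases)
      case (5 M')
      have "asked fst_long (\<lambda>_ _ _ _. True) j M'"
        using 3(2) 5 by (auto simp: asked_def stored_def pieces_received_def sampled_def windowed_def)
      then show ?case using 3 5 by (auto simp: local_post_def pieces_received_def sampled_def windowed_def)
    qed (use 3 in \<open>auto simp: pieces_received_def sampled_def windowed_def\<close>)
  qed (use m_le_B in \<open>auto simp: round_programs_def spread_inwords queries_received_def pieces_received_def sampled_def windowed_def\<close>)
  then show ?thesis by (simp only: Suc_numeral semiring_norm)
qed

lemma asked_unfinished: "asked s E j M \<Longrightarrow> \<not> finished M" and asked_outputs: "asked s E j M \<Longrightarrow> outputs M = []"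
  by (simp_all add: asked_def stored_def)

lemma query_step:
  assumes st: "bounded_stage N t (queries_received s E) cfg" and t: "Suc (Suc t) < 17"
    and prog: "round_programs k J ! t = answer_round" "round_programs k J ! Suc t = relay_round" "round_programs k J ! Suc (Suc t) = letters_round"
    and s: "\<And>j. s j + 1 < 2 * n"
  shows "\<exists>cfg'. run cfg = run cfg' \<and> bounded_stage (N + 200 * (m * B)) (Suc (Suc (Suc t))) (letters_received s E) cfg'"
proof -
  have "\<exists>cfg'. run cfg = run cfg' \<and> bounded_stage (N + (90 + 20) * (m * B)) (Suc t) (answers_received s E) cfg'"
  proof (rule det_step[OF st _ prog(1), where X = "asked s E" and c = "\<lambda>j. 30 * B + 60 * B * card {i. i < m \<and> (s i + 1) mod m = j}" and
      ob = "\<lambda>j. map (\<lambda>i. (i, if (s i + 1) mod m = j then loc (s i) else 0)) [0..<m]" and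
      inw = "\<lambda>j. map (\<lambda>r. if (s j + 1) mod m = r then loc (s j) else 0) [0..<m]"], goal_cases)
    case (2 j M)
    show ?case
    proof (rule wp_answer_round[of j M s], goal_cases)
      case (8 M')
      then show ?case using 2 asked_frame[OF 8(1,3), of s E j]
        by (auto simp: local_post_def frameD[OF 8(1)] queries_received_def asked_outputs)
    qed (use 2 s in \<open>auto simp: queries_received_def asked_def stored_def\<close>)
  next
    case (9)
    \<comment> \<open>Every query belongs to one residue class only, so the loads of all machines
      add up to at most \<open>m\<close> queries.\<close>
    have "60 * B * (\<Sum>j<m. card {i. i < m \<and> (s i + 1) mod m = j}) \<le> 60 * B * m"
      by (intro mult_le_mono2 sum_card_fibres)
    then show ?case by (simp add: sum.distrib sum_distrib_left[symmetric] algebra_simps)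
  qed (use t m_le_B in \<open>auto simp: queries_received_def answers_received_def asked_unfinished msgs_spread concat_map_singleton\<close>)
  then obtain cfg1 where c1: "run cfg = run cfg1" "bounded_stage (N + 110 * (m * B)) (Suc t) (answers_received s E) cfg1" by auto
  have "\<exists>cfg'. run cfg1 = run cfg' \<and> bounded_stage (N + 110 * (m * B) + (10 + 20) * (m * B)) (Suc (Suc t)) (relays_received s E) cfg'"
  proof (rule det_step[OF c1(2) _ prog(2), where X = "\<lambda>j M. asked s E j M \<and> regs M 15 = loc (s j)" and c = "\<lambda>j. 10 * B" and
      ob = "\<lambda>j. concat (map (\<lambda>r. [(r, s j), (r, loc (s j))]) [0..<m])" and
      inw = "\<lambda>j. concat (map (\<lambda>i. [s i, loc (s i)]) [0..<m])"], goal_cases)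
    case (2 j M)
    have sm: "(s j + 1) mod m < m" using m(1) by simp
    show ?case
    proof (rule wp_relay_round[of j M "s j" "loc (s j)"], goal_cases)
      case (6 M')
      have "asked s E j M'" using 2(2) 6 by (auto simp: answers_received_def asked_def stored_def)
      then show ?case using 2 6 by (auto simp: local_post_def answers_received_def asked_outputs)
    qed (use 2 s sm in \<open>auto simp: answers_received_def asked_def stored_def\<close>)
  next
    case (6 j)
    have "msgs (concat (map (\<lambda>r. [(r, s i), (r, loc (s i))]) [0..<m])) j = [s i, loc (s i)]" for i
      using 6 by (intro msgs_all_to_all) auto
    then show ?case by simp
  qed (use t m_le_B in \<open>auto simp: answers_received_def relays_received_def asked_unfinished nth_pairs(3) simp del: length_concat\<close>)
  then obtain cfg2 where c2: "run cfg = run cfg2" "bounded_stage (N + 140 * (m * B)) (Suc (Suc t)) (relays_received s E) cfg2"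
    using c1(1) by (auto simp: algebra_simps)
  have "\<exists>cfg'. run cfg2 = run cfg' \<and> bounded_stage (N + 140 * (m * B) + (30 + 20) * (m * B)) (Suc (Suc (Suc t))) (letters_received s E) cfg'"
  proof (rule det_step[OF c2(2) t prog(3), where X = "\<lambda>j M. asked s E j M \<and> regs M 15 = loc (s j)" and c = "\<lambda>j. 30 * B" and
      ob = "\<lambda>j. concat (map (\<lambda>i. [(i, Sp (j + loc (s i) * m)), (i, mirror_letter j (s i) (loc (s i)))]) [0..<m])" and
      inw = "\<lambda>j. concat (map (\<lambda>r. [Sp (r + loc (s j) * m), mirror_letter r (s j) (loc (s j))]) [0..<m])"], goal_cases)
    case (1 j M)
    have np: "i < m \<Longrightarrow> inwords M ! (2 * i) = s i" "i < m \<Longrightarrow> inwords M ! (2 * i + 1) = loc (s i)" "length (inwords M) = 2 * m" for i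
      using 1(2) nth_pairs(1,2)[of i m s "\<lambda>i. loc (s i)"] nth_pairs(3)[of s "\<lambda>i. loc (s i)" m] by (simp_all add: relays_received_def)
    show ?case
    proof (rule wp_letters_round[of j M s "\<lambda>i. loc (s i)"], goal_cases)
      case (9 M')
      then show ?case using 1 asked_frame[OF 9(1,3), of s E j]
        by (auto simp: local_post_def frameD[OF 9(1)] relays_received_def asked_outputs)
    qed (use 1 s np loc_bounds(3) in \<open>auto simp: relays_received_def asked_def stored_def\<close>)
  next
    case (5 j)
    have "msgs (concat (map (\<lambda>i'. [(i', Sp (i + loc (s i') * m)), (i', mirror_letter i (s i') (loc (s i')))]) [0..<m])) j =
        [Sp (i + loc (s j) * m), mirror_letter i (s j) (loc (s j))]" for i
      using 5 by (intro msgs_all_to_all) auto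
    then show ?case by simp
  qed (use m_le_B in \<open>auto simp: relays_received_def letters_received_def asked_unfinished nth_pairs(3) simp del: length_concat\<close>)
  then obtain cfg3 where c3: "run cfg = run cfg3" "bounded_stage (N + 190 * (m * B)) (Suc (Suc (Suc t))) (letters_received s E) cfg3"
    using c2(1) by (auto simp: algebra_simps)
  from c3(2) have "bounded_stage (N + 200 * (m * B)) (Suc (Suc (Suc t))) (letters_received s E) cfg3"
    unfolding bounded_stage_def by (elim ex_forward) auto
  then show ?thesis using c3(1) by blast
qed

lemma letters_nth:
  assumes "letters_received s E j M"
  shows "length (inwords M) = 2 * m" "r < m \<Longrightarrow> inwords M ! (2 * r) = Sp (r + loc (s j) * m)"
    "r < m \<Longrightarrow> inwords M ! (2 * r + 1) = mirror_letter r (s j) (loc (s j))"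
  using assms nth_pairs(1,2)[of r m "\<lambda>r. Sp (r + loc (s j) * m)" "\<lambda>r. mirror_letter r (s j) (loc (s j))"]
    nth_pairs(3)[of "\<lambda>r. Sp (r + loc (s j) * m)" "\<lambda>r. mirror_letter r (s j) (loc (s j))" m]
  by (simp_all add: letters_received_def)

abbreviation query3 :: "nat \<Rightarrow> nat" where "query3 j \<equiv> third_query j (end1 j) (end2 j)"

lemma first_step:
  assumes "bounded_stage N 8 (letters_received fst_long (\<lambda>_ _ _ _. True)) cfg"
  shows "\<exists>cfg'. run cfg = run cfg' \<and> bounded_stage (N + (30 + 20) * (m * B)) 9 (queries_received lst_long (\<lambda>j x y z. x = end1 j)) cfg'"
proof -
  have "\<exists>cfg'. run cfg = run cfg' \<and> bounded_stage (N + (30 + 20) * (m * B)) (Suc 8) (queries_received lst_long (\<lambda>j x y z. x = end1 j)) cfg'"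
  proof (rule det_step[OF assms, where p = first_round and X = "asked lst_long (\<lambda>j x y z. x = end1 j)" and c = "\<lambda>_. 30 * B" and
      ob = "\<lambda>j. map (\<lambda>r. (r, lst_long j)) [0..<m]" and inw = "\<lambda>j. map lst_long [0..<m]"], goal_cases)
    case (3 j M)
    note ln = letters_nth[OF 3(2)]
    show ?case
    proof (rule wp_first_round[of j M "fst_long j" "lst_long j"], goal_cases)
      case (10 M')
      have "asked lst_long (\<lambda>j x y z. x = end1 j) j M'"
        using 3(2) 10 by (auto simp: asked_def stored_def letters_received_def)
      then show ?case using 3 10 by (auto simp: local_post_def letters_received_def asked_outputs)
    qed (use 3 ln fst_long_less in \<open>auto simp: letters_received_def asked_def stored_def\<close>)
  qed (use m_le_B in \<open>auto simp: round_programs_def spread_inwords queries_received_def letters_received_def asked_unfinished\<close>)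
  then show ?thesis by (simp only: Suc_numeral semiring_norm)
qed

lemma second_step:
  assumes "bounded_stage N 12 (letters_received lst_long (\<lambda>j x y z. x = end1 j)) cfg"
  shows "\<exists>cfg'. run cfg = run cfg' \<and> bounded_stage (N + (30 + 20) * (m * B)) 13
     (queries_received query3 (\<lambda>j x y z. x = end1 j \<and> y = end2 j \<and> z = mid_center j (end1 j) (end2 j))) cfg'"
proof -
  have "\<exists>cfg'. run cfg = run cfg' \<and> bounded_stage (N + (30 + 20) * (m * B)) (Suc 12)
     (queries_received query3 (\<lambda>j x y z. x = end1 j \<and> y = end2 j \<and> z = mid_center j (end1 j) (end2 j))) cfg'"
  proof (rule det_step[OF assms, where p = second_round and
      X = "asked query3 (\<lambda>j x y z. x = end1 j \<and> y = end2 j \<and> z = mid_center j (end1 j) (end2 j))" and c = "\<lambda>_. 30 * B" and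
      ob = "\<lambda>j. map (\<lambda>r. (r, query3 j)) [0..<m]" and inw = "\<lambda>j. map query3 [0..<m]"], goal_cases)
    case (3 j M)
    note ln = letters_nth[OF 3(2)]
    show ?case
    proof (rule wp_second_round[of j M "lst_long j" "end1 j"], goal_cases)
      case (12 M')
      have "asked query3 (\<lambda>j x y z. x = end1 j \<and> y = end2 j \<and> z = mid_center j (end1 j) (end2 j)) j M'"
        using 3(2) 12 by (auto simp: asked_def stored_def letters_received_def)
      then show ?case using 3 12 by (auto simp: local_post_def letters_received_def asked_outputs)
    qed (use 3 ln lst_long_less in \<open>auto simp: letters_received_def asked_def stored_def\<close>)
  qed (use m_le_B in \<open>auto simp: round_programs_def spread_inwords queries_received_def letters_received_def asked_unfinished\<close>)
  then show ?thesis by (simp only: Suc_numeral semiring_norm)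
qed

definition done_machine :: "nat \<Rightarrow> machine \<Rightarrow> bool" where
  "done_machine j M \<longleftrightarrow> finished M \<and> outputs M = result j"

lemma length_result: "length (result j) \<le> 4 * B"
proof -
  have "length (concat (map (emitted j x y z) xs)) \<le> length xs" for x y z xs
    by (induction xs) (auto simp: emitted_def Let_def)
  from this[of _ _ _ "filter (\<lambda>s. s + 1 < 2 * n) [2 * (j * B)..<2 * (j * B) + 2 * B]"]
  have "length (result j) \<le> length (filter (\<lambda>s. s + 1 < 2 * n) [2 * (j * B)..<2 * (j * B) + 2 * B])"
    unfolding result_def .
  also have "\<dots> \<le> 2 * B" by (rule order_trans[OF length_filter_le]) simp
  finally show ?thesis by simp
qed

lemma last_step:
  assumes "bounded_stage N 16 (letters_received query3 (\<lambda>j x y z. x = end1 j \<and> y = end2 j \<and> z = mid_center j (end1 j) (end2 j))) cfg"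
  shows "\<exists>cfg'. run cfg = run cfg' \<and> bounded_stage (N + (200 + 20) * (m * B)) 17 done_machine cfg'"
proof -
  have "\<exists>cfg'. run cfg = run cfg' \<and> bounded_stage (N + (200 + 20) * (m * B)) (Suc 16) done_machine cfg'"
  proof (rule det_step[OF assms, where p = last_round and X = done_machine and c = "\<lambda>_. 200 * B" and
      ob = "\<lambda>j. []" and inw = "\<lambda>j. []"], goal_cases)
    case (3 j M)
    note ln = letters_nth[OF 3(2)]
    show ?case
    proof (rule wp_last_round[of j M "query3 j" "end1 j" "end2 j"], goal_cases)
      case (17 M')
      then have "outputs M' = result j" using asked_outputs 3(2) unfolding letters_received_def result_def by fastforce
      then show ?case using 3 17 length_result by (auto simp: local_post_def letters_received_def done_machine_def)
    qed (use 3 ln third_query_less far_end_le(3)[OF fst_long_less] in \<open>auto simp: letters_received_def asked_def stored_def\<close>)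
  qed (auto simp: round_programs_def letters_received_def asked_unfinished done_machine_def)
  then show ?thesis by (simp only: Suc_numeral semiring_norm)
qed

lemma deterministic_rounds:
  assumes "bounded_stage N 2 distributed cfg"
  shows "\<exists>cfg'. run cfg = return_spmf cfg' \<and> bounded_stage (N + 4000 * (m * B)) 17 done_machine cfg'"
proof -
  obtain c3 where 3: "run cfg = run c3" "bounded_stage (N + 70 * (m * B)) 3 hash_received c3"
    using hash_step[OF assms] by auto
  obtain c4 where 4: "run cfg = run c4" "bounded_stage (N + 190 * (m * B)) 4 pieces_received c4"
    using piece_step[OF 3(2)] 3(1) by (auto simp: algebra_simps)
  obtain c5 where 5: "run cfg = run c5" "bounded_stage (N + 2210 * (m * B)) 5 (queries_received fst_long (\<lambda>_ _ _ _. True)) c5"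
    using local_step[OF 4(2)] 4(1) by (auto simp: algebra_simps)
  obtain c8 where 8: "run cfg = run c8" "bounded_stage (N + 2410 * (m * B)) 8 (letters_received fst_long (\<lambda>_ _ _ _. True)) c8"
    using query_step[OF 5(2)] 5(1) fst_long_less by (auto simp: algebra_simps round_programs_def)
  obtain c9 where 9: "run cfg = run c9" "bounded_stage (N + 2460 * (m * B)) 9 (queries_received lst_long (\<lambda>j x y z. x = end1 j)) c9"
    using first_step[OF 8(2)] 8(1) by (auto simp: algebra_simps)
  obtain c12 where 12: "run cfg = run c12" "bounded_stage (N + 2660 * (m * B)) 12 (letters_received lst_long (\<lambda>j x y z. x = end1 j)) c12"
    using query_step[OF 9(2)] 9(1) lst_long_less by (auto simp: algebra_simps round_programs_def)
  obtain c13 where 13: "run cfg = run c13" "bounded_stage (N + 2710 * (m * B)) 13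
     (queries_received query3 (\<lambda>j x y z. x = end1 j \<and> y = end2 j \<and> z = mid_center j (end1 j) (end2 j))) c13"
    using second_step[OF 12(2)] 12(1) by (auto simp: algebra_simps)
  obtain c16 where 16: "run cfg = run c16" "bounded_stage (N + 2910 * (m * B)) 16
     (letters_received query3 (\<lambda>j x y z. x = end1 j \<and> y = end2 j \<and> z = mid_center j (end1 j) (end2 j))) c16"
    using query_step[OF 13(2)] 13(1) third_query_less by (auto simp: algebra_simps round_programs_def)
  obtain c17 where 17: "run cfg = run c17" "bounded_stage (N + 3130 * (m * B)) 17 done_machine c17"
    using last_step[OF 16(2)] 16(1) by (auto simp: algebra_simps)
  have "\<not> unfinished c17"
    using 17(2) by (cases c17) (auto simp: bounded_stage_def stage_def done_machine_def in_set_conv_nth)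
  moreover have "bounded_stage (N + 4000 * (m * B)) 17 done_machine c17"
    using 17(2) unfolding bounded_stage_def by (elim ex_forward) auto
  ultimately show ?thesis using 17(1) run_stop[of c17] by auto
qed

end


section \<open>Collision probability\<close>

lemma pair_spmf_of_set:
  assumes "finite A" "finite C"
  shows "pair_spmf (spmf_of_set A) (spmf_of_set C) = spmf_of_set (A \<times> C)"
proof (rule spmf_eqI)
  fix xy :: "'a \<times> 'b"
  show "spmf (pair_spmf (spmf_of_set A) (spmf_of_set C)) xy = spmf (spmf_of_set (A \<times> C)) xy"
    using assms by (cases xy) (simp add: spmf_of_set indicator_def card_cartesian_product)
qed

lemma prod_gt_power:
  fixes A :: "nat set"
  assumes "finite A" "\<And>p. p \<in> A \<Longrightarrow> Y \<le> p"
  shows "Y ^ card A \<le> \<Prod>A"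
proof -
  have "Y ^ card A = (\<Prod>p\<in>A. Y)" by simp
  also have "\<dots> \<le> (\<Prod>p\<in>A. p)" using assms by (intro prod_mono) auto
  finally show ?thesis by simp
qed

lemma prod_primes_dvd:
  assumes "finite A" "\<And>p. p \<in> A \<Longrightarrow> prime (p :: nat)" "\<And>p. p \<in> A \<Longrightarrow> int p dvd a"
  shows "int (\<Prod>A) dvd a"
  using assms
proof (induction A rule: finite_induct)
  case (insert p A)
  have "coprime p (\<Prod>A)"
    using insert by (intro prod_coprime_right) (metis insertCI primes_coprime)
  then have "coprime (int p) (int (\<Prod>A))" by (simp only: coprime_int_iff)
  then have "int p * int (\<Prod>A) dvd a" using insert by (intro divides_mult) (simp_all del: of_nat_prod)
  then show ?case using insert by simp
qed simp

text \<open>A collision modulo the product restricts \<open>x\<close> modulo each of its primes.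
  Exactly \<open>k - J\<close> primes that leave the difference polynomial nonzero are kept, so the
  bound does not depend on how many others there are.\<close>

lemma card_polynomial_collisions:
  assumes A: "finite A" "card A = k" "\<And>p. p \<in> A \<Longrightarrow> prime p \<and> Y < (p :: nat)" and J: "J \<le> k" "1 \<le> Y"
    and cd: "\<And>u. u < m \<Longrightarrow> c u < Y ^ J \<and> d u < Y ^ J" and u: "u < m" "c u \<noteq> d u"
  shows "card {x. x < W \<and> (\<Sum>i<m. c i * (x mod \<Prod>A) ^ i) mod \<Prod>A = (\<Sum>i<m. d i * (x mod \<Prod>A) ^ i) mod \<Prod>A}
     \<le> (W div Y ^ (k - J) + 1) * m ^ (k - J)"
proof -
  define f where "f = (\<Sum>i<m. monom (int (c i) - int (d i)) i)"
  have coeff: "coeff f i = (if i < m then int (c i) - int (d i) else 0)" for i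
    by (simp add: f_def coeff_sum)
  have deg: "degree f \<le> m" by (rule degree_le) (simp add: coeff)
  define Z where "Z = {p \<in> A. int p dvd coeff f u}"
  have "card Z < J"
  proof (rule ccontr)
    assume "\<not> card Z < J"
    then have "Y ^ J \<le> Y ^ card Z" using J(2) by (intro power_increasing) auto
    also have "\<dots> \<le> \<Prod>Z" by (rule prod_gt_power) (use A in \<open>auto simp: Z_def intro: less_imp_le\<close>)
    finally have 1: "Y ^ J \<le> \<Prod>Z" .
    have "int (\<Prod>Z) dvd coeff f u" by (rule prod_primes_dvd) (use A in \<open>auto simp: Z_def\<close>)
    then have "\<bar>int (\<Prod>Z)\<bar> \<le> \<bar>coeff f u\<bar>" using u by (intro dvd_imp_le_int) (auto simp: coeff)
    also have "\<dots> < int (Y ^ J)" using cd[OF u(1)] u(1) by (simp only: coeff if_True) linarith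
    finally show False using 1 by (simp only: abs_of_nat of_nat_less_iff)
  qed
  moreover have "card (A - Z) = k - card Z" using A(1,2) by (subst card_Diff_subset) (auto simp: Z_def)
  ultimately have "k - J \<le> card (A - Z)" by linarith
  then obtain A' where A': "A' \<subseteq> A - Z" "card A' = k - J" by (rule obtain_subset_with_card_n)
  have finA': "finite A'" using A' A(1) by (meson finite_Diff finite_subset)
  define R where "R p = {x. x < p \<and> int p dvd poly f (int x)}" for p :: nat
  have R: "finite (R p) \<and> card (R p) \<le> m" if "p \<in> A'" for p
  proof -
    have pA: "p \<in> A" "p \<notin> Z" using that A'(1) by auto
    then have "\<not> int p dvd coeff f u" by (simp add: Z_def)
    then have nd: "\<not> [:int p:] dvd f" unfolding const_poly_dvd_iff by blast
    have "prime p" using A(3)[OF pA(1)] by simp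
    from card_poly_roots_mod_prime[OF this nd] have "card (R p) \<le> m" using deg unfolding R_def by linarith
    then show ?thesis by (simp add: R_def)
  qed
  have pf: "poly f x = (\<Sum>i<m. int (c i) * x ^ i) - (\<Sum>i<m. int (d i) * x ^ i)" for x
    by (simp add: f_def poly_sum poly_monom left_diff_distrib sum_subtractf)
  have "x mod p \<in> R p" if p: "p \<in> A'" and eq: "(\<Sum>i<m. c i * (x mod \<Prod>A) ^ i) mod \<Prod>A = (\<Sum>i<m. d i * (x mod \<Prod>A) ^ i) mod \<Prod>A" for p x
  proof -
    have pA1: "p \<in> A" using p A'(1) by blast
    then have pA: "p \<in> A" "prime p" using A(3)[of p] by simp_all
    have pd: "int p dvd int (\<Prod>A)" using A(1) pA(1) by (simp add: dvd_prodI)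
    have "[int (\<Sum>i<m. c i * (x mod \<Prod>A) ^ i) = int (\<Sum>i<m. d i * (x mod \<Prod>A) ^ i)] (mod int (\<Prod>A))"
      using eq by (simp only: cong_def flip: zmod_int)
    then have "int (\<Prod>A) dvd poly f (int (x mod \<Prod>A))"
      by (simp add: pf cong_iff_dvd_diff zmod_int)
    then have 1: "int p dvd poly f (int (x mod \<Prod>A))" using pd dvd_trans by blast
    have "p dvd \<Prod>A" using pd by (simp only: int_dvd_int_iff)
    then have "[int (x mod \<Prod>A) = int (x mod p)] (mod int p)"
      by (simp add: cong_def mod_mod_cancel flip: zmod_int)
    then have "[poly f (int (x mod \<Prod>A)) = poly f (int (x mod p))] (mod int p)"
      unfolding pf by (intro cong_diff cong_sum cong_mult cong_pow cong_refl)
    then have "int p dvd poly f (int (x mod p))" using 1 by (simp add: cong_dvd_iff)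
    then show ?thesis using pA(2) by (simp add: R_def prime_gt_0_nat)
  qed
  then have "{x. x < W \<and> (\<Sum>i<m. c i * (x mod \<Prod>A) ^ i) mod \<Prod>A = (\<Sum>i<m. d i * (x mod \<Prod>A) ^ i) mod \<Prod>A}
      \<subseteq> {x. x < W \<and> (\<forall>p\<in>A'. x mod p \<in> R p)}" by blast
  then have "card {x. x < W \<and> (\<Sum>i<m. c i * (x mod \<Prod>A) ^ i) mod \<Prod>A = (\<Sum>i<m. d i * (x mod \<Prod>A) ^ i) mod \<Prod>A}
      \<le> card {x. x < W \<and> (\<forall>p\<in>A'. x mod p \<in> R p)}" by (rule card_mono[rotated]) simp
  also have "\<dots> \<le> (W div \<Prod>A' + 1) * m ^ card A'"
    by (rule card_simultaneous_residues) (use finA' A' A(3) R in auto)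
  also have "\<dots> \<le> (W div Y ^ (k - J) + 1) * m ^ (k - J)"
  proof -
    have "Y ^ card A' \<le> \<Prod>A'" using A' A(3) by (intro prod_gt_power finA') (auto intro: less_imp_le)
    then have "W div \<Prod>A' \<le> W div Y ^ (k - J)" using J(2) A'(2) by (intro div_le_mono2) auto
    then show ?thesis using A'(2) by simp
  qed
  finally show ?thesis .
qed


section \<open>Resource bounds for every draw and the count of bad draws\<close>

context mpc_input
begin

text \<open>The part of the claim that holds with certainty: bad hash values can spoil the output
  but neither time nor memory.\<close>

definition nice :: "nat \<Rightarrow> config \<Rightarrow> bool" where
  "nice N cfg \<longleftrightarrow> fst cfg = 17 \<and> length (snd cfg) = m \<and> total_time cfg \<le> N \<and> (\<forall>M\<in>set (snd cfg). peak M \<le> 500 * B)"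

lemma bounded_stage_nice:
  assumes "bounded_stage N 17 P cfg"
  shows "nice N cfg"
proof -
  obtain T where T: "stage 17 T P cfg" "(\<Sum>j<m. T j) \<le> N" using assms by (auto simp: bounded_stage_def)
  have l: "length (snd cfg) = m" and r: "\<And>j. j < m \<Longrightarrow> ready 17 (T j) (snd cfg ! j)" using T(1) by (auto simp: stage_def)
  have "total_time cfg = (\<Sum>j<m. steps (snd cfg ! j))"
    by (simp add: total_time_def sum_list_sum_nth l atLeast0LessThan)
  also have "\<dots> \<le> (\<Sum>j<m. T j)" by (rule sum_mono) (use r in \<open>auto simp: ready_def\<close>)
  finally show ?thesis using T l r by (auto simp: nice_def stage_def ready_def in_set_conv_nth)
qed

end

lemma (in hashed_input) final_config:
  assumes "bounded_stage N 2 distributed cfg"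
  shows "\<exists>cfg'. run cfg = return_spmf cfg' \<and> nice (N + 4000 * (m * B)) cfg' \<and>
    (good_hash n \<sigma> m \<beta> B w S \<alpha> b q Mo \<longrightarrow> outputs_maximal_palindromes S cfg')"
proof -
  obtain cfg' where c: "run cfg = return_spmf cfg'" "bounded_stage (N + 4000 * (m * B)) 17 done_machine cfg'"
    using deterministic_rounds[OF assms] by blast
  have "outputs_maximal_palindromes S cfg'" if "good_hash n \<sigma> m \<beta> B w S \<alpha> b q Mo"
  proof -
    interpret good: good_hash n \<sigma> m \<beta> B w S \<alpha> b q Mo by (rule that)
    have "map outputs (snd cfg') = map result [0..<m]"
      using c(2) by (intro nth_equalityI) (auto simp: bounded_stage_def stage_def done_machine_def)
    then have "all_outputs cfg' = concat (map result [0..<m])" by (simp add: all_outputs_def)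
    then show ?thesis using good.results_correct by (simp add: outputs_maximal_palindromes_def)
  qed
  then show ?thesis using c bounded_stage_nice by blast
qed

lemma failure_ratio:
  fixes v :: real
  assumes "0 < v" "v * v \<le> K + (v * a + v * c)"
  shows "1 - (a + c) / v \<le> K / (v * v)"
proof -
  have "1 - (a + c) / v = (v * v - (v * a + v * c)) / (v * v)"
    using assms(1) by (simp add: add_divide_distrib diff_divide_distrib)
  also have "\<dots> \<le> K / (v * v)" using assms by (intro divide_right_mono) auto
  finally show ?thesis .
qed

locale full_input = prime_input +
  assumes J: "J \<le> k" "1 \<le> J" and M4: "4 * ((D * D) ^ k * (D * D) ^ k) < word_bound w"
begin

lemma finite_primes: "finite (first_primes Y k)"
  by (rule finite_subset[of _ "{..D * D}"]) (use first_primes_props in auto)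

lemma Y_ge: "256 \<le> Y"
  using v(1) by (simp add: Y_def)

lemma YJ: "256 \<le> Y ^ J"
  using Y_ge self_le_power[of Y J] J(2) by linarith

lemma Mo_bounds: "Y ^ J \<le> Mo" "Mo \<le> (D * D) ^ k" "0 < Mo"
proof -
  have "Y ^ J \<le> Y ^ k" using Y_ge J by (intro power_increasing) auto
  also have "\<dots> \<le> Mo" using prod_gt_power[OF finite_primes, of Y] first_primes_props by (force simp: Mo_def first_primes_card)
  finally show "Y ^ J \<le> Mo" .
  then show "0 < Mo" using YJ by linarith
  have "Mo \<le> (\<Prod>p\<in>first_primes Y k. D * D)" unfolding Mo_def by (rule prod_mono) (use first_primes_props in auto)
  then show "Mo \<le> (D * D) ^ k" by (simp add: first_primes_card)
qed

lemma q_bounds: "0 < q" "(word_bound w - 1) div q < Y ^ J" "q \<le> word_bound w div Y ^ J + 1"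
proof -
  show q0: "0 < q" by (simp add: q_def)
  have "word_bound w - 1 < Y ^ J * q"
  proof -
    have "0 < Y ^ J" using YJ by linarith
    from dividend_less_times_div[OF this, of "word_bound w - 1"] show ?thesis by (simp add: q_def algebra_simps)
  qed
  then show "(word_bound w - 1) div q < Y ^ J" using q0 by (simp add: div_less_iff_less_mult)
  show "q \<le> word_bound w div Y ^ J + 1" unfolding q_def by (simp add: div_le_mono)
qed

lemma hashed_axioms:
  assumes "\<alpha> < word_bound w"
  shows "hashed n \<sigma> m \<beta> B w S \<alpha> (x mod Mo) q Mo"
proof unfold_locales
  show "4 * (Mo * Mo) < word_bound w"
    using mult_le_mono[OF Mo_bounds(2) Mo_bounds(2)] M4 by linarith
qed (use assms Mo_bounds q_bounds in auto)

definition letter_hash :: "nat \<Rightarrow> nat \<Rightarrow> nat" where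
  "letter_hash \<alpha> x = (\<alpha> * Sp x mod word_bound w) div q"

definition bad_letters :: "nat set" where
  "bad_letters = {\<alpha>. \<alpha> < word_bound w \<and> (\<exists>x\<in>set S. \<exists>y\<in>set S. x < y \<and> (\<alpha> * x mod word_bound w) div q = (\<alpha> * y mod word_bound w) div q)}"

text \<open>For fixed \<alpha> the letter hashes are fixed coefficients, and these are the points at
  which two different hash polynomials agree modulo \<open>Mo\<close>. The ranges of
  \<open>i\<close> and \<open>y\<close> are generous, as only a union bound over
  \<open>n * n\<close> pairs is wanted.\<close>

definition bad_base :: "nat \<Rightarrow> nat set" where
  "bad_base \<alpha> = {x. x < word_bound w \<and> (\<exists>i<n. \<exists>y<n. (\<exists>u<m. letter_hash \<alpha> (i * m + u) \<noteq> letter_hash \<alpha> (y + m - 1 - u)) \<and>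
     (\<Sum>u<m. letter_hash \<alpha> (i * m + u) * (x mod Mo) ^ u) mod Mo = (\<Sum>u<m. letter_hash \<alpha> (y + m - 1 - u) * (x mod Mo) ^ u) mod Mo)}"

lemma card_bad_letters: "card bad_letters \<le> n * n * (12 * (q + \<sigma>))"
proof -
  define C where "C x y = {\<alpha>. \<alpha> < word_bound w \<and> (\<alpha> * x mod word_bound w) div q = (\<alpha> * y mod word_bound w) div q}" for x y
  define Pr where "Pr = {(x, y). x \<in> set S \<and> y \<in> set S \<and> x < y}"
  have Pr: "Pr \<subseteq> set S \<times> set S" by (auto simp: Pr_def)
  have fPr: "finite Pr" by (rule finite_subset[OF Pr]) simp
  have "bad_letters \<subseteq> (\<Union>z\<in>Pr. C (fst z) (snd z))"
  proof
    fix \<alpha> assume "\<alpha> \<in> bad_letters"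
    then obtain x y where "(x, y) \<in> Pr" "\<alpha> \<in> C x y" unfolding bad_letters_def Pr_def C_def by blast
    then show "\<alpha> \<in> (\<Union>z\<in>Pr. C (fst z) (snd z))" by force
  qed
  then have "card bad_letters \<le> card (\<Union>z\<in>Pr. C (fst z) (snd z))"
    by (rule card_mono[rotated]) (use fPr in \<open>simp add: C_def\<close>)
  also have "\<dots> \<le> (\<Sum>z\<in>Pr. card (C (fst z) (snd z)))" by (rule card_UN_le) (rule finite_subset[OF Pr], simp)
  also have "\<dots> \<le> (\<Sum>z\<in>Pr. 12 * (q + \<sigma>))"
  proof (rule sum_mono)
    fix z assume "z \<in> Pr"
    then have "fst z < snd z" "snd z \<le> \<sigma>" using letters by (auto simp: Pr_def)
    then show "card (C (fst z) (snd z)) \<le> 12 * (q + \<sigma>)"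
      unfolding C_def using card_quotient_collisions[of "fst z" "snd z" \<sigma> "word_bound w" q] q_bounds(1) W'(6) by simp
  qed
  also have "\<dots> = card Pr * (12 * (q + \<sigma>))" by simp
  also have "card Pr \<le> card (set S \<times> set S)" by (rule card_mono[OF _ Pr]) simp
  also have "card (set S \<times> set S) \<le> n * n"
    using card_length[of S] n by (simp add: card_cartesian_product mult_le_mono)
  finally show ?thesis by simp
qed

lemma letter_hash_less: "letter_hash \<alpha> x < Y ^ J"
proof -
  have "\<alpha> * Sp x mod word_bound w \<le> word_bound w - 1" 
    using mod_less_divisor[OF word_bound_pos, of "\<alpha> * Sp x" w] by linarith
  then have "letter_hash \<alpha> x \<le> (word_bound w - 1) div q" unfolding letter_hash_def by (rule div_le_mono)
  then show ?thesis using q_bounds(2) by linarith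
qed

lemma card_bad_base: "card (bad_base \<alpha>) \<le> n * n * ((word_bound w div Y ^ (k - J) + 1) * m ^ (k - J))"
proof -
  define C where "C i y = {x. x < word_bound w \<and> (\<exists>u<m. letter_hash \<alpha> (i * m + u) \<noteq> letter_hash \<alpha> (y + m - 1 - u)) \<and>
     (\<Sum>u<m. letter_hash \<alpha> (i * m + u) * (x mod Mo) ^ u) mod Mo = (\<Sum>u<m. letter_hash \<alpha> (y + m - 1 - u) * (x mod Mo) ^ u) mod Mo}" for i y
  have Cb: "card (C i y) \<le> (word_bound w div Y ^ (k - J) + 1) * m ^ (k - J)" for i y
  proof (cases "\<exists>u<m. letter_hash \<alpha> (i * m + u) \<noteq> letter_hash \<alpha> (y + m - 1 - u)")
    case True
    then obtain u where u: "u < m" "letter_hash \<alpha> (i * m + u) \<noteq> letter_hash \<alpha> (y + m - 1 - u)" by blast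
    have "card {x. x < word_bound w \<and> (\<Sum>u<m. letter_hash \<alpha> (i * m + u) * (x mod Mo) ^ u) mod Mo = (\<Sum>u<m. letter_hash \<alpha> (y + m - 1 - u) * (x mod Mo) ^ u) mod Mo}
       \<le> (word_bound w div Y ^ (k - J) + 1) * m ^ (k - J)"
      unfolding Mo_def
      by (rule card_polynomial_collisions[where u = u]) (use finite_primes first_primes_card first_primes_props J Y_ge letter_hash_less u in auto)
    moreover have "card (C i y) \<le> card {x. x < word_bound w \<and> (\<Sum>u<m. letter_hash \<alpha> (i * m + u) * (x mod Mo) ^ u) mod Mo = (\<Sum>u<m. letter_hash \<alpha> (y + m - 1 - u) * (x mod Mo) ^ u) mod Mo}"
      by (rule card_mono) (auto simp: C_def)
    ultimately show ?thesis by (rule order_trans[rotated])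
  next
    case False
    then have "C i y = {}" unfolding C_def by blast
    then show ?thesis by (simp only: card.empty le0)
  qed
  have "bad_base \<alpha> \<subseteq> (\<Union>z\<in>{..<n} \<times> {..<n}. C (fst z) (snd z))"
  proof
    fix x assume "x \<in> bad_base \<alpha>"
    then obtain i y where "i < n" "y < n" "x \<in> C i y" unfolding bad_base_def C_def by blast
    then show "x \<in> (\<Union>z\<in>{..<n} \<times> {..<n}. C (fst z) (snd z))" by force
  qed
  then have "card (bad_base \<alpha>) \<le> card (\<Union>z\<in>{..<n} \<times> {..<n}. C (fst z) (snd z))"
    by (rule card_mono[rotated]) (simp add: C_def)
  also have "\<dots> \<le> (\<Sum>z\<in>{..<n} \<times> {..<n}. card (C (fst z) (snd z)))" by (rule card_UN_le) simp
  also have "\<dots> \<le> (\<Sum>z\<in>{..<n} \<times> {..<n}. (word_bound w div Y ^ (k - J) + 1) * m ^ (k - J))" by (rule sum_mono) (rule Cb)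
  finally show ?thesis by (simp add: card_cartesian_product)
qed

lemma good_hashI:
  assumes "\<alpha> < word_bound w" "x < word_bound w" "\<alpha> \<notin> bad_letters" "x \<notin> bad_base \<alpha>"
  shows "good_hash n \<sigma> m \<beta> B w S \<alpha> (x mod Mo) q Mo"
proof -
  interpret h: hashed n \<sigma> m \<beta> B w S \<alpha> "x mod Mo" q Mo by (rule hashed_axioms[OF assms(1)])
  have g: "h.g = letter_hash \<alpha>" by (rule ext) (simp add: h.g_def letter_hash_def)
  show ?thesis
  proof unfold_locales
    fix a c assume ac: "a \<in> set S" "c \<in> set S" "a \<noteq> c"
    then show "\<alpha> * a mod word_bound w div q \<noteq> \<alpha> * c mod word_bound w div q"
      using assms(1,3) nat_neq_iff[of a c] unfolding bad_letters_def by (metis (mono_tags, lifting) mem_Collect_eq)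
  next
    fix i y u assume iy: "(i + 1) * m \<le> n" "y + m \<le> n" "h.bwd_hash i = h.fwd_hash y" "u < m"
    have "(i + 1) * 1 \<le> n" by (rule le_trans[OF mult_le_mono2[OF m(1)] iy(1)])
    then have "i < n" by simp
    moreover have "y < n" using iy(2) m(1) by linarith
    moreover have "(\<Sum>u<m. letter_hash \<alpha> (i * m + u) * (x mod Mo) ^ u) mod Mo = (\<Sum>u<m. letter_hash \<alpha> (y + m - 1 - u) * (x mod Mo) ^ u) mod Mo"
      using iy(3) unfolding h.bwd_hash_def h.fwd_hash_def h.bwd_def h.fwd_sum g .
    ultimately show "h.g (i * m + u) = h.g (y + m - 1 - u)"
      using assms(2,4) iy(4) unfolding bad_base_def g by blast
  qed
qed

definition time_bound :: nat where
  "time_bound = 6000 * (m * B) + 3 * n + D * D * (30 + 3 * D)"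

text \<open>For fixed words the run is a point mass, so the whole run is the image of the uniform
  distribution on pairs of words, and probabilities become counts.\<close>

lemma random_run:
  "\<exists>F. run (initial_config n \<sigma> I) = map_spmf F (spmf_of_set ({..<word_bound w} \<times> {..<word_bound w})) \<and>
    (\<forall>x<word_bound w. \<forall>\<alpha><word_bound w. nice time_bound (F (x, \<alpha>)) \<and>
       (\<alpha> \<notin> bad_letters \<longrightarrow> x \<notin> bad_base \<alpha> \<longrightarrow> outputs_maximal_palindromes S (F (x, \<alpha>))))"
proof -
  obtain cf where cf: "mpc_round w (palindrome_program k J) (initial_config n \<sigma> I) = return_spmf cf"
    "stage 1 (\<lambda>j. 0 + 1000 * B + 20) P1 cf" using scatter_stage[OF first_stage] by auto
  have "unfinished (initial_config n \<sigma> I)" by (rule stage_unfinished[OF first_stage]) (simp add: P0_def)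
  then have r0: "run (initial_config n \<sigma> I) = run cf" using cf(1) run_step by simp
  let ?U = "spmf_of_set {..<word_bound w}"
  obtain F where F: "run cf = bind_spmf ?U (\<lambda>x. bind_spmf ?U (\<lambda>\<alpha>. run (F x \<alpha>)))"
    "\<And>x \<alpha>. stage 2 (\<lambda>j. (0 + 1000 * B + 20) + c1 j + 20) (P2 (x mod Mo) \<alpha>) (F x \<alpha>)"
    using modulus_step[OF cf(2)] by blast
  define R where "R x \<alpha> cfg' \<longleftrightarrow> (\<alpha> < word_bound w \<longrightarrow> run (F x \<alpha>) = return_spmf cfg' \<and> nice time_bound cfg' \<and>
      (good_hash n \<sigma> m \<beta> B w S \<alpha> (x mod Mo) q Mo \<longrightarrow> outputs_maximal_palindromes S cfg'))" for x \<alpha> cfg'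
  have "\<exists>cfg'. R x \<alpha> cfg'" for x \<alpha>
  proof (cases "\<alpha> < word_bound w")
    case True
    interpret h: hashed_input n \<sigma> m \<beta> B w S I k J \<alpha> "x mod Mo" q Mo
      by (intro hashed_input.intro mpc_input_axioms hashed_axioms True)
    have P: "P2 (x mod Mo) \<alpha> = h.distributed" by (intro ext) (simp add: P2_def h.distributed_def)
    define N where "N = 2000 * (m * B) + 3 * n + D * D * (30 + 3 * D)"
    have "(\<Sum>j<m. (0 + 1000 * B + 20) + c1 j + 20) = 1000 * (m * B) + 40 * m + (\<Sum>j<m. c1 j)"
      by (simp add: sum.distrib)
    also have "\<dots> \<le> N"
      using sum_c1 m_le_B B_le order_trans[OF m_le_B B_le] unfolding N_def by linarith
    finally have "bounded_stage N 2 h.distributed (F x \<alpha>)"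
      using F(2)[of x \<alpha>] unfolding bounded_stage_def P by blast
    from h.final_config[OF this] have "\<exists>cfg'. run (F x \<alpha>) = return_spmf cfg' \<and> nice (N + 4000 * (m * B)) cfg' \<and>
      (good_hash n \<sigma> m \<beta> B w S \<alpha> (x mod Mo) q Mo \<longrightarrow> outputs_maximal_palindromes S cfg')" .
    moreover have "N + 4000 * (m * B) = time_bound" by (simp add: N_def time_bound_def)
    ultimately show ?thesis unfolding R_def by (simp only:) blast
  qed (simp add: R_def)
  then obtain G where "\<And>x \<alpha>. R x \<alpha> (G x \<alpha>)" by metis
  then have G: "run (F x \<alpha>) = return_spmf (G x \<alpha>)" "nice time_bound (G x \<alpha>)"
    "good_hash n \<sigma> m \<beta> B w S \<alpha> (x mod Mo) q Mo \<Longrightarrow> outputs_maximal_palindromes S (G x \<alpha>)" if "\<alpha> < word_bound w" for x \<alpha>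
    using that unfolding R_def by blast+
  have "run cf = bind_spmf ?U (\<lambda>x. bind_spmf ?U (\<lambda>\<alpha>. return_spmf (G x \<alpha>)))"
    unfolding F(1) by (intro bind_spmf_cong refl) (use G in auto)
  also have "\<dots> = map_spmf (case_prod G) (pair_spmf ?U ?U)"
    by (simp add: pair_spmf_alt_def map_spmf_conv_bind_spmf)
  finally have "run (initial_config n \<sigma> I) = map_spmf (case_prod G) (spmf_of_set ({..<word_bound w} \<times> {..<word_bound w}))"
    by (simp add: r0 pair_spmf_of_set)
  then show ?thesis
    by (intro exI[of _ "case_prod G"] conjI) (use G(2,3) good_hashI in auto)
qed

lemma run_bounds:
  "lossless_spmf (run (initial_config n \<sigma> I))"
  "cfg \<in> set_spmf (run (initial_config n \<sigma> I)) \<Longrightarrow> nice time_bound cfg"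
  "measure (measure_spmf (run (initial_config n \<sigma> I))) {cfg. outputs_maximal_palindromes S cfg} \<ge>
     1 - (real (n * n * (12 * (q + \<sigma>))) + real (n * n * ((word_bound w div Y ^ (k - J) + 1) * m ^ (k - J)))) / real (word_bound w)"
proof -
  let ?A = "{..<word_bound w}"
  obtain F where F: "run (initial_config n \<sigma> I) = map_spmf F (spmf_of_set (?A \<times> ?A))"
    "\<And>x \<alpha>. x < word_bound w \<Longrightarrow> \<alpha> < word_bound w \<Longrightarrow> nice time_bound (F (x, \<alpha>))"
    "\<And>x \<alpha>. x < word_bound w \<Longrightarrow> \<alpha> < word_bound w \<Longrightarrow> \<alpha> \<notin> bad_letters \<Longrightarrow> x \<notin> bad_base \<alpha> \<Longrightarrow> outputs_maximal_palindromes S (F (x, \<alpha>))"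
    using random_run by blast
  show "lossless_spmf (run (initial_config n \<sigma> I))" unfolding F(1) by (auto simp: lessThan_empty_iff)
  show "cfg \<in> set_spmf (run (initial_config n \<sigma> I)) \<Longrightarrow> nice time_bound cfg" using F(2) unfolding F(1) by auto
  define b1 where "b1 = n * n * (12 * (q + \<sigma>))"
  define b2 where "b2 = n * n * ((word_bound w div Y ^ (k - J) + 1) * m ^ (k - J))"
  define K where "K = card ((?A \<times> ?A) \<inter> F -` {cfg. outputs_maximal_palindromes S cfg})"
  \<comment> \<open>The bad evaluation points depend on \<alpha>, so they are collected slice by
    slice; all slices obey the same bound.\<close>
  define Bad where "Bad = ?A \<times> bad_letters \<union> (\<Union>\<alpha>\<in>?A. bad_base \<alpha> \<times> {\<alpha>})"
  have fb: "finite bad_letters" "\<And>\<alpha>. finite (bad_base \<alpha>)" by (simp_all add: bad_letters_def bad_base_def)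
  then have fin: "finite Bad" by (simp add: Bad_def)
  have "card Bad \<le> card (?A \<times> bad_letters) + card (\<Union>\<alpha>\<in>?A. bad_base \<alpha> \<times> {\<alpha>})" unfolding Bad_def by (rule card_Un_le)
  also have "card (\<Union>\<alpha>\<in>?A. bad_base \<alpha> \<times> {\<alpha>}) \<le> (\<Sum>\<alpha>\<in>?A. card (bad_base \<alpha> \<times> {\<alpha>}))" by (rule card_UN_le) simp
  also have "\<dots> \<le> (\<Sum>\<alpha>\<in>?A. b2)"
    by (rule sum_mono) (use card_bad_base in \<open>simp add: card_cartesian_product b2_def\<close>)
  also have "card (?A \<times> bad_letters) \<le> word_bound w * b1"
    using card_bad_letters by (simp add: card_cartesian_product b1_def)
  finally have cB: "card Bad \<le> word_bound w * b1 + word_bound w * b2" by simp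
  have sub: "(?A \<times> ?A) - Bad \<subseteq> (?A \<times> ?A) \<inter> F -` {cfg. outputs_maximal_palindromes S cfg}"
    using F(3) by (auto simp: Bad_def)
  have "card (?A \<times> ?A) - card Bad \<le> card ((?A \<times> ?A) - Bad)" by (rule diff_card_le_card_Diff[OF fin])
  also have "\<dots> \<le> card ((?A \<times> ?A) \<inter> F -` {cfg. outputs_maximal_palindromes S cfg})" by (rule card_mono[OF _ sub]) simp
  finally have "word_bound w * word_bound w - card Bad \<le> K" by (simp only: card_cartesian_product card_lessThan K_def)
  then have "word_bound w * word_bound w \<le> K + (word_bound w * b1 + word_bound w * b2)" using cB by linarith
  then have "real (word_bound w * word_bound w) \<le> real (K + (word_bound w * b1 + word_bound w * b2))" by (simp only: of_nat_le_iff)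
  then have "1 - (real b1 + real b2) / real (word_bound w) \<le> real K / (real (word_bound w) * real (word_bound w))"
    by (intro failure_ratio) (simp_all only: of_nat_mult of_nat_add of_nat_0_less_iff word_bound_pos)
  then show "measure (measure_spmf (run (initial_config n \<sigma> I))) {cfg. outputs_maximal_palindromes S cfg} \<ge>
     1 - (real (n * n * (12 * (q + \<sigma>))) + real (n * n * ((word_bound w div Y ^ (k - J) + 1) * m ^ (k - J)))) / real (word_bound w)"
    unfolding F(1) measure_map_spmf measure_spmf_of_set K_def[symmetric] b1_def[symmetric] b2_def[symmetric] card_cartesian_product card_lessThan of_nat_mult[of "word_bound w" "word_bound w"] .
qed

end


section \<open>Choice of the parameters\<close>

lemma ex_twelfth_root: "1 \<le> n \<Longrightarrow> \<exists>v::nat. 1 \<le> v \<and> v ^ 12 \<le> n \<and> n < (v + 1) ^ 12"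
proof (induction n rule: nat_induct_at_least)
  case base
  have "(1::nat) < (1 + 1) ^ 12" unfolding one_add_one by simp
  then show ?case by (intro exI[of _ 1]) simp
next
  case (Suc n)
  then obtain v where v: "1 \<le> v" "v ^ 12 \<le> n" "n < (v + 1) ^ 12" by blast
  show ?case
  proof (cases "Suc n < (v + 1) ^ 12")
    case True
    then show ?thesis using v by (intro exI[of _ v]) simp
  next
    case False
    then have e: "Suc n = (v + 1) ^ 12" using v(3) by linarith
    have "(v + 1) ^ 12 < (v + 1 + 1) ^ 12" by (rule power_strict_mono) simp_all
    then show ?thesis unfolding e by (intro exI[of _ "v + 1"]) simp
  qed
qed

text \<open>\<open>\<epsilon> \<le> 1 / 2\<close> makes \<open>m * m\<close> linear in
  \<open>n\<close>, so rounding the length up to a multiple of \<open>m * m\<close> costs a constant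
  factor only. It also makes \<open>m\<close> at most
  \<open>2 * real n powr (1 - \<epsilon>)\<close>, which absorbs the rounding of
  \<open>B\<close>.\<close>

lemma machine_parameters:
  fixes \<epsilon> :: real and n :: nat
  assumes \<epsilon>: "0 < \<epsilon>" "\<epsilon> \<le> 1 / 2" and n: "1 \<le> n"
    and m_def: "m = nat \<lceil>real n powr \<epsilon>\<rceil>" and \<beta>_def: "\<beta> = (n + m * m - 1) div (m * m)" and B_def: "B = m * \<beta>"
  shows "1 \<le> m" "1 \<le> \<beta>" "n \<le> m * B" "m * B \<le> 5 * n" "m * m \<le> 4 * n"
    "real B \<le> 3 * real n powr (1 - \<epsilon>)" "nat \<lceil>real n powr (1 - \<epsilon>)\<rceil> \<le> 3 * B"
proof -
  define x where "x = real n powr \<epsilon>"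
  define y where "y = real n powr (1 - \<epsilon>)"
  have x1: "1 \<le> x" using n \<epsilon> by (simp add: x_def ge_one_powr_ge_zero)
  have xy: "x * y = real n" using n by (simp add: x_def y_def flip: powr_add)
  have le: "x \<le> y" unfolding x_def y_def using n \<epsilon> by (intro powr_mono) simp_all
  have "x * x \<le> x * y" using le x1 by (intro mult_left_mono) auto
  then have xx: "x * x \<le> real n" using xy by simp
  have "real m = of_int \<lceil>x\<rceil>" using x1 by (simp add: m_def x_def[symmetric])
  then have mx: "x \<le> real m" "real m \<le> 2 * x" using x1 by linarith+
  show m1: "1 \<le> m" using mx(1) x1 by linarith
  have "real m * real m \<le> (2 * x) * (2 * x)" using mx x1 by (intro mult_mono) auto
  then have "real (m * m) \<le> real (4 * n)" using xx by simp
  then show mm: "m * m \<le> 4 * n" by (simp only: of_nat_le_iff)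
  have pos: "0 < m * m" using m1 by simp
  have mB: "m * B = (m * m) * \<beta>" by (simp add: B_def)
  have "n + m * m - 1 < (m * m) * \<beta> + m * m"
    using dividend_less_times_div[OF pos, of "n + m * m - 1"] unfolding \<beta>_def by linarith
  then show nB: "n \<le> m * B" unfolding mB using pos by linarith
  have "m * B \<le> n + m * m - 1" unfolding mB \<beta>_def by (rule times_div_less_eq_dividend)
  then have up: "m * B \<le> n + m * m" by linarith
  then show "m * B \<le> 5 * n" using mm by linarith
  show "1 \<le> \<beta>" using nB n by (cases \<beta>) (simp_all add: B_def)
  have "real (m * B) \<le> real (n + m * m)" using up by (simp only: of_nat_le_iff)
  then have up': "real m * (real B - real m) \<le> x * y" by (simp add: xy algebra_simps)
  have "real B - real m \<le> y"
  proof (cases "B \<le> m")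
    case True
    then show ?thesis using le x1 by simp
  next
    case False
    then have "x * (real B - real m) \<le> real m * (real B - real m)" using mx by (intro mult_right_mono) auto
    then have "x * (real B - real m) \<le> x * y" using up' by linarith
    then show ?thesis using x1 by simp
  qed
  then show "real B \<le> 3 * real n powr (1 - \<epsilon>)" using mx le unfolding y_def[symmetric] by linarith
  have "x * y \<le> real (m * B)" unfolding xy using nB by (simp only: of_nat_le_iff)
  also have "\<dots> \<le> (2 * x) * real B" unfolding of_nat_mult using mx by (intro mult_right_mono) auto
  finally have "x * y \<le> x * (2 * real B)" by simp
  then have "y \<le> 2 * real B" using x1 by simp
  then have "nat \<lceil>y\<rceil> \<le> 2 * B" by (simp add: ceiling_le_iff nat_le_iff)
  then show "nat \<lceil>real n powr (1 - \<epsilon>)\<rceil> \<le> 3 * B" unfolding y_def by linarith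
qed

text \<open>Constant factors move into the exponent, so that word lengths can be compared by
  exponents of \<open>n + \<sigma>\<close> alone.\<close>

lemma two_power_bound:
  fixes N :: nat
  assumes "2 \<le> N" "X \<le> 2 ^ i * N ^ j"
  shows "X \<le> N ^ (i + j)"
proof -
  have "2 ^ i * N ^ j \<le> N ^ i * N ^ j" using assms(1) by (intro mult_right_mono power_mono) auto
  from order_trans[OF assms(2) this] show ?thesis by (simp only: power_add)
qed

text \<open>The exponents depend on \<open>k\<close> and \<open>J\<close> only; this is why one
  constant \<kappa> fixes the required word length.\<close>

lemma word_size_bounds:
  fixes n \<sigma> N k J v D Y :: nat
  assumes N: "N = n + \<sigma>" "1 \<le> n" "1 \<le> \<sigma>" and v: "v ^ 12 \<le> n" and D: "D = 2 ^ (k + 10) * v ^ 4" and Y: "Y = 256 * v ^ 7"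
    and mB: "mB \<le> 5 * n" "mm \<le> 4 * n"
  shows "1000 * mB + 1000 * mm + 1000 * \<sigma> + 10000 \<le> N ^ 15" "4096 * n + 1 \<le> N ^ 14"
    "(D + 2) * (D + 2) \<le> N ^ (2 * k + 24)" "(D * D) ^ k \<le> N ^ ((2 * k + 22) * k)"
    "4 * ((D * D) ^ k * (D * D) ^ k) \<le> N ^ (2 + 2 * ((2 * k + 22) * k))" "k \<le> N ^ k" "Y ^ J \<le> N ^ (9 * J)"
proof -
  have N2: "2 \<le> N" using N by linarith
  show "1000 * mB + 1000 * mm + 1000 * \<sigma> + 10000 \<le> N ^ 15"
    using two_power_bound[OF N2, of _ 14 1] N mB by simp
  show "4096 * n + 1 \<le> N ^ 14"
    using two_power_bound[OF N2, of _ 13 1] N by simp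
  have vp: "v ^ i \<le> N" if "1 \<le> i" "i \<le> 12" for i
  proof (cases "v = 0")
    case False
    then have "v ^ i \<le> v ^ 12" using that by (intro power_increasing) auto
    then show ?thesis using v N by linarith
  qed (use that in \<open>simp add: power_0_left\<close>)
  have k11: "k + 11 = (k + 10) + 1" by simp
  have D1: "D \<le> N ^ (k + 11)"
    unfolding k11 by (rule two_power_bound[OF N2]) (use vp[of 4] in \<open>simp add: D\<close>)
  have "D + 2 \<le> N ^ (k + 12)"
  proof -
    have "2 \<le> N ^ (k + 11)" using N2 self_le_power[of N "k + 11"] by linarith
    then have "D + 2 \<le> 2 * N ^ (k + 11)" using D1 by linarith
    also have "\<dots> \<le> N * N ^ (k + 11)" using N2 by (rule mult_le_mono1)
    finally have "D + 2 \<le> N ^ Suc (k + 11)" by (simp only: power_Suc)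
    moreover have "Suc (k + 11) = k + 12" by simp
    ultimately show ?thesis by (simp only:)
  qed
  from mult_le_mono[OF this this] have "(D + 2) * (D + 2) \<le> N ^ (k + 12) * N ^ (k + 12)" .
  then show "(D + 2) * (D + 2) \<le> N ^ (2 * k + 24)" by (simp flip: power_add)
  have "D * D \<le> N ^ (k + 11) * N ^ (k + 11)" using D1 D1 by (rule mult_le_mono)
  then have "D * D \<le> N ^ (2 * k + 22)" by (simp flip: power_add)
  then have "(D * D) ^ k \<le> (N ^ (2 * k + 22)) ^ k" by (rule power_mono) simp
  then show DD: "(D * D) ^ k \<le> N ^ ((2 * k + 22) * k)" by (simp only: power_mult)
  have "(D * D) ^ k * (D * D) ^ k \<le> N ^ (2 * ((2 * k + 22) * k))"
    using mult_le_mono[OF DD DD] by (simp only: mult_2 power_add)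
  then show "4 * ((D * D) ^ k * (D * D) ^ k) \<le> N ^ (2 + 2 * ((2 * k + 22) * k))"
    by (intro two_power_bound[OF N2]) simp
  have "k \<le> 2 ^ k" by (rule less_imp_le[OF less_exp])
  also have "\<dots> \<le> N ^ k" using N2 by (rule power_mono) simp
  finally show "k \<le> N ^ k" .
  have "Y \<le> N ^ (8 + 1)" by (rule two_power_bound[OF N2]) (use vp[of 7] in \<open>simp add: Y\<close>)
  then have "Y ^ J \<le> (N ^ 9) ^ J" by (intro power_mono) simp_all
  then show "Y ^ J \<le> N ^ (9 * J)" by (simp only: power_mult)
qed

text \<open>The word bound \<open>Wo\<close> may be arbitrarily large. Terms proportional to it are
  small because \<open>Yj\<close> exceeds \<open>mJ\<close> by a power of \<open>n\<close>; the
  remaining terms are absorbed by the lower bound on \<open>Wo\<close>. After doubling, each part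
  accounts for one \<open>Wo\<close>.\<close>

lemma failure_bound:
  fixes n m N d q \<sigma> Wo Yj mJ :: nat
  assumes n: "2 \<le> n" and Yj: "mJ * (n ^ d * n ^ 8) \<le> Yj" "1 \<le> mJ" and q: "q \<le> Wo div Yj + 1"
    and W: "2 * n ^ d * (n * n * (12 * (1 + \<sigma>) + mJ)) \<le> Wo"
  shows "n ^ d * (n * n * (12 * (q + \<sigma>)) + n * n * ((Wo div Yj + 1) * mJ)) \<le> Wo"
proof -
  define A where "A = Wo div Yj"
  have A: "A * Yj \<le> Wo" by (simp add: A_def)
  have "12 * (q + \<sigma>) + (A + 1) * mJ \<le> 13 * (A * mJ) + (12 * (1 + \<sigma>) + mJ)"
  proof -
    define P where "P = A * mJ"
    have "A \<le> P" using Yj(2) by (simp add: P_def)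
    then show ?thesis using q unfolding A_def[symmetric] add_mult_distrib P_def[symmetric] by simp
  qed
  then have "2 * n ^ d * (n * n * (12 * (q + \<sigma>) + (A + 1) * mJ)) \<le> 2 * n ^ d * (n * n * (13 * (A * mJ) + (12 * (1 + \<sigma>) + mJ)))"
    by (intro mult_le_mono2)
  also have "\<dots> = (26 * (n * n)) * (n ^ d * mJ * A) + 2 * n ^ d * (n * n * (12 * (1 + \<sigma>) + mJ))"
    by (simp add: algebra_simps)
  also have "\<dots> \<le> n ^ 8 * (n ^ d * mJ * A) + Wo"
  proof (intro add_mono W mult_le_mono1)
    \<comment> \<open>Of the eight spare factors \<open>n\<close>, two pay for the pairs in the
      union bound and six, being at least 64, for the constant 26.\<close>
    have "(2::nat) ^ 6 \<le> n ^ 6" using n by (rule power_mono) simp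
    then have "26 * (n * n) \<le> n ^ 6 * (n * n)" by (intro mult_le_mono1) simp
    then show "26 * (n * n) \<le> n ^ 8" by (simp add: numeral_eq_Suc mult_ac)
  qed
  also have "n ^ 8 * (n ^ d * mJ * A) = (mJ * (n ^ d * n ^ 8)) * A" by (simp add: mult_ac)
  also have "(mJ * (n ^ d * n ^ 8)) * A \<le> Yj * A" using Yj(1) by (rule mult_le_mono1)
  also have "Yj * A \<le> Wo" using A by (simp add: mult.commute)
  finally have "2 * n ^ d * (n * n * (12 * (q + \<sigma>) + (A + 1) * mJ)) \<le> Wo + Wo" by simp
  then show ?thesis unfolding A_def[symmetric] distrib_left[symmetric] by simp
qed

text \<open>From \<open>m \<le> 2 * (v + 1) ^ 6\<close> follows
  \<open>m * (v + 1) \<le> 2 * (2 * v) ^ 7 = 256 * v ^ 7\<close>, the origin of the constant 256.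
  Each factor thus has \<open>v + 1\<close> to spare, and twelve of these exceed
  \<open>n\<close>.\<close>

lemma prime_bound_ge:
  fixes m n v t :: nat
  assumes v: "1 \<le> v" "n < (v + 1) ^ 12" and m: "m * m \<le> 4 * n"
  shows "m ^ (12 * t) * n ^ t \<le> (256 * v ^ 7) ^ (12 * t)"
proof -
  have pow7: "x ^ 6 * x = x ^ 7" for x :: nat by (simp add: numeral_eq_Suc mult_ac)
  have "m * m \<le> (2 * (v + 1) ^ 6) * (2 * (v + 1) ^ 6)"
    using m v(2) by (simp flip: power_add)
  then have "m ^ 2 \<le> (2 * (v + 1) ^ 6) ^ 2" by (simp only: power2_eq_square)
  then have "m \<le> 2 * (v + 1) ^ 6" by (rule power2_le_imp_le) simp
  then have "m * (v + 1) \<le> 2 * (v + 1) ^ 6 * (v + 1)" by (rule mult_le_mono1)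
  also have "\<dots> = 2 * (v + 1) ^ 7" by (simp only: mult.assoc pow7)
  also have "\<dots> \<le> 2 * (2 * v) ^ 7" using v(1) by (intro mult_le_mono2 power_mono) simp_all
  also have "\<dots> = 256 * v ^ 7" by (simp add: power_mult_distrib)
  finally have "(m * (v + 1)) ^ (12 * t) \<le> (256 * v ^ 7) ^ (12 * t)" by (rule power_mono) simp
  moreover have "n ^ t \<le> ((v + 1) ^ 12) ^ t" using v(2) by (intro power_mono) simp_all
  then have "m ^ (12 * t) * n ^ t \<le> (m * (v + 1)) ^ (12 * t)"
    unfolding power_mult_distrib power_mult by (rule mult_le_mono2)
  ultimately show ?thesis by (rule order_trans[rotated])
qed

text \<open>Trial division costs about the cube of \<open>D\<close>, which the exponent 4 of
  \<open>v\<close> turns into \<open>v ^ 12 \<le> n\<close>; the power of two in \<open>D\<close>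
  depends on \<open>k\<close> only.\<close>

lemma time_bound_le:
  fixes n v D k mB :: nat
  assumes "v ^ 12 \<le> n" "1 \<le> v" "D = 2 ^ (k + 10) * v ^ 4" "mB \<le> 5 * n"
  shows "6000 * mB + 3 * n + D * D * (30 + 3 * D) \<le> (40000 + 33 * 2 ^ (3 * k + 30)) * n"
proof -
  have "1 \<le> D" using assms(2,3) by (simp add: Suc_leI)
  then have "D * D * (30 + 3 * D) \<le> D * D * (33 * D)" by (intro mult_le_mono2) simp
  also have "\<dots> = 33 * D ^ 3" by (simp add: power3_eq_cube)
  also have "D ^ 3 = (2 ^ (k + 10)) ^ 3 * (v ^ 4) ^ 3" unfolding assms(3) by (rule power_mult_distrib)
  also have "\<dots> = 2 ^ (3 * k + 30) * v ^ 12" by (simp only: flip: power_mult) (simp add: algebra_simps)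
  also have "33 * (2 ^ (3 * k + 30) * v ^ 12) \<le> 33 * (2 ^ (3 * k + 30) * n)" using assms(1) by (intro mult_le_mono2)
  finally show ?thesis using assms(4) unfolding add_mult_distrib mult.assoc by linarith
qed

theorem theorem1:
  fixes \<epsilon> c :: real
  assumes "0 < \<epsilon>" "\<epsilon> \<le> 1 / 2" "0 < c"
  shows "\<exists>(P :: program) (\<kappa> :: nat) (C :: real). \<kappa> \<ge> 1 \<and>
    (\<forall>(n :: nat) (\<sigma> :: nat) (S :: nat list) (w :: nat) (I :: (nat \<times> nat) list list).
       n \<ge> 1 \<longrightarrow> length S = n \<longrightarrow> set S \<subseteq> {0..<\<sigma>} \<longrightarrow>
       (n + \<sigma>) ^ \<kappa> \<le> 2 ^ w \<longrightarrow> input_distribution \<epsilon> S I \<longrightarrow>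
         lossless_spmf (mpc_run w P n \<sigma> I) \<and>
         (\<forall>cfg \<in> set_spmf (mpc_run w P n \<sigma> I).
            real (rounds cfg) \<le> C \<and>
            real (total_time cfg) \<le> C * real n \<and>
            real (total_memory cfg) \<le> C * real n \<and>
            (\<forall>M \<in> set (snd cfg). real (peak M) \<le> C * real n powr (1 - \<epsilon>))) \<and>
         measure (measure_spmf (mpc_run w P n \<sigma> I)) {cfg. outputs_maximal_palindromes S cfg}
           \<ge> 1 - real n powr (- c))"
proof -
  \<comment> \<open>The failure probability is to be at most \<open>1 / n ^ d\<close>; eight further
    powers of \<open>n\<close> are spent in \<open>failure_bound\<close>. A prime gains only a
    twelfth of a power, hence the factor 12 in \<open>J\<close>, and \<open>k = 2 * J\<close> leaves
    \<open>J\<close> primes after the loss of fewer than \<open>J\<close>.\<close>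
  define d where "d = nat \<lceil>c\<rceil>"
  define t where "t = d + 8"
  define J where "J = 12 * t"
  define k where "k = 2 * J"
  \<comment> \<open>Quadratic in \<open>k\<close>, because the square of the modulus is bounded by a
    power of \<open>N\<close> with an exponent of about \<open>4 * k * k\<close>; the constants
    leave room for all exponents in \<open>word_size_bounds\<close> and for the failure
    bound.\<close>
  define \<kappa> where "\<kappa> = (4 * k + 100) * (k + 100)"
  define C where "C = (40000 + 33 * 2 ^ (3 * k + 30) :: real)"
  have J8: "1 \<le> J" "d \<le> J" by (simp_all add: J_def t_def)
  have \<kappa>: "15 < \<kappa>" "2 * k + 24 < \<kappa>" "(2 * k + 22) * k < \<kappa>" "2 + 2 * ((2 * k + 22) * k) < \<kappa>" "k < \<kappa>" "9 * J < \<kappa>" "d + 1 + 5 + (3 * J + 5) < \<kappa>"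
    using J8 by (simp_all add: \<kappa>_def k_def algebra_simps)
  have main: "lossless_spmf (mpc_run w (palindrome_program k J) n \<sigma> I) \<and>
         (\<forall>cfg \<in> set_spmf (mpc_run w (palindrome_program k J) n \<sigma> I).
            real (rounds cfg) \<le> C \<and>
            real (total_time cfg) \<le> C * real n \<and>
            real (total_memory cfg) \<le> C * real n \<and>
            (\<forall>M \<in> set (snd cfg). real (peak M) \<le> C * real n powr (1 - \<epsilon>))) \<and>
         measure (measure_spmf (mpc_run w (palindrome_program k J) n \<sigma> I)) {cfg. outputs_maximal_palindromes S cfg}
           \<ge> 1 - real n powr (- c)"
    if n: "n \<ge> 1" "length S = n" and S: "set S \<subseteq> {0..<\<sigma>}" and w: "(n + \<sigma>) ^ \<kappa> \<le> 2 ^ w" and I: "input_distribution \<epsilon> S I"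
    for n \<sigma> :: nat and S :: "nat list" and w :: nat and I :: "(nat \<times> nat) list list"
  proof -
    define m where "m = nat \<lceil>real n powr \<epsilon>\<rceil>"
    define \<beta> where "\<beta> = (n + m * m - 1) div (m * m)"
    define B where "B = m * \<beta>"
    note mp = machine_parameters[OF assms(1,2) n(1) m_def \<beta>_def B_def]
    obtain v where v: "1 \<le> v" "v ^ 12 \<le> n" "n < (v + 1) ^ 12" using ex_twelfth_root[OF n(1)] by blast
    define D where "D = 2 ^ (k + 10) * v ^ 4"
    define Y where "Y = 256 * v ^ 7"
    define q where "q = (word_bound w - 1) div (Y ^ J) + 1"
    define Mo where "Mo = \<Prod>(first_primes Y k)"
    define N where "N = n + \<sigma>"
    obtain a where "a \<in> set S" using n by (cases S) auto
    then have \<sigma>1: "1 \<le> \<sigma>" using S by force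
    have N2: "2 \<le> N" using n \<sigma>1 by (simp add: N_def)
    have word: "X < word_bound w" if "X \<le> N ^ e" "e < \<kappa>" for X e
    proof -
      have "N ^ e < N ^ \<kappa>" using N2 that(2) by (intro power_strict_increasing) simp_all
      then show ?thesis using that(1) w by (simp add: word_bound_def N_def)
    qed
    note ws = word_size_bounds[OF N_def n(1) \<sigma>1 v(2) D_def Y_def mp(4,5)]
    have big: "10000 < word_bound w" using word[OF ws(1) \<kappa>(1)] by linarith
    have YJ2: "2 \<le> Y ^ J"
    proof -
      have "2 \<le> Y" using v(1) by (simp add: Y_def)
      then show ?thesis using self_le_power[of Y J] J8(1) by linarith
    qed
    have qW: "q < word_bound w"
    proof -
      have "(word_bound w - 1) div Y ^ J \<le> (word_bound w - 1) div 2" using YJ2 by (intro div_le_mono2) simp_all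
      then show ?thesis using big unfolding q_def by linarith
    qed
    have Idist: "length I = m" "mset (concat I) = mset (zip [0..<n] S)" "\<And>xs. xs \<in> set I \<Longrightarrow> length xs \<le> 3 * B"
      using I n mp(7) by (auto simp: input_distribution_def m_def intro: order_trans)
    interpret f: full_input n \<sigma> m \<beta> B w S I k J v D Y Mo q
    proof unfold_locales
      show "1000 * (m * B) + 1000 * (m * m) + 1000 * \<sigma> + 10000 < word_bound w" by (rule word[OF ws(1) \<kappa>(1)])
      show "4096 * n + 1 < word_bound w" by (rule word[OF ws(2)]) (use \<kappa>(1) in linarith)
      show "(D + 2) * (D + 2) < word_bound w" by (rule word[OF ws(3) \<kappa>(2)])
      show "(D * D) ^ k < word_bound w" by (rule word[OF ws(4) \<kappa>(3)])
      show "4 * ((D * D) ^ k * (D * D) ^ k) < word_bound w" by (rule word[OF ws(5) \<kappa>(4)])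
      show "k < word_bound w" by (rule word[OF ws(6) \<kappa>(5)])
      show "Y ^ J < word_bound w" by (rule word[OF ws(7) \<kappa>(6)])
      show "set S \<subseteq> {..<\<sigma>}" using S by auto
    qed (fact n mp(1-3) \<beta>_def B_def Idist D_def Y_def Mo_def q_def v qW J8(1) | simp add: k_def)+
    have run: "mpc_run w (palindrome_program k J) n \<sigma> I = f.run (initial_config n \<sigma> I)"
      unfolding mpc_run_def f.run_def ..
    have tb: "f.time_bound \<le> (40000 + 33 * 2 ^ (3 * k + 30)) * n"
      unfolding f.time_bound_def by (rule time_bound_le[OF v(2,1) D_def mp(4)])
    have costs: "real (rounds cfg) \<le> C \<and> real (total_time cfg) \<le> C * real n \<and> real (total_memory cfg) \<le> C * real n \<and>
        (\<forall>M \<in> set (snd cfg). real (peak M) \<le> C * real n powr (1 - \<epsilon>))" if "f.nice f.time_bound cfg" for cfg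
    proof (intro conjI ballI)
      have C: "40000 \<le> C" by (simp add: C_def)
      have nice: "fst cfg = 17" "length (snd cfg) = m" "total_time cfg \<le> f.time_bound" "\<And>M. M \<in> set (snd cfg) \<Longrightarrow> peak M \<le> 500 * B"
        using that by (auto simp: f.nice_def)
      show "real (rounds cfg) \<le> C" using nice(1) C by (simp add: rounds_def)
      have "real (total_time cfg) \<le> real ((40000 + 33 * 2 ^ (3 * k + 30)) * n)"
        using nice(3) tb by (simp only: of_nat_le_iff)
      then show "real (total_time cfg) \<le> C * real n" by (simp add: C_def)
      have "sum_list (map peak (snd cfg)) \<le> sum_list (map (\<lambda>_. 500 * B) (snd cfg))"
        by (rule sum_list_mono) (rule nice(4))
      then have "total_memory cfg \<le> m * (500 * B)" by (simp add: total_memory_def sum_list_triv nice(2))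
      also have "\<dots> \<le> 2500 * n" using mp(4) unfolding mult.left_commute[of m 500 B] by linarith
      finally have "real (total_memory cfg) \<le> 2500 * real n" by (simp flip: of_nat_le_iff)
      also have "\<dots> \<le> C * real n" using C by (intro mult_right_mono) simp_all
      finally show "real (total_memory cfg) \<le> C * real n" .
      fix M assume "M \<in> set (snd cfg)"
      then have "real (peak M) \<le> 500 * real B" using nice(4)[of M] by linarith
      also have "\<dots> \<le> 1500 * real n powr (1 - \<epsilon>)" using mp(6) by linarith
      also have "\<dots> \<le> C * real n powr (1 - \<epsilon>)" using C by (intro mult_right_mono) simp_all
      finally show "real (peak M) \<le> C * real n powr (1 - \<epsilon>)" .
    qed
    have prob: "measure (measure_spmf (f.run (initial_config n \<sigma> I))) {cfg. outputs_maximal_palindromes S cfg} \<ge> 1 - real n powr (- c)"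
    proof (cases "n = 1")
      \<comment> \<open>For \<open>n = 1\<close> the claimed probability is 0, while
        \<open>failure_bound\<close> needs \<open>2 \<le> n\<close>.\<close>
      case True
      then show ?thesis by simp
    next
      case False
      then have n2: "2 \<le> n" using n(1) by linarith
      define bad where "bad = n * n * (12 * (q + \<sigma>)) + n * n * ((word_bound w div Y ^ J + 1) * m ^ J)"
      have kJ: "k - J = J" by (simp add: k_def)
      have "n ^ d * bad \<le> word_bound w"
        unfolding bad_def
      proof (rule failure_bound[OF n2])
        have "m ^ J * n ^ t \<le> Y ^ J" unfolding J_def Y_def by (rule prime_bound_ge[OF v(1,3) mp(5)])
        then show "m ^ J * (n ^ d * n ^ 8) \<le> Y ^ J" by (simp only: t_def power_add)
        show "1 \<le> m ^ J" using mp(1) by simp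
        show "q \<le> word_bound w div Y ^ J + 1" by (rule f.q_bounds(3))
        have "m \<le> 4 * n" by (rule le_trans[OF _ mp(5)]) (use mp(1) in simp)
        then have "m \<le> 2 ^ 2 * N ^ 1" by (simp add: N_def)
        then have "m \<le> N ^ 3" using two_power_bound[OF N2, of m 2 1] by simp
        then have mJ: "m ^ J \<le> N ^ (3 * J)" unfolding power_mult by (rule power_mono) simp
        have "n * n * (12 * (1 + \<sigma>) + m ^ J) \<le> N ^ 2 * (2 ^ 4 * N ^ (3 * J + 1))"
        proof (rule mult_le_mono)
          show "n * n \<le> N ^ 2" unfolding power2_eq_square by (intro mult_le_mono) (simp_all add: N_def)
          have "1 + \<sigma> \<le> N" using n(1) by (simp add: N_def)
          moreover define X where "X = N ^ (3 * J + 1)"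
          moreover have "N \<le> X" "N ^ (3 * J) \<le> X" using N2 by (simp_all add: X_def)
          ultimately show "12 * (1 + \<sigma>) + m ^ J \<le> 2 ^ 4 * N ^ (3 * J + 1)" using mJ unfolding X_def[symmetric] by simp
        qed
        moreover have "2 * n ^ d \<le> 2 * N ^ d" by (intro mult_le_mono2 power_mono) (simp_all add: N_def)
        ultimately have "2 * n ^ d * (n * n * (12 * (1 + \<sigma>) + m ^ J)) \<le> 2 * N ^ d * (N ^ 2 * (2 ^ 4 * N ^ (3 * J + 1)))"
          by (rule mult_le_mono[rotated])
        also have "\<dots> = 2 ^ 5 * N ^ (d + 2 + (3 * J + 1))" by (simp add: power_add power2_eq_square)
        finally have "2 * n ^ d * (n * n * (12 * (1 + \<sigma>) + m ^ J)) \<le> N ^ (5 + (d + 2 + (3 * J + 1)))"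
          by (rule two_power_bound[OF N2])
        then have "2 * n ^ d * (n * n * (12 * (1 + \<sigma>) + m ^ J)) < word_bound w"
          by (rule word) (use \<kappa>(7) in linarith)
        then show "2 * n ^ d * (n * n * (12 * (1 + \<sigma>) + m ^ J)) \<le> word_bound w" by linarith
      qed
      then have "real (n ^ d * bad) \<le> real (word_bound w)" by (simp only: of_nat_le_iff)
      then have "real bad / real (word_bound w) \<le> 1 / real n ^ d"
        using n2 by (simp add: field_simps)
      also have "1 / real n ^ d = real n powr (- real d)"
        using n2 by (simp add: powr_minus powr_realpow divide_inverse)
      also have "\<dots> \<le> real n powr (- c)" using n2 assms(3) by (intro powr_mono) (simp_all add: d_def)
      finally show ?thesis
        using f.run_bounds(3) unfolding kJ bad_def of_nat_add by linarith
    qed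
    show ?thesis unfolding run using f.run_bounds(1,2) costs prob by blast
  qed
  have "1 \<le> \<kappa>" using \<kappa>(1) by linarith
  then show ?thesis using main by blast
qed

end
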